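(* Let $T=(T_j)_{j\ge 1}$ be a nonincreasing null sequence of nonnegative random variables and let $\alpha>0$. Assume that (i) $\mathbb{E}\big(\sum_{j\ge 1}\mathbf 1_{\{T_j>0\}}\big)>1$; (ii) $\mathbb{E}\big(\sum_{j\ge 1}T_j^{\alpha}\big)=1$; (iii) $-\infty<\mathbb{E}\big(\sum_{j\ge 1}T_j^{\alpha}\log T_j\big)<0$; (iv) $\mathbb{E}(W_1\log W_1)<\infty$, where $W_1=\sum_{j\ge1}T_j^\alpha$. Let $r\ge 1$ be the span of $T$. Then the elements of $\mathcal S(\mathcal M)$ are exactly the functions $$f(t)=\mathbb{E}\big(\exp(-h(t)\,t^{\alpha}\,W)\big),\qquad t\ge 0,$$ with left continuous $h\in\mathcal H_r$, where $W=\lim_{n\to\infty}W_n$ a.s. Moreover, $\mathcal S(\mathcal L)$ is nonempty only if $0<\alpha\le 1$, in which case it consists of all such $f\in\mathcal S(\mathcal M)$ with $h\in\mathcal P_r$.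
   Context: Null sequence means $T_j\to0$ a.s. Conventions: $0^\alpha\log 0=0$ and $0\log 0=0$. Branching random walk: let $\mathbb V=\bigcup_{n\ge0}\mathbb N^n$ be the Ulam–Harris tree (with $\mathbb N^0=\{\varnothing\}$), $|v|=n$ for $v=v_1\dots v_n$, and $v(j)=v_1\dots v_j$. Let $(T^v_j)_{j\ge1}$, $v\in\mathbb V$, be i.i.d. copies of $T$ and $L(v)=\prod_{j=1}^{|v|}T^{v(j-1)}_{v_j}$, $L(\varnothing)=1$. Put $W_n=\sum_{|v|=n}L(v)^\alpha$, a nonnegative martingale, which under the stated assumptions converges a.s. and in $L^1$ to a nondegenerate limit $W$. Function classes: $\mathcal M$ is the set of $f:[0,\infty)\to[0,1]$ that are nonincreasing and left continuous with $f(0)=f(0+)=1$ and $0<f(t)<1$ for some $t>0$. $\mathcal S(\mathcal M)$ is the set of $f\in\mathcal M$ satisfying $$f(t)=\mathbb{E}\Big(\prod_{j\ge1}f(tT_j)\Big)\quad\text{for all }t\ge0.$$ $\mathcal L$ is the subclass of $\mathcal M$ of Laplace transforms of probability measures on $[0,\infty)$, and $\mathcal S(\mathcal L)=\mathcal S(\mathcal M)\cap\mathcal L$. Span: $T$ is $r$-geometric (has span $r$) if $r>1$ is the maximal number such that $\mathbb P(T_j\in\{0\}\cup\{r^n:n\in\mathbb Z\}\text{ for all }j\ge1)=1$; $T$ is nongeometric, with span $r=1$, if no such $r>1$ exists. For $r>1$, $\mathcal H_r$ is the set of functions $h:[0,\infty)\to(0,\infty)$ with $h(rt)=h(t)$ for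 all $t\ge0$ and such that $t\mapsto h(t)t^\alpha$ is nondecreasing; $\mathcal H_1$ is the set of positive constant functions on $[0,\infty)$. $\mathcal P_1=\mathcal H_1$, and for $r>1$, $\mathcal P_r$ is the set of $h\in\mathcal H_r$ such that $t\mapsto t^\alpha h(t)$ has a completely monotone derivative on $(0,\infty)$. *)

theory Defs
  imports "HOL-Probability.Probability"
begin

text \<open>
  Sequences indexed by \<open>j \<ge> 1\<close> in the mathematics are indexed by \<open>j :: nat\<close> from \<open>0\<close> here.
  The conventions \<open>0 powr \<alpha> = 0\<close> and \<open>0 * ln 0 = 0\<close> hold in HOL.
  A function on \<open>[0,\<infinity>)\<close> is represented by a function of type \<^typ>\<open>real \<Rightarrow> real\<close>; all classes below
  only depend on its values on \<open>[0,\<infinity>)\<close>.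
\<close>

section \<open>Branching random walk\<close>

text \<open>Vertices of the Ulam--Harris tree are lists of natural numbers;
  \<open>take j v\<close> is the ancestor \<open>v(j)\<close> of \<open>v\<close>.\<close>

definition iid_copies ::
  "'a measure \<Rightarrow> (nat \<Rightarrow> 'a \<Rightarrow> real) \<Rightarrow> (nat list \<Rightarrow> nat \<Rightarrow> 'a \<Rightarrow> real) \<Rightarrow> bool" where
  "iid_copies M T TT \<longleftrightarrow>
     prob_space.indep_vars M (\<lambda>_. Pi\<^sub>M UNIV (\<lambda>_::nat. borel)) (\<lambda>v \<omega> j. TT v j \<omega>) UNIV \<and>
     (\<forall>v. distr M (Pi\<^sub>M UNIV (\<lambda>_::nat. borel)) (\<lambda>\<omega> j. TT v j \<omega>) =
          distr M (Pi\<^sub>M UNIV (\<lambda>_::nat. borel)) (\<lambda>\<omega> j. T j \<omega>))"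

definition branch_weight :: "(nat list \<Rightarrow> nat \<Rightarrow> 'a \<Rightarrow> real) \<Rightarrow> nat list \<Rightarrow> 'a \<Rightarrow> real" where
  "branch_weight TT v \<omega> = (\<Prod>j<length v. TT (take j v) (v ! j) \<omega>)"

definition Wn :: "(nat list \<Rightarrow> nat \<Rightarrow> 'a \<Rightarrow> real) \<Rightarrow> real \<Rightarrow> nat \<Rightarrow> 'a \<Rightarrow> real" where
  "Wn TT \<alpha> n \<omega> = (\<Sum>\<^sub>\<infinity>v\<in>{v. length v = n}. branch_weight TT v \<omega> powr \<alpha>)"

definition Wlim :: "(nat list \<Rightarrow> nat \<Rightarrow> 'a \<Rightarrow> real) \<Rightarrow> real \<Rightarrow> 'a \<Rightarrow> real" where
  "Wlim TT \<alpha> \<omega> = lim (\<lambda>n. Wn TT \<alpha> n \<omega>)"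

section \<open>Function classes and the functional equation\<close>

definition left_cont :: "(real \<Rightarrow> real) \<Rightarrow> bool" where
  "left_cont f \<longleftrightarrow> (\<forall>t>0. continuous (at_left t) f)"

definition class_M :: "(real \<Rightarrow> real) set" where
  "class_M = {f. (\<forall>t\<ge>0. 0 \<le> f t \<and> f t \<le> 1) \<and> antimono_on {0..} f \<and> left_cont f \<and>
     f 0 = 1 \<and> (f \<longlongrightarrow> 1) (at_right 0) \<and> (\<exists>t>0. 0 < f t \<and> f t < 1)}"

definition class_L :: "(real \<Rightarrow> real) set" where
  "class_L = {f \<in> class_M. \<exists>\<mu>. real_distribution \<mu> \<and> (AE x in \<mu>. 0 \<le> x) \<and>
     (\<forall>t\<ge>0. f t = (\<integral>x. exp (- t * x) \<partial>\<mu>))}"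

text \<open>The infinite product is the limit of its (nonincreasing) partial products. The library
  constant \<^const>\<open>prodinf\<close> is unsuitable, since \<^const>\<open>has_prod\<close> does not hold for products of
  nonzero factors whose partial products tend to \<open>0\<close>.\<close>

definition solutions_M :: "'a measure \<Rightarrow> (nat \<Rightarrow> 'a \<Rightarrow> real) \<Rightarrow> (real \<Rightarrow> real) set" where
  "solutions_M M T = {f \<in> class_M.
     \<forall>t\<ge>0. f t = (\<integral>\<omega>. lim (\<lambda>n. \<Prod>j<n. f (t * T j \<omega>)) \<partial>M)}"

definition solutions_L :: "'a measure \<Rightarrow> (nat \<Rightarrow> 'a \<Rightarrow> real) \<Rightarrow> (real \<Rightarrow> real) set" where
  "solutions_L M T = solutions_M M T \<inter> class_L"

section \<open>Span\<close>

definition supported_on_powers :: "'a measure \<Rightarrow> (nat \<Rightarrow> 'a \<Rightarrow> real) \<Rightarrow> real \<Rightarrow> bool" where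
  "supported_on_powers M T r \<longleftrightarrow>
     (AE \<omega> in M. \<forall>j. T j \<omega> \<in> {0} \<union> range (\<lambda>n::int. r powi n))"

definition geometric :: "'a measure \<Rightarrow> (nat \<Rightarrow> 'a \<Rightarrow> real) \<Rightarrow> real \<Rightarrow> bool" where
  "geometric M T r \<longleftrightarrow> r > 1 \<and> supported_on_powers M T r \<and>
     (\<forall>s>1. supported_on_powers M T s \<longrightarrow> s \<le> r)"

definition has_span :: "'a measure \<Rightarrow> (nat \<Rightarrow> 'a \<Rightarrow> real) \<Rightarrow> real \<Rightarrow> bool" where
  "has_span M T r \<longleftrightarrow> geometric M T r \<or> (r = 1 \<and> (\<nexists>s. geometric M T s))"

section \<open>Multiplicatively periodic functions\<close>

text \<open>Both classes are only meaningful for \<open>r \<ge> 1\<close>.\<close>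

definition class_H :: "real \<Rightarrow> real \<Rightarrow> (real \<Rightarrow> real) set" where
  "class_H \<alpha> r =
     (if r = 1 then {h. \<exists>c>0. \<forall>t\<ge>0. h t = c}
      else {h. (\<forall>t\<ge>0. h t > 0 \<and> h (r * t) = h t) \<and> mono_on {0..} (\<lambda>t. h t * t powr \<alpha>)})"

definition completely_monotone :: "(real \<Rightarrow> real) \<Rightarrow> bool" where
  "completely_monotone g \<longleftrightarrow>
     (\<forall>n. \<forall>t>0. (deriv ^^ n) g field_differentiable at t \<and> 0 \<le> (-1) ^ n * (deriv ^^ n) g t)"

definition class_P :: "real \<Rightarrow> real \<Rightarrow> (real \<Rightarrow> real) set" where
  "class_P \<alpha> r =
     (if r = 1 then class_H \<alpha> 1
      else {h \<in> class_H \<alpha> r. \<exists>g. completely_monotone g \<and>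
              (\<forall>t>0. ((\<lambda>t. t powr \<alpha> * h t) has_real_derivative g t) (at t))})"

end

theory Submission
  imports Defs
begin

text \<open>
  Normalise the equation by \<open>A j = T j powr \<alpha>\<close> and \<open>x = t powr \<alpha>\<close>. Then
  a solution is a fixed point of the smoothing operator \<open>S\<close>, where \<open>S F x\<close> is the mean
  of the product of the \<open>F (x * A j)\<close>, and the sum of the \<open>A j\<close> has mean
  \<open>1\<close>. Hence choosing the child \<open>j\<close> with weight \<open>A j\<close> is a change of
  measure under which \<open>- ln (A j)\<close> becomes the step of a random walk on the line. Its mean is
  \<open>- E (\<Sum>j. A j * ln (A j)) > 0\<close>, so the walk drifts to \<open>\<infinity>\<close>. Products
  of numbers in \<open>[0,1]\<close> are Lipschitz in their factors; so if \<open>F\<close> and \<open>G\<close>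
  are fixed points, the positive part of \<open>exp y * (F (exp (- y)) - G (exp (- y)))\<close> does not
  decrease in mean along the walk (\<open>gap_submartingale\<close>). Everything said about fixed points comes
  from this inequality and from four facts on the walk: the expected number of visits to a bounded interval is
  bounded (\<open>green_function_bounded\<close>), the probability of being below any given level tends to
  \<open>0\<close> (\<open>iter_below_tendsto_0\<close>), it hits some interval \<open>{0..b}\<close> with
  probability at least \<open>1/2\<close> from every negative starting point (\<open>overshoot_bounded\<close>),
  and its bounded harmonic functions are invariant under almost every step (\<open>choquet_deny\<close>).

  Existence. The iterates of \<open>S\<close> on \<open>exp (- x)\<close> are the Laplace transforms of
  \<open>W\<^sub>n\<close>. The condition on \<open>W\<^sub>1 log W\<^sub>1\<close> makes the error of
  linearising \<open>S\<close> summable along the walk, so that the slopes \<open>(1 - (S ^^ n) expo x) /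
  x\<close> are close to \<open>1\<close> for small \<open>x\<close>, uniformly in \<open>n\<close>
  (\<open>iterates_slope\<close>). This is uniform integrability of the martingale in terms of Laplace
  transforms; it gives convergence in mean (\<open>w_L1_Cauchy\<close>) and, with the maximal inequality, almost
  sure convergence. The Laplace transform \<open>phi\<close> of the limit \<open>W\<close> is a fixed point with
  slope \<open>1\<close> at \<open>0\<close>, and so is \<open>phi (x * h x)\<close> whenever \<open>h (x * A j)
  = h x\<close> almost surely.

  Uniqueness. The slope \<open>exp y * (1 - F (exp (- y)))\<close> of a monotone fixed point \<open>F\<close> is
  bounded: otherwise \<open>F\<close> lies below \<open>phi (c * x)\<close> on an interval that the walk hits
  with probability at least \<open>1/2\<close>, hence lies below it everywhere, for every \<open>c\<close>,
  which contradicts \<open>F x \<longlonglongrightarrow> 1\<close> as \<open>x\<close> tends to \<open>0\<close>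
  (\<open>fixed_point_slope_bounded\<close>). Therefore the slope has a bounded harmonic majorant
  \<open>k\<close>, and \<open>h x = k (- ln x)\<close> satisfies \<open>h (x * A j) = h x\<close> almost
  surely. The fixed points \<open>F\<close> and \<open>phi (x * h x)\<close> have asymptotically the same slope
  along the walk, so they agree (\<open>fixed_point_representation\<close>).

  Span. The logarithms of the periods of \<open>h\<close> form an additive group that contains almost surely all
  \<open>ln (T j)\<close> with \<open>T j > 0\<close>. If the group is dense, left continuity makes
  \<open>h\<close> constant; otherwise it is cyclic, and maximality of the span shows that \<open>r\<close> is a
  period.

  Laplace transforms. If \<open>f\<close> is one, then \<open>1 - f s\<close> is at least a constant times
  \<open>s\<close> for small \<open>s\<close>, while \<open>1 - f s \<le> C * s powr \<alpha>\<close>; so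
  \<open>\<alpha> \<le> 1\<close>. Moreover \<open>h t * t powr \<alpha>\<close> is the limit of the functions
  \<open>(1 - f (a * t)) / a powr \<alpha>\<close> along \<open>a = 1 / r ^ n\<close>, and limits of Bernstein
  functions are Bernstein functions. Conversely, if \<open>h t * t powr \<alpha>\<close> is a Bernstein
  function, then \<open>f\<close> is a mixture of the completely monotone functions \<open>exp (- (w * (h t * t
  powr \<alpha>)))\<close>, and Bernstein's theorem represents it by a measure
  (\<open>Bernstein_Widder\<close>).
\<close>

section \<open>Series of nonnegative extended reals\<close>

lemma suminf_swap_ennreal: "(\<Sum>i. \<Sum>j. f i j) = (\<Sum>j. \<Sum>i. (f i j :: ennreal))"
proof -
  have "(\<Sum>i. \<Sum>j. f i j) = (\<integral>\<^sup>+i. (\<Sum>j. f i j) \<partial>count_space UNIV)"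
    by (simp add: nn_integral_count_space_nat)
  also have "\<dots> = (\<Sum>j. \<integral>\<^sup>+i. f i j \<partial>count_space UNIV)"
    by (rule nn_integral_suminf) simp
  finally show ?thesis by (simp add: nn_integral_count_space_nat)
qed

lemma tendsto_0_ennrealI:
  assumes "\<And>\<epsilon>::real. \<epsilon> > 0 \<Longrightarrow> eventually (\<lambda>n. f n < ennreal \<epsilon>) F"
  shows "(f \<longlongrightarrow> 0) F"
proof (rule order_tendstoI)
  fix a :: ennreal assume "0 < a"
  then obtain b where b: "0 < b" "b < a" using dense by blast
  then obtain e where e: "b = ennreal e" "0 < e" by (cases b) auto
  show "eventually (\<lambda>n. f n < a) F"
    using assms[OF e(2)] by eventually_elim (use b e in simp)
qed simp

lemma suminf_finite_imp_tendsto_0: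
  fixes f :: "nat \<Rightarrow> ennreal"
  assumes "(\<Sum>n. f n) < \<infinity>"
  shows "f \<longlonglongrightarrow> 0"
proof -
  have fin: "f n < \<infinity>" for n
    using ennreal_suminf_lessD[of f \<infinity> n] assms by simp
  then have eq: "f n = ennreal (enn2real (f n))" for n by simp
  have "summable (\<lambda>n. enn2real (f n))"
    using assms eq by (intro summable_suminf_not_top) auto
  then have "(\<lambda>n. ennreal (enn2real (f n))) \<longlonglongrightarrow> ennreal 0"
    by (intro tendsto_ennrealI summable_LIMSEQ_zero)
  then show ?thesis using eq by simp
qed

lemma suminf_finite_imp_tail_tendsto_0:
  fixes f :: "nat \<Rightarrow> ennreal"
  assumes "(\<Sum>n. f n) < \<infinity>"
  shows "(\<lambda>k. \<Sum>n. f (n + k)) \<longlonglongrightarrow> 0"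
proof -
  have fin: "f n < \<infinity>" for n
    using ennreal_suminf_lessD[of f \<infinity> n] assms by simp
  then have eq: "f n = ennreal (enn2real (f n))" for n by simp
  have s: "summable (\<lambda>n. enn2real (f n))"
    using assms eq by (intro summable_suminf_not_top) auto
  have "(\<Sum>n. f (n + k)) = ennreal (\<Sum>n. enn2real (f (n + k)))" for k
    using eq summable_ignore_initial_segment[OF s, of k]
    by (subst suminf_ennreal2[symmetric]) auto
  moreover have "(\<lambda>k. \<Sum>n. enn2real (f (n + k))) \<longlonglongrightarrow> 0"
    by (rule suminf_exist_split2[OF s])
  ultimately show ?thesis by (auto simp: tendsto_ennrealI[where x=0, simplified])
qed

lemma ennreal_complement_le:
  fixes a b e :: ennreal
  assumes "a + b = 1" "1 - e \<le> b"
  shows "a \<le> e"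
proof -
  have "a \<noteq> \<top>" "b \<noteq> \<top>" using assms(1) by auto
  then obtain a' b' where ab: "a = ennreal a'" "0 \<le> a'" "b = ennreal b'" "0 \<le> b'"
    by (metis ennreal_cases)
  then have "a' + b' = 1" using assms(1) by (simp flip: ennreal_plus)
  show ?thesis
  proof (cases e)
    case (real e')
    then have "1 - e' \<le> b'"
      using assms(2) ab ennreal_minus[of e' 1] by (simp add: ennreal_le_iff)
    then show ?thesis using real ab \<open>a' + b' = 1\<close> by (simp add: ennreal_leI)
  qed simp
qed

lemma ennreal_add_le_less_mono: "a \<le> c \<Longrightarrow> b < d \<Longrightarrow> c < \<infinity> \<Longrightarrow> a + b < c + (d::ennreal)"
  by (metis add.commute add_mono_thms_linordered_semiring(3) add_right_mono ennreal_add_left_cancel_less infinity_ennreal_def order_le_less_trans less_irrefl)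

lemma member_le_suminf_ennreal: "f k \<le> (\<Sum>k. f k :: ennreal)"
  using sum_le_suminf[of f "{k}"] by simp

section \<open>Random walks on the line with positive drift\<close>

locale drift_walk = prob_space \<nu> for \<nu> :: "real measure" +
  assumes sets_step [measurable_cong, simp]: "sets \<nu> = sets borel"
    and integrable_step: "integrable \<nu> (\<lambda>z. z)"
    and drift_pos: "0 < (\<integral>z. z \<partial>\<nu>)"
begin

lemma space_step [simp]: "space \<nu> = UNIV"
  using sets_eq_imp_space_eq[OF sets_step] by simp

text \<open>
  No path space of the walk is built. For the position \<open>S\<^sub>n\<close> after
  \<open>n\<close> steps from \<open>y\<close>, \<open>iter g n y\<close> is the mean of
  \<open>g S\<^sub>n\<close>, and \<open>stay B n y\<close> is the probability that
  \<open>S\<^sub>0, \<dots>, S\<^sub>n\<close> all lie in \<open>B\<close>; both recursions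
  condition on the first step.
\<close>

primrec iter :: "(real \<Rightarrow> ennreal) \<Rightarrow> nat \<Rightarrow> real \<Rightarrow> ennreal" where
  "iter g 0 = g"
| "iter g (Suc n) = (\<lambda>y. \<integral>\<^sup>+z. iter g n (y + z) \<partial>\<nu>)"

primrec stay :: "real set \<Rightarrow> nat \<Rightarrow> real \<Rightarrow> ennreal" where
  "stay B 0 = indicator B"
| "stay B (Suc n) = (\<lambda>y. indicator B y * (\<integral>\<^sup>+z. stay B n (y + z) \<partial>\<nu>))"

definition stay_forever :: "real set \<Rightarrow> real \<Rightarrow> ennreal" where
  "stay_forever B y = (INF n. stay B n y)"

lemma iter_measurable [measurable]:
  assumes [measurable]: "g \<in> borel_measurable borel"
  shows "iter g n \<in> borel_measurable borel"
  by (induction n) simp_all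

lemma stay_measurable [measurable]:
  assumes [measurable]: "B \<in> sets borel"
  shows "stay B n \<in> borel_measurable borel"
  by (induction n) simp_all

lemma stay_forever_measurable [measurable]:
  assumes [measurable]: "B \<in> sets borel"
  shows "stay_forever B \<in> borel_measurable borel"
  unfolding stay_forever_def by measurable

lemma emeasure_step_UNIV [simp]: "emeasure \<nu> UNIV = 1"
  using emeasure_space_1 by simp

lemma iter_mono: "(\<And>y. f y \<le> g y) \<Longrightarrow> iter f n y \<le> iter g n y"
  by (induction n arbitrary: y) (auto intro!: nn_integral_mono)

lemma iter_const [simp]: "iter (\<lambda>_. c) n y = c"
  by (induction n arbitrary: y) auto

lemma iter_Suc_right:
  "iter g (Suc n) y = iter (\<lambda>y. \<integral>\<^sup>+z. g (y + z) \<partial>\<nu>) n y"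
  by (induction n arbitrary: y) auto

lemma iter_add:
  assumes [measurable]: "f \<in> borel_measurable borel" "g \<in> borel_measurable borel"
  shows "iter (\<lambda>y. f y + g y) n y = iter f n y + iter g n y"
proof (induction n arbitrary: y)
  case (Suc n)
  show ?case by (simp add: Suc nn_integral_add)
qed simp

lemma iter_cmult:
  assumes [measurable]: "g \<in> borel_measurable borel"
  shows "iter (\<lambda>y. c * g y) n y = c * iter g n y"
proof (induction n arbitrary: y)
  case (Suc n)
  show ?case by (simp add: Suc nn_integral_cmult)
qed simp

lemma iter_suminf:
  assumes [measurable]: "\<And>k. f k \<in> borel_measurable borel"
  shows "iter (\<lambda>y. \<Sum>k. f k y) n y = (\<Sum>k. iter (f k) n y)"
proof (induction n arbitrary: y)
  case (Suc n)
  show ?case by (simp add: Suc nn_integral_suminf)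
qed simp

lemma stay_le_indicator: "stay B n y \<le> indicator B y"
proof -
  have "stay B n y \<le> 1 \<and> stay B n y \<le> indicator B y" for y
  proof (induction n arbitrary: y)
    case (Suc n)
    have "(\<integral>\<^sup>+z. stay B n (y + z) \<partial>\<nu>) \<le> (\<integral>\<^sup>+z. 1 \<partial>\<nu>)"
      by (intro nn_integral_mono) (use Suc in auto)
    then show ?case by (auto simp: indicator_def)
  qed (auto simp: indicator_def)
  then show ?thesis by blast
qed

lemma stay_le_1: "stay B n y \<le> 1"
  using stay_le_indicator[of B n y] by (auto simp: indicator_def split: if_splits intro: order_trans)

lemma stay_Suc_le: "stay B (Suc n) y \<le> stay B n y"
proof (induction n arbitrary: y)
  case 0
  show ?case using stay_le_indicator[of B "Suc 0" y] by (simp only: stay.simps(1))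
next
  case (Suc n)
  have "(\<integral>\<^sup>+z. stay B (Suc n) (y + z) \<partial>\<nu>) \<le> (\<integral>\<^sup>+z. stay B n (y + z) \<partial>\<nu>)"
    by (intro nn_integral_mono Suc)
  then show ?case by (simp only: stay.simps(2)[of B "Suc n"] stay.simps(2)[of B n]) (auto intro: mult_left_mono)
qed

lemma decseq_stay: "decseq (\<lambda>n. stay B n y)"
  by (intro decseq_SucI stay_Suc_le)

lemma stay_mono: "B \<subseteq> C \<Longrightarrow> stay B n y \<le> stay C n y"
  by (induction n arbitrary: y) (auto intro!: nn_integral_mono mult_mono simp: indicator_def)

lemma stay_le_iter: "stay B n y \<le> iter (indicator B) n y"
proof (induction n arbitrary: y)
  case (Suc n)
  have "indicator B y * (\<integral>\<^sup>+z. stay B n (y + z) \<partial>\<nu>) \<le> 1 * (\<integral>\<^sup>+z. iter (indicator B) n (y + z) \<partial>\<nu>)"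
    by (intro mult_mono nn_integral_mono Suc) (auto simp: indicator_def)
  then show ?case by simp
qed simp

lemma stay_shift: "stay {c..} n y = stay {0..} n (y - c)"
proof (induction n arbitrary: y)
  case (Suc n)
  have "stay {c..} n (y + z) = stay {0..} n (y - c + z)" for z
    by (simp add: Suc algebra_simps)
  then show ?case by (simp add: indicator_def)
qed (auto simp: indicator_def)

lemma stay_half_line_mono: "x \<le> y \<Longrightarrow> stay {c..} n x \<le> stay {c..} n y"
  by (induction n arbitrary: x y) (auto intro!: nn_integral_mono mult_mono simp: indicator_def)

lemma stay_tendsto: "(\<lambda>n. stay B n y) \<longlonglongrightarrow> stay_forever B y"
  unfolding stay_forever_def by (intro LIMSEQ_INF decseq_stay)

lemma stay_forever_le: "stay_forever B y \<le> stay B n y"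
  unfolding stay_forever_def by (intro INF_lower) simp

lemma stay_forever_le_1: "stay_forever B y \<le> 1"
  using stay_forever_le[of B y 0] stay_le_1[of B 0 y] by (rule order_trans)

lemma stay_forever_step:
  assumes [measurable]: "B \<in> sets borel"
  shows "stay_forever B y = indicator B y * (\<integral>\<^sup>+z. stay_forever B (y + z) \<partial>\<nu>)"
proof -
  have "(\<lambda>n. \<integral>\<^sup>+z. stay B n (y + z) \<partial>\<nu>) \<longlonglongrightarrow> (\<integral>\<^sup>+z. stay_forever B (y + z) \<partial>\<nu>)"
    by (intro nn_integral_dominated_convergence[where w="\<lambda>_. 1"])
       (auto simp: stay_le_1 stay_tendsto)
  then have "(\<lambda>n. stay B (Suc n) y) \<longlonglongrightarrow> indicator B y * (\<integral>\<^sup>+z. stay_forever B (y + z) \<partial>\<nu>)"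
    by (auto simp: indicator_def)
  moreover have "(\<lambda>n. stay B (Suc n) y) \<longlonglongrightarrow> stay_forever B y"
    by (rule LIMSEQ_Suc[OF stay_tendsto])
  ultimately show ?thesis by (rule LIMSEQ_unique[symmetric])
qed

text \<open>
  Lindley's waiting-time chain. Its value at time \<open>n\<close> is distributed like minus the
  minimum of \<open>n + 1\<close> successive positions of the walk started at \<open>0\<close>,
  so that \<open>emeasure_lindley\<close> turns the probability of staying above
  \<open>0\<close> into a distribution function. Unlike the minimum itself, the chain satisfies
  a one-step balance of means, which detects the sign of the drift.
\<close>

primrec lindley :: "nat \<Rightarrow> real measure" where
  "lindley 0 = return borel 0"
| "lindley (Suc n) = distr (lindley n \<Otimes>\<^sub>M \<nu>) borel (\<lambda>(q, x). max 0 (q - x))"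

lemma sets_lindley [measurable_cong, simp]: "sets (lindley n) = sets borel"
  by (cases n) auto

lemma prob_space_lindley: "prob_space (lindley n)"
proof (induction n)
  case 0
  show ?case by (simp add: prob_space_return)
next
  case (Suc n)
  interpret L: prob_space "lindley n" by fact
  interpret LN: pair_prob_space "lindley n" \<nu> ..
  show ?case unfolding lindley.simps by (intro LN.prob_space_distr) measurable
qed

lemma nn_integral_lindley_Suc:
  assumes [measurable]: "f \<in> borel_measurable borel"
  shows "(\<integral>\<^sup>+q. f q \<partial>lindley (Suc n)) = (\<integral>\<^sup>+q. \<integral>\<^sup>+x. f (max 0 (q - x)) \<partial>\<nu> \<partial>lindley n)"
proof -
  interpret L: prob_space "lindley n" by (rule prob_space_lindley)
  interpret LN: pair_prob_space "lindley n" \<nu> ..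
  show ?thesis
    by (simp add: nn_integral_distr nn_integral_fst[symmetric] split_beta')
qed

text \<open>
  The transition of the chain preserves monotone functions, and the chain starts in its smallest
  state; so it is stochastically increasing in time.
\<close>

lemma nn_integral_lindley_mono:
  assumes "mono f" and [measurable]: "f \<in> borel_measurable borel"
  shows "(\<integral>\<^sup>+q. f q \<partial>lindley n) \<le> (\<integral>\<^sup>+q. f q \<partial>lindley (Suc n))"
  using assms
proof (induction n arbitrary: f)
  case (0 f)
  note [measurable] = 0(2)
  have "(\<integral>\<^sup>+q. f q \<partial>lindley 0) = (\<integral>\<^sup>+x. f 0 \<partial>\<nu>)"
    by (simp add: nn_integral_return)
  also have "\<dots> \<le> (\<integral>\<^sup>+x. f (max 0 (0 - x)) \<partial>\<nu>)"
    by (intro nn_integral_mono monoD[OF 0(1)]) simp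
  also have "\<dots> = (\<integral>\<^sup>+q. f q \<partial>lindley (Suc 0))"
    by (subst nn_integral_lindley_Suc) (auto simp: nn_integral_return)
  finally show ?case .
next
  case (Suc n f)
  note [measurable] = Suc(3)
  have "mono (\<lambda>q. \<integral>\<^sup>+x. f (max 0 (q - x)) \<partial>\<nu>)"
    by (intro monoI nn_integral_mono monoD[OF Suc(2)]) auto
  then show ?case
    unfolding nn_integral_lindley_Suc[OF Suc(3)] by (rule Suc.IH) measurable
qed

lemma emeasure_lindley: "emeasure (lindley n) {..y} = stay {0..} n y"
proof (induction n arbitrary: y)
  case 0
  show ?case by (simp add: indicator_def)
next
  case (Suc n)
  interpret L: prob_space "lindley n" by (rule prob_space_lindley)
  interpret LN: pair_prob_space "lindley n" \<nu> ..
  have "emeasure (lindley (Suc n)) {..y} = (\<integral>\<^sup>+q. indicator {..y} q \<partial>lindley (Suc n))"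
    by simp
  also have "\<dots> = (\<integral>\<^sup>+q. \<integral>\<^sup>+x. indicator {..y} (max 0 (q - x)) \<partial>\<nu> \<partial>lindley n)"
    by (rule nn_integral_lindley_Suc) simp
  also have "\<dots> = (\<integral>\<^sup>+x. \<integral>\<^sup>+q. indicator {..y} (max 0 (q - x)) \<partial>lindley n \<partial>\<nu>)"
    by (rule LN.Fubini'[symmetric]) measurable
  also have "\<dots> = (\<integral>\<^sup>+x. indicator {0..} y * (\<integral>\<^sup>+q. indicator {..y + x} q \<partial>lindley n) \<partial>\<nu>)"
    by (subst nn_integral_cmult[symmetric])
       (auto intro!: nn_integral_cong simp: indicator_def)
  also have "\<dots> = (\<integral>\<^sup>+x. indicator {0..} y * stay {0..} n (y + x) \<partial>\<nu>)"
    by (simp add: Suc)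
  also have "\<dots> = stay {0..} (Suc n) y"
    by (simp add: nn_integral_cmult)
  finally show ?case .
qed

lemma pos_part_finite: "(\<integral>\<^sup>+x. ennreal x \<partial>\<nu>) < \<infinity>"
proof -
  have "(\<integral>\<^sup>+x. ennreal x \<partial>\<nu>) \<le> (\<integral>\<^sup>+x. ennreal (norm x) \<partial>\<nu>)"
    by (intro nn_integral_mono ennreal_leI) simp
  also have "\<dots> < \<infinity>" using integrable_step by (simp add: integrable_iff_bounded)
  finally show ?thesis .
qed

lemma neg_part_finite: "(\<integral>\<^sup>+x. ennreal (- x) \<partial>\<nu>) < \<infinity>"
proof -
  have "(\<integral>\<^sup>+x. ennreal (- x) \<partial>\<nu>) \<le> (\<integral>\<^sup>+x. ennreal (norm x) \<partial>\<nu>)"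
    by (intro nn_integral_mono ennreal_leI) simp
  also have "\<dots> < \<infinity>" using integrable_step by (simp add: integrable_iff_bounded)
  finally show ?thesis .
qed

lemma neg_part_less_pos_part: "(\<integral>\<^sup>+x. ennreal (- x) \<partial>\<nu>) < (\<integral>\<^sup>+x. ennreal x \<partial>\<nu>)"
proof -
  have "(\<integral>z. z \<partial>\<nu>) = enn2real (\<integral>\<^sup>+x. ennreal x \<partial>\<nu>) - enn2real (\<integral>\<^sup>+x. ennreal (- x) \<partial>\<nu>)"
    by (rule real_lebesgue_integral_def[OF integrable_step])
  then have "enn2real (\<integral>\<^sup>+x. ennreal (- x) \<partial>\<nu>) < enn2real (\<integral>\<^sup>+x. ennreal x \<partial>\<nu>)"
    using drift_pos by simp
  then show ?thesis using pos_part_finite neg_part_finite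
    by (metis enn2real_mono infinity_ennreal_def not_less)
qed

lemma lindley_nonneg: "AE q in lindley n. 0 \<le> q"
proof (cases n)
  case 0
  show ?thesis unfolding 0 lindley.simps by (subst AE_return) auto
next
  case (Suc m)
  show ?thesis unfolding Suc lindley.simps by (subst AE_distr_iff) (auto simp: split_beta')
qed

text \<open>
  For \<open>q \<ge> 0\<close>, \<open>max 0 (q - x) + max 0 x = q + max 0 (- x) + max 0 (x -
  q)\<close>. Taking means over the chain and the step, and using that the (finite) mean of the
  chain does not decrease, bounds the upward mean of the step by its downward mean plus the mean
  idle time \<open>max 0 (x - q)\<close>. Under positive drift the idle time therefore cannot
  vanish.
\<close>

lemma lindley_drift_balance:
  "(\<integral>\<^sup>+x. ennreal x \<partial>\<nu>) \<le> (\<integral>\<^sup>+x. ennreal (- x) \<partial>\<nu>) + (\<integral>\<^sup>+q. \<integral>\<^sup>+x. ennreal (x - q) \<partial>\<nu> \<partial>lindley n)"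
proof -
  let ?m = "\<lambda>n. \<integral>\<^sup>+q. ennreal q \<partial>lindley n"
  have mono: "mono (\<lambda>q::real. ennreal q)" by (intro monoI ennreal_leI)
  note AE0 = lindley_nonneg
  have eq: "?m (Suc n) + (\<integral>\<^sup>+x. ennreal x \<partial>\<nu>) =
    ?m n + ((\<integral>\<^sup>+x. ennreal (- x) \<partial>\<nu>) + (\<integral>\<^sup>+q. \<integral>\<^sup>+x. ennreal (x - q) \<partial>\<nu> \<partial>lindley n))" for n
  proof -
    have const: "(\<integral>\<^sup>+q. c \<partial>lindley n) = c" for c
      by (simp add: prob_space.emeasure_space_1[OF prob_space_lindley])
    have pointwise: "ennreal (max 0 (q - x)) + ennreal x = ennreal q + (ennreal (- x) + ennreal (x - q))"
      if q: "0 \<le> q" for q x :: real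
    proof -
      have "ennreal (max 0 (q - x)) + ennreal x = ennreal (max 0 (q - x) + max 0 x)"
        by (subst ennreal_plus) (auto simp: max_def ennreal_neg)
      also have "max 0 (q - x) + max 0 x = q + (max 0 (-x) + max 0 (x - q))"
        using q by (auto simp: max_def)
      also have "ennreal \<dots> = ennreal q + (ennreal (- x) + ennreal (x - q))"
        using q by (auto simp: max_def ennreal_neg ennreal_plus[symmetric] simp del: ennreal_plus)
      finally show ?thesis .
    qed
    have "?m (Suc n) + (\<integral>\<^sup>+x. ennreal x \<partial>\<nu>) =
      (\<integral>\<^sup>+q. \<integral>\<^sup>+x. ennreal (max 0 (q - x)) \<partial>\<nu> \<partial>lindley n) + (\<integral>\<^sup>+q. (\<integral>\<^sup>+x. ennreal x \<partial>\<nu>) \<partial>lindley n)"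
      unfolding const by (subst nn_integral_lindley_Suc) simp_all
    also have "\<dots> = (\<integral>\<^sup>+q. (\<integral>\<^sup>+x. ennreal (max 0 (q - x)) \<partial>\<nu>) + (\<integral>\<^sup>+x. ennreal x \<partial>\<nu>) \<partial>lindley n)"
      by (rule nn_integral_add[symmetric]) measurable
    also have "\<dots> = (\<integral>\<^sup>+q. \<integral>\<^sup>+x. ennreal (max 0 (q - x)) + ennreal x \<partial>\<nu> \<partial>lindley n)"
      by (intro nn_integral_cong nn_integral_add[symmetric]) measurable
    also have "\<dots> = (\<integral>\<^sup>+q. \<integral>\<^sup>+x. ennreal q + (ennreal (- x) + ennreal (x - q)) \<partial>\<nu> \<partial>lindley n)"
      by (rule nn_integral_cong_AE, rule AE_mp[OF AE0], intro AE_I2 impI nn_integral_cong pointwise)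
    also have "\<dots> = (\<integral>\<^sup>+q. ennreal q + ((\<integral>\<^sup>+x. ennreal (- x) \<partial>\<nu>) + (\<integral>\<^sup>+x. ennreal (x - q) \<partial>\<nu>)) \<partial>lindley n)"
      by (intro nn_integral_cong) (simp add: nn_integral_add)
    also have "\<dots> = ?m n + (\<integral>\<^sup>+q. (\<integral>\<^sup>+x. ennreal (- x) \<partial>\<nu>) + (\<integral>\<^sup>+x. ennreal (x - q) \<partial>\<nu>) \<partial>lindley n)"
      by (rule nn_integral_add) measurable
    also have "(\<integral>\<^sup>+q. (\<integral>\<^sup>+x. ennreal (- x) \<partial>\<nu>) + (\<integral>\<^sup>+x. ennreal (x - q) \<partial>\<nu>) \<partial>lindley n) =
      (\<integral>\<^sup>+x. ennreal (- x) \<partial>\<nu>) + (\<integral>\<^sup>+q. \<integral>\<^sup>+x. ennreal (x - q) \<partial>\<nu> \<partial>lindley n)"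
      by (subst nn_integral_add) (simp_all only: const, measurable)
    finally show ?thesis .
  qed
  have fin: "?m n < \<infinity>" for n
  proof (induction n)
    case 0 show ?case by (simp add: nn_integral_return)
  next
    case (Suc n)
    have "(\<integral>\<^sup>+q. \<integral>\<^sup>+x. ennreal (x - q) \<partial>\<nu> \<partial>lindley n) \<le> (\<integral>\<^sup>+q. \<integral>\<^sup>+x. ennreal x \<partial>\<nu> \<partial>lindley n)"
      by (rule nn_integral_mono_AE, rule AE_mp[OF AE0], intro AE_I2 impI nn_integral_mono ennreal_leI) simp
    also have "\<dots> < \<infinity>"
      using prob_space.emeasure_space_1[OF prob_space_lindley[of n]] pos_part_finite by simp
    finally have "?m (Suc n) + (\<integral>\<^sup>+x. ennreal x \<partial>\<nu>) < \<infinity>"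
      using Suc neg_part_finite unfolding eq infinity_ennreal_def ennreal_add_less_top by blast
    then show ?case unfolding infinity_ennreal_def ennreal_add_less_top by blast
  qed
  have "?m n + (\<integral>\<^sup>+x. ennreal x \<partial>\<nu>) \<le> ?m (Suc n) + (\<integral>\<^sup>+x. ennreal x \<partial>\<nu>)"
    by (intro add_right_mono nn_integral_lindley_mono mono) simp
  also note eq
  finally show ?thesis using fin[of n] by (auto simp: ennreal_add_left_cancel_le)
qed

lemma excess_tendsto_0: "(\<lambda>n::nat. \<integral>\<^sup>+x. ennreal (x - real n) \<partial>\<nu>) \<longlonglongrightarrow> 0"
proof -
  have "(\<lambda>n::nat. \<integral>\<^sup>+x. ennreal (x - real n) \<partial>\<nu>) \<longlonglongrightarrow> (\<integral>\<^sup>+x. 0 \<partial>\<nu>)"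
  proof (rule nn_integral_dominated_convergence[where w="\<lambda>x. ennreal x"])
    show "AE x in \<nu>. (\<lambda>n. ennreal (x - real n)) \<longlonglongrightarrow> 0"
    proof (intro AE_I2 tendsto_eventually)
      fix x :: real
      have "eventually (\<lambda>n. real n \<ge> x) sequentially"
        by (rule eventually_sequentiallyI[of "nat \<lceil>x\<rceil>"]) linarith
      then show "eventually (\<lambda>n. ennreal (x - real n) = 0) sequentially"
        by eventually_elim (simp add: ennreal_neg)
    qed
    show "(\<integral>\<^sup>+x. ennreal x \<partial>\<nu>) < \<infinity>" by (rule pos_part_finite)
    show "AE x in \<nu>. ennreal (x - real n) \<le> ennreal x" for n
      by (intro AE_I2 ennreal_leI) simp
  qed simp_all
  then show ?thesis by simp
qed

text \<open>
  By the drift balance the mean idle time is at least the drift, uniformly in \<open>n\<close>.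
  Idle time collected while the chain is above a large level \<open>K\<close> is less than that;
  hence the chain lies below \<open>K\<close> with a probability bounded away from
  \<open>0\<close>.
\<close>

lemma stay_half_line_pos: "\<exists>K\<ge>0. 0 < stay_forever {0..} K"
proof -
  let ?p = "\<integral>\<^sup>+x. ennreal x \<partial>\<nu>" and ?m = "\<integral>\<^sup>+x. ennreal (- x) \<partial>\<nu>"
  have "0 < ?p - ?m" using neg_part_less_pos_part by (simp add: diff_gr0_ennreal)
  then have "eventually (\<lambda>n::nat. (\<integral>\<^sup>+x. ennreal (x - real n) \<partial>\<nu>) < ?p - ?m) sequentially"
    by (rule order_tendstoD(2)[OF excess_tendsto_0])
  then obtain K0 :: nat where K0: "(\<integral>\<^sup>+x. ennreal (x - real K0) \<partial>\<nu>) < ?p - ?m"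
    by (auto simp: eventually_sequentially)
  \<comment> \<open>\<open>c\<close> bounds the idle time above level \<open>K\<close>; it is less than the drift, the difference of \<open>?p\<close> and \<open>?m\<close>\<close>
  define K where "K = real K0"
  define c where "c = (\<integral>\<^sup>+x. ennreal (x - K) \<partial>\<nu>)"
  have c: "?m + c < ?p"
    using K0 neg_part_finite unfolding c_def[symmetric] K_def[symmetric]
    by (subst (asm) less_diff_eq_ennreal) (auto simp: less_top[symmetric] add.commute)
  have bound: "?p \<le> (?m + c) + ennreal K * stay {0..} n K" for n
  proof -
    interpret L: prob_space "lindley n" by (rule prob_space_lindley)
    have "(\<integral>\<^sup>+q. \<integral>\<^sup>+x. ennreal (x - q) \<partial>\<nu> \<partial>lindley n) \<le>
          (\<integral>\<^sup>+q. c + ennreal K * indicator {..K} q \<partial>lindley n)"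
    proof (intro nn_integral_mono_AE)
      show "AE q in lindley n. (\<integral>\<^sup>+x. ennreal (x - q) \<partial>\<nu>) \<le> c + ennreal K * indicator {..K} q"
        using lindley_nonneg
      proof eventually_elim
        fix q :: real assume q: "0 \<le> q"
        show "(\<integral>\<^sup>+x. ennreal (x - q) \<partial>\<nu>) \<le> c + ennreal K * indicator {..K} q"
        proof (cases "q \<le> K")
          case True
          have "(\<integral>\<^sup>+x. ennreal (x - q) \<partial>\<nu>) \<le> (\<integral>\<^sup>+x. ennreal (x - K) + ennreal K \<partial>\<nu>)"
          proof (intro nn_integral_mono)
            fix x
            have "ennreal (x - q) \<le> ennreal (max 0 (x - K) + K)"
              using q by (intro ennreal_leI) (auto simp: K_def)
            also have "\<dots> = ennreal (x - K) + ennreal K"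
              by (subst ennreal_plus) (auto simp: K_def max_def ennreal_neg)
            finally show "ennreal (x - q) \<le> ennreal (x - K) + ennreal K" .
          qed
          also have "\<dots> = c + ennreal K" by (simp add: nn_integral_add c_def)
          finally show ?thesis using True by simp
        next
          case False
          then have "(\<integral>\<^sup>+x. ennreal (x - q) \<partial>\<nu>) \<le> c"
            unfolding c_def by (intro nn_integral_mono ennreal_leI) simp
          then show ?thesis by (simp add: add_increasing2)
        qed
      qed
    qed
    also have "\<dots> = c + ennreal K * stay {0..} n K"
      using L.emeasure_space_1 by (simp add: nn_integral_add nn_integral_cmult emeasure_lindley)
    finally have "?m + (\<integral>\<^sup>+q. \<integral>\<^sup>+x. ennreal (x - q) \<partial>\<nu> \<partial>lindley n) \<le> ?m + (c + ennreal K * stay {0..} n K)"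
      by (rule add_left_mono)
    with lindley_drift_balance[of n] show ?thesis
      unfolding add.assoc by (rule order_trans)
  qed
  have "(\<lambda>n. (?m + c) + ennreal K * stay {0..} n K) \<longlonglongrightarrow> (?m + c) + ennreal K * stay_forever {0..} K"
    by (intro tendsto_add tendsto_const ennreal_tendsto_cmult stay_tendsto) simp
  then have "?p \<le> (?m + c) + ennreal K * stay_forever {0..} K"
    by (rule LIMSEQ_le_const) (use bound in blast)
  then have "stay_forever {0..} K \<noteq> 0" using c by auto
  then show ?thesis by (intro exI[of _ K]) (auto simp: K_def zero_less_iff_neq_zero)
qed

text \<open>
  A zero-one argument: with \<open>L\<close> the supremum of the probabilities of never falling
  below \<open>0\<close>, the Markov property gives \<open>stay_forever {0..} y \<le> L * stay
  {0..} n y\<close>. In the limit \<open>n \<longlonglongrightarrow> \<infinity>\<close> a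
  positive value of \<open>stay_forever\<close> cancels, and \<open>L \<ge> 1\<close> remains.
\<close>

lemma stay_half_line_tendsto_1:
  assumes "a < 1"
  shows "\<exists>y\<ge>0. a < stay_forever {0..} y"
proof -
  define L where "L = (SUP y\<in>{0..}. stay_forever {0..} y)"
  have L1: "L \<le> 1" unfolding L_def by (intro SUP_least stay_forever_le_1)
  have le_L: "stay_forever {0..} y \<le> L" for y
  proof (cases "0 \<le> y")
    case True then show ?thesis unfolding L_def by (intro SUP_upper) auto
  next
    case False then have "stay_forever {0..} y \<le> 0"
      using stay_forever_le[of "{0..}" y 0] by (simp add: indicator_def)
    then show ?thesis by simp
  qed
  have le_stay: "stay_forever {0..} y \<le> L * stay {0..} n y" for n y
  proof (induction n arbitrary: y)
    case 0
    show ?case using le_L[of y] stay_forever_le[of "{0..}" y 0] by (auto simp: indicator_def split: if_splits)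
  next
    case (Suc n)
    have "stay_forever {0..} y = indicator {0..} y * (\<integral>\<^sup>+z. stay_forever {0..} (y + z) \<partial>\<nu>)"
      by (rule stay_forever_step) simp
    also have "\<dots> \<le> indicator {0..} y * (\<integral>\<^sup>+z. L * stay {0..} n (y + z) \<partial>\<nu>)"
      by (intro mult_left_mono nn_integral_mono Suc) simp
    also have "\<dots> = L * stay {0..} (Suc n) y"
      by (simp add: nn_integral_cmult mult_ac)
    finally show ?case .
  qed
  obtain K where K: "0 < stay_forever {0..} K" using stay_half_line_pos by blast
  have "(\<lambda>n. L * stay {0..} n K) \<longlonglongrightarrow> L * stay_forever {0..} K"
    using L1 by (intro ennreal_tendsto_cmult stay_tendsto) (auto simp: less_top[symmetric] top_unique)
  then have "stay_forever {0..} K \<le> L * stay_forever {0..} K"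
    by (rule LIMSEQ_le_const) (use le_stay in blast)
  moreover have "stay_forever {0..} K < \<infinity>"
    using le_less_trans[OF stay_forever_le_1[of "{0..}" K], of \<infinity>] by simp
  ultimately have "1 \<le> L"
    using K by (metis ennreal_mult_le_mult_iff infinity_ennreal_def less_irrefl mult.commute mult.right_neutral)
  then have "a < L" using assms by simp
  then show ?thesis unfolding L_def less_SUP_iff by auto
qed

lemma stay_half_line_large:
  assumes "\<epsilon> > 0"
  shows "\<exists>a\<ge>0. \<forall>n. \<forall>y\<ge>a. 1 - ennreal \<epsilon> \<le> stay {0..} n y"
proof -
  have "1 - ennreal \<epsilon> < 1" using assms by (simp add: ennreal_between)
  from stay_half_line_tendsto_1[OF this] obtain a where a: "a \<ge> 0" "1 - ennreal \<epsilon> < stay_forever {0..} a" by blast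
  have "1 - ennreal \<epsilon> \<le> stay {0..} n y" if "a \<le> y" for n y
    using a(2) order_trans[OF stay_forever_le[of "{0..}" a n] stay_half_line_mono[OF that, of 0 n]]
    by (intro less_imp_le) (rule less_le_trans)
  with a(1) show ?thesis by blast
qed

lemma step_above: "\<exists>\<eta>>0. 0 < emeasure \<nu> {\<eta>..}"
proof (rule ccontr)
  assume "\<not> ?thesis"
  then have "emeasure \<nu> {\<eta>..} = 0" if "\<eta> > 0" for \<eta>
    using that by (meson not_gr_zero)
  then have null: "{1 / real (Suc n)..} \<in> null_sets \<nu>" for n by (intro null_setsI) auto
  have "AE z in \<nu>. z \<le> 0"
  proof (rule AE_I)
    show "{z \<in> space \<nu>. \<not> z \<le> 0} \<subseteq> (\<Union>n. {1 / real (Suc n)..})"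
    proof
      fix z assume "z \<in> {z \<in> space \<nu>. \<not> z \<le> 0}"
      then have "0 < z" by simp
      then obtain n where "1 / real (Suc n) < z" by (rule nat_approx_posE)
      then show "z \<in> (\<Union>n. {1 / real (Suc n)..})" by (auto intro: less_imp_le)
    qed
    show "(\<Union>n. {1 / real (Suc n)..}) \<in> sets \<nu>" by auto
    show "emeasure \<nu> (\<Union>n. {1 / real (Suc n)..}) = 0"
      using null by (intro null_setsD1) auto
  qed
  then have "0 \<le> (\<integral>z. - z \<partial>\<nu>)" by (intro integral_nonneg_AE) auto
  then show False using drift_pos by simp
qed

text \<open>
  From each point of an interval of length \<open>\<eta>\<close> the walk can step beyond its
  right end and then never return, with a probability at least \<open>\<rho>\<close> that does
  not depend on the interval. Each visit is the last one with that probability, so the expected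
  number of visits is at most \<open>1 / \<rho>\<close>.
\<close>

theorem green_function_bounded:
  "\<exists>\<eta>>0. \<exists>C<\<infinity>. \<forall>u y. (\<Sum>n. iter (indicator {u..<u+\<eta>}) n y) \<le> C"
proof -
  obtain \<eta> where \<eta>: "\<eta> > 0" "0 < emeasure \<nu> {\<eta>..}" using step_above by blast
  define p where "p = emeasure \<nu> {\<eta>..}"
  have p: "0 < p" "p \<le> 1" using \<eta> emeasure_le_1 unfolding p_def by auto
  let ?G = "stay_forever {0..}"
  have G_mono: "?G x \<le> ?G y" if "x \<le> y" for x y
    unfolding stay_forever_def by (intro INF_mono') (rule stay_half_line_mono[OF that])
  have step: "p * ?G (y + \<eta>) \<le> (\<integral>\<^sup>+z. ?G (y + z) \<partial>\<nu>)" for y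
  proof -
    have "p * ?G (y + \<eta>) = (\<integral>\<^sup>+z. ?G (y + \<eta>) * indicator {\<eta>..} z \<partial>\<nu>)"
      by (subst nn_integral_cmult_indicator) (simp_all add: p_def mult.commute)
    also have "\<dots> \<le> (\<integral>\<^sup>+z. ?G (y + z) \<partial>\<nu>)"
      by (intro nn_integral_mono) (auto simp: indicator_def intro: G_mono)
    finally show ?thesis .
  qed
  \<comment> \<open>\<open>k\<close> upward steps of size at least \<open>\<eta>\<close> lead to a level from which the walk may stay above \<open>0\<close> forever\<close>
  have "p ^ k * ?G (y + real k * \<eta>) \<le> ?G y" if "y \<ge> 0" for k y
    using that
  proof (induction k arbitrary: y)
    case (Suc k)
    have "p ^ Suc k * ?G (y + real (Suc k) * \<eta>) = p * (p ^ k * ?G (y + \<eta> + real k * \<eta>))"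
      by (simp add: algebra_simps)
    also have "\<dots> \<le> p * ?G (y + \<eta>)"
      using Suc \<eta>(1) by (intro mult_left_mono) auto
    also have "\<dots> \<le> (\<integral>\<^sup>+z. ?G (y + z) \<partial>\<nu>)" by (rule step)
    also have "\<dots> = ?G y" using Suc.prems by (subst (2) stay_forever_step) auto
    finally show ?case .
  qed simp
  then have pow: "p ^ k * ?G (real k * \<eta>) \<le> ?G 0" for k
    by (metis add.left_neutral order_refl)
  obtain K where K: "0 < ?G K" using stay_half_line_pos by blast
  obtain k :: nat where "K < real k * \<eta>" using reals_Archimedean3[OF \<eta>(1)] by blast
  then have "0 < ?G (real k * \<eta>)" using K G_mono[of K "real k * \<eta>"] by auto
  then have "0 < p ^ k * ?G (real k * \<eta>)"
  proof -
    have "p ^ k \<noteq> 0" using p(1) by simp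
    then have "0 < p ^ k" by (metis not_gr_zero)
    with \<open>0 < ?G (real k * \<eta>)\<close> show ?thesis by (simp only: ennreal_zero_less_mult_iff simp_thms)
  qed
  then have G0: "0 < ?G 0" using less_le_trans[OF _ pow[of k]] by blast
  define \<rho> where "\<rho> = p * ?G 0"
  have \<rho>: "0 < \<rho>" "\<rho> \<le> 1"
  proof -
    show "0 < \<rho>" using p(1) G0 by (simp add: \<rho>_def ennreal_zero_less_mult_iff)
    show "\<rho> \<le> 1" unfolding \<rho>_def using mult_mono[OF p(2) stay_forever_le_1, of "{0..}" 0] by simp
  qed
  have escape: "\<rho> \<le> (\<integral>\<^sup>+z. stay_forever (- {u..<u+\<eta>}) (y + z) \<partial>\<nu>)" if y: "u \<le> y" for u y
  proof -
    have "\<rho> \<le> (\<integral>\<^sup>+z. ?G (- \<eta> + z) \<partial>\<nu>)"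
      using step[of "-\<eta>"] by (simp add: \<rho>_def)
    also have "\<dots> \<le> (\<integral>\<^sup>+z. stay_forever (- {u..<u+\<eta>}) (y + z) \<partial>\<nu>)"
    proof (intro nn_integral_mono)
      fix z
      have "?G (- \<eta> + z) \<le> ?G (y + z - (u + \<eta>))" by (rule G_mono) (use y in simp)
      also have "\<dots> = stay_forever {u+\<eta>..} (y + z)"
        by (simp add: stay_forever_def stay_shift[of "u + \<eta>"])
      also have "\<dots> \<le> stay_forever (- {u..<u+\<eta>}) (y + z)"
        unfolding stay_forever_def by (intro INF_mono' stay_mono) auto
      finally show "?G (- \<eta> + z) \<le> stay_forever (- {u..<u+\<eta>}) (y + z)" .
    qed
    finally show ?thesis .
  qed
  \<comment> \<open>the last visit before time \<open>n\<close>: visits weighted by their probability \<open>\<rho>\<close> of being the last one\<close>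
  have sums: "stay_forever (- {u..<u+\<eta>}) y + \<rho> * (\<Sum>i<n. iter (indicator {u..<u+\<eta>}) i y)
      \<le> iter (stay_forever (- {u..<u+\<eta>})) n y" for u n y
  proof (induction n arbitrary: y)
    case (Suc n)
    let ?I = "{u..<u+\<eta>}" and ?N = "stay_forever (- {u..<u+\<eta>})"
    have "?N y + \<rho> * (\<Sum>i<Suc n. iter (indicator ?I) i y) =
      (?N y + \<rho> * indicator ?I y) + \<rho> * (\<Sum>i<n. iter (indicator ?I) (Suc i) y)"
      by (subst sum.lessThan_Suc_shift) (simp add: distrib_left add_ac)
    also have "?N y + \<rho> * indicator ?I y \<le> (\<integral>\<^sup>+z. ?N (y + z) \<partial>\<nu>)"
    proof (cases "y \<in> ?I")
      case True
      then have "?N y \<le> 0" using stay_forever_le[of "- ?I" y 0] by simp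
      then show ?thesis using True escape[of u y] by simp
    next
      case False
      then show ?thesis by (subst stay_forever_step) auto
    qed
    also have "(\<Sum>i<n. iter (indicator ?I) (Suc i) y) = (\<integral>\<^sup>+z. (\<Sum>i<n. iter (indicator ?I) i (y + z)) \<partial>\<nu>)"
      by (simp add: nn_integral_sum)
    also have "(\<integral>\<^sup>+z. ?N (y + z) \<partial>\<nu>) + \<rho> * \<dots> =
      (\<integral>\<^sup>+z. ?N (y + z) + \<rho> * (\<Sum>i<n. iter (indicator ?I) i (y + z)) \<partial>\<nu>)"
      by (simp add: nn_integral_add nn_integral_cmult)
    also have "\<dots> \<le> (\<integral>\<^sup>+z. iter ?N n (y + z) \<partial>\<nu>)"
      by (intro nn_integral_mono Suc)
    finally show ?case by (simp add: add_right_mono)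
  qed simp
  have bound: "(\<Sum>i<n. iter (indicator {u..<u+\<eta>}) i y) \<le> 1 / \<rho>" for u n y
  proof -
    have "\<rho> * (\<Sum>i<n. iter (indicator {u..<u+\<eta>}) i y) \<le>
      stay_forever (- {u..<u+\<eta>}) y + \<rho> * (\<Sum>i<n. iter (indicator {u..<u+\<eta>}) i y)"
      by simp
    also note sums
    also have "iter (stay_forever (- {u..<u+\<eta>})) n y \<le> iter (\<lambda>_. 1) n y"
      by (intro iter_mono stay_forever_le_1)
    finally have "\<rho> * (\<Sum>i<n. iter (indicator {u..<u+\<eta>}) i y) \<le> 1" by simp
    then have "(\<Sum>i<n. iter (indicator {u..<u+\<eta>}) i y) * \<rho> / \<rho> \<le> 1 / \<rho>"
      unfolding mult.commute[of \<rho>] by (rule divide_right_mono_ennreal)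
    moreover have "\<rho> \<noteq> top" using \<rho>(2) by (auto simp: top_unique)
    moreover have "\<rho> \<noteq> 0" using \<rho>(1) by auto
    ultimately show ?thesis
      by (simp only: mult_divide_eq_ennreal not_False_eq_True)
  qed
  have "(\<Sum>n. iter (indicator {u..<u+\<eta>}) n y) \<le> 1 / \<rho>" for u y
    by (intro suminf_le_const) (auto intro: bound)
  moreover have "1 / \<rho> < \<infinity>" using \<rho> by (simp add: ennreal_divide_eq_top_iff less_top[symmetric])
  ultimately show ?thesis using \<eta>(1) by blast
qed

text \<open>
  Extends the bound on visits from single intervals to functions dominated by a step function
  with cells of length \<open>\<eta>\<close>.
\<close>

lemma green_function_bounded_layers:
  assumes "\<And>u y. (\<Sum>n. iter (indicator {u..<u+\<eta>}) n y) \<le> C"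
    and le: "\<And>v. g v \<le> (\<Sum>k. a k * indicator {u k..<u k+\<eta>} v)"
  shows "(\<Sum>n. iter g n y) \<le> C * (\<Sum>k. a k)"
proof -
  have "(\<Sum>n. iter g n y) \<le> (\<Sum>n. iter (\<lambda>v. \<Sum>k. a k * indicator {u k..<u k+\<eta>} v) n y)"
    by (intro suminf_le iter_mono le) auto
  also have "\<dots> = (\<Sum>n. \<Sum>k. a k * iter (indicator {u k..<u k+\<eta>}) n y)"
    by (subst iter_suminf) (auto simp: iter_cmult)
  also have "\<dots> = (\<Sum>k. \<Sum>n. a k * iter (indicator {u k..<u k+\<eta>}) n y)"
    by (rule suminf_swap_ennreal)
  also have "\<dots> \<le> (\<Sum>k. a k * C)"
    by (intro suminf_le) (auto intro!: mult_left_mono assms(1))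
  also have "\<dots> = C * (\<Sum>k. a k)" by (simp add: mult.commute)
  finally show ?thesis .
qed

text \<open>
  The interval between \<open>c\<close> and \<open>s\<close> is covered by finitely many cells,
  each with a finite expected number of visits, so its probability tends to \<open>0\<close>;
  below \<open>c\<close> the walk is with small probability at any time, if \<open>c\<close> is
  far enough below the starting point.
\<close>

lemma iter_below_tendsto_0: "(\<lambda>n. iter (indicator {..<s}) n y) \<longlonglongrightarrow> 0"
proof (rule tendsto_0_ennrealI)
  fix \<epsilon> :: real assume \<epsilon>: "\<epsilon> > 0"
  obtain \<eta> C where gf: "\<eta> > 0" "C < \<infinity>" "\<And>u y. (\<Sum>n. iter (indicator {u..<u+\<eta>}) n y) \<le> C"
    using green_function_bounded by blast
  obtain a where a: "a \<ge> 0" "\<And>n y. y \<ge> a \<Longrightarrow> 1 - ennreal (\<epsilon>/2) \<le> stay {0..} n y"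
    using stay_half_line_large[of "\<epsilon>/2"] \<epsilon> by auto
  define c where "c = y - a"
  obtain K :: nat where K: "s - c < real K * \<eta>" using reals_Archimedean3[OF gf(1)] by blast
  let ?cell = "\<lambda>k. {c + real k * \<eta> ..< c + real k * \<eta> + \<eta>}"
  have "(\<lambda>n. \<Sum>k<K. iter (indicator (?cell k)) n y) \<longlonglongrightarrow> (\<Sum>k<K. 0)"
  proof (intro tendsto_sum)
    fix k
    have "(\<Sum>n. iter (indicator (?cell k)) n y) < \<infinity>" using gf(2) gf(3) by (rule order.strict_trans1[rotated])
    then show "(\<lambda>n. iter (indicator (?cell k)) n y) \<longlonglongrightarrow> 0"
      by (rule suminf_finite_imp_tendsto_0)
  qed
  then have "eventually (\<lambda>n. (\<Sum>k<K. iter (indicator (?cell k)) n y) < ennreal (\<epsilon>/2)) sequentially"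
    using \<epsilon> by (intro order_tendstoD(2)[where y=0]) auto
  then show "eventually (\<lambda>n. iter (indicator {..<s}) n y < ennreal \<epsilon>) sequentially"
  proof eventually_elim
    case (elim n)
    have cover: "indicator {..<s} v \<le> (indicator {..<c} v :: ennreal) + (\<Sum>k<K. indicator (?cell k) v)" for v
    proof (cases "v < s \<and> c \<le> v")
      case True
      define k where "k = nat \<lfloor>(v - c) / \<eta>\<rfloor>"
      have k: "real k \<le> (v - c) / \<eta>" "(v - c) / \<eta> < real k + 1"
        using True gf(1) by (auto simp: k_def)
      then have "v \<in> ?cell k" using gf(1) by (auto simp: field_simps)
      moreover have "real k * \<eta> \<le> v - c" using k(1) gf(1) by (simp add: pos_le_divide_eq)
      then have "real k * \<eta> < real K * \<eta>" using K True by linarith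
      then have "k < K" using gf(1) by simp
      ultimately have "(1::ennreal) \<le> (\<Sum>k<K. indicator (?cell k) v)"
        using member_le_sum[of k "{..<K}" "\<lambda>k. indicator (?cell k) v :: ennreal"] by simp
      then show ?thesis by (simp add: indicator_def add_increasing)
    qed (auto simp: indicator_def)
    have "iter (indicator {..<c}) n y + iter (indicator {c..}) n y = iter (\<lambda>_. 1) n y"
    proof -
      have "(\<lambda>v. indicator {..<c} v + indicator {c..} v) = (\<lambda>_. 1 :: ennreal)"
        by (auto simp: fun_eq_iff indicator_def)
      then show ?thesis by (subst iter_add[symmetric]) (simp_all only:, measurable)
    qed
    then have one: "iter (indicator {..<c}) n y + iter (indicator {c..}) n y = 1" by simp
    have "1 - ennreal (\<epsilon>/2) \<le> stay {c..} n y"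
      using a(2)[of a n] unfolding stay_shift[of c n y] by (simp add: c_def)
    then have "1 - ennreal (\<epsilon>/2) \<le> iter (indicator {c..}) n y"
      by (rule order_trans[OF _ stay_le_iter])
    then have low: "iter (indicator {..<c}) n y \<le> ennreal (\<epsilon>/2)"
      by (rule ennreal_complement_le[OF one])
    have "iter (indicator {..<s}) n y \<le> iter (\<lambda>v. indicator {..<c} v + (\<Sum>k<K. indicator (?cell k) v)) n y"
      by (intro iter_mono cover)
    also have "\<dots> = iter (indicator {..<c}) n y + (\<Sum>k<K. iter (indicator (?cell k)) n y)"
    proof -
      have "iter (\<lambda>v. \<Sum>k<K. indicator (?cell k) v) n y = (\<Sum>k<K. iter (indicator (?cell k)) n y)" for K
        by (induction K) (auto simp: iter_add)
      then show ?thesis by (subst iter_add) auto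
    qed
    also have "\<dots> < ennreal (\<epsilon>/2) + ennreal (\<epsilon>/2)"
      using low elim by (rule ennreal_add_le_less_mono) simp
    also have "\<dots> = ennreal \<epsilon>" using \<epsilon> by (subst ennreal_plus[symmetric]) auto
    finally show ?case .
  qed
qed

text \<open>
  Optional stopping at the first exit from \<open>B\<close>: outside \<open>B\<close> the
  function vanishes, so only paths that stay in \<open>B\<close> count.
\<close>

lemma submartingale_le_stay:
  assumes [measurable]: "B \<in> sets borel"
    and sub: "\<And>y. f y \<le> (\<integral>\<^sup>+z. f (y + z) \<partial>\<nu>)"
    and bound: "\<And>y. f y \<le> K"
    and zero: "\<And>y. y \<notin> B \<Longrightarrow> f y = 0"
  shows "f y \<le> K * stay B n y"
proof (induction n arbitrary: y)
  case 0
  show ?case using bound[of y] zero[of y] by (auto simp: indicator_def)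
next
  case (Suc n)
  show ?case
  proof (cases "y \<in> B")
    case True
    note sub[of y]
    also have "(\<integral>\<^sup>+z. f (y + z) \<partial>\<nu>) \<le> (\<integral>\<^sup>+z. K * stay B n (y + z) \<partial>\<nu>)"
      by (intro nn_integral_mono Suc)
    also have "\<dots> = K * stay B (Suc n) y" using True by (simp add: nn_integral_cmult)
    finally show ?thesis .
  qed (simp add: zero)
qed

lemma tail_sum_finite:
  assumes "\<eta> > 0"
  shows "(\<Sum>k. emeasure \<nu> {real k * \<eta>..}) < \<infinity>"
proof -
  have "(\<Sum>k. emeasure \<nu> {real k * \<eta>..}) = (\<Sum>k. \<integral>\<^sup>+z. indicator {real k * \<eta>..} z \<partial>\<nu>)"
    by simp
  also have "\<dots> = (\<integral>\<^sup>+z. (\<Sum>k. indicator {real k * \<eta>..} z) \<partial>\<nu>)"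
    by (rule nn_integral_suminf[symmetric]) simp
  also have "\<dots> \<le> (\<integral>\<^sup>+z. 1 + ennreal (1 / \<eta>) * ennreal z \<partial>\<nu>)"
  proof (intro nn_integral_mono)
    fix z :: real
    define N where "N = nat (\<lfloor>z / \<eta>\<rfloor> + 1)"
    have "indicator {real k * \<eta>..} z = (0::ennreal)" if "k \<notin> {..<N}" for k
    proof -
      have "z / \<eta> < real k" using that unfolding N_def by (simp add: not_less) linarith
      then show ?thesis using assms by (simp add: field_simps)
    qed
    then have "(\<Sum>k. indicator {real k * \<eta>..} z :: ennreal) = (\<Sum>k<N. indicator {real k * \<eta>..} z)"
      by (intro suminf_finite) auto
    also have "\<dots> \<le> (\<Sum>k<N. 1)"
      by (intro sum_mono) (auto simp: indicator_def)
    also have "\<dots> = ennreal (real N)" by (simp add: ennreal_of_nat_eq_real_of_nat)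
    also have "\<dots> \<le> ennreal (1 + (1 / \<eta>) * max 0 z)"
    proof (intro ennreal_leI)
      show "real N \<le> 1 + (1 / \<eta>) * max 0 z"
      proof (cases "0 \<le> z")
        case True then show ?thesis using assms of_int_floor_le[of "z/\<eta>"] by (simp add: N_def max_def)
      next
        case False
        then have "z / \<eta> < 0" using assms by (simp add: field_simps)
        then have "N = 0" unfolding N_def by (simp add: floor_less_iff) linarith
        then show ?thesis using assms by simp
      qed
    qed
    also have "\<dots> = 1 + ennreal (1 / \<eta>) * ennreal z"
      using assms by (cases "0 \<le> z") (auto simp: ennreal_mult'[symmetric] ennreal_neg max_def)
    finally show "(\<Sum>k. indicator {real k * \<eta>..} z) \<le> 1 + ennreal (1 / \<eta>) * ennreal z" .
  qed
  also have "\<dots> = 1 + ennreal (1 / \<eta>) * (\<integral>\<^sup>+z. ennreal z \<partial>\<nu>)"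
    by (simp add: nn_integral_add nn_integral_cmult)
  also have "\<dots> < \<infinity>" using pos_part_finite by (simp add: ennreal_mult_less_top)
  finally show ?thesis .
qed

text \<open>
  To pass from the left of \<open>0\<close> to the right without touching \<open>{0..b}\<close>,
  the walk must make a step larger than \<open>b - u\<close> from some \<open>u < 0\<close>. The
  expected number of such steps is a Green function sum of the tails of the step, and these are
  summable because the step has finite mean. A large \<open>b\<close> makes it at most \<open>1
  / 2\<close>.
\<close>

theorem overshoot_bounded:
  "\<exists>b\<ge>0. \<forall>y<0. stay_forever (- {0..b}) y \<le> 1 / 2"
proof -
  obtain \<eta> C where gf: "\<eta> > 0" "C < \<infinity>" "\<And>u y. (\<Sum>n. iter (indicator {u..<u+\<eta>}) n y) \<le> C"
    using green_function_bounded by blast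
  define a where "a k = emeasure \<nu> {real k * \<eta>..}" for k
  have "(\<lambda>K. C * (\<Sum>k. a (k + K))) \<longlonglongrightarrow> C * 0"
    using gf(2) suminf_finite_imp_tail_tendsto_0[OF tail_sum_finite[OF gf(1), folded a_def]]
    by (intro ennreal_tendsto_cmult) auto
  then have "eventually (\<lambda>K. C * (\<Sum>k. a (k + K)) < 1 / 2) sequentially"
    by (intro order_tendstoD(2)[where y=0]) (auto simp: ennreal_zero_less_divide)
  then obtain K where K: "C * (\<Sum>k. a (k + K)) \<le> 1 / 2"
    by (auto simp: eventually_sequentially intro: less_imp_le)
  define b where "b = real K * \<eta>"
  have b: "b \<ge> 0" using gf(1) by (simp add: b_def)
  \<comment> \<open>\<open>g u\<close> is the probability of jumping over \<open>{0..b}\<close> from \<open>u < 0\<close>\<close>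
  define g :: "real \<Rightarrow> ennreal" where "g u = indicator {..<0} u * emeasure \<nu> {b - u<..}" for u
  have [measurable]: "g \<in> borel_measurable borel"
  proof -
    have "emeasure \<nu> {b - u<..} = (\<integral>\<^sup>+z. indicator {b<..} (u + z) \<partial>\<nu>)" for u
    proof -
      have "emeasure \<nu> {b - u<..} = (\<integral>\<^sup>+z. indicator {b - u<..} z \<partial>\<nu>)" by simp
      also have "\<dots> = (\<integral>\<^sup>+z. indicator {b<..} (u + z) \<partial>\<nu>)"
        by (intro nn_integral_cong) (auto simp: indicator_def)
      finally show ?thesis .
    qed
    then show ?thesis unfolding g_def by simp
  qed
  have g_layers: "g v \<le> (\<Sum>k. a (k + K) * indicator {- real (Suc k) * \<eta>..< - real (Suc k) * \<eta> + \<eta>} v)" for v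
  proof (cases "v < 0")
    case True
    define k where "k = nat (\<lceil>- v / \<eta>\<rceil> - 1)"
    have pos: "0 < - v / \<eta>" using True gf(1) by (simp add: divide_neg_pos)
    then have "0 < \<lceil>- v / \<eta>\<rceil>" by simp
    then have rk: "real k = of_int \<lceil>- v / \<eta>\<rceil> - 1" by (simp add: k_def)
    have k: "real k < - v / \<eta>" "- v / \<eta> \<le> real k + 1"
      unfolding rk by linarith+
    then have k': "real k * \<eta> < - v" "- v \<le> (real k + 1) * \<eta>"
      using gf(1) by (auto simp: field_simps)
    have "g v = emeasure \<nu> {b - v<..}" using True by (simp add: g_def)
    also have "\<dots> \<le> a (k + K)"
      unfolding a_def using k' by (intro emeasure_mono) (auto simp: b_def algebra_simps)
    also have "\<dots> = a (k + K) * indicator {- real (Suc k) * \<eta>..< - real (Suc k) * \<eta> + \<eta>} v"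
      using k' by (auto simp: indicator_def algebra_simps)
    also have "\<dots> \<le> (\<Sum>k. a (k + K) * indicator {- real (Suc k) * \<eta>..< - real (Suc k) * \<eta> + \<eta>} v)"
      by (rule member_le_suminf_ennreal)
    finally show ?thesis .
  qed (simp add: g_def)
  have green: "(\<Sum>n. iter g n y) \<le> 1 / 2" for y
    using green_function_bounded_layers[OF gf(3), of g "\<lambda>k. a (k + K)" "\<lambda>k. - real (Suc k) * \<eta>" y] g_layers K
    by (auto intro: order_trans)
  \<comment> \<open>avoiding \<open>{0..b}\<close> up to time \<open>n\<close> means being still on the left, or having jumped over it\<close>
  have skip: "stay (- {0..b}) n y \<le> iter (indicator {..<0}) n y + (\<Sum>i<n. iter g i y)" if "y < 0" for n y
    using that
  proof (induction n arbitrary: y)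
    case 0
    then show ?case by (simp add: indicator_def)
  next
    case (Suc n)
    let ?R = "\<lambda>n y. iter (indicator {..<0}) n y + (\<Sum>i<n. iter g i y)"
    have "stay (- {0..b}) (Suc n) y = (\<integral>\<^sup>+z. stay (- {0..b}) n (y + z) \<partial>\<nu>)"
      using Suc.prems by simp
    also have "\<dots> \<le> (\<integral>\<^sup>+z. ?R n (y + z) + indicator {b - y<..} z \<partial>\<nu>)"
    proof (intro nn_integral_mono)
      fix z
      show "stay (- {0..b}) n (y + z) \<le> ?R n (y + z) + indicator {b - y<..} z"
      proof (cases "y + z < 0")
        case True
        then show ?thesis by (intro order_trans[OF Suc.IH[OF True]]) simp
      next
        case False
        then have "stay (- {0..b}) n (y + z) \<le> indicator {b - y<..} z"
          using stay_le_indicator[of "- {0..b}" n "y + z"] by (auto simp: indicator_def split: if_splits)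
        then show ?thesis by (intro add_increasing) auto
      qed
    qed
    also have "\<dots> = iter (indicator {..<0}) (Suc n) y + ((\<Sum>i<n. iter g (Suc i) y) + g y)"
      using Suc.prems by (simp add: nn_integral_add nn_integral_sum g_def add.assoc)
    also have "(\<Sum>i<n. iter g (Suc i) y) + g y = (\<Sum>i<Suc n. iter g i y)"
      by (subst sum.lessThan_Suc_shift) (simp add: add.commute)
    finally show ?case .
  qed
  have "stay_forever (- {0..b}) y \<le> 1 / 2" if y: "y < 0" for y
  proof (rule LIMSEQ_le[OF stay_tendsto])
    have "(\<lambda>n. iter (indicator {..<0}) n y + 1 / 2) \<longlonglongrightarrow> 0 + 1 / 2"
      by (intro tendsto_add iter_below_tendsto_0 tendsto_const)
    then show "(\<lambda>n. iter (indicator {..<0}) n y + 1 / 2) \<longlonglongrightarrow> 1 / 2" by simp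
    have "(\<Sum>i<n. iter g i y) \<le> 1 / 2" for n
      using sum_le_suminf[of "\<lambda>i. iter g i y" "{..<n}"] green[of y] by (auto intro: order_trans)
    then show "\<exists>N. \<forall>n\<ge>N. stay (- {0..b}) n y \<le> iter (indicator {..<0}) n y + 1 / 2"
      using skip[OF y] by (meson add_left_mono order_trans)
  qed
  then show ?thesis using b by blast
qed

end

section \<open>Infinite products of numbers in the unit interval\<close>

definition infprod :: "(nat \<Rightarrow> real) \<Rightarrow> real" where
  "infprod a = lim (\<lambda>n. \<Prod>j<n. a j)"

lemma prod_unit_bounds:
  fixes a :: "nat \<Rightarrow> real"
  assumes "\<And>j. 0 \<le> a j" "\<And>j. a j \<le> 1"
  shows "0 \<le> (\<Prod>j<n. a j)" "(\<Prod>j<n. a j) \<le> 1"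
  using assms by (auto intro!: prod_nonneg prod_le_1)

lemma infprod_LIMSEQ:
  assumes "\<And>j. 0 \<le> a j" "\<And>j. a j \<le> 1"
  shows "(\<lambda>n. \<Prod>j<n. a j) \<longlonglongrightarrow> infprod a"
proof -
  have "decseq (\<lambda>n. \<Prod>j<n. a j)"
    by (intro decseq_SucI) (auto simp: assms mult_left_le prod_unit_bounds)
  then have "convergent (\<lambda>n. \<Prod>j<n. a j)"
    by (intro Bseq_monoseq_convergent BseqI'[where K=1] decseq_imp_monoseq)
       (use prod_unit_bounds[of a] assms in \<open>auto simp: abs_of_nonneg\<close>)
  then show ?thesis unfolding infprod_def by (simp add: convergent_LIMSEQ_iff)
qed

lemma infprod_bounds:
  assumes "\<And>j. 0 \<le> a j" "\<And>j. a j \<le> 1"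
  shows "0 \<le> infprod a" "infprod a \<le> 1"
  using LIMSEQ_le_const[OF infprod_LIMSEQ] LIMSEQ_le_const2[OF infprod_LIMSEQ] prod_unit_bounds[of a] assms
  by blast+

lemma infprod_measurable [measurable]:
  assumes [measurable]: "\<And>j. f j \<in> borel_measurable M"
  shows "(\<lambda>x. infprod (\<lambda>j. f j x)) \<in> borel_measurable M"
  unfolding infprod_def by measurable

lemma infprod_mono:
  assumes "\<And>j. 0 \<le> a j" "\<And>j. a j \<le> b j" "\<And>j. b j \<le> 1"
  shows "infprod a \<le> infprod b"
proof (rule LIMSEQ_le[OF infprod_LIMSEQ infprod_LIMSEQ])
  show "\<exists>N. \<forall>n\<ge>N. (\<Prod>j<n. a j) \<le> (\<Prod>j<n. b j)"
    using assms by (auto intro!: prod_mono)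
qed (use assms order_trans in blast)+

lemma prod_diff_le_sum:
  fixes a b :: "nat \<Rightarrow> real"
  assumes "\<And>j. 0 \<le> a j" "\<And>j. a j \<le> 1" "\<And>j. 0 \<le> b j" "\<And>j. b j \<le> 1"
  shows "(\<Prod>j<n. a j) - (\<Prod>j<n. b j) \<le> (\<Sum>j<n. max 0 (a j - b j))"
proof (induction n)
  case (Suc n)
  let ?a = "\<Prod>j<n. a j" and ?b = "\<Prod>j<n. b j"
  have "(\<Prod>j<Suc n. a j) - (\<Prod>j<Suc n. b j) = (?a - ?b) * b n + ?a * (a n - b n)"
    by (simp add: algebra_simps)
  also have "\<dots> \<le> (\<Sum>j<n. max 0 (a j - b j)) * 1 + 1 * max 0 (a n - b n)"
  proof (intro add_mono)
    have "(?a - ?b) * b n \<le> (\<Sum>j<n. max 0 (a j - b j)) * b n"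
      using Suc assms by (intro mult_right_mono) auto
    also have "\<dots> \<le> (\<Sum>j<n. max 0 (a j - b j)) * 1"
      using assms by (intro mult_left_mono sum_nonneg) auto
    finally show "(?a - ?b) * b n \<le> (\<Sum>j<n. max 0 (a j - b j)) * 1" .
    have "?a * (a n - b n) \<le> ?a * max 0 (a n - b n)"
      using prod_unit_bounds[of a] assms by (intro mult_left_mono) auto
    also have "\<dots> \<le> 1 * max 0 (a n - b n)"
      using prod_unit_bounds[of a] assms by (intro mult_right_mono) auto
    finally show "?a * (a n - b n) \<le> 1 * max 0 (a n - b n)" .
  qed
  finally show ?case by simp
qed simp

text \<open>
  Telescoping, since the factors not exchanged are at most \<open>1\<close>. As
  \<open>ennreal\<close> truncates at \<open>0\<close>, only the positive parts of the
  differences enter; this one-sidedness is what produces submartingales below.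
\<close>

lemma infprod_diff_le:
  assumes "\<And>j. 0 \<le> a j" "\<And>j. a j \<le> 1" "\<And>j. 0 \<le> b j" "\<And>j. b j \<le> 1"
  shows "ennreal (infprod a - infprod b) \<le> (\<Sum>j. ennreal (a j - b j))"
proof (rule LIMSEQ_le_const2)
  show "(\<lambda>n. ennreal ((\<Prod>j<n. a j) - (\<Prod>j<n. b j))) \<longlonglongrightarrow> ennreal (infprod a - infprod b)"
    by (intro tendsto_ennrealI tendsto_diff infprod_LIMSEQ assms)
  have "ennreal ((\<Prod>j<n. a j) - (\<Prod>j<n. b j)) \<le> (\<Sum>j. ennreal (a j - b j))" for n
  proof -
    have "ennreal ((\<Prod>j<n. a j) - (\<Prod>j<n. b j)) \<le> ennreal (\<Sum>j<n. max 0 (a j - b j))"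
      by (intro ennreal_leI prod_diff_le_sum assms)
    also have "\<dots> = (\<Sum>j<n. ennreal (max 0 (a j - b j)))" by (subst sum_ennreal) auto
    also have "\<dots> = (\<Sum>j<n. ennreal (a j - b j))" by (intro sum.cong) (auto simp: max_def ennreal_neg)
    also have "\<dots> \<le> (\<Sum>j. ennreal (a j - b j))" by (intro sum_le_suminf) auto
    finally show ?thesis .
  qed
  then show "\<exists>N. \<forall>n\<ge>N. ennreal ((\<Prod>j<n. a j) - (\<Prod>j<n. b j)) \<le> (\<Sum>j. ennreal (a j - b j))" by blast
qed

lemma infprod_le_exp:
  assumes "\<And>j. 0 \<le> a j" "\<And>j. a j \<le> 1" and "summable (\<lambda>j. 1 - a j)"
  shows "infprod a \<le> exp (- (\<Sum>j. 1 - a j))"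
proof (rule LIMSEQ_le[OF infprod_LIMSEQ])
  show "(\<lambda>n. exp (- (\<Sum>j<n. 1 - a j))) \<longlonglongrightarrow> exp (- (\<Sum>j. 1 - a j))"
    by (intro tendsto_exp tendsto_minus summable_LIMSEQ assms)
  have "(\<Prod>j<n. a j) \<le> exp (- (\<Sum>j<n. 1 - a j))" for n
  proof -
    have "(\<Prod>j<n. a j) \<le> (\<Prod>j<n. exp (- (1 - a j)))"
      by (intro prod_mono conjI assms order_trans[OF _ exp_ge_add_one_self]) auto
    also have "\<dots> = exp (- (\<Sum>j<n. 1 - a j))" by (simp only: exp_sum[symmetric] sum_negf finite_lessThan)
    finally show ?thesis .
  qed
  then show "\<exists>N. \<forall>n\<ge>N. (\<Prod>j<n. a j) \<le> exp (- (\<Sum>j<n. 1 - a j))" by blast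
qed (use assms in auto)

lemma exp_minus_le_quadratic: "0 \<le> x \<Longrightarrow> exp (- x) \<le> 1 - x + x\<^sup>2" for x :: real
proof -
  assume x: "0 \<le> x"
  have "exp (- x) \<le> 1 / (1 + x)"
    using x exp_ge_add_one_self[of x] by (simp add: exp_minus field_simps)
  also have "\<dots> \<le> 1 - x + x\<^sup>2"
  proof -
    have "1 \<le> (1 - x + x\<^sup>2) * (1 + x)" using x by (simp add: power2_eq_square algebra_simps)
    then show ?thesis using x by (simp add: pos_divide_le_eq)
  qed
  finally show ?thesis .
qed

lemma exp_minus_defect:
  fixes x s :: real
  assumes "0 \<le> x" "x \<le> s"
  shows "x - (1 - exp (- x)) \<le> s * min 1 s"
proof -
  have "x - (1 - exp (- x)) \<le> x * min 1 x"
    using exp_minus_le_quadratic[OF assms(1)] assms(1) by (auto simp: min_def power2_eq_square)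
  also have "\<dots> \<le> s * min 1 s" using assms by (intro mult_mono) auto
  finally show ?thesis .
qed

text \<open>
  A converse to \<open>infprod_diff_le\<close> for comparison with the constant
  \<open>1\<close>. With \<open>\<sigma> = (\<Sum>j. 1 - a j)\<close> one has \<open>1 - infprod
  a \<ge> 1 - exp (- \<sigma>)\<close>, and the second-order error \<open>\<sigma> - (1 - exp (-
  \<sigma>))\<close> is at most \<open>s * min 1 s\<close> for every upper bound
  \<open>s\<close> of \<open>\<sigma>\<close>.
\<close>

lemma infprod_defect:
  assumes a: "\<And>j. 0 \<le> a j" "\<And>j. a j \<le> 1" and q: "\<And>j. 1 - a j \<le> q j" "summable q"
  shows "(\<Sum>j. ennreal (1 - a j)) \<le> ennreal (1 - infprod a) + ennreal ((\<Sum>j. q j) * min 1 (\<Sum>j. q j))"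
proof -
  have s: "summable (\<lambda>j. 1 - a j)"
    by (rule summable_comparison_test'[OF q(2), of 0]) (use a q in auto)
  define \<sigma> where "\<sigma> = (\<Sum>j. 1 - a j)"
  have \<sigma>: "0 \<le> \<sigma>" "\<sigma> \<le> (\<Sum>j. q j)"
    unfolding \<sigma>_def using a q s by (auto intro!: suminf_nonneg suminf_le)
  have q0: "0 \<le> (\<Sum>j. q j)" using \<sigma> by simp
  have "(\<Sum>j. ennreal (1 - a j)) = ennreal \<sigma>"
    unfolding \<sigma>_def using a s by (intro suminf_ennreal2) auto
  also have "\<dots> \<le> ennreal ((1 - infprod a) + ((\<Sum>j. q j) * min 1 (\<Sum>j. q j)))"
    using exp_minus_defect[OF \<sigma>] infprod_le_exp[OF a s] unfolding \<sigma>_def[symmetric]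
    by (intro ennreal_leI) auto
  also have "\<dots> = ennreal (1 - infprod a) + ennreal ((\<Sum>j. q j) * min 1 (\<Sum>j. q j))"
    using infprod_bounds[OF a] q0 by (intro ennreal_plus) auto
  finally show ?thesis .
qed

section \<open>The smoothing operator and its random walk\<close>

text \<open>
  About \<open>ln w / \<eta>\<close> of the terms equal \<open>1\<close>, and the others are
  bounded by a geometric series. This logarithm is the source of the condition on
  \<open>W\<^sub>1 log W\<^sub>1\<close>.
\<close>

lemma sum_min_geometric:
  assumes "\<eta> > 0" "w > 0"
  shows "(\<Sum>k. ennreal (min 1 (exp (- real k * \<eta>) * w))) \<le>
    ennreal (max 0 (ln w) / \<eta> + 1 + 1 / (1 - exp (- \<eta>)))"
proof -
  define N where "N = nat \<lceil>max 0 (ln w) / \<eta>\<rceil>"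
  have N: "real N \<le> max 0 (ln w) / \<eta> + 1" "max 0 (ln w) / \<eta> \<le> real N"
  proof -
    have "0 \<le> max 0 (ln w) / \<eta>" using assms by simp
    then have "real N = of_int \<lceil>max 0 (ln w) / \<eta>\<rceil>" unfolding N_def by simp
    then show "real N \<le> max 0 (ln w) / \<eta> + 1" "max 0 (ln w) / \<eta> \<le> real N" by linarith+
  qed
  have wN: "w * exp (- real N * \<eta>) \<le> 1"
  proof -
    have "ln w \<le> real N * \<eta>" using N(2) assms by (auto simp: pos_divide_le_eq)
    then have "exp (ln w) \<le> exp (real N * \<eta>)" by simp
    then show ?thesis using assms by (simp add: exp_minus field_simps)
  qed
  have e1: "exp (- \<eta>) < 1" using assms by simp
  have "(\<Sum>k. ennreal (min 1 (exp (- real k * \<eta>) * w))) =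
    (\<Sum>k. ennreal (min 1 (exp (- real (k + N) * \<eta>) * w))) + (\<Sum>k<N. ennreal (min 1 (exp (- real k * \<eta>) * w)))"
    by (rule suminf_offset) simp
  also have "\<dots> \<le> (\<Sum>k. ennreal (exp (- \<eta>) ^ k)) + (\<Sum>k<N. ennreal 1)"
  proof (intro add_mono suminf_le sum_mono ennreal_leI)
    fix k
    have "exp (- real (k + N) * \<eta>) * w = exp (- \<eta>) ^ k * (w * exp (- real N * \<eta>))"
      by (simp add: exp_of_nat_mult[symmetric] exp_add[symmetric] algebra_simps)
    also have "\<dots> \<le> exp (- \<eta>) ^ k * 1" using wN by (intro mult_left_mono) auto
    finally show "min 1 (exp (- real (k + N) * \<eta>) * w) \<le> exp (- \<eta>) ^ k" by simp
  qed auto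
  also have "\<dots> = ennreal (1 / (1 - exp (- \<eta>))) + ennreal (real N)"
    using e1 by (subst suminf_ennreal2) (auto simp: suminf_geometric summable_geometric ennreal_of_nat_eq_real_of_nat)
  also have "\<dots> = ennreal (1 / (1 - exp (- \<eta>)) + real N)"
    using e1 by (subst ennreal_plus) auto
  also have "\<dots> \<le> ennreal (max 0 (ln w) / \<eta> + 1 + 1 / (1 - exp (- \<eta>)))"
    using N by (intro ennreal_leI) simp
  finally show ?thesis .
qed

locale smoothing = prob_space M for M :: "'a measure" +
  fixes A :: "nat \<Rightarrow> 'a \<Rightarrow> real"
  assumes A_measurable [measurable]: "\<And>j. A j \<in> borel_measurable M"
    and A_nonneg: "\<And>j \<omega>. 0 \<le> A j \<omega>"
    and mean_1: "(\<integral>\<^sup>+\<omega>. (\<Sum>j. ennreal (A j \<omega>)) \<partial>M) = 1"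
    and log_summable: "AE \<omega> in M. summable (\<lambda>j. A j \<omega> * ln (A j \<omega>))"
    and log_integrable: "integrable M (\<lambda>\<omega>. \<Sum>j. A j \<omega> * ln (A j \<omega>))"
    and log_neg: "(\<integral>\<omega>. (\<Sum>j. A j \<omega> * ln (A j \<omega>)) \<partial>M) < 0"
    and x_log_x: "integrable M (\<lambda>\<omega>. (\<Sum>j. A j \<omega>) * ln (\<Sum>j. A j \<omega>))"
begin

definition total :: "'a \<Rightarrow> real" where "total \<omega> = (\<Sum>j. A j \<omega>)"

lemma total_measurable [measurable]: "total \<in> borel_measurable M"
  unfolding total_def by measurable

lemma AE_summable: "AE \<omega> in M. summable (\<lambda>j. A j \<omega>)"
proof -
  have "AE \<omega> in M. (\<Sum>j. ennreal (A j \<omega>)) \<noteq> \<infinity>"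
    using mean_1 by (intro nn_integral_PInf_AE) auto
  then show ?thesis
    by eventually_elim (auto intro!: summable_suminf_not_top A_nonneg)
qed

lemma AE_total_nonneg: "AE \<omega> in M. 0 \<le> total \<omega>"
  using AE_summable by eventually_elim (auto simp: total_def intro!: suminf_nonneg A_nonneg)

lemma total_mean: "(\<integral>\<^sup>+\<omega>. ennreal (total \<omega>) \<partial>M) = 1"
proof -
  have "(\<integral>\<^sup>+\<omega>. ennreal (total \<omega>) \<partial>M) = (\<integral>\<^sup>+\<omega>. (\<Sum>j. ennreal (A j \<omega>)) \<partial>M)"
    using AE_summable
    by (intro nn_integral_cong_AE) (auto elim!: eventually_mono simp: total_def suminf_ennreal2 A_nonneg)
  then show ?thesis using mean_1 by simp
qed

text \<open>
  The size-biased displacement: a child is chosen with weight \<open>A j \<omega>\<close>, and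
  the walk moves by \<open>- ln (A j \<omega>)\<close>. Children of weight \<open>0\<close>
  carry no mass, so the value of \<open>ln 0\<close> does not matter.
\<close>

definition step_law :: "real measure" where
  "step_law = distr (density (M \<Otimes>\<^sub>M count_space UNIV) (\<lambda>(\<omega>, j). ennreal (A j \<omega>))) borel (\<lambda>(\<omega>, j). - ln (A j \<omega>))"

lemma A_pair_measurable [measurable]: "(\<lambda>(\<omega>, j). A j \<omega>) \<in> borel_measurable (M \<Otimes>\<^sub>M count_space UNIV)"
  unfolding split_beta'
  by (rule measurable_compose_countable[where f="\<lambda>j x. A j (fst x)" and g=snd]) simp_all

lemma nn_integral_step_law:
  assumes [measurable]: "g \<in> borel_measurable borel"
  shows "(\<integral>\<^sup>+z. g z \<partial>step_law) = (\<integral>\<^sup>+\<omega>. (\<Sum>j. ennreal (A j \<omega>) * g (- ln (A j \<omega>))) \<partial>M)"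
proof -
  interpret C: sigma_finite_measure "count_space (UNIV :: nat set)" by (rule sigma_finite_measure_count_space)
  have [measurable]: "(\<lambda>x. A (snd x) (fst x)) \<in> borel_measurable (M \<Otimes>\<^sub>M count_space UNIV)"
    using A_pair_measurable by (simp add: split_beta')
  have "(\<integral>\<^sup>+z. g z \<partial>step_law) = (\<integral>\<^sup>+x. ennreal (A (snd x) (fst x)) * g (- ln (A (snd x) (fst x))) \<partial>(M \<Otimes>\<^sub>M count_space UNIV))"
    unfolding step_law_def by (simp add: nn_integral_distr nn_integral_density split_beta')
  also have "\<dots> = (\<integral>\<^sup>+\<omega>. \<integral>\<^sup>+j. ennreal (A j \<omega>) * g (- ln (A j \<omega>)) \<partial>count_space UNIV \<partial>M)"
    by (subst C.nn_integral_fst[symmetric]) auto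
  finally show ?thesis by (simp add: nn_integral_count_space_nat)
qed

lemma prob_space_step_law: "prob_space step_law"
proof (rule prob_spaceI)
  have "emeasure step_law (space step_law) = (\<integral>\<^sup>+z. 1 \<partial>step_law)" by simp
  also have "\<dots> = 1" by (subst nn_integral_step_law) (auto simp: mean_1)
  finally show "emeasure step_law (space step_law) = 1" .
qed

lemma sets_step_law [measurable_cong, simp]: "sets step_law = sets borel"
  by (simp add: step_law_def)

text \<open>
  A step \<open>- ln a\<close> multiplies \<open>exp y\<close> by \<open>1 / a\<close>, which
  cancels the weight \<open>a\<close> with which the child is chosen. Children of weight
  \<open>0\<close> are seen by the right-hand side only, and contribute \<open>K 0 = 0\<close>.
\<close>

lemma many_to_one:
  assumes [measurable]: "K \<in> borel_measurable borel" and "K 0 = 0"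
  shows "(\<integral>\<^sup>+z. ennreal (exp (y + z)) * K (exp (- (y + z))) \<partial>step_law) =
    ennreal (exp y) * (\<integral>\<^sup>+\<omega>. (\<Sum>j. K (exp (- y) * A j \<omega>)) \<partial>M)"
proof -
  have eq: "ennreal a * (ennreal (exp (y + - ln a)) * K (exp (- (y + - ln a)))) = ennreal (exp y) * K (exp (- y) * a)"
    if "0 \<le> a" for a
  proof (cases "a = 0")
    case False
    then have "a > 0" using that by simp
    then have "exp (y + - ln a) = exp y / a" "exp (- (y + - ln a)) = exp (- y) * a"
      by (simp_all add: exp_diff exp_minus exp_add divide_simps)
    moreover have "ennreal a * ennreal (exp y / a) = ennreal (exp y)"
      using \<open>a > 0\<close> by (simp add: ennreal_mult[symmetric])
    ultimately show ?thesis by (metis mult.assoc)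
  qed (simp add: assms)
  show ?thesis
    by (subst nn_integral_step_law, measurable)
       (simp only: eq[OF A_nonneg] ennreal_suminf_cmult, rule nn_integral_cmult, measurable)
qed

definition S :: "(real \<Rightarrow> real) \<Rightarrow> real \<Rightarrow> real" where
  "S F x = (\<integral>\<omega>. infprod (\<lambda>j. F (x * A j \<omega>)) \<partial>M)"

definition admissible :: "(real \<Rightarrow> real) \<Rightarrow> bool" where
  "admissible F \<longleftrightarrow> F \<in> borel_measurable borel \<and> (\<forall>x. 0 \<le> F x \<and> F x \<le> 1)"

lemma admissibleD:
  assumes "admissible F"
  shows "F \<in> borel_measurable borel" "0 \<le> F x" "F x \<le> 1"
  using assms by (auto simp: admissible_def)

lemma admissible_one: "admissible (\<lambda>_. 1)"
  by (simp add: admissible_def)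

lemma S_integrable:
  assumes "admissible F"
  shows "integrable M (\<lambda>\<omega>. infprod (\<lambda>j. F (x * A j \<omega>)))"
proof -
  note [measurable] = admissibleD(1)[OF assms]
  show ?thesis
    by (rule integrable_const_bound[where B=1])
       (use infprod_bounds[of "\<lambda>j. F (x * A j _)"] admissibleD[OF assms] in \<open>auto simp: abs_of_nonneg\<close>)
qed

lemma admissible_S:
  assumes "admissible F"
  shows "admissible (S F)"
  unfolding admissible_def
proof (intro conjI allI)
  note [measurable] = admissibleD(1)[OF assms]
  have bounds: "0 \<le> infprod (\<lambda>j. F (x * A j \<omega>))" "infprod (\<lambda>j. F (x * A j \<omega>)) \<le> 1" for x \<omega>
    using infprod_bounds[of "\<lambda>j. F (x * A j \<omega>)"] admissibleD[OF assms] by auto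
  show "S F \<in> borel_measurable borel" unfolding S_def by measurable
  fix x
  show "0 \<le> S F x" unfolding S_def by (intro integral_nonneg_AE) (auto simp: bounds)
  have "S F x \<le> (\<integral>\<omega>. 1 \<partial>M)"
    unfolding S_def by (intro integral_mono S_integrable assms) (auto simp: bounds)
  then show "S F x \<le> 1" by (simp add: prob_space)
qed

lemma S_mono:
  assumes "admissible F" "admissible G" "\<And>x. F x \<le> G x"
  shows "S F x \<le> S G x"
  unfolding S_def
  by (intro integral_mono S_integrable infprod_mono) (use assms in \<open>auto simp: admissible_def\<close>)

lemma S_diff_le:
  assumes F: "admissible F" and G: "admissible G"
  shows "ennreal (S F x - S G x) \<le> (\<integral>\<^sup>+\<omega>. (\<Sum>j. ennreal (F (x * A j \<omega>) - G (x * A j \<omega>))) \<partial>M)"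
proof -
  note [measurable] = admissibleD(1)[OF F] admissibleD(1)[OF G]
  let ?d = "\<lambda>\<omega>. infprod (\<lambda>j. F (x * A j \<omega>)) - infprod (\<lambda>j. G (x * A j \<omega>))"
  have "S F x - S G x = (\<integral>\<omega>. ?d \<omega> \<partial>M)"
    unfolding S_def by (intro Bochner_Integration.integral_diff[symmetric] S_integrable F G)
  also have "\<dots> \<le> (\<integral>\<omega>. max 0 (?d \<omega>) \<partial>M)"
    by (intro integral_mono integrable_max Bochner_Integration.integrable_diff S_integrable F G) auto
  finally have "ennreal (S F x - S G x) \<le> ennreal (\<integral>\<omega>. max 0 (?d \<omega>) \<partial>M)" by (rule ennreal_leI)
  also have "\<dots> = (\<integral>\<^sup>+\<omega>. ennreal (max 0 (?d \<omega>)) \<partial>M)"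
    by (intro nn_integral_eq_integral[symmetric] integrable_max Bochner_Integration.integrable_diff S_integrable F G) auto
  also have "\<dots> \<le> (\<integral>\<^sup>+\<omega>. (\<Sum>j. ennreal (F (x * A j \<omega>) - G (x * A j \<omega>))) \<partial>M)"
  proof (intro nn_integral_mono)
    fix \<omega>
    have "ennreal (max 0 (?d \<omega>)) = ennreal (?d \<omega>)" by (simp add: max_def ennreal_neg)
    also have "\<dots> \<le> (\<Sum>j. ennreal (F (x * A j \<omega>) - G (x * A j \<omega>)))"
      by (intro infprod_diff_le) (use F G in \<open>auto simp: admissible_def\<close>)
    finally show "ennreal (max 0 (?d \<omega>)) \<le> (\<Sum>j. ennreal (F (x * A j \<omega>) - G (x * A j \<omega>)))" .
  qed
  finally show ?thesis .
qed

text \<open>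
  The difference of \<open>F\<close> and \<open>G\<close> at \<open>x = exp (- y)\<close>,
  divided by \<open>x\<close>. Truncation by \<open>ennreal\<close> keeps its positive part, so
  that \<open>gap F G\<close> and \<open>gap G F\<close> together measure \<open>\<bar>F -
  G\<bar>\<close>, and, if \<open>F 0 = 1\<close>, \<open>gap (\<lambda>_. 1) F\<close> is the
  downward slope of the chord of \<open>F\<close> from \<open>0\<close> to \<open>x\<close>.
\<close>

definition gap :: "(real \<Rightarrow> real) \<Rightarrow> (real \<Rightarrow> real) \<Rightarrow> real \<Rightarrow> ennreal" where
  "gap F G y = ennreal (exp y * (F (exp (- y)) - G (exp (- y))))"

lemma gap_measurable [measurable]:
  assumes "admissible F" "admissible G"
  shows "gap F G \<in> borel_measurable borel"
proof -
  note [measurable] = admissibleD(1)[OF assms(1)] admissibleD(1)[OF assms(2)]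
  show ?thesis unfolding gap_def by measurable
qed

lemma gap_S_le:
  assumes F: "admissible F" and G: "admissible G" and "F 0 = G 0"
  shows "gap (S F) (S G) y \<le> (\<integral>\<^sup>+z. gap F G (y + z) \<partial>step_law)"
proof -
  note [measurable] = admissibleD(1)[OF F] admissibleD(1)[OF G]
  have "gap (S F) (S G) y = ennreal (exp y) * ennreal (S F (exp (- y)) - S G (exp (- y)))"
    unfolding gap_def by (rule ennreal_mult') simp
  also have "\<dots> \<le> ennreal (exp y) * (\<integral>\<^sup>+\<omega>. (\<Sum>j. ennreal (F (exp (- y) * A j \<omega>) - G (exp (- y) * A j \<omega>))) \<partial>M)"
    by (intro mult_left_mono S_diff_le F G) simp
  also have "\<dots> = (\<integral>\<^sup>+z. ennreal (exp (y + z)) * ennreal (F (exp (- (y + z))) - G (exp (- (y + z)))) \<partial>step_law)"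
    using assms(3) by (intro many_to_one[symmetric, where K="\<lambda>x. ennreal (F x - G x)"]) auto
  also have "\<dots> = (\<integral>\<^sup>+z. gap F G (y + z) \<partial>step_law)"
    unfolding gap_def by (intro nn_integral_cong ennreal_mult'[symmetric]) simp
  finally show ?thesis .
qed

text \<open>
  Each \<open>A j\<close> is at most the sum \<open>total\<close>, so the sum of the \<open>A j
  * max 0 (ln (A j))\<close> is at most \<open>\<bar>total * ln total\<bar>\<close>.
\<close>

lemma positive_log_part_integrable:
  "AE \<omega> in M. summable (\<lambda>j. A j \<omega> * max 0 (ln (A j \<omega>)))" (is ?AE)
  "integrable M (\<lambda>\<omega>. \<Sum>j. A j \<omega> * max 0 (ln (A j \<omega>)))" (is ?int)
proof -
  have *: "summable (\<lambda>j. A j \<omega> * max 0 (ln (A j \<omega>))) \<and>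
    (\<Sum>j. A j \<omega> * max 0 (ln (A j \<omega>))) \<le> \<bar>total \<omega> * ln (total \<omega>)\<bar> \<and>
    0 \<le> (\<Sum>j. A j \<omega> * max 0 (ln (A j \<omega>)))"
    if s: "summable (\<lambda>j. A j \<omega>)" for \<omega>
  proof -
    have le: "A j \<omega> * max 0 (ln (A j \<omega>)) \<le> A j \<omega> * max 0 (ln (total \<omega>))" for j
    proof (cases "A j \<omega> = 0")
      case False
      then have "0 < A j \<omega>" using A_nonneg[of j \<omega>] by simp
      moreover have "A j \<omega> \<le> total \<omega>"
        using sum_le_suminf[OF s, of "{j}"] A_nonneg by (simp add: total_def)
      ultimately show ?thesis by (intro mult_left_mono max.mono) auto
    qed simp
    have s': "summable (\<lambda>j. A j \<omega> * max 0 (ln (total \<omega>)))" using s by (rule summable_mult2)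
    have s'': "summable (\<lambda>j. A j \<omega> * max 0 (ln (A j \<omega>)))"
      by (rule summable_comparison_test'[OF s', of 0]) (use le A_nonneg in auto)
    have "(\<Sum>j. A j \<omega> * max 0 (ln (A j \<omega>))) \<le> (\<Sum>j. A j \<omega> * max 0 (ln (total \<omega>)))"
      by (intro suminf_le le s' s'')
    also have "\<dots> = total \<omega> * max 0 (ln (total \<omega>))"
      unfolding total_def by (rule suminf_mult2[OF s, symmetric])
    also have "\<dots> \<le> \<bar>total \<omega> * ln (total \<omega>)\<bar>"
      using suminf_nonneg[OF s A_nonneg] by (simp add: abs_mult total_def mult_left_mono)
    finally show ?thesis using s'' A_nonneg by (auto intro!: suminf_nonneg)
  qed
  show ?AE using AE_summable by eventually_elim (use * in blast)
  show ?int
  proof (rule Bochner_Integration.integrable_bound)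
    show "integrable M (\<lambda>\<omega>. total \<omega> * ln (total \<omega>))" using x_log_x by (simp add: total_def)
    show "AE \<omega> in M. norm (\<Sum>j. A j \<omega> * max 0 (ln (A j \<omega>))) \<le> norm (total \<omega> * ln (total \<omega>))"
      using AE_summable by eventually_elim (use * in auto)
  qed measurable
qed

text \<open>
  The upward and the downward mean of the step differ by \<open>- E (\<Sum>j. A j * ln (A
  j))\<close>, which is finite and positive; the downward one is finite by
  \<open>positive_log_part_integrable\<close>, hence both are.
\<close>

lemma drift_walk_step_law: "drift_walk step_law"
proof -
  interpret L: prob_space step_law by (rule prob_space_step_law)
  let ?P = "\<lambda>\<omega>. \<Sum>j. A j \<omega> * max 0 (ln (A j \<omega>))" and ?L = "\<lambda>\<omega>. \<Sum>j. A j \<omega> * ln (A j \<omega>)"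
  have pos: "(\<integral>\<^sup>+z. ennreal (- z) \<partial>step_law) = ennreal (\<integral>\<omega>. ?P \<omega> \<partial>M)"
  proof -
    have "(\<integral>\<^sup>+z. ennreal (- z) \<partial>step_law) = (\<integral>\<^sup>+\<omega>. ennreal (?P \<omega>) \<partial>M)"
    proof (subst nn_integral_step_law, simp, rule nn_integral_cong_AE)
      show "AE \<omega> in M. (\<Sum>j. ennreal (A j \<omega>) * ennreal (- (- ln (A j \<omega>)))) = ennreal (?P \<omega>)"
        using positive_log_part_integrable(1)
      proof eventually_elim
        case (elim \<omega>)
        have "(\<Sum>j. ennreal (A j \<omega>) * ennreal (- (- ln (A j \<omega>)))) = (\<Sum>j. ennreal (A j \<omega> * max 0 (ln (A j \<omega>))))"
          by (intro suminf_cong) (auto simp: ennreal_mult A_nonneg max_def ennreal_neg)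
        also have "\<dots> = ennreal (?P \<omega>)"
          by (intro suminf_ennreal2 elim) (simp add: A_nonneg)
        finally show ?case .
      qed
    qed
    also have "\<dots> = ennreal (\<integral>\<omega>. ?P \<omega> \<partial>M)"
      by (intro nn_integral_eq_integral positive_log_part_integrable)
         (use positive_log_part_integrable(1) in \<open>eventually_elim, auto intro!: suminf_nonneg simp: A_nonneg\<close>)
    finally show ?thesis .
  qed
  have split: "summable (\<lambda>j. A j \<omega> * max 0 (- ln (A j \<omega>)))"
    "(\<Sum>j. A j \<omega> * max 0 (- ln (A j \<omega>))) = ?P \<omega> - ?L \<omega>"
    if "summable (\<lambda>j. A j \<omega> * max 0 (ln (A j \<omega>)))" "summable (\<lambda>j. A j \<omega> * ln (A j \<omega>))" for \<omega>
  proof -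
    have eq: "A j \<omega> * max 0 (- ln (A j \<omega>)) = A j \<omega> * max 0 (ln (A j \<omega>)) - A j \<omega> * ln (A j \<omega>)" for j
      by (auto simp: max_def)
    show "summable (\<lambda>j. A j \<omega> * max 0 (- ln (A j \<omega>)))" unfolding eq by (intro summable_diff that)
    show "(\<Sum>j. A j \<omega> * max 0 (- ln (A j \<omega>))) = ?P \<omega> - ?L \<omega>"
      unfolding eq by (intro suminf_diff[symmetric] that)
  qed
  have neg: "(\<integral>\<^sup>+z. ennreal z \<partial>step_law) = ennreal (\<integral>\<omega>. ?P \<omega> - ?L \<omega> \<partial>M)" "0 \<le> (\<integral>\<omega>. ?P \<omega> - ?L \<omega> \<partial>M)"
  proof -
    have nn: "AE \<omega> in M. 0 \<le> ?P \<omega> - ?L \<omega>"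
      using positive_log_part_integrable(1) log_summable
    proof eventually_elim
      case (elim \<omega>)
      show ?case unfolding split(2)[OF elim, symmetric]
        by (intro suminf_nonneg split(1)[OF elim]) (simp add: A_nonneg)
    qed
    have "(\<integral>\<^sup>+z. ennreal z \<partial>step_law) = (\<integral>\<^sup>+\<omega>. ennreal (?P \<omega> - ?L \<omega>) \<partial>M)"
    proof (subst nn_integral_step_law, simp, rule nn_integral_cong_AE)
      show "AE \<omega> in M. (\<Sum>j. ennreal (A j \<omega>) * ennreal (- ln (A j \<omega>))) = ennreal (?P \<omega> - ?L \<omega>)"
        using positive_log_part_integrable(1) log_summable
      proof eventually_elim
        case (elim \<omega>)
        have "(\<Sum>j. ennreal (A j \<omega>) * ennreal (- ln (A j \<omega>))) = (\<Sum>j. ennreal (A j \<omega> * max 0 (- ln (A j \<omega>))))"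
          by (intro suminf_cong) (auto simp: ennreal_mult A_nonneg max_def ennreal_neg)
        also have "\<dots> = ennreal (?P \<omega> - ?L \<omega>)"
          unfolding split(2)[OF elim, symmetric]
          by (intro suminf_ennreal2 split(1)[OF elim]) (simp add: A_nonneg)
        finally show ?case .
      qed
    qed
    also have "\<dots> = ennreal (\<integral>\<omega>. ?P \<omega> - ?L \<omega> \<partial>M)"
      by (intro nn_integral_eq_integral nn Bochner_Integration.integrable_diff positive_log_part_integrable log_integrable)
    finally show "(\<integral>\<^sup>+z. ennreal z \<partial>step_law) = ennreal (\<integral>\<omega>. ?P \<omega> - ?L \<omega> \<partial>M)" .
    show "0 \<le> (\<integral>\<omega>. ?P \<omega> - ?L \<omega> \<partial>M)" by (rule integral_nonneg_AE[OF nn])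
  qed
  have P0: "0 \<le> (\<integral>\<omega>. ?P \<omega> \<partial>M)"
    by (intro integral_nonneg_AE) (use positive_log_part_integrable(1) in \<open>eventually_elim, auto intro!: suminf_nonneg simp: A_nonneg\<close>)
  show ?thesis
  proof
    show int: "integrable step_law (\<lambda>z. z)"
      by (rule real_integrable_def[THEN iffD2]) (simp add: pos neg)
    have "(\<integral>z. z \<partial>step_law) = (\<integral>\<omega>. ?P \<omega> - ?L \<omega> \<partial>M) - (\<integral>\<omega>. ?P \<omega> \<partial>M)"
      by (subst real_lebesgue_integral_def[OF int]) (simp add: pos neg P0)
    also have "\<dots> = - (\<integral>\<omega>. ?L \<omega> \<partial>M)"
      by (subst Bochner_Integration.integral_diff) (auto intro: positive_log_part_integrable log_integrable)
    finally show "0 < (\<integral>z. z \<partial>step_law)" using log_neg by simp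
  qed simp
qed

sublocale walk: drift_walk step_law by (rule drift_walk_step_law)

text \<open>
  Bounds the loss in \<open>gap_S_le\<close> when \<open>F\<close> is the constant
  \<open>1\<close>, see \<open>gap_one_S_ge\<close>.
\<close>

definition defect :: "real \<Rightarrow> ennreal" where
  "defect y = (\<integral>\<^sup>+\<omega>. ennreal (total \<omega> * min 1 (exp (- y) * total \<omega>)) \<partial>M)"

lemma defect_measurable [measurable]: "defect \<in> borel_measurable borel"
  unfolding defect_def by measurable

lemma defect_antimono: "x \<le> y \<Longrightarrow> defect y \<le> defect x"
  unfolding defect_def
proof (rule nn_integral_mono_AE)
  assume "x \<le> y"
  show "AE \<omega> in M. ennreal (total \<omega> * min 1 (exp (- y) * total \<omega>)) \<le> ennreal (total \<omega> * min 1 (exp (- x) * total \<omega>))"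
    using AE_total_nonneg
    by eventually_elim (intro ennreal_leI mult_left_mono min.mono mult_right_mono, use \<open>x \<le> y\<close> in auto)
qed

lemma defect_sum_finite:
  assumes \<eta>: "\<eta> > 0"
  shows "(\<Sum>k. defect (real k * \<eta>)) < \<infinity>"
proof -
  define B where "B = 1 + 1 / (1 - exp (- \<eta>))"
  have B: "0 \<le> B" using \<eta> by (simp add: B_def)
  have "(\<Sum>k. defect (real k * \<eta>)) = (\<integral>\<^sup>+\<omega>. (\<Sum>k. ennreal (total \<omega> * min 1 (exp (- (real k * \<eta>)) * total \<omega>))) \<partial>M)"
    unfolding defect_def by (rule nn_integral_suminf[symmetric]) simp
  also have "\<dots> \<le> (\<integral>\<^sup>+\<omega>. ennreal (1 / \<eta>) * ennreal (norm (total \<omega> * ln (total \<omega>))) + ennreal B * ennreal (total \<omega>) \<partial>M)"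
  proof (rule nn_integral_mono_AE)
    show "AE \<omega> in M. (\<Sum>k. ennreal (total \<omega> * min 1 (exp (- (real k * \<eta>)) * total \<omega>))) \<le>
      ennreal (1 / \<eta>) * ennreal (norm (total \<omega> * ln (total \<omega>))) + ennreal B * ennreal (total \<omega>)"
      using AE_total_nonneg
    proof eventually_elim
      case (elim \<omega>)
      show ?case
      proof (cases "total \<omega> = 0")
        case False
        then have pos: "0 < total \<omega>" using elim by simp
        have "(\<Sum>k. ennreal (total \<omega> * min 1 (exp (- (real k * \<eta>)) * total \<omega>))) =
          ennreal (total \<omega>) * (\<Sum>k. ennreal (min 1 (exp (- real k * \<eta>) * total \<omega>)))"
          using pos by (subst ennreal_suminf_cmult[symmetric]) (simp add: ennreal_mult')
        also have "\<dots> \<le> ennreal (total \<omega>) * ennreal (max 0 (ln (total \<omega>)) / \<eta> + B)"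
          using sum_min_geometric[OF \<eta> pos] by (intro mult_left_mono) (auto simp: B_def add.assoc)
        also have "\<dots> = ennreal (total \<omega> * (max 0 (ln (total \<omega>)) / \<eta> + B))"
          using pos by (simp add: ennreal_mult')
        also have "\<dots> \<le> ennreal (1 / \<eta> * norm (total \<omega> * ln (total \<omega>)) + B * total \<omega>)"
          using pos \<eta> by (intro ennreal_leI) (auto simp: abs_mult field_simps max_def mult_left_mono)
        also have "\<dots> = ennreal (1 / \<eta>) * ennreal (norm (total \<omega> * ln (total \<omega>))) + ennreal B * ennreal (total \<omega>)"
          using \<eta> B pos by (subst ennreal_plus) (simp_all add: ennreal_mult'[symmetric])
        finally show ?thesis .
      qed simp
    qed
  qed
  also have "\<dots> = ennreal (1 / \<eta>) * (\<integral>\<^sup>+\<omega>. ennreal (norm (total \<omega> * ln (total \<omega>))) \<partial>M) + ennreal B"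
    by (simp add: nn_integral_add nn_integral_cmult total_mean)
  also have "\<dots> < \<infinity>"
    using x_log_x unfolding total_def[symmetric] by (simp add: integrable_iff_bounded ennreal_mult_less_top)
  finally show ?thesis .
qed

lemma gap_one_S_ge:
  assumes F: "admissible F" and le: "\<And>x. 0 \<le> x \<Longrightarrow> 1 - F x \<le> x"
  shows "(\<integral>\<^sup>+z. gap (\<lambda>_. 1) F (y + z) \<partial>step_law) \<le> gap (\<lambda>_. 1) (S F) y + defect y"
proof -
  note [measurable] = admissibleD(1)[OF F]
  define x where "x = exp (- y)"
  have x: "x > 0" by (simp add: x_def)
  let ?i = "\<lambda>\<omega>. infprod (\<lambda>j. F (x * A j \<omega>))"
  have i: "0 \<le> ?i \<omega>" "?i \<omega> \<le> 1" for \<omega>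
    using infprod_bounds[of "\<lambda>j. F (x * A j \<omega>)"] admissibleD[OF F] by auto
  have F0: "F 0 = 1" using le[of 0] admissibleD(3)[OF F, of 0] by simp
  have "(\<integral>\<^sup>+z. gap (\<lambda>_. 1) F (y + z) \<partial>step_law) =
    (\<integral>\<^sup>+z. ennreal (exp (y + z)) * ennreal (1 - F (exp (- (y + z)))) \<partial>step_law)"
    unfolding gap_def by (intro nn_integral_cong ennreal_mult') simp
  also have "\<dots> = ennreal (exp y) * (\<integral>\<^sup>+\<omega>. (\<Sum>j. ennreal (1 - F (x * A j \<omega>))) \<partial>M)"
    unfolding x_def using F0 by (intro many_to_one) auto
  also have "(\<integral>\<^sup>+\<omega>. (\<Sum>j. ennreal (1 - F (x * A j \<omega>))) \<partial>M) \<le>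
    (\<integral>\<^sup>+\<omega>. ennreal (1 - ?i \<omega>) + ennreal x * ennreal (total \<omega> * min 1 (x * total \<omega>)) \<partial>M)"
  proof (rule nn_integral_mono_AE)
    show "AE \<omega> in M. (\<Sum>j. ennreal (1 - F (x * A j \<omega>))) \<le>
      ennreal (1 - ?i \<omega>) + ennreal x * ennreal (total \<omega> * min 1 (x * total \<omega>))"
      using AE_summable
    proof eventually_elim
      case (elim \<omega>)
      have sum: "(\<Sum>j. x * A j \<omega>) = x * total \<omega>" unfolding total_def by (rule suminf_mult[OF elim])
      have "(\<Sum>j. ennreal (1 - F (x * A j \<omega>))) \<le>
        ennreal (1 - ?i \<omega>) + ennreal ((\<Sum>j. x * A j \<omega>) * min 1 (\<Sum>j. x * A j \<omega>))"
        by (intro infprod_defect admissibleD[OF F] le summable_mult elim mult_nonneg_nonneg A_nonneg)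
           (use x in simp)
      also have "ennreal ((\<Sum>j. x * A j \<omega>) * min 1 (\<Sum>j. x * A j \<omega>)) =
        ennreal x * ennreal (total \<omega> * min 1 (x * total \<omega>))"
        unfolding sum using x by (simp add: ennreal_mult' mult.assoc)
      finally show ?case .
    qed
  qed
  also have "\<dots> = (\<integral>\<^sup>+\<omega>. ennreal (1 - ?i \<omega>) \<partial>M) + ennreal x * defect y"
    by (simp add: nn_integral_add nn_integral_cmult defect_def x_def)
  also have "(\<integral>\<^sup>+\<omega>. ennreal (1 - ?i \<omega>) \<partial>M) = ennreal (\<integral>\<omega>. 1 - ?i \<omega> \<partial>M)"
    by (intro nn_integral_eq_integral Bochner_Integration.integrable_diff S_integrable F) (auto simp: i)
  also have "(\<integral>\<omega>. 1 - ?i \<omega> \<partial>M) = 1 - S F x"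
    unfolding S_def by (subst Bochner_Integration.integral_diff) (auto simp: S_integrable F prob_space)
  also have "ennreal (exp y) * (ennreal (1 - S F x) + ennreal x * defect y) =
    gap (\<lambda>_. 1) (S F) y + ennreal (exp y * x) * defect y"
    by (simp add: gap_def x_def distrib_left ennreal_mult' mult.assoc)
  also have "exp y * x = 1" by (simp add: x_def exp_minus)
  finally show ?thesis by (simp add: mult_left_mono)
qed

text \<open>
  The function \<open>exp (- x)\<close> on \<open>{0..}\<close>, continued by \<open>1\<close>
  so that it takes values in \<open>[0,1]\<close> everywhere.
\<close>

definition expo :: "real \<Rightarrow> real" where "expo x = exp (- max 0 x)"

lemma admissible_expo: "admissible expo"
  by (auto simp: admissible_def expo_def[abs_def])

lemma admissible_iterates: "admissible ((S ^^ n) expo)"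
  by (induction n) (auto intro: admissible_expo admissible_S)

lemma S_expo: "0 \<le> x \<Longrightarrow> S expo x = (\<integral>\<omega>. exp (- (x * total \<omega>)) \<partial>M)"
  unfolding S_def
proof (rule integral_cong_AE)
  assume x: "0 \<le> x"
  note [measurable] = admissibleD(1)[OF admissible_expo]
  show "(\<lambda>\<omega>. infprod (\<lambda>j. expo (x * A j \<omega>))) \<in> borel_measurable M" by measurable
  show "AE \<omega> in M. infprod (\<lambda>j. expo (x * A j \<omega>)) = exp (- (x * total \<omega>))"
    using AE_summable
  proof eventually_elim
    case (elim \<omega>)
    have "(\<lambda>n. \<Prod>j<n. expo (x * A j \<omega>)) = (\<lambda>n. exp (- (x * (\<Sum>j<n. A j \<omega>))))"
      using x A_nonneg by (simp add: expo_def exp_sum[symmetric] sum_negf sum_distrib_left max_def)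
    moreover have "\<dots> \<longlonglongrightarrow> exp (- (x * total \<omega>))"
      unfolding total_def by (intro tendsto_intros summable_LIMSEQ elim)
    ultimately show ?case unfolding infprod_def by (simp add: limI)
  qed
qed measurable

lemma integrable_total: "integrable M total" and integral_total: "(\<integral>\<omega>. total \<omega> \<partial>M) = 1"
proof -
  show int: "integrable M total"
    using AE_total_nonneg total_mean by (intro integrableI_nonneg) auto
  have "ennreal (\<integral>\<omega>. total \<omega> \<partial>M) = 1"
    using nn_integral_eq_integral[OF int AE_total_nonneg] total_mean by simp
  then show "(\<integral>\<omega>. total \<omega> \<partial>M) = 1" by (simp add: ennreal_eq_1)
qed

text \<open>
  Jensen's inequality for the mean \<open>1\<close> of \<open>total\<close>, in the form of the
  tangent of \<open>exp (- (x * z))\<close> at \<open>z = 1\<close>.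
\<close>

lemma expo_le_S_expo: "expo x \<le> S expo x"
proof (cases "0 \<le> x")
  case True
  have "expo x = (\<integral>\<omega>. exp (- x) * (1 - x * (total \<omega> - 1)) \<partial>M)"
    using True by (simp add: expo_def integrable_total integral_total prob_space)
  also have "\<dots> \<le> (\<integral>\<omega>. exp (- (x * total \<omega>)) \<partial>M)"
  proof (rule integral_mono_AE)
    show "integrable M (\<lambda>\<omega>. exp (- (x * total \<omega>)))"
    proof (rule integrable_const_bound[where B=1])
      show "AE \<omega> in M. norm (exp (- (x * total \<omega>))) \<le> 1"
        using AE_total_nonneg by eventually_elim (use True in simp)
    qed measurable
    show "AE \<omega> in M. exp (- x) * (1 - x * (total \<omega> - 1)) \<le> exp (- (x * total \<omega>))"
    proof (rule AE_I2)
      fix \<omega>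
      have "exp (- x) * (1 + - (x * (total \<omega> - 1))) \<le> exp (- x) * exp (- (x * (total \<omega> - 1)))"
        by (intro mult_left_mono exp_ge_add_one_self) simp
      also have "\<dots> = exp (- (x * total \<omega>))" by (simp add: exp_add[symmetric] algebra_simps)
      finally show "exp (- x) * (1 - x * (total \<omega> - 1)) \<le> exp (- (x * total \<omega>))" by simp
    qed
  qed (auto simp: integrable_total)
  finally show ?thesis using S_expo[OF True] by simp
next
  case False
  have "infprod (\<lambda>j. expo (x * A j \<omega>)) = 1" for \<omega>
  proof -
    have "x * A j \<omega> \<le> 0" for j using False A_nonneg[of j \<omega>] by (simp add: mult_nonpos_nonneg)
    then have "expo (x * A j \<omega>) = 1" for j by (simp add: expo_def max_absorb1)
    then show ?thesis by (simp add: infprod_def)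
  qed
  then show ?thesis using False by (simp add: S_def prob_space expo_def)
qed

lemma iterates_mono: "(S ^^ n) expo x \<le> (S ^^ Suc n) expo x"
proof (induction n arbitrary: x)
  case (Suc n)
  have "S ((S ^^ n) expo) x \<le> S ((S ^^ Suc n) expo) x"
    by (rule S_mono[OF admissible_iterates admissible_iterates Suc])
  then show ?case by simp
qed (simp add: expo_le_S_expo)

lemma expo_le_iterates: "expo x \<le> (S ^^ n) expo x"
proof (induction n)
  case (Suc n)
  then show ?case using iterates_mono[of n x] by (rule order_trans)
qed simp

lemma one_minus_iterates_le: "0 \<le> x \<Longrightarrow> 1 - (S ^^ n) expo x \<le> x"
  using expo_le_iterates[of x n] exp_ge_add_one_self[of "-x"] by (simp add: expo_def)

text \<open>
  Applying \<open>gap_one_S_ge\<close> \<open>n\<close> times along the paths that stay above a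
  level \<open>c\<close> shows that the slope of the \<open>n\<close>-th iterate at
  \<open>y\<close> is at least the slope of \<open>expo\<close> above \<open>c\<close>, times
  the probability of staying above \<open>c\<close>, minus the defects collected above
  \<open>c\<close>. The defects are summable over cells, so for large \<open>c\<close> their
  Green function sum is small; and from \<open>y = c + a\<close> the walk stays above
  \<open>c\<close> with probability close to \<open>1\<close>. Neither bound depends on
  \<open>n\<close>.
\<close>

theorem iterates_slope:
  assumes \<epsilon>: "\<epsilon> > 0"
  shows "\<exists>y. \<forall>n. ennreal (1 - \<epsilon>) \<le> gap (\<lambda>_. 1) ((S ^^ n) expo) y"
proof -
  \<comment> \<open>three losses of at most \<open>\<delta>\<close>: the initial slope, the probability of staying, and the defects\<close>
  define \<delta> where "\<delta> = min (1/2) (\<epsilon> / 3)"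
  have \<delta>: "0 < \<delta>" "\<delta> < 1" "3 * \<delta> \<le> \<epsilon>" using \<epsilon> by (auto simp: \<delta>_def)
  obtain \<eta> C where gf: "\<eta> > 0" "C < \<infinity>" "\<And>u y. (\<Sum>n. walk.iter (indicator {u..<u+\<eta>}) n y) \<le> C"
    using walk.green_function_bounded by blast
  obtain a where a: "a \<ge> 0" "\<And>n y. y \<ge> a \<Longrightarrow> 1 - ennreal \<delta> \<le> walk.stay {0..} n y"
    using walk.stay_half_line_large[OF \<delta>(1)] by auto
  have "(\<lambda>K. C * (\<Sum>k. defect (real (k + K) * \<eta>))) \<longlonglongrightarrow> C * 0"
    using gf(2) suminf_finite_imp_tail_tendsto_0[OF defect_sum_finite[OF gf(1)]]
    by (intro ennreal_tendsto_cmult) auto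
  then have "eventually (\<lambda>K. C * (\<Sum>k. defect (real (k + K) * \<eta>)) < ennreal \<delta>) sequentially"
    using \<delta> by (intro order_tendstoD(2)[where y=0]) auto
  moreover obtain K0 :: nat where K0: "- ln \<delta> < real K0 * \<eta>" using reals_Archimedean3[OF gf(1)] by blast
  ultimately obtain K where K: "C * (\<Sum>k. defect (real (k + K) * \<eta>)) \<le> ennreal \<delta>" "K \<ge> K0"
    by (metis (no_types, lifting) eventually_sequentially less_imp_le nle_le)
  define c where "c = real K * \<eta>"
  have "real K0 * \<eta> \<le> real K * \<eta>" using K(2) gf(1) by (intro mult_right_mono) auto
  then have c: "- ln \<delta> \<le> c" using K0 by (simp add: c_def)
  define e where "e y = indicator {c..} y * defect y" for y
  have [measurable]: "e \<in> borel_measurable borel" unfolding e_def by measurable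
  have layers: "e v \<le> (\<Sum>k. defect (real (k + K) * \<eta>) * indicator {real (k + K) * \<eta>..<real (k + K) * \<eta> + \<eta>} v)" for v
  proof (cases "c \<le> v")
    case True
    define k where "k = nat \<lfloor>(v - c) / \<eta>\<rfloor>"
    have k: "real k \<le> (v - c) / \<eta>" "(v - c) / \<eta> < real k + 1"
      using True gf(1) by (auto simp: k_def)
    then have k': "real (k + K) * \<eta> \<le> v" "v < real (k + K) * \<eta> + \<eta>"
      using gf(1) by (auto simp: field_simps c_def)
    have "e v \<le> defect (real (k + K) * \<eta>) * indicator {real (k + K) * \<eta>..<real (k + K) * \<eta> + \<eta>} v"
      using k' by (simp add: e_def indicator_def defect_antimono)
    also have "\<dots> \<le> (\<Sum>k. defect (real (k + K) * \<eta>) * indicator {real (k + K) * \<eta>..<real (k + K) * \<eta> + \<eta>} v)"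
      by (rule member_le_suminf_ennreal)
    finally show ?thesis .
  qed (simp add: e_def)
  have green: "(\<Sum>n. walk.iter e n y) \<le> ennreal \<delta>" for y
    using walk.green_function_bounded_layers[OF gf(3), of e "\<lambda>k. defect (real (k + K) * \<eta>)" "\<lambda>k. real (k + K) * \<eta>" y]
      layers K(1) by (auto intro: order_trans)
  let ?D = "\<lambda>n. gap (\<lambda>_. 1) ((S ^^ n) expo)"
  note [measurable] = gap_measurable[OF admissible_one admissible_iterates]
  have key: "ennreal (1 - \<delta>) * walk.stay {c..} n y \<le> ?D n y + (\<Sum>i<n. walk.iter e i y)" for n y
  proof (induction n arbitrary: y)
    case 0
    show ?case
    proof (cases "c \<le> y")
      case True
      have small: "exp (- y) \<le> \<delta>"
        using c True \<delta>(1) by (metis exp_le_cancel_iff exp_ln minus_le_iff order_trans)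
      have "1 - exp (- y) \<le> exp y * (1 - exp (- exp (- y)))"
      proof -
        have "exp (- exp (- y)) \<le> 1 - exp (- y) + (exp (- y))\<^sup>2" by (rule exp_minus_le_quadratic) simp
        then have "exp y * (exp (- y) - (exp (- y))\<^sup>2) \<le> exp y * (1 - exp (- exp (- y)))"
          by (intro mult_left_mono) auto
        moreover have "exp y * (exp (- y) - (exp (- y))\<^sup>2) = 1 - exp (- y)"
          by (simp add: right_diff_distrib power2_eq_square mult.assoc[symmetric] exp_add[symmetric] del: exp_minus)
        ultimately show ?thesis by simp
      qed
      then have "1 - \<delta> \<le> exp y * (1 - expo (exp (- y)))" using small by (simp add: expo_def)
      then show ?thesis using True by (simp add: gap_def ennreal_leI)
    qed simp
  next
    case (Suc n)
    show ?case
    proof (cases "c \<le> y")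
      case True
      have "ennreal (1 - \<delta>) * walk.stay {c..} (Suc n) y = (\<integral>\<^sup>+z. ennreal (1 - \<delta>) * walk.stay {c..} n (y + z) \<partial>step_law)"
        using True by (simp add: nn_integral_cmult)
      also have "\<dots> \<le> (\<integral>\<^sup>+z. ?D n (y + z) + (\<Sum>i<n. walk.iter e i (y + z)) \<partial>step_law)"
        by (intro nn_integral_mono Suc)
      also have "\<dots> = (\<integral>\<^sup>+z. ?D n (y + z) \<partial>step_law) + (\<Sum>i<n. walk.iter e (Suc i) y)"
        by (simp add: nn_integral_add nn_integral_sum)
      also have "(\<integral>\<^sup>+z. ?D n (y + z) \<partial>step_law) \<le> ?D (Suc n) y + e y"
        using gap_one_S_ge[OF admissible_iterates one_minus_iterates_le, of n y] True by (simp add: e_def)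
      also have "?D (Suc n) y + e y + (\<Sum>i<n. walk.iter e (Suc i) y) = ?D (Suc n) y + (\<Sum>i<Suc n. walk.iter e i y)"
        by (subst sum.lessThan_Suc_shift) (simp add: add.assoc)
      finally show ?thesis by (simp add: add_right_mono)
    qed simp
  qed
  have "ennreal (1 - \<epsilon>) \<le> ?D n (c + a)" for n
  proof -
    have "ennreal (1 - \<delta>) * ennreal (1 - \<delta>) \<le> ennreal (1 - \<delta>) * walk.stay {c..} n (c + a)"
      using a(2)[of a n] \<delta> unfolding walk.stay_shift[of c n "c + a"]
      by (intro mult_left_mono) (auto simp: ennreal_minus[symmetric])
    also have "\<dots> \<le> ?D n (c + a) + (\<Sum>i<n. walk.iter e i (c + a))" by (rule key)
    also have "\<dots> \<le> ?D n (c + a) + ennreal \<delta>"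
      using sum_le_suminf[of "\<lambda>i. walk.iter e i (c + a)" "{..<n}"] green[of "c + a"]
      by (intro add_left_mono) (auto intro: order_trans)
    finally have *: "ennreal ((1 - \<delta>) * (1 - \<delta>)) \<le> ?D n (c + a) + ennreal \<delta>"
      using \<delta> by (simp add: ennreal_mult)
    have "ennreal (1 - \<epsilon>) + ennreal \<delta> \<le> ennreal (1 - 3 * \<delta> + \<delta>) "
      if "\<delta> \<le> 1/3" using \<delta> that by (subst ennreal_plus) (auto intro!: add_right_mono ennreal_leI)
    moreover have "1 - 3 * \<delta> + \<delta> \<le> (1 - \<delta>) * (1 - \<delta>)" by (simp add: algebra_simps)
    ultimately have "ennreal (1 - \<epsilon>) + ennreal \<delta> \<le> ?D n (c + a) + ennreal \<delta>" if "\<delta> \<le> 1/3"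
      using that * by (meson ennreal_leI order_trans)
    moreover have "ennreal (1 - \<epsilon>) = 0" if "\<not> \<delta> \<le> 1/3" using that \<delta> by (intro ennreal_neg) auto
    ultimately show ?thesis
      by (cases "\<delta> \<le> 1/3") (auto simp: add.commute[of _ "ennreal \<delta>"] ennreal_add_left_cancel_le)
  qed
  then show ?thesis by blast
qed

end

section \<open>The multiplicative martingale\<close>

text \<open>
  \<open>exp (- z)\<close> with \<open>exp (- \<infinity>) = 0\<close>: the total weight of a
  generation may be infinite on a null set, and the identities below hold without excluding it.
\<close>

definition eexp :: "ennreal \<Rightarrow> ennreal" where
  "eexp z = (if z = \<top> then 0 else ennreal (exp (- enn2real z)))"

lemma eexp_ennreal: "0 \<le> x \<Longrightarrow> eexp (ennreal x) = ennreal (exp (- x))"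
  by (simp add: eexp_def)

lemma eexp_0 [simp]: "eexp 0 = 1"
  by (simp add: eexp_def)

lemma eexp_le_1: "eexp z \<le> 1"
  by (cases z) (auto simp: eexp_def ennreal_le_1)

lemma eexp_add: "eexp (a + b) = eexp a * eexp b"
  by (cases a; cases b)
     (auto simp: eexp_def ennreal_plus[symmetric] ennreal_mult[symmetric] exp_add[symmetric] simp del: ennreal_plus)

lemma eexp_sum: "finite F \<Longrightarrow> eexp (\<Sum>v\<in>F. z v) = (\<Prod>v\<in>F. eexp (z v))"
  by (induction F rule: finite_induct) (auto simp: eexp_add)

lemma eexp_measurable [measurable]: "eexp \<in> borel_measurable borel"
  unfolding eexp_def by measurable

lemma eexp_tendsto:
  assumes "z \<longlonglongrightarrow> l"
  shows "(\<lambda>n. eexp (z n)) \<longlonglongrightarrow> eexp l"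
proof (cases "l = \<top>")
  case True
  show ?thesis unfolding True
  proof (subst eexp_def, simp, rule tendsto_0_ennrealI)
    fix \<epsilon> :: real assume \<epsilon>: "\<epsilon> > 0"
    have "eventually (\<lambda>n. z n > ennreal (max 0 (- ln \<epsilon>))) sequentially"
      using assms True by (intro order_tendstoD(1)) auto
    then show "eventually (\<lambda>n. eexp (z n) < ennreal \<epsilon>) sequentially"
    proof eventually_elim
      case (elim n)
      show ?case
      proof (cases "z n")
        case (real x)
        then have "max 0 (- ln \<epsilon>) < x"
          using elim ennreal_less_iff[of "max 0 (- ln \<epsilon>)" x] by (simp only: max.cobounded1)
        then have "- ln \<epsilon> < x" by simp
        then have "exp (- x) < exp (ln \<epsilon>)" by simp
        then show ?thesis using real \<epsilon> by (simp add: eexp_ennreal ennreal_lessI)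
      qed (use \<epsilon> in \<open>simp add: eexp_def\<close>)
    qed
  qed
next
  case False
  have "eventually (\<lambda>n. z n < \<top>) sequentially"
    using assms False by (intro order_tendstoD(2)) (auto simp: less_top)
  then have ev: "eventually (\<lambda>n. ennreal (exp (- enn2real (z n))) = eexp (z n)) sequentially"
    by eventually_elim (auto simp: eexp_def)
  have "(\<lambda>n. ennreal (exp (- enn2real (z n)))) \<longlonglongrightarrow> ennreal (exp (- enn2real l))"
    by (intro tendsto_ennrealI tendsto_exp tendsto_minus tendsto_enn2real)
       (use assms False in \<open>simp_all add: top.not_eq_extremum\<close>)
  with ev have "(\<lambda>n. eexp (z n)) \<longlonglongrightarrow> ennreal (exp (- enn2real l))" by (rule Lim_transform_eventually[rotated])
  then show ?thesis using False by (simp add: eexp_def)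
qed

lemma eexp_suminf_ln:
  assumes "\<And>j. 0 < a j" "\<And>j. a j \<le> 1"
  shows "eexp (\<Sum>j. ennreal (- ln (a j))) = ennreal (infprod a)"
proof (rule LIMSEQ_unique)
  show "(\<lambda>n. eexp (\<Sum>j<n. ennreal (- ln (a j)))) \<longlonglongrightarrow> eexp (\<Sum>j. ennreal (- ln (a j)))"
    by (intro eexp_tendsto summable_LIMSEQ) simp
  have "eexp (\<Sum>j<n. ennreal (- ln (a j))) = ennreal (\<Prod>j<n. a j)" for n
  proof -
    have "eexp (ennreal (- ln (a j))) = ennreal (a j)" for j
      using assms[of j] by (subst eexp_ennreal) auto
    then have "eexp (\<Sum>j<n. ennreal (- ln (a j))) = (\<Prod>j<n. ennreal (a j))"
      by (subst eexp_sum) auto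
    then show ?thesis using assms by (simp add: prod_ennreal less_imp_le)
  qed
  moreover have "(\<lambda>n. ennreal (\<Prod>j<n. a j)) \<longlonglongrightarrow> ennreal (infprod a)"
    using assms by (intro tendsto_ennrealI infprod_LIMSEQ) (auto intro: less_imp_le)
  ultimately show "(\<lambda>n. eexp (\<Sum>j<n. ennreal (- ln (a j)))) \<longlonglongrightarrow> ennreal (infprod a)" by simp
qed

text \<open>
  One exhaustion by finite sets serves all sums at once, in particular the sums at every point
  of the probability space.
\<close>

lemma count_space_exhaustion:
  assumes "countable A"
  shows "\<exists>F. (\<forall>m. finite (F m) \<and> F m \<subseteq> A) \<and>
    (\<forall>z :: 'a \<Rightarrow> ennreal. (\<lambda>m. \<Sum>v\<in>F m. z v) \<longlonglongrightarrow> (\<integral>\<^sup>+v. z v \<partial>count_space A))"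
proof -
  define F where "F m = {v \<in> A. to_nat_on A v < m}" for m
  have inj: "inj_on (to_nat_on A) A" by (rule inj_on_to_nat_on[OF assms])
  have fin: "finite (F m)" for m
    by (rule finite_imageD[of "to_nat_on A"]) (auto simp: F_def intro: finite_subset[of _ "{..<m}"] inj_on_subset[OF inj])
  have "(\<lambda>m. \<Sum>v\<in>F m. z v) \<longlonglongrightarrow> (\<integral>\<^sup>+v. z v \<partial>count_space A)" for z :: "'a \<Rightarrow> ennreal"
  proof -
    have eq: "(\<Sum>v\<in>F m. z v) = (\<integral>\<^sup>+v. z v * indicator (F m) v \<partial>count_space A)" for m
      using fin[of m] by (subst nn_integral_count_space'[of "F m"])
        (auto simp: indicator_def F_def intro!: sum.cong)
    have inc: "incseq (\<lambda>m v. z v * indicator (F m) v)"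
      by (auto simp: incseq_def le_fun_def indicator_def F_def)
    have "(\<lambda>m. \<integral>\<^sup>+v. z v * indicator (F m) v \<partial>count_space A) \<longlonglongrightarrow> (SUP m. \<integral>\<^sup>+v. z v * indicator (F m) v \<partial>count_space A)"
      using inc by (intro LIMSEQ_SUP) (auto simp: incseq_def le_fun_def intro!: nn_integral_mono)
    also have "(SUP m. \<integral>\<^sup>+v. z v * indicator (F m) v \<partial>count_space A) = (\<integral>\<^sup>+v. (SUP m. z v * indicator (F m) v) \<partial>count_space A)"
      using inc by (intro nn_integral_monotone_convergence_SUP[symmetric]) auto
    also have "\<dots> = (\<integral>\<^sup>+v. z v \<partial>count_space A)"
    proof (intro nn_integral_cong antisym)
      fix v assume "v \<in> space (count_space A)"
      then have "v \<in> F (Suc (to_nat_on A v))" by (simp add: F_def)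
      then show "z v \<le> (SUP m. z v * indicator (F m) v)"
        by (intro SUP_upper2[of "Suc (to_nat_on A v)"]) auto
    qed (auto intro!: SUP_least simp: indicator_def)
    finally show ?thesis unfolding eq .
  qed
  then show ?thesis using fin by (intro exI[of _ F]) (auto simp: F_def)
qed

abbreviation level :: "nat \<Rightarrow> nat list set" where "level n \<equiv> {v. length v = n}"

lemma nn_integral_level_Suc:
  "(\<integral>\<^sup>+v. f v \<partial>count_space (level (Suc n))) = (\<integral>\<^sup>+v. (\<Sum>j. f (v @ [j])) \<partial>count_space (level n))"
proof -
  have bij: "bij_betw (\<lambda>(v, j). v @ [j]) (level n \<times> UNIV) (level (Suc n))"
  proof (rule bij_betw_imageI)
    show "inj_on (\<lambda>(v, j). v @ [j]) (level n \<times> UNIV)" by (auto simp: inj_on_def)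
    show "(\<lambda>(v, j). v @ [j]) ` (level n \<times> UNIV) = level (Suc n)"
    proof (intro equalityI subsetI)
      fix w :: "nat list" assume "w \<in> level (Suc n)"
      then have "w \<noteq> []" "length (butlast w) = n" by auto
      then have "w = butlast w @ [last w]" by simp
      then show "w \<in> (\<lambda>(v, j). v @ [j]) ` (level n \<times> UNIV)"
        using \<open>length (butlast w) = n\<close> by (intro image_eqI[of _ _ "(butlast w, last w)"]) auto
    qed auto
  qed
  have "(\<integral>\<^sup>+v. f v \<partial>count_space (level (Suc n))) = (\<integral>\<^sup>+p. f (fst p @ [snd p]) \<partial>count_space (level n \<times> UNIV))"
    using nn_integral_bij_count_space[OF bij, of f] by (simp add: split_beta')
  also have "\<dots> = (\<integral>\<^sup>+p. f (fst p @ [snd p]) * indicator (level n) (fst p) \<partial>count_space UNIV)"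
    by (subst nn_integral_count_space_indicator) (auto intro!: nn_integral_cong simp: indicator_def)
  also have "\<dots> = (\<integral>\<^sup>+v. \<integral>\<^sup>+j. f (v @ [j]) * indicator (level n) v \<partial>count_space UNIV \<partial>count_space UNIV)"
    by (subst nn_integral_fst_count_space[symmetric]) simp
  also have "\<dots> = (\<integral>\<^sup>+v. (\<Sum>j. f (v @ [j])) * indicator (level n) v \<partial>count_space UNIV)"
    by (simp add: nn_integral_multc nn_integral_count_space_nat)
  also have "\<dots> = (\<integral>\<^sup>+v. (\<Sum>j. f (v @ [j])) \<partial>count_space (level n))"
    by (subst nn_integral_count_space_indicator) auto
  finally show ?thesis .
qed

context smoothing
begin

text \<open>
  Independent copies of the reproduction law, one for each vertex of the tree.
\<close>

abbreviation field :: "(nat list \<Rightarrow> 'a) measure" where "field \<equiv> Pi\<^sub>M UNIV (\<lambda>_. M)"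

sublocale field: prob_space field
  by (intro prob_space_PiM prob_space_axioms)

text \<open>
  Redrawing the coordinate at one vertex preserves the product measure. This replaces
  conditioning on the other vertices.
\<close>

lemma resample:
  assumes [measurable]: "H \<in> borel_measurable field"
  shows "(\<integral>\<^sup>+b. H b \<partial>field) = (\<integral>\<^sup>+b. \<integral>\<^sup>+c. H (b(v := c)) \<partial>M \<partial>field)"
proof -
  interpret pair_sigma_finite M field ..
  have eq: "distr (M \<Otimes>\<^sub>M field) field (\<lambda>(x, X). X(v := x)) = field"
    using distr_pair_PiM_eq_PiM[of UNIV "\<lambda>_. M" v] prob_space_axioms by simp
  have m [measurable]: "(\<lambda>(x, X). X(v := x)) \<in> measurable (M \<Otimes>\<^sub>M field) field"
    unfolding split_beta' by (rule measurable_fun_upd[where J=UNIV]) auto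
  have "(\<integral>\<^sup>+b. H b \<partial>field) = (\<integral>\<^sup>+p. H ((snd p)(v := fst p)) \<partial>(M \<Otimes>\<^sub>M field))"
    by (subst eq[symmetric], subst nn_integral_distr) (auto simp: split_beta')
  also have "\<dots> = (\<integral>\<^sup>+b. \<integral>\<^sup>+c. H (b(v := c)) \<partial>M \<partial>field)"
    using m by (subst nn_integral_snd[symmetric]) (auto simp: split_beta')
  finally show ?thesis .
qed

definition wt :: "(nat list \<Rightarrow> 'a) \<Rightarrow> nat list \<Rightarrow> real" where
  "wt b v = (\<Prod>i<length v. A (v ! i) (b (take i v)))"

lemma wt_measurable [measurable]: "(\<lambda>b. wt b v) \<in> borel_measurable field"
  unfolding wt_def by measurable

lemma wt_nonneg: "0 \<le> wt b v"
  unfolding wt_def by (intro prod_nonneg) (simp add: A_nonneg)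

lemma wt_Nil [simp]: "wt b [] = 1"
  by (simp add: wt_def)

lemma wt_snoc: "wt b (v @ [j]) = wt b v * A j (b v)"
  by (simp add: wt_def nth_append)

lemma wt_update: "length v \<le> length u \<Longrightarrow> wt (b(u := c)) v = wt b v"
  unfolding wt_def by (intro prod.cong) auto

definition W :: "nat \<Rightarrow> (nat list \<Rightarrow> 'a) \<Rightarrow> ennreal" where
  "W n b = (\<integral>\<^sup>+v. ennreal (wt b v) \<partial>count_space (level n))"

lemma level_sum_measurable [measurable]:
  assumes [measurable]: "\<And>v. f v \<in> borel_measurable N"
  shows "(\<lambda>b. \<integral>\<^sup>+v. f v b \<partial>count_space (level n)) \<in> borel_measurable N"
proof -
  interpret sigma_finite_measure "count_space (level n)" by (rule sigma_finite_measure_count_space_countable) simp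
  have "(\<lambda>x. f (snd x) (fst x)) \<in> borel_measurable (N \<Otimes>\<^sub>M count_space (level n))"
    by (rule measurable_compose_countable'[where f="\<lambda>v x. f v (fst x)" and g=snd and I="level n"]) auto
  then show ?thesis by (intro borel_measurable_nn_integral) (simp add: split_beta')
qed

lemma W_measurable [measurable]: "W n \<in> borel_measurable field"
  unfolding W_def by measurable

text \<open>
  The weight of a vertex depends on its strict ancestors only. So the coordinates at the
  vertices of one generation can be redrawn one after the other without changing the weights of
  that generation.
\<close>

lemma integrate_out_level:
  assumes "finite F" "F \<subseteq> level n"
    and [measurable]: "case_prod k \<in> borel_measurable (borel \<Otimes>\<^sub>M M)"
    and [measurable]: "Y \<in> borel_measurable field"
    and inv: "\<And>v b c. v \<in> F \<Longrightarrow> Y (b(v := c)) = Y b"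
  shows "(\<integral>\<^sup>+b. Y b * (\<Prod>v\<in>F. k (wt b v) (b v)) \<partial>field) =
    (\<integral>\<^sup>+b. Y b * (\<Prod>v\<in>F. \<integral>\<^sup>+c. k (wt b v) c \<partial>M) \<partial>field)"
  using assms(1,2,4,5)
proof (induction F arbitrary: Y rule: finite_induct)
  case (insert u F)
  note [measurable] = insert.prems(2)
  have [measurable]: "(\<lambda>b. k (wt b v) (b v)) \<in> borel_measurable field" for v by measurable
  have [measurable]: "(\<lambda>b. \<integral>\<^sup>+c. k (wt b v) c \<partial>M) \<in> borel_measurable field" for v by measurable
  have wt_inv: "wt (b(v := c)) v' = wt b v'" if "v \<in> insert u F" "v' \<in> insert u F" for b c v v'
  proof -
    have "length v = n" "length v' = n" using that insert.prems(1) by blast+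
    then show ?thesis by (intro wt_update) simp
  qed
  have "(\<integral>\<^sup>+b. Y b * (\<Prod>v\<in>insert u F. k (wt b v) (b v)) \<partial>field) =
    (\<integral>\<^sup>+b. (Y b * (\<Prod>v\<in>F. k (wt b v) (b v))) * k (wt b u) (b u) \<partial>field)"
    using insert.hyps by (simp add: ac_simps)
  also have "\<dots> = (\<integral>\<^sup>+b. \<integral>\<^sup>+c. (Y (b(u := c)) * (\<Prod>v\<in>F. k (wt (b(u := c)) v) ((b(u := c)) v))) *
      k (wt (b(u := c)) u) ((b(u := c)) u) \<partial>M \<partial>field)"
    by (rule resample) measurable
  also have "\<dots> = (\<integral>\<^sup>+b. \<integral>\<^sup>+c. (Y b * (\<Prod>v\<in>F. k (wt b v) (b v))) * k (wt b u) c \<partial>M \<partial>field)"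
  proof (intro nn_integral_cong)
    fix b c
    have "(\<Prod>v\<in>F. k (wt (b(u := c)) v) ((b(u := c)) v)) = (\<Prod>v\<in>F. k (wt b v) (b v))"
      using insert.hyps(2) by (intro prod.cong) (auto simp: wt_inv)
    moreover have "Y (b(u := c)) = Y b" by (rule insert.prems(3)) simp
    ultimately show "(Y (b(u := c)) * (\<Prod>v\<in>F. k (wt (b(u := c)) v) ((b(u := c)) v))) *
      k (wt (b(u := c)) u) ((b(u := c)) u) = (Y b * (\<Prod>v\<in>F. k (wt b v) (b v))) * k (wt b u) c"
      using wt_inv[of u u b c] by (simp only: fun_upd_same insertI1 simp_thms)
  qed
  also have "\<dots> = (\<integral>\<^sup>+b. (Y b * (\<Prod>v\<in>F. k (wt b v) (b v))) * (\<integral>\<^sup>+c. k (wt b u) c \<partial>M) \<partial>field)"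
    by (intro nn_integral_cong nn_integral_cmult) measurable
  also have "\<dots> = (\<integral>\<^sup>+b. (Y b * (\<integral>\<^sup>+c. k (wt b u) c \<partial>M)) * (\<Prod>v\<in>F. k (wt b v) (b v)) \<partial>field)"
    by (simp add: ac_simps)
  also have "\<dots> = (\<integral>\<^sup>+b. (Y b * (\<integral>\<^sup>+c. k (wt b u) c \<partial>M)) * (\<Prod>v\<in>F. \<integral>\<^sup>+c. k (wt b v) c \<partial>M) \<partial>field)"
  proof (rule insert.IH)
    show "Y (b(v := c)) * (\<integral>\<^sup>+c'. k (wt (b(v := c)) u) c' \<partial>M) = Y b * (\<integral>\<^sup>+c'. k (wt b u) c' \<partial>M)"
      if "v \<in> F" for v b c
      by (simp only: insert.prems(3)[OF insertI2[OF that]] wt_inv[OF insertI2[OF that] insertI1])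
  qed (use insert.prems(1) in auto)
  also have "\<dots> = (\<integral>\<^sup>+b. Y b * (\<Prod>v\<in>insert u F. \<integral>\<^sup>+c. k (wt b v) c \<partial>M) \<partial>field)"
    using insert.hyps by (simp add: ac_simps)
  finally show ?case .
qed simp

lemma integrate_out_generation:
  assumes [measurable]: "u \<in> borel_measurable borel" "u' \<in> borel_measurable borel"
    and u': "\<And>x. eexp (u' x) = (\<integral>\<^sup>+c. eexp (\<Sum>j. u (x * A j c)) \<partial>M)"
  shows "(\<integral>\<^sup>+b. eexp (\<integral>\<^sup>+v. u (wt b v) \<partial>count_space (level (Suc n))) \<partial>field) =
    (\<integral>\<^sup>+b. eexp (\<integral>\<^sup>+v. u' (wt b v) \<partial>count_space (level n)) \<partial>field)"
proof -
  obtain F :: "nat \<Rightarrow> nat list set" where F: "\<And>m. finite (F m)" "\<And>m. F m \<subseteq> level n"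
    "\<And>z :: nat list \<Rightarrow> ennreal. (\<lambda>m. \<Sum>v\<in>F m. z v) \<longlonglongrightarrow> (\<integral>\<^sup>+v. z v \<partial>count_space (level n))"
    using count_space_exhaustion[of "level n"] by auto
  define k where "k x c = eexp (\<Sum>j. u (x * A j c))" for x c
  have [measurable]: "case_prod k \<in> borel_measurable (borel \<Otimes>\<^sub>M M)" unfolding k_def by measurable
  let ?L = "\<lambda>b. \<integral>\<^sup>+v. (\<Sum>j. u (wt b v * A j (b v))) \<partial>count_space (level n)"
  let ?R = "\<lambda>b. \<integral>\<^sup>+v. u' (wt b v) \<partial>count_space (level n)"
  have "(\<lambda>m. \<integral>\<^sup>+b. eexp (\<Sum>v\<in>F m. (\<Sum>j. u (wt b v * A j (b v)))) \<partial>field) \<longlonglongrightarrow> (\<integral>\<^sup>+b. eexp (?L b) \<partial>field)"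
    by (intro nn_integral_dominated_convergence[where w="\<lambda>_. 1"])
       (auto simp: eexp_le_1 field.emeasure_space_1 intro!: eexp_tendsto F(3))
  moreover have "(\<lambda>m. \<integral>\<^sup>+b. eexp (\<Sum>v\<in>F m. u' (wt b v)) \<partial>field) \<longlonglongrightarrow> (\<integral>\<^sup>+b. eexp (?R b) \<partial>field)"
    by (intro nn_integral_dominated_convergence[where w="\<lambda>_. 1"])
       (auto simp: eexp_le_1 field.emeasure_space_1 intro!: eexp_tendsto F(3))
  moreover have "(\<integral>\<^sup>+b. eexp (\<Sum>v\<in>F m. (\<Sum>j. u (wt b v * A j (b v)))) \<partial>field) =
    (\<integral>\<^sup>+b. eexp (\<Sum>v\<in>F m. u' (wt b v)) \<partial>field)" for m
    using integrate_out_level[OF F(1) F(2), of k "\<lambda>_. 1" m]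
    by (simp add: eexp_sum F(1) u' k_def)
  ultimately have "(\<integral>\<^sup>+b. eexp (?L b) \<partial>field) = (\<integral>\<^sup>+b. eexp (?R b) \<partial>field)"
    using LIMSEQ_unique by auto
  then show ?thesis by (simp add: nn_integral_level_Suc wt_snoc)
qed

lemma iterates_pos: "0 < (S ^^ n) expo x"
  by (rule less_le_trans[OF _ expo_le_iterates]) (simp add: expo_def)

text \<open>
  Let \<open>u k w = - ln ((S ^^ k) expo (x * w))\<close>. Integrating out the last generation
  replaces \<open>u k\<close>, summed over generation \<open>n + 1\<close>, by \<open>u (k +
  1)\<close>, summed over generation \<open>n\<close>. So the \<open>n\<close> generations add
  up to \<open>n\<close> applications of \<open>S\<close>.
\<close>

theorem laplace_W:
  assumes x: "0 \<le> x"
  shows "(\<integral>\<^sup>+b. eexp (ennreal x * W n b) \<partial>field) = ennreal ((S ^^ n) expo x)"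
proof -
  define u where "u k w = ennreal (- ln ((S ^^ k) expo (x * w)))" for k w
  have [measurable]: "u k \<in> borel_measurable borel" for k
    unfolding u_def using admissibleD(1)[OF admissible_iterates[of k]] by measurable
  have e: "eexp (u k w) = ennreal ((S ^^ k) expo (x * w))" for k w
    unfolding u_def using iterates_pos[of k "x * w"] admissibleD(3)[OF admissible_iterates, of k "x * w"]
    by (subst eexp_ennreal) auto
  have step: "eexp (u (Suc k) w) = (\<integral>\<^sup>+c. eexp (\<Sum>j. u k (w * A j c)) \<partial>M)" for k w
  proof -
    have "(\<integral>\<^sup>+c. eexp (\<Sum>j. u k (w * A j c)) \<partial>M) = (\<integral>\<^sup>+c. ennreal (infprod (\<lambda>j. (S ^^ k) expo (x * w * A j c))) \<partial>M)"
      unfolding u_def mult.assoc[symmetric]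
      by (intro nn_integral_cong eexp_suminf_ln iterates_pos admissibleD[OF admissible_iterates])
    also have "\<dots> = ennreal (S ((S ^^ k) expo) (x * w))"
      unfolding S_def[of "(S ^^ k) expo" "x * w"]
      by (intro nn_integral_eq_integral S_integrable admissible_iterates AE_I2 infprod_bounds admissibleD[OF admissible_iterates])
    finally show ?thesis by (simp add: e)
  qed
  have "(\<integral>\<^sup>+b. eexp (\<integral>\<^sup>+v. u k (wt b v) \<partial>count_space (level n)) \<partial>field) = ennreal ((S ^^ (n + k)) expo x)" for k
  proof (induction n arbitrary: k)
    case 0
    have "level 0 = {[]}" by auto
    then show ?case by (simp add: e nn_integral_count_space_finite field.emeasure_space_1)
  next
    case (Suc n)
    have "(\<integral>\<^sup>+b. eexp (\<integral>\<^sup>+v. u k (wt b v) \<partial>count_space (level (Suc n))) \<partial>field) =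
      (\<integral>\<^sup>+b. eexp (\<integral>\<^sup>+v. u (Suc k) (wt b v) \<partial>count_space (level n)) \<partial>field)"
      by (intro integrate_out_generation step) measurable
    also have "\<dots> = ennreal ((S ^^ (n + Suc k)) expo x)" by (rule Suc)
    finally show ?case by simp
  qed
  from this[of 0] have "(\<integral>\<^sup>+b. eexp (\<integral>\<^sup>+v. u 0 (wt b v) \<partial>count_space (level n)) \<partial>field) = ennreal ((S ^^ n) expo x)"
    by simp
  moreover have "(\<integral>\<^sup>+v. u 0 (wt b v) \<partial>count_space (level n)) = ennreal x * W n b" for b
    unfolding W_def u_def using x
    by (subst nn_integral_cmult[symmetric]) (auto simp: expo_def ennreal_mult' wt_nonneg max_def intro!: nn_integral_cong)
  ultimately show ?thesis by simp
qed

text \<open>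
  Measurability with respect to the generations before \<open>n\<close>, expressed as invariance
  under changes at depth \<open>n\<close> and more.
\<close>

definition determined_below :: "nat \<Rightarrow> ((nat list \<Rightarrow> 'a) \<Rightarrow> 'b) \<Rightarrow> bool" where
  "determined_below n Y \<longleftrightarrow> (\<forall>v b c. n \<le> length v \<longrightarrow> Y (b(v := c)) = Y b)"

lemma determined_belowD: "determined_below n Y \<Longrightarrow> n \<le> length v \<Longrightarrow> Y (b(v := c)) = Y b"
  by (auto simp: determined_below_def)

lemma W_determined_below: "n \<le> m \<Longrightarrow> determined_below m (W n)"
  unfolding determined_below_def W_def
  by (auto intro!: nn_integral_cong simp: wt_update)

lemma W_martingale_step:
  assumes [measurable]: "Y \<in> borel_measurable field" and inv: "determined_below n Y"
  shows "(\<integral>\<^sup>+b. Y b * W (Suc n) b \<partial>field) = (\<integral>\<^sup>+b. Y b * W n b \<partial>field)"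
proof -
  interpret C: sigma_finite_measure "count_space (level n)" by (rule sigma_finite_measure_count_space_countable) simp
  interpret FC: pair_sigma_finite field "count_space (level n)" ..
  have swap: "(\<integral>\<^sup>+b. \<integral>\<^sup>+v. f v b \<partial>count_space (level n) \<partial>field) = (\<integral>\<^sup>+v. \<integral>\<^sup>+b. f v b \<partial>field \<partial>count_space (level n))"
    if [measurable]: "\<And>v. f v \<in> borel_measurable field" for f :: "nat list \<Rightarrow> (nat list \<Rightarrow> 'a) \<Rightarrow> ennreal"
  proof -
    have "(\<lambda>x. f (snd x) (fst x)) \<in> borel_measurable (field \<Otimes>\<^sub>M count_space (level n))"
      by (rule measurable_compose_countable'[where f="\<lambda>v x. f v (fst x)" and g=snd and I="level n"]) auto
    then show ?thesis by (intro FC.Fubini'[symmetric]) (simp add: split_beta')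
  qed
  have "(\<integral>\<^sup>+b. Y b * W (Suc n) b \<partial>field) =
    (\<integral>\<^sup>+b. \<integral>\<^sup>+v. Y b * (ennreal (wt b v) * (\<Sum>j. ennreal (A j (b v)))) \<partial>count_space (level n) \<partial>field)"
    unfolding W_def nn_integral_level_Suc wt_snoc
    by (simp add: nn_integral_cmult ennreal_mult wt_nonneg A_nonneg)
  also have "\<dots> = (\<integral>\<^sup>+v. \<integral>\<^sup>+b. Y b * (ennreal (wt b v) * (\<Sum>j. ennreal (A j (b v)))) \<partial>field \<partial>count_space (level n))"
    by (rule swap) measurable
  also have "\<dots> = (\<integral>\<^sup>+v. \<integral>\<^sup>+b. Y b * ennreal (wt b v) \<partial>field \<partial>count_space (level n))"
  proof (rule nn_integral_cong)
    fix v assume "v \<in> space (count_space (level n))"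
    then have v: "length v = n" by simp
    have "(\<integral>\<^sup>+b. Y b * (ennreal (wt b v) * (\<Sum>j. ennreal (A j (b v)))) \<partial>field) =
      (\<integral>\<^sup>+b. \<integral>\<^sup>+c. Y (b(v := c)) * (ennreal (wt (b(v := c)) v) * (\<Sum>j. ennreal (A j ((b(v := c)) v)))) \<partial>M \<partial>field)"
      by (rule resample) measurable
    also have "\<dots> = (\<integral>\<^sup>+b. \<integral>\<^sup>+c. Y b * ennreal (wt b v) * (\<Sum>j. ennreal (A j c)) \<partial>M \<partial>field)"
      using determined_belowD[OF inv, of v] v by (simp add: wt_update mult.assoc)
    also have "\<dots> = (\<integral>\<^sup>+b. Y b * ennreal (wt b v) \<partial>field)"
      by (simp add: nn_integral_cmult mean_1)
    finally show "(\<integral>\<^sup>+b. Y b * (ennreal (wt b v) * (\<Sum>j. ennreal (A j (b v)))) \<partial>field) =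
      (\<integral>\<^sup>+b. Y b * ennreal (wt b v) \<partial>field)" .
  qed
  also have "\<dots> = (\<integral>\<^sup>+b. \<integral>\<^sup>+v. Y b * ennreal (wt b v) \<partial>count_space (level n) \<partial>field)"
    by (rule swap[symmetric]) measurable
  also have "\<dots> = (\<integral>\<^sup>+b. Y b * W n b \<partial>field)"
    unfolding W_def by (simp add: nn_integral_cmult)
  finally show ?thesis .
qed

lemma W_martingale:
  assumes [measurable]: "Y \<in> borel_measurable field" and inv: "determined_below m Y" and "m \<le> n"
  shows "(\<integral>\<^sup>+b. Y b * W n b \<partial>field) = (\<integral>\<^sup>+b. Y b * W m b \<partial>field)"
  using \<open>m \<le> n\<close>
proof (induction n rule: dec_induct)
  case (step n)
  have "determined_below n Y" using inv step.hyps(1) by (auto simp: determined_below_def)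
  then show ?case using step W_martingale_step[of Y n] by simp
qed simp

lemma W_mean: "(\<integral>\<^sup>+b. W n b \<partial>field) = 1"
proof -
  have "level 0 = {[]}" by auto
  then have "W 0 b = 1" for b by (simp add: W_def nn_integral_count_space_finite)
  then show ?thesis
    using W_martingale[of "\<lambda>_. 1" 0 n] by (simp add: determined_below_def field.emeasure_space_1)
qed

text \<open>
  The real version of \<open>W n\<close>, which is almost surely finite.
\<close>

definition w :: "nat \<Rightarrow> (nat list \<Rightarrow> 'a) \<Rightarrow> real" where "w n b = enn2real (W n b)"

lemma w_measurable [measurable]: "w n \<in> borel_measurable field"
  unfolding w_def by measurable

lemma w_nonneg [simp]: "0 \<le> w n b"
  by (simp add: w_def)

lemma AE_W_eq_w: "AE b in field. W n b = ennreal (w n b)"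
proof -
  have "AE b in field. W n b \<noteq> \<infinity>" by (intro nn_integral_PInf_AE) (auto simp: W_mean)
  then show ?thesis by eventually_elim (simp add: w_def less_top[symmetric])
qed

lemma nn_integral_w:
  assumes [measurable]: "Y \<in> borel_measurable field"
  shows "(\<integral>\<^sup>+b. Y b * ennreal (w n b) \<partial>field) = (\<integral>\<^sup>+b. Y b * W n b \<partial>field)"
  using AE_W_eq_w[of n] by (intro nn_integral_cong_AE) (auto elim!: eventually_mono)

lemma w_integrable: "integrable field (w n)"
proof (rule integrableI_nonneg)
  show "(\<integral>\<^sup>+b. ennreal (w n b) \<partial>field) < \<infinity>"
    using nn_integral_w[of "\<lambda>_. 1" n] by (simp add: W_mean)
qed auto

lemma w_mean: "(\<integral>b. w n b \<partial>field) = 1"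
proof -
  have "ennreal (\<integral>b. w n b \<partial>field) = (\<integral>\<^sup>+b. ennreal (w n b) \<partial>field)"
    by (rule nn_integral_eq_integral[symmetric, OF w_integrable]) simp
  also have "\<dots> = 1" using nn_integral_w[of "\<lambda>_. 1" n] by (simp add: W_mean)
  finally show ?thesis by (simp add: ennreal_eq_1)
qed

lemma w_determined_below: "n \<le> m \<Longrightarrow> determined_below m (w n)"
  using W_determined_below[of n m] by (auto simp: determined_below_def w_def)

lemma w_times_integrable:
  assumes [measurable]: "Y \<in> borel_measurable field" and "\<And>b. \<bar>Y b\<bar> \<le> B"
  shows "integrable field (\<lambda>b. Y b * w n b)"
proof (rule Bochner_Integration.integrable_bound)
  show "integrable field (\<lambda>b. B * w n b)" using w_integrable by simp
  show "AE b in field. norm (Y b * w n b) \<le> norm (B * w n b)"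
    using assms(2) by (intro AE_I2) (auto simp: abs_mult intro!: mult_right_mono intro: order_trans[OF _ abs_ge_self])
qed measurable

lemma w_martingale:
  assumes [measurable]: "Y \<in> borel_measurable field" and inv: "determined_below m Y" and "m \<le> n"
    and Y: "\<And>b. 0 \<le> Y b" "\<And>b. Y b \<le> B"
  shows "(\<integral>b. Y b * w n b \<partial>field) = (\<integral>b. Y b * w m b \<partial>field)"
proof -
  have eq: "(\<integral>b. Y b * w n b \<partial>field) = enn2real (\<integral>\<^sup>+b. ennreal (Y b) * W n b \<partial>field)" for n
    by (subst integral_eq_nn_integral)
       (auto simp: Y ennreal_mult nn_integral_w[symmetric])
  have "(\<integral>\<^sup>+b. ennreal (Y b) * W n b \<partial>field) = (\<integral>\<^sup>+b. ennreal (Y b) * W m b \<partial>field)"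
    using inv \<open>m \<le> n\<close> by (intro W_martingale) (auto simp: determined_below_def)
  then show ?thesis by (simp add: eq)
qed

lemma laplace_w:
  assumes x: "0 \<le> x"
  shows "(\<integral>b. exp (- (x * w n b)) \<partial>field) = (S ^^ n) expo x"
proof -
  have int: "integrable field (\<lambda>b. exp (- (x * w n b)))"
    by (rule field.integrable_const_bound[where B=1]) (use x in auto)
  have "ennreal (\<integral>b. exp (- (x * w n b)) \<partial>field) = (\<integral>\<^sup>+b. ennreal (exp (- (x * w n b))) \<partial>field)"
    by (rule nn_integral_eq_integral[symmetric, OF int]) simp
  also have "\<dots> = (\<integral>\<^sup>+b. eexp (ennreal x * W n b) \<partial>field)"
  proof (rule nn_integral_cong_AE)
    show "AE b in field. ennreal (exp (- (x * w n b))) = eexp (ennreal x * W n b)"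
      using AE_W_eq_w[of n] by eventually_elim (use x in \<open>simp add: eexp_ennreal ennreal_mult[symmetric]\<close>)
  qed
  also have "\<dots> = ennreal ((S ^^ n) expo x)" by (rule laplace_W[OF x])
  finally show ?thesis
    using iterates_pos[of n x] by (subst (asm) ennreal_inj) (auto intro!: integral_nonneg_AE)
qed

lemma exp_w_integrable: "0 \<le> x \<Longrightarrow> integrable field (\<lambda>b. exp (- (x * w n b)))"
  by (rule field.integrable_const_bound[where B=1]) auto

text \<open>
  By convexity \<open>Z\<^sub>n = exp (- (x * w n))\<close> is a bounded submartingale, hence
  \<open>E ((Z\<^sub>n - Z\<^sub>m)\<^sup>2) \<le> E (Z\<^sub>n\<^sup>2) - E
  (Z\<^sub>m\<^sup>2)\<close>; and the second moments are again iterates, at \<open>2 *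
  x\<close>.
\<close>

lemma exp_w_L2_Cauchy:
  assumes x: "0 \<le> x" and mn: "m \<le> n"
  shows "(\<integral>b. \<bar>exp (- (x * w n b)) - exp (- (x * w m b))\<bar> \<partial>field)\<^sup>2 \<le> (S ^^ n) expo (2 * x) - (S ^^ m) expo (2 * x)"
proof -
  let ?Z = "\<lambda>n b. exp (- (x * w n b))"
  have prod_int: "integrable field (\<lambda>b. ?Z i b * ?Z j b)" for i j
    by (rule field.integrable_const_bound[where B=1]) (use x in \<open>auto simp: abs_mult intro!: mult_le_one\<close>)
  have sq: "(\<integral>b. ?Z i b * ?Z i b \<partial>field) = (S ^^ i) expo (2 * x)" for i
    using laplace_w[of "2 * x" i] x by (simp add: exp_add[symmetric] algebra_simps)
  have cross: "(\<integral>b. ?Z m b * ?Z m b \<partial>field) \<le> (\<integral>b. ?Z n b * ?Z m b \<partial>field)"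
  proof -
    let ?Y = "\<lambda>b. ?Z m b * ?Z m b"
    have Y1: "\<bar>?Y b\<bar> \<le> 1" for b using x by (simp add: exp_add[symmetric])
    have det: "determined_below m ?Y" using w_determined_below[of m m] by (auto simp: determined_below_def)
    have "(\<integral>b. ?Y b * w n b \<partial>field) = (\<integral>b. ?Y b * w m b \<partial>field)"
      using Y1 by (intro w_martingale[OF _ det mn, where B=1]) (auto simp: abs_le_iff)
    moreover have i: "integrable field (\<lambda>b. ?Y b * w i b)" for i
      by (rule w_times_integrable[where B=1]) (use Y1 in auto)
    ultimately have "(\<integral>b. ?Y b \<partial>field) = (\<integral>b. ?Y b - x * (?Y b * w n b - ?Y b * w m b) \<partial>field)"
      using prod_int by simp
    also have "\<dots> \<le> (\<integral>b. ?Z n b * ?Z m b \<partial>field)"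
    proof (rule integral_mono)
      fix b
      have "?Y b * (1 + - (x * (w n b - w m b))) \<le> ?Y b * exp (- (x * (w n b - w m b)))"
        by (intro mult_left_mono exp_ge_add_one_self) auto
      also have "\<dots> = ?Z n b * ?Z m b" by (simp add: exp_add[symmetric] algebra_simps)
      finally show "?Y b - x * (?Y b * w n b - ?Y b * w m b) \<le> ?Z n b * ?Z m b" by (simp add: algebra_simps)
    qed (use prod_int i in auto)
    finally show ?thesis .
  qed
  have int1: "integrable field (\<lambda>b. ?Z n b - ?Z m b)"
    using exp_w_integrable[OF x] by simp
  have "(\<integral>b. \<bar>?Z n b - ?Z m b\<bar> \<partial>field)\<^sup>2 \<le> (\<integral>b. \<bar>?Z n b - ?Z m b\<bar>\<^sup>2 \<partial>field)"
  proof -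
    let ?e = "\<integral>b. \<bar>?Z n b - ?Z m b\<bar> \<partial>field"
    have i2: "integrable field (\<lambda>b. \<bar>?Z n b - ?Z m b\<bar>\<^sup>2)"
    proof (rule field.integrable_const_bound[where B=1])
      have "\<bar>?Z n b - ?Z m b\<bar> \<le> 1" for b
        using x exp_gt_zero[of "- (x * w n b)"] exp_gt_zero[of "- (x * w m b)"]
          exp_le_one_iff[of "- (x * w n b)"] exp_le_one_iff[of "- (x * w m b)"]
        by (auto simp: abs_le_iff simp del: exp_gt_zero exp_le_one_iff)
      then show "AE b in field. norm (\<bar>?Z n b - ?Z m b\<bar>\<^sup>2) \<le> 1"
        by (intro AE_I2) (auto simp: abs_square_le_1)
    qed measurable
    have "0 \<le> (\<integral>b. (\<bar>?Z n b - ?Z m b\<bar> - ?e)\<^sup>2 \<partial>field)" by (intro integral_nonneg_AE) auto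
    also have "\<dots> = (\<integral>b. \<bar>?Z n b - ?Z m b\<bar>\<^sup>2 - 2 * ?e * \<bar>?Z n b - ?Z m b\<bar> + ?e\<^sup>2 \<partial>field)"
      by (simp only: power2_diff) (simp add: algebra_simps)
    also have "\<dots> = (\<integral>b. \<bar>?Z n b - ?Z m b\<bar>\<^sup>2 \<partial>field) - 2 * ?e * ?e + ?e\<^sup>2"
      using i2 integrable_abs[OF int1] by (simp add: field.prob_space)
    finally show ?thesis by (simp add: power2_eq_square)
  qed
  also have "\<dots> = (\<integral>b. ?Z n b * ?Z n b - 2 * (?Z n b * ?Z m b) + ?Z m b * ?Z m b \<partial>field)"
    by (simp add: power2_eq_square algebra_simps)
  also have "\<dots> = (\<integral>b. ?Z n b * ?Z n b \<partial>field) - 2 * (\<integral>b. ?Z n b * ?Z m b \<partial>field) + (\<integral>b. ?Z m b * ?Z m b \<partial>field)"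
    using prod_int by simp
  also have "\<dots> \<le> (S ^^ n) expo (2 * x) - (S ^^ m) expo (2 * x)"
    using cross unfolding sq by simp
  finally show ?thesis .
qed

lemma iterates_Cauchy: "Cauchy (\<lambda>n. (S ^^ n) expo x)"
proof (intro convergent_Cauchy Bseq_monoseq_convergent)
  show "Bseq (\<lambda>n. (S ^^ n) expo x)"
    by (rule BseqI'[where K=1]) (use admissibleD[OF admissible_iterates] in \<open>simp add: abs_of_nonneg\<close>)
  show "monoseq (\<lambda>n. (S ^^ n) expo x)"
    by (intro incseq_imp_monoseq incseq_SucI iterates_mono)
qed

text \<open>
  Split \<open>t = k t + (1 - exp (- (s * t))) / s\<close>. By \<open>iterates_slope\<close> the
  mean of \<open>k (w n) \<ge> 0\<close> is small for small \<open>s\<close>, uniformly in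
  \<open>n\<close>, and the bounded remainder converges in mean for each fixed \<open>s\<close>.
\<close>

theorem w_L1_Cauchy:
  assumes \<epsilon>: "\<epsilon> > 0"
  shows "\<exists>m0. \<forall>m\<ge>m0. \<forall>n\<ge>m. (\<integral>b. \<bar>w n b - w m b\<bar> \<partial>field) \<le> \<epsilon>"
proof -
  obtain y where y: "\<And>n. ennreal (1 - \<epsilon> / 4) \<le> gap (\<lambda>_. 1) ((S ^^ n) expo) y"
    using iterates_slope[of "\<epsilon> / 4"] \<epsilon> by auto
  define s where "s = exp (- y)"
  have s: "0 < s" by (simp add: s_def)
  define k where "k t = t - (1 - exp (- (s * t))) / s" for t
  have k_int: "integrable field (\<lambda>b. k (w n b))" for n
    unfolding k_def using s exp_w_integrable[of s n] w_integrable by simp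
  have k_small: "(\<integral>b. k (w n b) \<partial>field) \<le> \<epsilon> / 4" for n
  proof -
    have "(\<integral>b. k (w n b) \<partial>field) = 1 - (1 - (S ^^ n) expo s) / s"
      unfolding k_def using s exp_w_integrable[of s n] w_integrable laplace_w[of s n]
      by (simp add: w_mean field.prob_space)
    moreover have "1 - \<epsilon> / 4 \<le> (1 - (S ^^ n) expo s) / s"
    proof -
      have "0 \<le> exp y * (1 - (S ^^ n) expo (exp (- y)))"
        using admissibleD(3)[OF admissible_iterates] by simp
      then have "1 - \<epsilon> / 4 \<le> exp y * (1 - (S ^^ n) expo (exp (- y)))"
        using y[of n] by (simp add: gap_def ennreal_le_iff)
      then show ?thesis by (simp add: s_def exp_minus divide_simps mult.commute)
    qed
    ultimately show ?thesis by linarith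
  qed
  have k_bound: "\<bar>t - u\<bar> \<le> k t + k u + \<bar>exp (- (s * t)) - exp (- (s * u))\<bar> / s" if "0 \<le> t" "0 \<le> u" for t u
  proof -
    have k0: "0 \<le> k t" if "0 \<le> t" for t
      using exp_ge_add_one_self[of "- (s * t)"] s by (simp add: k_def divide_simps mult.commute)
    have "t - u = k t - k u + (exp (- (s * u)) - exp (- (s * t))) / s"
      using s by (simp add: k_def field_simps)
    then have "\<bar>t - u\<bar> \<le> \<bar>k t\<bar> + \<bar>k u\<bar> + \<bar>(exp (- (s * u)) - exp (- (s * t))) / s\<bar>" by linarith
    then show ?thesis using k0 that s by (simp add: abs_minus_commute)
  qed
  have pos: "0 < (s * \<epsilon> / 2)\<^sup>2" using s \<epsilon> by simp
  obtain m0 where m0: "\<And>m n. m0 \<le> m \<Longrightarrow> m0 \<le> n \<Longrightarrow> dist ((S ^^ m) expo (2 * s)) ((S ^^ n) expo (2 * s)) < (s * \<epsilon> / 2)\<^sup>2"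
    using iterates_Cauchy[of "2 * s"] pos unfolding Cauchy_def by blast
  have "(\<integral>b. \<bar>w n b - w m b\<bar> \<partial>field) \<le> \<epsilon>" if mn: "m0 \<le> m" "m \<le> n" for m n
  proof -
    let ?d = "\<lambda>b. \<bar>exp (- (s * w n b)) - exp (- (s * w m b))\<bar>"
    have d_int: "integrable field ?d" using exp_w_integrable[of s] s by simp
    have "(\<integral>b. ?d b \<partial>field)\<^sup>2 \<le> (S ^^ n) expo (2 * s) - (S ^^ m) expo (2 * s)"
      using s mn by (intro exp_w_L2_Cauchy) auto
    also have "\<dots> \<le> (s * \<epsilon> / 2)\<^sup>2" using m0[of m n] mn by (simp add: dist_real_def)
    finally have d: "(\<integral>b. ?d b \<partial>field) \<le> s * \<epsilon> / 2"
      using s \<epsilon> by (rule_tac power2_le_imp_le) auto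
    have "(\<integral>b. \<bar>w n b - w m b\<bar> \<partial>field) \<le> (\<integral>b. k (w n b) + k (w m b) + ?d b / s \<partial>field)"
      using w_integrable k_int d_int by (intro integral_mono k_bound) auto
    also have "\<dots> = (\<integral>b. k (w n b) \<partial>field) + (\<integral>b. k (w m b) \<partial>field) + (\<integral>b. ?d b \<partial>field) / s"
      using k_int d_int by simp
    also have "\<dots> \<le> \<epsilon> / 4 + \<epsilon> / 4 + (s * \<epsilon> / 2) / s"
      using k_small d s by (intro add_mono divide_right_mono) auto
    also have "\<dots> = \<epsilon>" using s by simp
    finally show ?thesis .
  qed
  then show ?thesis by blast
qed

text \<open>
  Doob's argument: decompose according to the first time \<open>k\<close> at which the
  martingale has moved by more than \<open>\<theta>\<close> since time \<open>m\<close>. That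
  event is determined by the generations before \<open>k\<close>, so on it \<open>w k\<close>
  may be replaced by \<open>w N\<close> under the integral, separately for upward and downward
  moves.
\<close>

lemma w_maximal_inequality:
  assumes \<theta>: "\<theta> > 0"
  shows "\<theta> * measure field {b \<in> space field. \<exists>k\<in>{m..N}. \<theta> < \<bar>w k b - w m b\<bar>} \<le> (\<integral>b. \<bar>w N b - w m b\<bar> \<partial>field)"
proof -
  define first where "first k b \<longleftrightarrow> \<theta> < \<bar>w k b - w m b\<bar> \<and> (\<forall>j\<in>{m..<k}. \<bar>w j b - w m b\<bar> \<le> \<theta>)" for k b
  \<comment> \<open>\<open>U\<close> and \<open>D\<close> indicate first moves upward and downward; \<open>Y\<close> is their sum\<close>
  define Y where "Y k b = (if first k b then 1 else 0 :: real)" for k b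
  define U where "U k b = (if first k b \<and> w m b \<le> w k b then 1 else 0 :: real)" for k b
  define D where "D k b = (if first k b \<and> w k b < w m b then 1 else 0 :: real)" for k b
  have [measurable]: "Measurable.pred field (first k)" for k
    unfolding first_def by measurable
  have [measurable]: "Measurable.pred field (\<lambda>b. w m b \<le> w k b)" "Measurable.pred field (\<lambda>b. w k b < w m b)" for k
    unfolding pred_def by (simp_all add: borel_measurable_le borel_measurable_less)
  have [measurable]: "Y k \<in> borel_measurable field" "U k \<in> borel_measurable field" "D k \<in> borel_measurable field" for k
    unfolding Y_def U_def D_def by measurable
  have det: "determined_below k (U k)" "determined_below k (D k)" if "m \<le> k" for k
    using w_determined_below[of _ k] that
    by (auto simp: determined_below_def U_def D_def first_def)
  have int: "integrable field (\<lambda>b. U k b * w j b)" "integrable field (\<lambda>b. D k b * w j b)" for k j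
    by (intro w_times_integrable[where B=1]; auto simp: U_def D_def)+
  have Y_int: "integrable field (Y k)" for k
    by (rule field.integrable_const_bound[where B=1]) (auto simp: Y_def)
  have stop: "\<theta> * (\<integral>b. Y k b \<partial>field) \<le> (\<integral>b. Y k b * \<bar>w N b - w m b\<bar> \<partial>field)" if k: "k \<in> {m..N}" for k
  proof -
    have "\<theta> * (\<integral>b. Y k b \<partial>field) = (\<integral>b. \<theta> * Y k b \<partial>field)" by simp
    also have "\<dots> \<le> (\<integral>b. (U k b * w k b - U k b * w m b) - (D k b * w k b - D k b * w m b) \<partial>field)"
    proof (rule integral_mono)
      show "integrable field (\<lambda>b. \<theta> * Y k b)" using Y_int by simp
      show "integrable field (\<lambda>b. (U k b * w k b - U k b * w m b) - (D k b * w k b - D k b * w m b))"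
        using int by simp
    qed (auto simp: Y_def U_def D_def first_def)
    also have "\<dots> = ((\<integral>b. U k b * w k b \<partial>field) - (\<integral>b. U k b * w m b \<partial>field)) -
        ((\<integral>b. D k b * w k b \<partial>field) - (\<integral>b. D k b * w m b \<partial>field))"
      using int by simp
    also have "(\<integral>b. U k b * w k b \<partial>field) = (\<integral>b. U k b * w N b \<partial>field)"
      using k by (intro w_martingale[symmetric, OF _ det(1), where B=1]) (auto simp: U_def)
    also have "(\<integral>b. D k b * w k b \<partial>field) = (\<integral>b. D k b * w N b \<partial>field)"
      using k by (intro w_martingale[symmetric, OF _ det(2), where B=1]) (auto simp: D_def)
    also have "((\<integral>b. U k b * w N b \<partial>field) - (\<integral>b. U k b * w m b \<partial>field)) -
        ((\<integral>b. D k b * w N b \<partial>field) - (\<integral>b. D k b * w m b \<partial>field)) =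
      (\<integral>b. (U k b * w N b - U k b * w m b) - (D k b * w N b - D k b * w m b) \<partial>field)"
      using int by simp
    also have "\<dots> \<le> (\<integral>b. Y k b * \<bar>w N b - w m b\<bar> \<partial>field)"
    proof (rule integral_mono)
      have "integrable field (\<lambda>b. \<bar>Y k b * w N b - Y k b * w m b\<bar>)"
        by (intro integrable_abs Bochner_Integration.integrable_diff w_times_integrable[where B=1]) (auto simp: Y_def)
      moreover have "(\<lambda>b. \<bar>Y k b * w N b - Y k b * w m b\<bar>) = (\<lambda>b. Y k b * \<bar>w N b - w m b\<bar>)"
        by (auto simp: Y_def)
      ultimately show "integrable field (\<lambda>b. Y k b * \<bar>w N b - w m b\<bar>)" by simp
    qed (use int in \<open>auto simp: Y_def U_def D_def\<close>)
    finally show ?thesis .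
  qed
  have one: "(\<Sum>k\<in>{m..N}. Y k b) = indicator {b. \<exists>k\<in>{m..N}. \<theta> < \<bar>w k b - w m b\<bar>} b" for b
  proof (cases "\<exists>k\<in>{m..N}. \<theta> < \<bar>w k b - w m b\<bar>")
    case True
    define k where "k = (LEAST k. m \<le> k \<and> \<theta> < \<bar>w k b - w m b\<bar>)"
    obtain k' where k': "k' \<in> {m..N}" "\<theta> < \<bar>w k' b - w m b\<bar>" using True by blast
    have k: "m \<le> k \<and> \<theta> < \<bar>w k b - w m b\<bar>" unfolding k_def by (rule LeastI[of _ k']) (use k' in auto)
    have least: "k \<le> j" if "m \<le> j" "\<theta> < \<bar>w j b - w m b\<bar>" for j
      unfolding k_def by (rule Least_le) (use that in auto)
    have "k \<in> {m..N}" using k least[of k'] k' by auto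
    have "first j b \<longleftrightarrow> j = k" if "j \<in> {m..N}" for j
    proof
      assume j: "first j b"
      then have "k \<le> j" using that by (intro least) (auto simp: first_def)
      moreover have "\<not> k < j" using j k by (force simp: first_def)
      ultimately show "j = k" by simp
    next
      assume "j = k"
      have "\<bar>w i b - w m b\<bar> \<le> \<theta>" if "i \<in> {m..<k}" for i
        using least[of i] that by force
      then show "first j b" using k \<open>j = k\<close> by (auto simp: first_def)
    qed
    then have "(\<Sum>k\<in>{m..N}. Y k b) = (\<Sum>j\<in>{m..N}. if j = k then 1 else 0)"
      by (intro sum.cong) (auto simp: Y_def)
    also have "\<dots> = 1" using \<open>k \<in> {m..N}\<close> by simp
    finally show ?thesis using True by simp
  next
    case False
    then have "\<not> first j b" if "j \<in> {m..N}" for j using that by (auto simp: first_def)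
    then have "(\<Sum>k\<in>{m..N}. Y k b) = 0" by (simp add: Y_def)
    then show ?thesis using False by simp
  qed
  have prob: "measure field {b \<in> space field. \<exists>k\<in>{m..N}. \<theta> < \<bar>w k b - w m b\<bar>} = (\<integral>b. (\<Sum>k\<in>{m..N}. Y k b) \<partial>field)"
  proof -
    have "(\<integral>b. (\<Sum>k\<in>{m..N}. Y k b) \<partial>field) = (\<integral>b. indicator {b \<in> space field. \<exists>k\<in>{m..N}. \<theta> < \<bar>w k b - w m b\<bar>} b \<partial>field)"
      unfolding one by (intro Bochner_Integration.integral_cong) (auto simp: indicator_def)
    then show ?thesis by simp
  qed
  have "\<theta> * measure field {b \<in> space field. \<exists>k\<in>{m..N}. \<theta> < \<bar>w k b - w m b\<bar>} = (\<Sum>k\<in>{m..N}. \<theta> * (\<integral>b. Y k b \<partial>field))"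
    unfolding prob by (simp add: Y_int sum_distrib_left)
  also have "\<dots> \<le> (\<Sum>k\<in>{m..N}. \<integral>b. Y k b * \<bar>w N b - w m b\<bar> \<partial>field)"
    by (intro sum_mono stop)
  also have "\<dots> = (\<integral>b. (\<Sum>k\<in>{m..N}. Y k b) * \<bar>w N b - w m b\<bar> \<partial>field)"
    unfolding sum_distrib_right
  proof (rule Bochner_Integration.integral_sum[symmetric])
    fix k
    have "integrable field (\<lambda>b. \<bar>Y k b * w N b - Y k b * w m b\<bar>)"
      by (intro integrable_abs Bochner_Integration.integrable_diff w_times_integrable[where B=1]) (auto simp: Y_def)
    moreover have "(\<lambda>b. \<bar>Y k b * w N b - Y k b * w m b\<bar>) = (\<lambda>b. Y k b * \<bar>w N b - w m b\<bar>)"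
      by (auto simp: Y_def)
    ultimately show "integrable field (\<lambda>b. Y k b * \<bar>w N b - w m b\<bar>)" by simp
  qed
  also have "\<dots> \<le> (\<integral>b. \<bar>w N b - w m b\<bar> \<partial>field)"
    unfolding one
  proof (rule integral_mono')
    show "integrable field (\<lambda>b. \<bar>w N b - w m b\<bar>)" using w_integrable by simp
  qed (auto simp: indicator_def)
  finally show ?thesis .
qed

lemma AE_w_oscillation:
  assumes \<theta>: "\<theta> > 0"
  shows "AE b in field. \<exists>m. \<forall>k\<ge>m. \<bar>w k b - w m b\<bar> \<le> \<theta>"
proof -
  let ?E = "\<lambda>m N. {b \<in> space field. \<exists>k\<in>{m..N}. \<theta> < \<bar>w k b - w m b\<bar>}"
  let ?B = "{b \<in> space field. \<forall>m. \<exists>k\<ge>m. \<theta> < \<bar>w k b - w m b\<bar>}"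
  have small: "measure field ?B \<le> \<epsilon>" if \<epsilon>: "\<epsilon> > 0" for \<epsilon>
  proof -
    obtain m where m: "\<And>n. m \<le> n \<Longrightarrow> (\<integral>b. \<bar>w n b - w m b\<bar> \<partial>field) \<le> \<theta> * \<epsilon>"
      using w_L1_Cauchy[of "\<theta> * \<epsilon>"] \<theta> \<epsilon> by (meson mult_pos_pos order_refl)
    have le: "measure field (?E m (m + n)) \<le> \<epsilon>" for n
    proof -
      have "\<theta> * measure field (?E m (m + n)) \<le> \<theta> * \<epsilon>"
        by (rule order_trans[OF w_maximal_inequality[OF \<theta>] m]) simp
      then show ?thesis using \<theta> by simp
    qed
    have "(\<lambda>n. measure field (?E m (m + n))) \<longlonglongrightarrow> measure field (\<Union>n. ?E m (m + n))"
      by (intro field.finite_Lim_measure_incseq) (auto simp: incseq_def)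
    then have "measure field (\<Union>n. ?E m (m + n)) \<le> \<epsilon>"
      by (rule LIMSEQ_le_const2) (use le in blast)
    moreover have "measure field ?B \<le> measure field (\<Union>n. ?E m (m + n))"
    proof (intro field.finite_measure_mono subsetI)
      fix b assume b: "b \<in> ?B"
      then obtain k where "m \<le> k" "\<theta> < \<bar>w k b - w m b\<bar>" by blast
      then have "b \<in> ?E m (m + (k - m))" using b by auto
      then show "b \<in> (\<Union>n. ?E m (m + n))" by blast
    qed measurable
    ultimately show ?thesis by simp
  qed
  have "measure field ?B = 0"
    by (rule antisym[OF field_le_epsilon]) (use small in auto)
  then have "emeasure field ?B = 0" by (simp add: field.emeasure_eq_measure)
  then have "AE b in field. b \<notin> ?B" by (intro AE_not_in null_setsI) auto
  then show ?thesis
    by (rule AE_mp) (auto intro!: AE_I2 simp: not_less)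
qed

lemma AE_w_convergent: "AE b in field. convergent (\<lambda>n. w n b)"
proof -
  have "AE b in field. \<forall>i. \<exists>m. \<forall>k\<ge>m. \<bar>w k b - w m b\<bar> \<le> 1 / real (Suc i)"
    by (subst AE_all_countable) (auto intro!: AE_w_oscillation)
  then show ?thesis
  proof eventually_elim
    case (elim b)
    have "Cauchy (\<lambda>n. w n b)"
    proof (rule metric_CauchyI)
      fix e :: real assume "0 < e"
      then obtain i where i: "1 / real (Suc i) < e / 2" using nat_approx_posE[of "e/2"] by auto
      obtain m where m: "\<And>k. m \<le> k \<Longrightarrow> \<bar>w k b - w m b\<bar> \<le> 1 / real (Suc i)" using elim by blast
      have "dist (w k b) (w l b) < e" if "m \<le> k" "m \<le> l" for k l
        using m[OF that(1)] m[OF that(2)] i by (auto simp: dist_real_def)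
      then show "\<exists>M. \<forall>m\<ge>M. \<forall>n\<ge>M. dist (w m b) (w n b) < e" by blast
    qed
    then show ?case by (rule Cauchy_convergent)
  qed
qed

definition wlim :: "(nat list \<Rightarrow> 'a) \<Rightarrow> real" where "wlim b = lim (\<lambda>n. w n b)"

lemma wlim_measurable [measurable]: "wlim \<in> borel_measurable field"
  unfolding wlim_def by measurable

lemma AE_w_tendsto: "AE b in field. (\<lambda>n. w n b) \<longlonglongrightarrow> wlim b"
  using AE_w_convergent by eventually_elim (simp add: wlim_def convergent_LIMSEQ_iff)

lemma AE_wlim_nonneg: "AE b in field. 0 \<le> wlim b"
  using AE_w_tendsto by eventually_elim (rule LIMSEQ_le_const, auto)

text \<open>
  The Laplace transform of the martingale limit, continued by \<open>1\<close> to negative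
  arguments.
\<close>

definition phi :: "real \<Rightarrow> real" where "phi x = (\<integral>b. exp (- (max 0 x * wlim b)) \<partial>field)"

lemma exp_wlim_integrable: "0 \<le> x \<Longrightarrow> integrable field (\<lambda>b. exp (- (x * wlim b)))"
proof (rule field.integrable_const_bound[where B=1])
  assume x: "0 \<le> x"
  show "AE b in field. norm (exp (- (x * wlim b))) \<le> 1"
    using AE_wlim_nonneg by eventually_elim (use x in simp)
qed measurable

lemma iterates_tendsto_phi: "(\<lambda>n. (S ^^ n) expo x) \<longlonglongrightarrow> phi x"
proof -
  have "(\<lambda>n. \<integral>b. exp (- (max 0 x * w n b)) \<partial>field) \<longlonglongrightarrow> phi x"
    unfolding phi_def
  proof (rule integral_dominated_convergence[where w="\<lambda>_. 1"])
    show "AE b in field. (\<lambda>n. exp (- (max 0 x * w n b))) \<longlonglongrightarrow> exp (- (max 0 x * wlim b))"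
      using AE_w_tendsto by eventually_elim (intro tendsto_intros)
  qed auto
  moreover have "(\<integral>b. exp (- (max 0 x * w n b)) \<partial>field) = (S ^^ n) expo x" for n
  proof (cases "0 \<le> x")
    case False
    then have "1 \<le> (S ^^ n) expo x" using expo_le_iterates[of x n] by (simp add: expo_def)
    moreover have "(S ^^ n) expo x \<le> 1" by (rule admissibleD(3)[OF admissible_iterates])
    ultimately show ?thesis using False by (simp add: field.prob_space)
  qed (simp add: laplace_w max_def)
  ultimately show ?thesis by simp
qed

lemma admissible_phi: "admissible phi"
  unfolding admissible_def
proof (intro conjI allI)
  show "phi \<in> borel_measurable borel" unfolding phi_def by measurable
  fix x
  show "0 \<le> phi x" by (rule LIMSEQ_le_const[OF iterates_tendsto_phi]) (use admissibleD[OF admissible_iterates] in blast)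
  show "phi x \<le> 1" by (rule LIMSEQ_le_const2[OF iterates_tendsto_phi]) (use admissibleD[OF admissible_iterates] in blast)
qed

lemma iterates_le_phi: "(S ^^ n) expo x \<le> phi x"
  by (rule incseq_le[OF _ iterates_tendsto_phi]) (intro incseq_SucI iterates_mono)

lemma phi_0 [simp]: "phi 0 = 1"
  by (simp add: phi_def field.prob_space)

lemma one_minus_phi_le: "0 \<le> x \<Longrightarrow> 1 - phi x \<le> x"
  using iterates_le_phi[of 0 x] exp_ge_add_one_self[of "-x"] by (simp add: expo_def)

text \<open>
  Monotonicity of \<open>S\<close> gives \<open>phi x \<le> S phi x\<close>. The converse passes
  to the limit in \<open>gap_S_le\<close>, whose right-hand side is dominated, because
  \<open>phi\<close> and all iterates lie between \<open>1 - x\<close> and \<open>1\<close>.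
\<close>

theorem phi_fixed_point: "0 \<le> x \<Longrightarrow> S phi x = phi x"
proof -
  assume "0 \<le> x"
  have low: "phi x \<le> S phi x" for x
  proof (rule LIMSEQ_le_const2[OF LIMSEQ_Suc[OF iterates_tendsto_phi]])
    have "(S ^^ Suc n) expo x \<le> S phi x" for n
      using S_mono[OF admissible_iterates admissible_phi iterates_le_phi] by simp
    then show "\<exists>N. \<forall>n\<ge>N. (S ^^ Suc n) expo x \<le> S phi x" by blast
  qed
  note [measurable] = gap_measurable[OF admissible_phi admissible_iterates]
  have up: "S phi (exp (- y)) \<le> phi (exp (- y))" for y
  proof -
    have gap_le: "gap phi ((S ^^ n) expo) z \<le> 1" for n z
    proof -
      have "phi (exp (- z)) - (S ^^ n) expo (exp (- z)) \<le> exp (- z)"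
        using admissibleD(3)[OF admissible_phi, of "exp (-z)"] one_minus_iterates_le[of "exp (-z)" n] by simp
      then have "exp z * (phi (exp (- z)) - (S ^^ n) expo (exp (- z))) \<le> exp z * exp (- z)"
        by (intro mult_left_mono) auto
      then show ?thesis by (simp add: gap_def exp_add[symmetric] ennreal_le_1)
    qed
    have "(\<lambda>n. \<integral>\<^sup>+z. gap phi ((S ^^ n) expo) (y + z) \<partial>step_law) \<longlonglongrightarrow> (\<integral>\<^sup>+z. 0 \<partial>step_law)"
    proof (rule nn_integral_dominated_convergence[where w="\<lambda>_. 1"])
      have "(\<lambda>n. gap phi ((S ^^ n) expo) z) \<longlonglongrightarrow> ennreal (exp z * (phi (exp (- z)) - phi (exp (- z))))" for z
        unfolding gap_def by (intro tendsto_ennrealI tendsto_intros iterates_tendsto_phi)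
      then show "AE z in step_law. (\<lambda>n. gap phi ((S ^^ n) expo) (y + z)) \<longlonglongrightarrow> 0" by simp
    qed (use gap_le in auto)
    moreover have "gap (S phi) ((S ^^ Suc n) expo) y \<le> (\<integral>\<^sup>+z. gap phi ((S ^^ n) expo) (y + z) \<partial>step_law)" for n
    proof -
      have "1 \<le> (S ^^ n) expo 0" using expo_le_iterates[of 0 n] by (simp add: expo_def)
      then have "phi 0 = (S ^^ n) expo 0" using admissibleD(3)[OF admissible_iterates, of n 0] by simp
      then show ?thesis using gap_S_le[OF admissible_phi admissible_iterates, of n y] by simp
    qed
    moreover have "(\<lambda>n. gap (S phi) ((S ^^ Suc n) expo) y) \<longlonglongrightarrow> ennreal (exp y * (S phi (exp (- y)) - phi (exp (- y))))"
      unfolding gap_def by (intro tendsto_ennrealI tendsto_intros LIMSEQ_Suc[OF iterates_tendsto_phi])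
    ultimately have "ennreal (exp y * (S phi (exp (- y)) - phi (exp (- y)))) \<le> 0"
      by (intro LIMSEQ_le[of _ _ "\<lambda>n. \<integral>\<^sup>+z. gap phi ((S ^^ n) expo) (y + z) \<partial>step_law"]) auto
    then show ?thesis by (simp add: ennreal_eq_0_iff mult_le_0_iff)
  qed
  show ?thesis
  proof (cases "x = 0")
    case True
    then show ?thesis using low[of 0] admissibleD(3)[OF admissible_S[OF admissible_phi], of 0] by simp
  next
    case False
    then show ?thesis using up[of "- ln x"] low[of x] \<open>0 \<le> x\<close> by simp
  qed
qed

end

section \<open>Bounded harmonic functions of the walk\<close>

context drift_walk
begin

lemma stay_translate: "stay ((\<lambda>x. x - u) -` B) n y = stay B n (y - u)"
proof (induction n arbitrary: y)
  case (Suc n)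
  have "stay ((\<lambda>x. x - u) -` B) n (y + z) = stay B n (y - u + z)" for z
    by (simp add: Suc algebra_simps)
  then show ?case by (simp add: indicator_def)
qed (simp add: indicator_def)

lemma submartingale_le_iter:
  assumes "\<And>y. f y \<le> (\<integral>\<^sup>+z. f (y + z) \<partial>\<nu>)"
  shows "f y \<le> iter f n y"
proof (induction n)
  case (Suc n)
  also have "iter f n y \<le> iter f (Suc n) y"
    unfolding iter_Suc_right by (intro iter_mono assms)
  finally show ?case .
qed simp

text \<open>
  Let \<open>g y\<close> be the variance of \<open>h\<close> after one step from
  \<open>y\<close>. For a fixed displacement \<open>z\<close>, \<open>h (y + z) - h y\<close> is
  again harmonic in \<open>y\<close>, so its square and hence \<open>g\<close> do not decrease
  in mean along the walk. On the other hand the means of \<open>g\<close> along the walk add up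
  to an increment of the mean of \<open>h\<^sup>2\<close>, which is at most
  \<open>C\<^sup>2\<close>. So \<open>n * g y \<le> C\<^sup>2\<close> for every
  \<open>n\<close>, and \<open>g y = 0\<close>.
\<close>

theorem choquet_deny:
  fixes h :: "real \<Rightarrow> real"
  assumes [measurable]: "h \<in> borel_measurable borel"
    and bound: "\<And>y. \<bar>h y\<bar> \<le> C"
    and harmonic: "\<And>y. (\<integral>z. h (y + z) \<partial>\<nu>) = h y"
  shows "AE z in \<nu>. h (y + z) = h y"
proof -
  interpret pair_sigma_finite \<nu> \<nu> ..
  define g where "g y = (\<integral>\<^sup>+z. ennreal ((h (y + z) - h y)\<^sup>2) \<partial>\<nu>)" for y
  have [measurable]: "g \<in> borel_measurable borel" unfolding g_def by measurable
  have C: "0 \<le> C" using bound[of 0] by simp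
  have int: "integrable \<nu> (\<lambda>z. h (y + z))" for y
    by (rule integrable_const_bound[where B=C]) (auto simp: bound)
  have int2: "integrable \<nu> (\<lambda>z. (h (y + z))\<^sup>2)" for y
    by (rule integrable_const_bound[where B="C\<^sup>2"]) (use bound C in \<open>auto simp: abs_le_square_iff[symmetric]\<close>)
  have sub: "g y \<le> (\<integral>\<^sup>+v. g (y + v) \<partial>\<nu>)" for y
  proof -
    have diff_bound: "(h a - h b)\<^sup>2 \<le> (2 * C)\<^sup>2" for a b
      using bound[of a] bound[of b] C by (subst abs_le_square_iff[symmetric]) auto
    have X2: "integrable \<nu> (\<lambda>v. (h (y + v + z) - h (y + v))\<^sup>2)" for z
      by (rule integrable_const_bound[where B="(2 * C)\<^sup>2"]) (use diff_bound in auto)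
    have X: "integrable \<nu> (\<lambda>v. h (y + v + z) - h (y + v))" for z
      using int[of "y + z"] int[of y] by (simp add: ac_simps)
    have "ennreal ((h (y + z) - h y)\<^sup>2) \<le> (\<integral>\<^sup>+v. ennreal ((h (y + v + z) - h (y + v))\<^sup>2) \<partial>\<nu>)" for z
    proof -
      have "h (y + z) - h y = (\<integral>v. h (y + v + z) - h (y + v) \<partial>\<nu>)"
        using harmonic[of "y + z"] harmonic[of y] int[of "y + z"] int[of y]
        by (subst Bochner_Integration.integral_diff) (simp_all add: ac_simps)
      then have "(h (y + z) - h y)\<^sup>2 \<le> (\<integral>v. (h (y + v + z) - h (y + v))\<^sup>2 \<partial>\<nu>)"
        using variance_eq[OF X X2] variance_positive[of "\<lambda>v. h (y + v + z) - h (y + v)"] by simp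
      then have "ennreal ((h (y + z) - h y)\<^sup>2) \<le> ennreal (\<integral>v. (h (y + v + z) - h (y + v))\<^sup>2 \<partial>\<nu>)"
        by (rule ennreal_leI)
      also have "\<dots> = (\<integral>\<^sup>+v. ennreal ((h (y + v + z) - h (y + v))\<^sup>2) \<partial>\<nu>)"
        by (rule nn_integral_eq_integral[symmetric, OF X2]) simp
      finally show ?thesis .
    qed
    then have "g y \<le> (\<integral>\<^sup>+z. \<integral>\<^sup>+v. ennreal ((h (y + v + z) - h (y + v))\<^sup>2) \<partial>\<nu> \<partial>\<nu>)"
      unfolding g_def by (intro nn_integral_mono) auto
    also have "\<dots> = (\<integral>\<^sup>+v. \<integral>\<^sup>+z. ennreal ((h (y + v + z) - h (y + v))\<^sup>2) \<partial>\<nu> \<partial>\<nu>)"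
      by (rule Fubini') measurable
    finally show ?thesis unfolding g_def .
  qed
  have split: "ennreal ((h y)\<^sup>2) + g y = (\<integral>\<^sup>+z. ennreal ((h (y + z))\<^sup>2) \<partial>\<nu>)" for y
  proof -
    have i: "integrable \<nu> (\<lambda>z. (h (y + z) - h y)\<^sup>2)"
      unfolding power2_diff using int int2 by simp
    have "(\<integral>z. (h (y + z) - h y)\<^sup>2 \<partial>\<nu>) = (\<integral>z. (h (y + z))\<^sup>2 \<partial>\<nu>) - (h y)\<^sup>2"
      unfolding power2_diff using int[of y] int2[of y] harmonic[of y] prob_space
      by (simp add: power2_eq_square)
    then have "ennreal (\<integral>z. (h (y + z))\<^sup>2 \<partial>\<nu>) = ennreal ((h y)\<^sup>2 + (\<integral>z. (h (y + z) - h y)\<^sup>2 \<partial>\<nu>))"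
      by simp
    also have "\<dots> = ennreal ((h y)\<^sup>2) + ennreal (\<integral>z. (h (y + z) - h y)\<^sup>2 \<partial>\<nu>)"
      by (intro ennreal_plus integral_nonneg_AE) auto
    finally show ?thesis
      unfolding g_def using i int2[of y] by (simp add: nn_integral_eq_integral)
  qed
  have tele: "ennreal ((h y)\<^sup>2) + (\<Sum>i<n. iter g i y) = iter (\<lambda>y. ennreal ((h y)\<^sup>2)) n y" for n
  proof (induction n)
    case (Suc n)
    have "iter (\<lambda>y. ennreal ((h y)\<^sup>2)) (Suc n) y = iter (\<lambda>y. ennreal ((h y)\<^sup>2) + g y) n y"
      unfolding iter_Suc_right split ..
    also have "\<dots> = iter (\<lambda>y. ennreal ((h y)\<^sup>2)) n y + iter g n y" by (rule iter_add) measurable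
    finally show ?case using Suc by (simp add: add.assoc)
  qed simp
  have "of_nat n * g y \<le> ennreal (C\<^sup>2)" for n
  proof -
    have "of_nat n * g y = (\<Sum>i<n. g y)" by simp
    also have "\<dots> \<le> (\<Sum>i<n. iter g i y)" by (intro sum_mono submartingale_le_iter sub)
    also have "\<dots> \<le> iter (\<lambda>y. ennreal ((h y)\<^sup>2)) n y" unfolding tele[symmetric] by simp
    also have "\<dots> \<le> iter (\<lambda>_. ennreal (C\<^sup>2)) n y"
      using bound C by (intro iter_mono ennreal_leI) (auto simp: abs_le_square_iff[symmetric])
    finally show ?thesis by simp
  qed
  note le = this
  have "g y = 0"
  proof (rule ccontr)
    assume "g y \<noteq> 0"
    moreover have "g y \<noteq> \<top>" using le[of 1] by (auto simp: top_unique)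
    ultimately obtain e where e: "g y = ennreal e" "0 < e" by (cases "g y") auto
    obtain n :: nat where "C\<^sup>2 < real n * e" using reals_Archimedean3[OF e(2)] by blast
    moreover have "ennreal (real n * e) \<le> ennreal (C\<^sup>2)"
      using le[of n] e by (simp add: ennreal_mult ennreal_of_nat_eq_real_of_nat)
    ultimately show False by (simp add: ennreal_le_iff)
  qed
  then have "AE z in \<nu>. ennreal ((h (y + z) - h y)\<^sup>2) = 0"
    unfolding g_def by (subst (asm) nn_integral_0_iff_AE) auto
  then show ?thesis by eventually_elim simp
qed

end

section \<open>Uniqueness of fixed points up to periodic factors\<close>

text \<open>
  Concavity: \<open>1 - exp (- (x * t))\<close> divided by \<open>x\<close> decreases in
  \<open>x\<close>.
\<close>

lemma one_minus_exp_slope_antimono: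
  fixes x x' t :: real
  assumes "0 < x" "x \<le> x'"
  shows "x * (1 - exp (- (x' * t))) \<le> x' * (1 - exp (- (x * t)))"
proof -
  define p where "p = x / x'"
  have p: "0 \<le> p" "p \<le> 1" "x = p * x'" using assms by (auto simp: p_def)
  have "exp ((1 - p) * 0 + p * (- (x' * t))) \<le> (1 - p) * exp 0 + p * exp (- (x' * t))"
    using convex_onD[OF exp_convex, of p 0 "- (x' * t)"] p by simp
  then have "exp (- (x * t)) \<le> 1 - p + p * exp (- (x' * t))" using p(3) by (simp add: mult.assoc)
  then have "x' * (p * (1 - exp (- (x' * t)))) \<le> x' * (1 - exp (- (x * t)))"
    using assms by (intro mult_left_mono) (auto simp: algebra_simps)
  then show ?thesis using p(3) by (simp add: mult.commute mult.left_commute)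
qed

context smoothing
begin

lemma phi_eq: "0 \<le> x \<Longrightarrow> phi x = (\<integral>b. exp (- (x * wlim b)) \<partial>field)"
  by (simp add: phi_def max_def)

lemma phi_slope_antimono:
  assumes "0 < x" "x \<le> x'"
  shows "x * (1 - phi x') \<le> x' * (1 - phi x)"
proof -
  have "x * (1 - phi x') = (\<integral>b. x * (1 - exp (- (x' * wlim b))) \<partial>field)"
    using assms exp_wlim_integrable[of x'] by (simp add: phi_eq field.prob_space)
  also have "\<dots> \<le> (\<integral>b. x' * (1 - exp (- (x * wlim b))) \<partial>field)"
    using assms exp_wlim_integrable[of x'] exp_wlim_integrable[of x]
    by (intro integral_mono one_minus_exp_slope_antimono) auto
  also have "\<dots> = x' * (1 - phi x)"
    using assms exp_wlim_integrable[of x] by (simp add: phi_eq field.prob_space)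
  finally show ?thesis .
qed

definition slope :: "real \<Rightarrow> real" where "slope y = exp y * (1 - phi (exp (- y)))"

lemma slope_mono: "y \<le> y' \<Longrightarrow> slope y \<le> slope y'"
  using phi_slope_antimono[of "exp (- y')" "exp (- y)"]
  by (simp add: slope_def exp_minus field_simps)

lemma slope_le_1: "slope y \<le> 1"
proof -
  have "slope y \<le> exp y * exp (- y)"
    unfolding slope_def using one_minus_phi_le[of "exp (- y)"] by (intro mult_left_mono) auto
  then show ?thesis by (simp add: exp_add[symmetric])
qed

text \<open>
  The uniform bound on the slopes of the iterates passes to the limit, and \<open>slope\<close>
  is monotone.
\<close>

lemma slope_tendsto_1:
  assumes "\<epsilon> > 0"
  shows "\<exists>y0. \<forall>y\<ge>y0. 1 - \<epsilon> \<le> slope y"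
proof -
  obtain y0 where y0: "\<And>n. ennreal (1 - \<epsilon>) \<le> gap (\<lambda>_. 1) ((S ^^ n) expo) y0"
    using iterates_slope[OF assms] by blast
  have "1 - \<epsilon> \<le> exp y0 * (1 - (S ^^ n) expo (exp (- y0)))" for n
  proof -
    have "0 \<le> exp y0 * (1 - (S ^^ n) expo (exp (- y0)))"
      using admissibleD(3)[OF admissible_iterates] by simp
    then show ?thesis using y0[of n] by (simp add: gap_def ennreal_le_iff)
  qed
  moreover have "(\<lambda>n. exp y0 * (1 - (S ^^ n) expo (exp (- y0)))) \<longlonglongrightarrow> slope y0"
    unfolding slope_def by (intro tendsto_intros iterates_tendsto_phi)
  ultimately have "1 - \<epsilon> \<le> slope y0" by (intro LIMSEQ_le_const) auto
  then show ?thesis using slope_mono order_trans by blast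
qed

text \<open>
  Otherwise \<open>W\<close> would vanish almost surely, and \<open>slope\<close> would be
  \<open>0\<close> instead of tending to \<open>1\<close>.
\<close>

lemma phi_strict_antimono:
  assumes "0 \<le> x" "x < x'"
  shows "phi x' < phi x"
proof -
  have diff: "phi x - phi x' = (\<integral>b. exp (- (x * wlim b)) - exp (- (x' * wlim b)) \<partial>field)"
    using assms exp_wlim_integrable by (simp add: phi_eq)
  have nonneg: "AE b in field. 0 \<le> exp (- (x * wlim b)) - exp (- (x' * wlim b))"
    using AE_wlim_nonneg by eventually_elim (use assms in \<open>simp add: mult_right_mono\<close>)
  have "phi x - phi x' \<noteq> 0"
  proof
    assume "phi x - phi x' = 0"
    then have "AE b in field. exp (- (x * wlim b)) - exp (- (x' * wlim b)) = 0"
      unfolding diff using assms exp_wlim_integrable nonneg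
      by (subst (asm) integral_nonneg_eq_0_iff_AE) auto
    then have "AE b in field. wlim b = 0" by eventually_elim (use assms in auto)
    then have "phi t = (\<integral>b. 1 \<partial>field)" for t
      unfolding phi_def by (intro integral_cong_AE) (auto elim!: eventually_mono)
    then have "slope y = 0" for y by (simp add: slope_def field.prob_space)
    moreover obtain y0 where "1 - 1/2 \<le> slope y0" using slope_tendsto_1[of "1/2"] by auto
    ultimately show False by simp
  qed
  moreover have "0 \<le> phi x - phi x'" unfolding diff by (rule integral_nonneg_AE[OF nonneg])
  ultimately show ?thesis by simp
qed

lemma phi_le_iff: "0 \<le> x \<Longrightarrow> 0 \<le> x' \<Longrightarrow> phi x \<le> phi x' \<longleftrightarrow> x' \<le> x"
  using phi_strict_antimono[of x x'] phi_strict_antimono[of x' x] by (cases x x' rule: linorder_cases) auto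

lemma phi_pos: "0 < phi x"
  using iterates_pos[of 0 x] iterates_le_phi[of 0 x] by linarith

lemma isCont_phi: "isCont phi x"
proof (rule continuous_at_sequentiallyI)
  fix u :: "nat \<Rightarrow> real" assume u: "u \<longlonglongrightarrow> x"
  show "(\<lambda>n. phi (u n)) \<longlonglongrightarrow> phi x"
    unfolding phi_def
  proof (rule integral_dominated_convergence[where w="\<lambda>_. 1"])
    show "AE b in field. (\<lambda>n. exp (- (max 0 (u n) * wlim b))) \<longlonglongrightarrow> exp (- (max 0 x * wlim b))"
      by (intro AE_I2 tendsto_intros u)
    show "AE b in field. norm (exp (- (max 0 (u n) * wlim b))) \<le> 1" for n
      using AE_wlim_nonneg by eventually_elim simp
  qed auto
qed

lemma S_scale: "S (\<lambda>x. F (c * x)) x = S F (c * x)"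
  by (simp add: S_def mult.assoc)

lemma S_one: "S (\<lambda>_. 1) x = 1"
  by (simp add: S_def infprod_def prob_space)

lemma gap_submartingale:
  assumes "admissible F" "admissible G" "F 0 = G 0"
    and "\<And>x. 0 < x \<Longrightarrow> S F x = F x" "\<And>x. 0 < x \<Longrightarrow> S G x = G x"
  shows "gap F G y \<le> (\<integral>\<^sup>+z. gap F G (y + z) \<partial>step_law)"
  using gap_S_le[OF assms(1-3), of y] assms(4,5)[of "exp (- y)"] by (simp add: gap_def)

text \<open>
  Suppose the slope is unbounded, and compare \<open>F\<close> with the fixed point \<open>G x =
  phi (c * x)\<close>, whose slope is at most \<open>c\<close>. Where the slope of
  \<open>F\<close> is large, monotonicity of \<open>F\<close> keeps \<open>F \<le> G\<close> on
  a whole interval of length \<open>b\<close>. There are such intervals to the right of every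
  starting point, the walk hits them with probability at least \<open>1 / 2\<close>, and
  \<open>gap F G\<close> vanishes there. So the supremum \<open>K\<close> of \<open>gap F
  G\<close> is at most \<open>K / 2\<close>, that is, \<open>F \<le> G\<close>. As
  \<open>c\<close> is arbitrary, \<open>F \<le> phi 1 < 1\<close> on the positive half-line,
  against \<open>lim\<close>.
\<close>

lemma fixed_point_slope_bounded:
  assumes F: "admissible F" and fixed: "\<And>x. 0 < x \<Longrightarrow> S F x = F x"
    and F0: "F 0 = 1" and anti: "\<And>x x'. 0 < x \<Longrightarrow> x \<le> x' \<Longrightarrow> F x' \<le> F x"
    and lim: "(F \<longlongrightarrow> 1) (at_right 0)"
  shows "\<exists>C. \<forall>y. exp y * (1 - F (exp (- y))) \<le> C"
proof (rule ccontr)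
  assume "\<not> ?thesis"
  then have unbounded: "\<exists>y. C < exp y * (1 - F (exp (- y)))" for C by (auto simp: not_le)
  have F_le: "F x \<le> phi (c * x)" if c: "c > 0" and x: "x > 0" for c x
  proof -
    let ?G = "\<lambda>x. phi (c * x)"
    have G: "admissible ?G"
      using admissibleD[OF admissible_phi] by (auto simp: admissible_def)
    have G_fixed: "S ?G x = ?G x" if "0 < x" for x
      unfolding S_scale using c that by (intro phi_fixed_point) auto
    have sub: "gap F ?G y \<le> (\<integral>\<^sup>+z. gap F ?G (y + z) \<partial>step_law)" for y
      using F G F0 fixed G_fixed by (intro gap_submartingale) auto
    define K where "K = (SUP y. gap F ?G y)"
    have "gap F ?G y \<le> ennreal c" for y
    proof -
      have "F (exp (- y)) - phi (c * exp (- y)) \<le> c * exp (- y)"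
        using one_minus_phi_le[of "c * exp (- y)"] admissibleD(3)[OF F, of "exp (- y)"] c by simp
      then have "exp y * (F (exp (- y)) - phi (c * exp (- y))) \<le> exp y * (c * exp (- y))"
        by (intro mult_left_mono) auto
      also have "\<dots> = c" by (simp add: exp_minus)
      finally show ?thesis unfolding gap_def by (rule ennreal_leI)
    qed
    then have "K \<le> ennreal c" unfolding K_def by (intro SUP_least)
    then have K_fin: "K < \<top>" by (auto simp: less_top[symmetric] top_unique)
    obtain b where b: "b \<ge> 0" "\<And>y. y < 0 \<Longrightarrow> walk.stay_forever (- {0..b}) y \<le> 1 / 2"
      using walk.overshoot_bounded by auto
    have half: "gap F ?G y \<le> K * (1 / 2)" for y
    proof -
      \<comment> \<open>the slope at \<open>y1\<close> exceeds \<open>c * exp b\<close>, to give \<open>F \<le> G\<close> on all of \<open>{y1 - b..y1}\<close>; and it exceeds \<open>exp (y + b)\<close>, to place this interval to the right of \<open>y\<close>\<close>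
      obtain y1 where y1: "max (c * exp b) (exp (y + b)) < exp y1 * (1 - F (exp (- y1)))"
        using unbounded by blast
      have "exp y1 * (1 - F (exp (- y1))) \<le> exp y1 * 1"
        using admissibleD(2)[OF F] by (intro mult_left_mono) auto
      moreover have "exp (y + b) < exp y1 * (1 - F (exp (- y1)))" using y1 by simp
      ultimately have "exp (y + b) < exp y1" by linarith
      then have lt: "y < y1 - b" by simp
      define u where "u = y1 - b"
      let ?B = "(\<lambda>x. x - u) -` (- {0..b})"
      have zero: "gap F ?G y' = 0" if "y' \<notin> ?B" for y'
      proof -
        have y': "y1 - b \<le> y'" "y' \<le> y1" using that by (auto simp: u_def)
        have "c * exp (- y') \<le> c * exp (b - y1)" using c y' by simp
        also have "\<dots> = exp (- y1) * (c * exp b)" by (simp add: exp_diff exp_minus field_simps)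
        also have "\<dots> \<le> exp (- y1) * (exp y1 * (1 - F (exp (- y1))))"
          using y1 by (intro mult_left_mono) auto
        also have "\<dots> = 1 - F (exp (- y1))" by (simp add: exp_minus)
        also have "\<dots> \<le> 1 - F (exp (- y'))" using anti[of "exp (- y1)" "exp (- y')"] y' by simp
        finally have "F (exp (- y')) \<le> phi (c * exp (- y'))"
          using one_minus_phi_le[of "c * exp (- y')"] c by simp
        then show ?thesis by (simp add: gap_def ennreal_neg mult_nonneg_nonpos)
      qed
      have "gap F ?G y \<le> K * walk.stay ?B n y" for n
      proof (rule walk.submartingale_le_stay[OF _ sub _ zero])
        show "?B \<in> sets borel" by (rule measurable_sets_borel[where M=borel]) auto
      qed (auto simp: K_def intro: SUP_upper)
      then have "gap F ?G y \<le> K * walk.stay (- {0..b}) n (y - u)" for n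
        unfolding walk.stay_translate .
      moreover have "(\<lambda>n. K * walk.stay (- {0..b}) n (y - u)) \<longlonglongrightarrow> K * walk.stay_forever (- {0..b}) (y - u)"
        using K_fin by (intro ennreal_tendsto_cmult walk.stay_tendsto)
      ultimately have "gap F ?G y \<le> K * walk.stay_forever (- {0..b}) (y - u)"
        by (intro LIMSEQ_le_const) auto
      also have "\<dots> \<le> K * (1 / 2)" using lt by (intro mult_left_mono b(2)) (auto simp: u_def)
      finally show ?thesis .
    qed
    then have "K \<le> K * (1 / 2)" unfolding K_def by (intro SUP_least)
    have "K = 0"
    proof (cases K)
      case (real k)
      have "1 / 2 = ennreal (1 / 2)" using ennreal_divide_numeral[of 1 "num.Bit0 num.One"] by simp
      then have "ennreal k * (1 / 2) = ennreal (k * (1 / 2))"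
        using real(1) by (simp only: ennreal_mult[symmetric])
      then have "ennreal k \<le> ennreal (k * (1 / 2))"
        using \<open>K \<le> K * (1 / 2)\<close> unfolding real(2) by (simp only:)
      then show ?thesis using real by (simp add: ennreal_le_iff)
    qed (use K_fin in simp)
    then have "gap F ?G (- ln x) = 0" using SUP_upper[of "- ln x" UNIV "gap F ?G"] by (simp add: K_def)
    then show ?thesis using x by (simp add: gap_def ennreal_eq_0_iff mult_le_0_iff exp_minus)
  qed
  have "F x \<le> phi 1" if "x > 0" for x using F_le[of "1 / x" x] that by simp
  then have "1 \<le> phi 1"
    by (intro tendsto_upperbound[OF lim]) (auto simp: eventually_at_right_field intro!: exI[of _ 1])
  then show False using phi_strict_antimono[of 0 1] by simp
qed

lemma AE_step_law:
  assumes ae: "AE z in step_law. P z" and [measurable]: "Measurable.pred borel P"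
  shows "AE \<omega> in M. \<forall>j. 0 < A j \<omega> \<longrightarrow> P (- ln (A j \<omega>))"
proof -
  have "0 = (\<integral>\<^sup>+z. indicator {z. \<not> P z} z \<partial>step_law)"
    using ae by (subst nn_integral_0_iff_AE[THEN iffD2]) (auto elim!: eventually_mono simp: indicator_def)
  also have "\<dots> = (\<integral>\<^sup>+\<omega>. (\<Sum>j. ennreal (A j \<omega>) * indicator {z. \<not> P z} (- ln (A j \<omega>))) \<partial>M)"
    by (rule nn_integral_step_law) measurable
  finally have "AE \<omega> in M. (\<Sum>j. ennreal (A j \<omega>) * indicator {z. \<not> P z} (- ln (A j \<omega>))) = 0"
    by (subst (asm) eq_commute, subst (asm) nn_integral_0_iff_AE) auto
  then show ?thesis
  proof eventually_elim
    case (elim \<omega>)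
    have zero: "ennreal (A j \<omega>) * indicator {z. \<not> P z} (- ln (A j \<omega>)) = 0" for j
      using member_le_suminf_ennreal[of "\<lambda>j. ennreal (A j \<omega>) * indicator {z. \<not> P z} (- ln (A j \<omega>))" j] elim
      by simp
    show ?case
    proof (intro allI impI)
      fix j assume "0 < A j \<omega>"
      then show "P (- ln (A j \<omega>))" using zero[of j] by (auto simp: ennreal_eq_0_iff indicator_def split: if_splits)
    qed
  qed
qed

text \<open>
  On the event that \<open>h (x * A j) = h x\<close> for all \<open>j\<close>, the factor
  \<open>h x\<close> can be pulled out of the product, and the equation at \<open>x\<close>
  becomes that of \<open>phi\<close> at \<open>x * h x\<close>.
\<close>

lemma phi_mixture_fixed_point:
  assumes G: "admissible G" and G_eq: "\<And>x. 0 \<le> x \<Longrightarrow> G x = phi (x * h x)"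
    and h: "\<And>x. 0 < x \<Longrightarrow> 0 \<le> h x"
    and x: "0 < x" and period: "AE \<omega> in M. \<forall>j. 0 < A j \<omega> \<longrightarrow> h (x * A j \<omega>) = h x"
  shows "S G x = G x"
proof -
  note [measurable] = admissibleD(1)[OF G] admissibleD(1)[OF admissible_phi]
  have "S G x = (\<integral>\<omega>. infprod (\<lambda>j. phi (x * h x * A j \<omega>)) \<partial>M)"
    unfolding S_def
  proof (rule integral_cong_AE)
    show "AE \<omega> in M. infprod (\<lambda>j. G (x * A j \<omega>)) = infprod (\<lambda>j. phi (x * h x * A j \<omega>))"
      using period
    proof eventually_elim
      case (elim \<omega>)
      have "G (x * A j \<omega>) = phi (x * h x * A j \<omega>)" for j
      proof (cases "A j \<omega> = 0")
        case False
        then have "0 < A j \<omega>" using A_nonneg[of j \<omega>] by simp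
        then show ?thesis using elim x by (simp add: G_eq mult_ac)
      qed (simp add: G_eq)
      then show ?case by simp
    qed
  qed measurable
  also have "\<dots> = S phi (x * h x)" by (simp add: S_def)
  also have "\<dots> = G x" using x h[OF x] by (simp add: phi_fixed_point G_eq)
  finally show ?thesis .
qed

text \<open>
  The slope of \<open>F\<close> is bounded and does not decrease in mean along the walk, so its
  means converge to a harmonic function \<open>k\<close>; by \<open>choquet_deny\<close>,
  \<open>h x = k (- ln x)\<close> is invariant under almost every step. The slope of the fixed
  point \<open>G x = phi (x * h x)\<close> is at most \<open>k\<close>, and far to the right
  almost \<open>k\<close>, because \<open>phi\<close> has slope \<open>1\<close> at
  \<open>0\<close>. Hence the differences of \<open>F\<close> and \<open>G\<close> in both
  directions vanish in mean along the walk, and they cannot have been positive at the start.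
\<close>

theorem fixed_point_representation:
  assumes F: "admissible F" and fixed: "\<And>x. 0 < x \<Longrightarrow> S F x = F x"
    and F0: "F 0 = 1" and anti: "\<And>x x'. 0 < x \<Longrightarrow> x \<le> x' \<Longrightarrow> F x' \<le> F x"
    and lim: "(F \<longlongrightarrow> 1) (at_right 0)"
  shows "\<exists>h C. (\<forall>x>0. 0 \<le> h x \<and> h x \<le> C) \<and> (\<forall>x>0. F x = phi (x * h x)) \<and>
    (\<forall>x>0. AE \<omega> in M. \<forall>j. 0 < A j \<omega> \<longrightarrow> h (x * A j \<omega>) = h x)"
proof -
  obtain C0 where C0: "\<And>y. exp y * (1 - F (exp (- y))) \<le> C0"
    using fixed_point_slope_bounded[OF assms] by blast
  define C where "C = max 1 C0"
  have C: "0 < C" "\<And>y. exp y * (1 - F (exp (- y))) \<le> C"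
    using C0 by (auto simp: C_def le_max_iff_disj)
  define D where "D = gap (\<lambda>_. 1) F"
  have D_eq: "D y = ennreal (exp y * (1 - F (exp (- y))))" for y by (simp add: D_def gap_def)
  have [measurable]: "D \<in> borel_measurable borel" unfolding D_def by (rule gap_measurable[OF admissible_one F])
  have D_sub: "D y \<le> (\<integral>\<^sup>+z. D (y + z) \<partial>step_law)" for y
    unfolding D_def using F F0 fixed S_one by (intro gap_submartingale admissible_one) auto
  have D_iter_mono: "walk.iter D n y \<le> walk.iter D (Suc n) y" for n y
    unfolding walk.iter_Suc_right by (intro walk.iter_mono D_sub)
  have D_iter_le: "walk.iter D n y \<le> ennreal C" for n y
    using walk.iter_mono[of D "\<lambda>_. ennreal C" n y] C(2) by (simp add: D_eq ennreal_leI)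
  define H where "H y = (SUP n. walk.iter D n y)" for y
  have [measurable]: "H \<in> borel_measurable borel" unfolding H_def by measurable
  have H_le: "H y \<le> ennreal C" for y unfolding H_def by (intro SUP_least D_iter_le)
  have D_le_H: "D y \<le> H y" for y unfolding H_def by (rule SUP_upper2[of 0]) auto
  have iter_tendsto: "(\<lambda>n. walk.iter D n y) \<longlonglongrightarrow> H y" for y
    unfolding H_def by (intro LIMSEQ_SUP incseq_SucI D_iter_mono)
  have H_harmonic: "(\<integral>\<^sup>+z. H (y + z) \<partial>step_law) = H y" for y
  proof (rule LIMSEQ_unique)
    have "(\<lambda>n. \<integral>\<^sup>+z. walk.iter D n (y + z) \<partial>step_law) \<longlonglongrightarrow> (\<integral>\<^sup>+z. H (y + z) \<partial>step_law)"
      by (rule nn_integral_dominated_convergence[where w="\<lambda>_. ennreal C"]) (auto intro: D_iter_le iter_tendsto)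
    then show "(\<lambda>n. walk.iter D (Suc n) y) \<longlonglongrightarrow> (\<integral>\<^sup>+z. H (y + z) \<partial>step_law)" by simp
    show "(\<lambda>n. walk.iter D (Suc n) y) \<longlonglongrightarrow> H y" by (rule LIMSEQ_Suc[OF iter_tendsto])
  qed
  define k where "k y = enn2real (H y)" for y
  have [measurable]: "k \<in> borel_measurable borel" unfolding k_def by measurable
  have H_k: "H y = ennreal (k y)" for y
    using H_le[of y] unfolding k_def by (simp add: le_less_trans[of _ "ennreal C"])
  have k: "0 \<le> k y" "k y \<le> C" for y
    using H_le[of y] C(1) unfolding H_k by (auto simp: k_def ennreal_le_iff)
  have F_slope_le: "exp v * (1 - F (exp (- v))) \<le> k v" for v
    using D_le_H[of v] k[of v] by (simp add: D_eq H_k ennreal_le_iff)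
  have k_harmonic: "(\<integral>z. k (y + z) \<partial>step_law) = k y" for y
  proof -
    have "(\<integral>z. k (y + z) \<partial>step_law) = enn2real (\<integral>\<^sup>+z. H (y + z) \<partial>step_law)"
      unfolding H_k by (rule integral_eq_nn_integral) (auto simp: k)
    then show ?thesis unfolding H_harmonic k_def .
  qed
  have k_period: "AE z in step_law. k (y + z) = k y" for y
    using k by (intro walk.choquet_deny[where C=C] k_harmonic) auto
  define h where "h x = k (- ln x)" for x
  have [measurable]: "h \<in> borel_measurable borel" unfolding h_def by measurable
  have h_period: "AE \<omega> in M. \<forall>j. 0 < A j \<omega> \<longrightarrow> h (x * A j \<omega>) = h x" if x: "0 < x" for x
  proof -
    have "AE \<omega> in M. \<forall>j. 0 < A j \<omega> \<longrightarrow> k (- ln x + - ln (A j \<omega>)) = k (- ln x)"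
      by (rule AE_step_law[OF k_period]) measurable
    then show ?thesis
    proof eventually_elim
      case (elim \<omega>)
      show ?case
      proof (intro allI impI)
        fix j assume "0 < A j \<omega>"
        then show "h (x * A j \<omega>) = h x" using elim[rule_format, of j] x by (simp add: h_def ln_mult)
      qed
    qed
  qed
  define G where "G x = phi (max 0 x * h x)" for x
  have G: "admissible G"
    unfolding admissible_def G_def using admissibleD[OF admissible_phi] by auto
  have G_fixed: "S G x = G x" if "0 < x" for x
    using that by (intro phi_mixture_fixed_point[OF G, of h] h_period) (auto simp: G_def h_def k)
  have G0: "G 0 = 1" by (simp add: G_def)
  have G_exp: "G (exp (- y)) = phi (exp (- y) * k y)" for y by (simp add: G_def h_def)
  have G_slope_le: "exp y * (1 - G (exp (- y))) \<le> k y" for y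
  proof -
    have "exp y * (1 - G (exp (- y))) \<le> exp y * (exp (- y) * k y)"
      unfolding G_exp using k by (intro mult_left_mono one_minus_phi_le) auto
    also have "\<dots> = k y" by (simp add: exp_minus)
    finally show ?thesis .
  qed
  have G_slope_ge: "k y * slope (y - ln C) \<le> exp y * (1 - G (exp (- y)))" for y
  proof (cases "k y = 0")
    case True then show ?thesis using admissibleD(3)[OF G] by simp
  next
    case False
    then have pos: "0 < k y" using k[of y] by simp
    have "slope (y - ln C) \<le> slope (y - ln (k y))" using k[of y] pos by (intro slope_mono) simp
    also have "\<dots> = exp y / k y * (1 - phi (exp (- y) * k y))"
      using pos by (simp add: slope_def exp_diff exp_minus field_simps)
    finally show ?thesis using pos unfolding G_exp by (simp add: field_simps)
  qed
  have "F x = G x" if x: "0 < x" for x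
  proof -
    define y where "y = - ln x"
    have xy: "x = exp (- y)" using x by (simp add: y_def)
    \<comment> \<open>\<open>F - G\<close> is at most the distance from the slope of \<open>F\<close> to its harmonic majorant, whose means tend to \<open>0\<close>\<close>
    have 1: "gap F G y = 0"
    proof -
      have FG: "gap F G v \<le> ennreal (k v - exp v * (1 - F (exp (- v))))" for v
        unfolding gap_def using G_slope_le[of v] by (intro ennreal_leI) (simp add: algebra_simps)
      have sum: "walk.iter (\<lambda>v. ennreal (k v - exp v * (1 - F (exp (- v))))) n y + walk.iter D n y = H y" for n
      proof -
        note [measurable] = admissibleD(1)[OF F]
        have "ennreal (k v - exp v * (1 - F (exp (- v)))) + D v = H v" for v
          using admissibleD(3)[OF F] F_slope_le[of v] by (simp add: D_eq H_k ennreal_plus[symmetric] del: ennreal_plus)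
        then have "walk.iter (\<lambda>v. ennreal (k v - exp v * (1 - F (exp (- v))))) n y + walk.iter D n y = walk.iter H n y"
          by (subst walk.iter_add[symmetric]) simp_all
        also have "walk.iter H n y = H y" by (induction n arbitrary: y) (simp_all add: H_harmonic)
        finally show ?thesis .
      qed
      have "gap F G y + walk.iter D n y \<le> H y" for n
      proof -
        have "gap F G y \<le> walk.iter (gap F G) n y"
          using F G F0 G0 fixed G_fixed by (intro walk.submartingale_le_iter gap_submartingale) auto
        also have "\<dots> \<le> walk.iter (\<lambda>v. ennreal (k v - exp v * (1 - F (exp (- v))))) n y"
          by (intro walk.iter_mono FG)
        finally show ?thesis unfolding sum[symmetric, of n] by (rule add_right_mono)
      qed
      moreover have "(\<lambda>n. gap F G y + walk.iter D n y) \<longlonglongrightarrow> gap F G y + H y"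
        by (intro tendsto_add tendsto_const iter_tendsto)
      ultimately have "gap F G y + H y \<le> 0 + H y" by (intro LIMSEQ_le_const2) auto
      then show ?thesis
        unfolding H_k add.commute[of _ "ennreal (k y)"] ennreal_add_left_cancel_le by simp
    qed
    have 2: "gap G F y = 0"
    proof -
      have small: "gap G F y \<le> ennreal \<epsilon>" if \<epsilon>: "0 < \<epsilon>" for \<epsilon>
      proof -
        obtain y0 where y0: "\<And>v. y0 \<le> v \<Longrightarrow> 1 - \<epsilon> / C \<le> slope v"
          using slope_tendsto_1[of "\<epsilon> / C"] \<epsilon> C(1) by auto
        define y1 where "y1 = y0 + ln C"
        have GF: "gap G F v \<le> ennreal \<epsilon> + ennreal C * indicator {..<y1} v" for v
        proof (cases "v < y1")
          case True
          have "exp v * (G (exp (- v)) - F (exp (- v))) \<le> exp v * (1 - F (exp (- v)))"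
            using admissibleD(3)[OF G] by (intro mult_left_mono) auto
          then have "gap G F v \<le> ennreal C"
            unfolding gap_def by (intro ennreal_leI order_trans[OF _ C(2)[of v]])
          then show ?thesis using True by (simp add: add_increasing)
        next
          case False
          have "exp v * (1 - F (exp (- v))) \<le> k v" by (rule F_slope_le)
          moreover have "k v * (1 - \<epsilon> / C) \<le> exp v * (1 - G (exp (- v)))"
            using False k[of v] y0[of "v - ln C"]
            by (intro order_trans[OF mult_left_mono G_slope_ge]) (auto simp: y1_def)
          moreover have "k v * (\<epsilon> / C) \<le> \<epsilon>"
            using k[of v] C(1) \<epsilon> by (simp add: divide_simps mult.commute)
          ultimately have "exp v * (G (exp (- v)) - F (exp (- v))) \<le> \<epsilon>"
            by (simp add: algebra_simps)
          then show ?thesis using False by (simp add: gap_def ennreal_leI)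
        qed
        have "gap G F y \<le> ennreal \<epsilon> + ennreal C * walk.iter (indicator {..<y1}) n y" for n
        proof -
          have "gap G F y \<le> walk.iter (gap G F) n y"
            using F G F0 G0 fixed G_fixed by (intro walk.submartingale_le_iter gap_submartingale) auto
          also have "\<dots> \<le> walk.iter (\<lambda>v. ennreal \<epsilon> + ennreal C * indicator {..<y1} v) n y"
            by (intro walk.iter_mono GF)
          also have "\<dots> = ennreal \<epsilon> + ennreal C * walk.iter (indicator {..<y1}) n y"
            by (simp add: walk.iter_add walk.iter_cmult)
          finally show ?thesis .
        qed
        moreover have "(\<lambda>n. ennreal \<epsilon> + ennreal C * walk.iter (indicator {..<y1}) n y) \<longlonglongrightarrow> ennreal \<epsilon> + ennreal C * 0"
          by (intro tendsto_add tendsto_const ennreal_tendsto_cmult walk.iter_below_tendsto_0) simp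
        ultimately show ?thesis by (intro LIMSEQ_le_const) auto
      qed
      have "gap G F y \<le> 0 + ennreal \<epsilon>" if "0 < \<epsilon>" for \<epsilon> using small[OF that] by simp
      then have "gap G F y \<le> 0" by (rule ennreal_le_epsilon)
      then show ?thesis by simp
    qed
    show "F x = G x"
      using 1 2 unfolding gap_def xy by (simp add: ennreal_eq_0_iff mult_le_0_iff)
  qed
  then have "\<forall>x>0. F x = phi (x * h x)" by (simp add: G_def)
  then show ?thesis using k h_period by (intro exI[of _ h] exI[of _ C]) (auto simp: h_def)
qed

end

section \<open>Completely monotone and Bernstein functions\<close>

text \<open>
  Complete monotonicity up to order \<open>n\<close>, with the derivatives given as witnesses
  instead of iterating \<open>deriv\<close>. Closure properties become inductions on the order,
  and by \<open>completely_monotone_iff_order\<close> nothing is lost.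
\<close>

fun monotone_order :: "nat \<Rightarrow> (real \<Rightarrow> real) \<Rightarrow> bool" where
  "monotone_order 0 f \<longleftrightarrow> (\<forall>t>0. 0 \<le> f t)"
| "monotone_order (Suc n) f \<longleftrightarrow> (\<forall>t>0. 0 \<le> f t) \<and>
    (\<exists>g. (\<forall>t>0. (f has_real_derivative - g t) (at t)) \<and> monotone_order n g)"

lemma deriv_cong_pos:
  assumes "\<And>t. t > 0 \<Longrightarrow> f t = g t" "t > 0"
  shows "deriv f t = deriv g (t :: real)"
proof -
  have "eventually (\<lambda>t. t \<in> {0<..}) (nhds t)" using assms(2) by (intro eventually_nhds_in_open) auto
  then have "eventually (\<lambda>t. f t = g t) (nhds t)" by eventually_elim (use assms in auto)
  then show ?thesis by (intro deriv_cong_ev) auto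
qed

lemma has_real_derivative_cong_pos:
  assumes "\<And>t. t > 0 \<Longrightarrow> f t = g t" "t > 0"
  shows "(f has_real_derivative d) (at t) \<longleftrightarrow> (g has_real_derivative d) (at (t :: real))"
proof -
  have "eventually (\<lambda>t. t \<in> {0<..}) (nhds t)" using assms(2) by (intro eventually_nhds_in_open) auto
  then have "eventually (\<lambda>t. f t = g t) (nhds t)" by eventually_elim (use assms in auto)
  then show ?thesis by (intro DERIV_cong_ev) auto
qed

lemma monotone_order_cong:
  assumes "\<And>t. t > 0 \<Longrightarrow> f t = g t"
  shows "monotone_order n f \<longleftrightarrow> monotone_order n g"
  using assms by (cases n) (auto simp: has_real_derivative_cong_pos[of f g])

lemma monotone_order_nonneg: "monotone_order n f \<Longrightarrow> t > 0 \<Longrightarrow> 0 \<le> f t"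
  by (cases n) auto

lemma monotone_order_Suc_imp: "monotone_order (Suc n) f \<Longrightarrow> monotone_order n f"
  by (induction n arbitrary: f) auto

lemma deriv_pow_uminus:
  "(deriv ^^ n) (\<lambda>t. - deriv f t) t = - (deriv ^^ Suc n) f t"
  if "\<forall>n. \<forall>t>0. (deriv ^^ n) f field_differentiable at t" "t > 0" for f :: "real \<Rightarrow> real"
  using that(2)
proof (induction n arbitrary: t)
  case (Suc n)
  have "(deriv ^^ Suc n) (\<lambda>t. - deriv f t) t = deriv (\<lambda>t. - (deriv ^^ Suc n) f t) t"
    using Suc by (auto intro!: deriv_cong_pos)
  also have "\<dots> = - (deriv ^^ Suc (Suc n)) f t"
    using that(1)[rule_format, of t "Suc n"] Suc.prems by (subst deriv_minus) auto
  finally show ?case .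
qed simp

lemma completely_monotone_imp_deriv:
  assumes "completely_monotone f"
  shows "completely_monotone (\<lambda>t. - deriv f t)"
    and "t > 0 \<Longrightarrow> (f has_real_derivative - (- deriv f t)) (at t)"
    and "t > 0 \<Longrightarrow> 0 \<le> f t"
proof -
  have d: "\<forall>n. \<forall>t>0. (deriv ^^ n) f field_differentiable at t"
    using assms by (auto simp: completely_monotone_def)
  note eq = deriv_pow_uminus[OF d]
  show "completely_monotone (\<lambda>t. - deriv f t)"
    unfolding completely_monotone_def
  proof (intro allI impI conjI)
    fix n and t :: real assume t: "t > 0"
    have "(\<lambda>t. - (deriv ^^ Suc n) f t) field_differentiable at t"
      using d t by (intro field_differentiable_minus) blast
    then obtain e where "((\<lambda>t. - (deriv ^^ Suc n) f t) has_real_derivative e) (at t)"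
      by (auto simp: field_differentiable_def)
    then have "((deriv ^^ n) (\<lambda>t. - deriv f t) has_real_derivative e) (at t)"
      by (subst has_real_derivative_cong_pos[of _ "\<lambda>t. - (deriv ^^ Suc n) f t"]) (use t eq in auto)
    then show "(deriv ^^ n) (\<lambda>t. - deriv f t) field_differentiable at t"
      by (auto simp: field_differentiable_def)
    have "0 \<le> (- 1) ^ Suc n * (deriv ^^ Suc n) f t" using assms t by (simp only: completely_monotone_def)
    then show "0 \<le> (- 1) ^ n * (deriv ^^ n) (\<lambda>t. - deriv f t) t" unfolding eq[OF t] by simp
  qed
  show "t > 0 \<Longrightarrow> (f has_real_derivative - (- deriv f t)) (at t)"
    using d[rule_format, of t 0] by (simp add: DERIV_deriv_iff_field_differentiable)
  show "t > 0 \<Longrightarrow> 0 \<le> f t" using assms[unfolded completely_monotone_def, rule_format, of t 0] by simp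
qed

lemma completely_monotone_imp_order: "completely_monotone f \<Longrightarrow> monotone_order n f"
proof (induction n arbitrary: f)
  case (Suc n)
  have "monotone_order n (\<lambda>t. - deriv f t)"
    by (intro Suc.IH completely_monotone_imp_deriv(1) Suc.prems)
  then show ?case using completely_monotone_imp_deriv(2,3)[OF Suc.prems]
    by (auto intro!: exI[of _ "\<lambda>t. - deriv f t"])
qed (auto dest: completely_monotone_imp_deriv(3))

lemma monotone_order_deriv:
  assumes "monotone_order (Suc n) f"
  shows "monotone_order n (\<lambda>t. - deriv f t)" "t > 0 \<Longrightarrow> (f has_real_derivative deriv f t) (at t)"
proof -
  obtain g where g: "\<And>t. t > 0 \<Longrightarrow> (f has_real_derivative - g t) (at t)" "monotone_order n g"
    using assms by auto
  have eq: "- deriv f t = g t" if "t > 0" for t using DERIV_imp_deriv[OF g(1)[OF that]] by simp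
  show "monotone_order n (\<lambda>t. - deriv f t)" using g(2) monotone_order_cong[OF eq] by simp
  show "t > 0 \<Longrightarrow> (f has_real_derivative deriv f t) (at t)"
    using g(1)[of t] DERIV_imp_deriv[OF g(1)[of t]] by simp
qed

lemma monotone_order_imp_pow:
  assumes "monotone_order (Suc n) f"
  shows "\<forall>k\<le>n. \<forall>t>0. (deriv ^^ k) f field_differentiable at t \<and> 0 \<le> (-1) ^ k * (deriv ^^ k) f t"
  using assms
proof (induction n arbitrary: f)
  case 0
  then show ?case using monotone_order_deriv[OF 0] by (auto simp: field_differentiable_def)
next
  case (Suc n)
  let ?g = "\<lambda>t. - deriv f t"
  have IH: "\<forall>k\<le>n. \<forall>t>0. (deriv ^^ k) ?g field_differentiable at t \<and> 0 \<le> (-1) ^ k * (deriv ^^ k) ?g t"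
    by (intro Suc.IH monotone_order_deriv(1)[OF Suc.prems])
  have eq: "(deriv ^^ Suc k) f t = - (deriv ^^ k) ?g t" if "k \<le> n" "t > 0" for k t
    using that
  proof (induction k arbitrary: t)
    case (Suc k)
    have "(deriv ^^ Suc (Suc k)) f t = deriv (\<lambda>t. - (deriv ^^ k) ?g t) t"
      using Suc by (auto intro!: deriv_cong_pos)
    also have "\<dots> = - (deriv ^^ Suc k) ?g t"
      using IH Suc.prems by (subst deriv_minus) auto
    finally show ?case .
  qed simp
  show ?case
  proof (intro allI impI)
    fix k t assume k: "k \<le> Suc n" and t: "(t::real) > 0"
    show "(deriv ^^ k) f field_differentiable at t \<and> 0 \<le> (-1) ^ k * (deriv ^^ k) f t"
    proof (cases k)
      case 0
      then show ?thesis
        using monotone_order_deriv(2)[OF Suc.prems t] monotone_order_nonneg[OF Suc.prems t]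
        by (auto simp: field_differentiable_def)
    next
      case (Suc j)
      then have j: "j \<le> n" using k by simp
      obtain e where "((deriv ^^ j) ?g has_real_derivative e) (at t)"
        using IH j t by (auto simp: field_differentiable_def)
      then have "((\<lambda>t. - (deriv ^^ j) ?g t) has_real_derivative - e) (at t)" by (rule DERIV_minus)
      then have "((deriv ^^ k) f has_real_derivative - e) (at t)"
        unfolding Suc by (subst has_real_derivative_cong_pos[of _ "\<lambda>t. - (deriv ^^ j) ?g t"]) (use eq[OF j] t in auto)
      then show ?thesis
        using IH j t eq[OF j t] unfolding Suc by (auto simp: field_differentiable_def simp del: funpow.simps)
    qed
  qed
qed

lemma completely_monotone_iff_order: "completely_monotone f \<longleftrightarrow> (\<forall>n. monotone_order n f)"
proof
  assume "\<forall>n. monotone_order n f"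
  then show "completely_monotone f"
    unfolding completely_monotone_def using monotone_order_imp_pow[of _ f] by blast
qed (simp add: completely_monotone_imp_order)

lemma completely_monotone_cong:
  "(\<And>t. t > 0 \<Longrightarrow> f t = g t) \<Longrightarrow> completely_monotone f \<longleftrightarrow> completely_monotone g"
  by (simp add: completely_monotone_iff_order monotone_order_cong[of f g])

lemma monotone_order_add:
  "monotone_order n f \<Longrightarrow> monotone_order n g \<Longrightarrow> monotone_order n (\<lambda>t. f t + g t)"
proof (induction n arbitrary: f g)
  case (Suc n)
  from Suc.prems obtain f' g' where
    "\<And>t. t > 0 \<Longrightarrow> (f has_real_derivative - f' t) (at t)" "monotone_order n f'"
    "\<And>t. t > 0 \<Longrightarrow> (g has_real_derivative - g' t) (at t)" "monotone_order n g'" by auto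
  moreover from this have "((\<lambda>t. f t + g t) has_real_derivative - (f' t + g' t)) (at t)" if "t > 0" for t
    using that by (auto intro!: derivative_eq_intros)
  ultimately show ?case using Suc
    by (auto intro!: exI[of _ "\<lambda>t. f' t + g' t"] dest: monotone_order_nonneg)
qed auto

lemma monotone_order_mult:
  "monotone_order n f \<Longrightarrow> monotone_order n g \<Longrightarrow> monotone_order n (\<lambda>t. f t * g t)"
proof (induction n arbitrary: f g)
  case (Suc n)
  from Suc.prems obtain f' g' where *:
    "\<And>t. t > 0 \<Longrightarrow> (f has_real_derivative - f' t) (at t)" "monotone_order n f'"
    "\<And>t. t > 0 \<Longrightarrow> (g has_real_derivative - g' t) (at t)" "monotone_order n g'" by auto
  then have "((\<lambda>t. f t * g t) has_real_derivative - (f' t * g t + f t * g' t)) (at t)" if "t > 0" for t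
    using that by (auto intro!: derivative_eq_intros)
  moreover have "monotone_order n (\<lambda>t. f' t * g t + f t * g' t)"
    using * Suc.prems by (intro monotone_order_add Suc.IH monotone_order_Suc_imp[of n g] monotone_order_Suc_imp[of n f])
  ultimately show ?case using monotone_order_nonneg[OF Suc.prems(1)] monotone_order_nonneg[OF Suc.prems(2)]
    by (auto intro!: exI[of _ "\<lambda>t. f' t * g t + f t * g' t"])
qed auto

lemma completely_monotone_const: "0 \<le> c \<Longrightarrow> completely_monotone (\<lambda>_. c)"
proof -
  have "monotone_order n (\<lambda>_. c)" if "0 \<le> c" for n c
    using that by (induction n arbitrary: c) (auto intro!: exI[of _ "\<lambda>_. 0"])
  then show "0 \<le> c \<Longrightarrow> completely_monotone (\<lambda>_. c)" by (simp add: completely_monotone_iff_order)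
qed

lemma completely_monotone_add:
  "completely_monotone f \<Longrightarrow> completely_monotone g \<Longrightarrow> completely_monotone (\<lambda>t. f t + g t)"
  by (simp add: completely_monotone_iff_order monotone_order_add)

lemma completely_monotone_mult:
  "completely_monotone f \<Longrightarrow> completely_monotone g \<Longrightarrow> completely_monotone (\<lambda>t. f t * g t)"
  by (simp add: completely_monotone_iff_order monotone_order_mult)

lemma completely_monotone_sum:
  "(\<And>i. i \<in> I \<Longrightarrow> completely_monotone (f i)) \<Longrightarrow> completely_monotone (\<lambda>t. \<Sum>i\<in>I. f i t)"
  by (induction I rule: infinite_finite_induct) (auto intro: completely_monotone_add completely_monotone_const)

lemma completely_monotone_scale:
  assumes "completely_monotone f" "0 < a"
  shows "completely_monotone (\<lambda>t. f (a * t))"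
proof -
  have "monotone_order n f \<Longrightarrow> monotone_order n (\<lambda>t. f (a * t))" for n f
  proof (induction n arbitrary: f)
    case (Suc n)
    then obtain g where g: "\<And>t. t > 0 \<Longrightarrow> (f has_real_derivative - g t) (at t)" "monotone_order n g" by auto
    have "((\<lambda>t. f (a * t)) has_real_derivative - (a * g (a * t))) (at t)" if "t > 0" for t
    proof -
      have "((\<lambda>t. f (a * t)) has_real_derivative - g (a * t) * a) (at t)"
        by (rule DERIV_chain2[where f=f and g="\<lambda>t. a * t", OF g(1)])
           (use that assms(2) in \<open>auto intro!: DERIV_cmult_Id\<close>)
      then show ?thesis by (simp add: mult.commute)
    qed
    moreover have "monotone_order n (\<lambda>t. a * g (a * t))"
      by (rule monotone_order_mult[OF completely_monotone_imp_order[OF completely_monotone_const] Suc.IH[OF g(2)]])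
         (use assms(2) in simp)
    ultimately show ?case using Suc.prems assms(2) by (auto intro!: exI[of _ "\<lambda>t. a * g (a * t)"])
  qed (use assms in auto)
  then show ?thesis using assms by (simp add: completely_monotone_iff_order)
qed

text \<open>
  The derivative is minus the product of \<open>w * g\<close> with the function itself, so order
  \<open>n\<close> gives order \<open>n + 1\<close>.
\<close>

lemma completely_monotone_exp_Bernstein:
  assumes g: "completely_monotone g" and w: "0 \<le> w"
    and \<psi>: "\<And>t. t > 0 \<Longrightarrow> (\<psi> has_real_derivative g t) (at t)"
  shows "completely_monotone (\<lambda>t. exp (- (w * \<psi> t)))"
proof -
  have "monotone_order n (\<lambda>t. exp (- (w * \<psi> t)))" for n
  proof (induction n)
    case (Suc n)
    have "((\<lambda>t. exp (- (w * \<psi> t))) has_real_derivative - ((w * g t) * exp (- (w * \<psi> t)))) (at t)" if "t > 0" for t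
      using \<psi>[OF that] by (auto intro!: derivative_eq_intros)
    moreover have "monotone_order n (\<lambda>t. (w * g t) * exp (- (w * \<psi> t)))"
    proof (rule monotone_order_mult[OF _ Suc])
      show "monotone_order n (\<lambda>t. w * g t)"
        by (intro completely_monotone_imp_order completely_monotone_mult completely_monotone_const w g)
    qed
    ultimately show ?case by (auto intro!: exI[of _ "\<lambda>t. (w * g t) * exp (- (w * \<psi> t))"])
  qed auto
  then show ?thesis by (simp add: completely_monotone_iff_order)
qed

lemma completely_monotone_powr:
  assumes "\<beta> \<le> 0" "0 \<le> c"
  shows "completely_monotone (\<lambda>t. c * t powr \<beta>)"
proof -
  have "monotone_order n (\<lambda>t. c * t powr \<beta>)" for n
    using assms
  proof (induction n arbitrary: c \<beta>)
    case (Suc n)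
    have "((\<lambda>t. c * t powr \<beta>) has_real_derivative - ((- \<beta> * c) * t powr (\<beta> - 1))) (at t)" if "t > 0" for t
      using that by (auto intro!: derivative_eq_intros)
    moreover have "monotone_order n (\<lambda>t. (- \<beta> * c) * t powr (\<beta> - 1))"
      using Suc.prems by (intro Suc.IH) (auto simp: mult_nonpos_nonneg)
    ultimately show ?case using Suc.prems by (auto intro!: exI[of _ "\<lambda>t. (- \<beta> * c) * t powr (\<beta> - 1)"])
  qed auto
  then show ?thesis by (simp add: completely_monotone_iff_order)
qed

lemma completely_monotone_antimono:
  assumes "completely_monotone f" "0 < s" "s \<le> t"
  shows "f t \<le> f s"
proof (rule DERIV_nonpos_imp_nonincreasing[OF assms(3)])
  fix x assume "s \<le> x" "x \<le> t"
  then have "x > 0" using assms by simp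
  then show "\<exists>y. (f has_real_derivative y) (at x) \<and> y \<le> 0"
    using completely_monotone_imp_deriv(2)[OF assms(1), of x]
      completely_monotone_imp_deriv(3)[OF completely_monotone_imp_deriv(1)[OF assms(1)], of x] by auto
qed

lemma Bernstein_derivative_bound:
  assumes g: "completely_monotone g" and t: "t > 0"
    and f: "\<And>t. t > 0 \<Longrightarrow> (f has_real_derivative g t) (at t)" "\<And>t. t > 0 \<Longrightarrow> 0 \<le> f t"
  shows "g t \<le> (2 / t) * f t"
proof -
  obtain z where z: "t / 2 < z" "z < t" "f t - f (t / 2) = (t - t / 2) * g z"
    using MVT2[of "t/2" t f g] t f(1) by auto
  have "(t / 2) * g t \<le> (t / 2) * g z"
    using z t by (intro mult_left_mono completely_monotone_antimono[OF g]) auto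
  also have "\<dots> = f t - f (t / 2)" using z by simp
  also have "\<dots> \<le> f t" using f(2)[of "t/2"] t by simp
  finally show ?thesis using t by (simp add: field_simps)
qed

text \<open>
  The mean value theorem on \<open>[t / 2, t]\<close>, where \<open>- deriv f\<close> is
  smallest at the right end.
\<close>

lemma completely_monotone_derivative_bound:
  assumes f: "completely_monotone f" and t: "t > 0"
  shows "- deriv f t \<le> (2 / t) * f (t / 2)"
proof -
  let ?g = "\<lambda>t. - deriv f t"
  note d = completely_monotone_imp_deriv[OF f]
  obtain z where z: "t / 2 < z" "z < t" "f t - f (t / 2) = (t - t / 2) * deriv f z"
    using MVT2[of "t/2" t f "deriv f"] t d(2) by auto
  have "(t / 2) * ?g t \<le> (t / 2) * ?g z"
    using z t by (intro mult_left_mono completely_monotone_antimono[OF d(1)]) auto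
  also have "\<dots> = f (t / 2) - f t" using z by (simp add: algebra_simps)
  also have "\<dots> \<le> f (t / 2)" using d(3)[of t] t by simp
  finally show ?thesis using t by (simp add: field_simps)
qed

text \<open>
  Bounds on the second derivatives \<open>z n\<close> make the difference quotients of \<open>u
  n\<close> close to \<open>v n\<close>, uniformly in \<open>n\<close>. So convergence of the
  functions forces convergence of the derivatives, and limit and derivative can be exchanged.
\<close>

lemma derivative_of_limit:
  fixes u v z :: "nat \<Rightarrow> real \<Rightarrow> real"
  assumes conv: "\<And>t. t > 0 \<Longrightarrow> (\<lambda>n. u n t) \<longlonglongrightarrow> l t"
    and uv: "\<And>n t. t > 0 \<Longrightarrow> (u n has_real_derivative v n t) (at t)"
    and vz: "\<And>n t. t > 0 \<Longrightarrow> (v n has_real_derivative z n t) (at t)"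
    and bound: "\<And>a. a > 0 \<Longrightarrow> \<exists>B. \<forall>n. \<forall>t\<ge>a. \<bar>z n t\<bar> \<le> B"
  shows "\<exists>l'. \<forall>t>0. (\<lambda>n. v n t) \<longlonglongrightarrow> l' t \<and> (l has_real_derivative l' t) (at t)"
proof -
  have taylor: "\<exists>B\<ge>0. \<forall>n e. 0 < \<bar>e\<bar> \<and> \<bar>e\<bar> \<le> t / 2 \<longrightarrow> \<bar>(u n (t + e) - u n t) / e - v n t\<bar> \<le> B * \<bar>e\<bar>"
    if t: "t > 0" for t
  proof -
    obtain B where B: "\<And>n s. s \<ge> t / 2 \<Longrightarrow> \<bar>z n s\<bar> \<le> B" using bound[of "t/2"] t by auto
    have "\<bar>(u n (t + e) - u n t) / e - v n t\<bar> \<le> B * \<bar>e\<bar>" if e: "0 < \<bar>e\<bar>" "\<bar>e\<bar> \<le> t / 2" for n e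
    proof -
      have mvt: "\<exists>\<xi>. \<bar>\<xi> - t\<bar> \<le> \<bar>e\<bar> \<and> u n (t + e) - u n t = e * v n \<xi>"
      proof (cases "e > 0")
        case True
        obtain \<xi> where "t < \<xi>" "\<xi> < t + e" "u n (t + e) - u n t = (t + e - t) * v n \<xi>"
          using MVT2[of t "t + e" "u n" "v n"] True t uv by auto
        then show ?thesis by (intro exI[of _ \<xi>]) auto
      next
        case False
        then have e': "e < 0" using e by auto
        obtain \<xi> where "t + e < \<xi>" "\<xi> < t" "u n t - u n (t + e) = (t - (t + e)) * v n \<xi>"
          using MVT2[of "t + e" t "u n" "v n"] e' e t uv by auto
        then show ?thesis by (intro exI[of _ \<xi>]) (auto simp: algebra_simps)
      qed
      then obtain \<xi> where \<xi>: "\<bar>\<xi> - t\<bar> \<le> \<bar>e\<bar>" "u n (t + e) - u n t = e * v n \<xi>" by blast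
      have "\<bar>v n \<xi> - v n t\<bar> \<le> B * \<bar>\<xi> - t\<bar>"
      proof -
        have "norm (v n \<xi> - v n t) \<le> B * norm (\<xi> - t)"
        proof (rule field_differentiable_bound[where S="{t/2..}" and f'="z n"])
          fix s assume "s \<in> {t/2..}"
          then show "(v n has_field_derivative z n s) (at s within {t/2..})" "norm (z n s) \<le> B"
            using t B vz[of s n] by (auto intro: has_field_derivative_at_within)
        qed (use \<xi> e t in auto)
        then show ?thesis by simp
      qed
      also have "\<dots> \<le> B * \<bar>e\<bar>" using \<xi>(1) B[of t n] t by (intro mult_left_mono) auto
      finally show ?thesis using \<xi>(2) e by simp
    qed
    moreover have "0 \<le> B" using B[of t 0] t by simp
    ultimately show ?thesis by blast
  qed
  have conv_v: "convergent (\<lambda>n. v n t)" if t: "t > 0" for t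
  proof -
    obtain B where B: "B \<ge> 0" "\<And>n e. 0 < \<bar>e\<bar> \<Longrightarrow> \<bar>e\<bar> \<le> t / 2 \<Longrightarrow> \<bar>(u n (t + e) - u n t) / e - v n t\<bar> \<le> B * \<bar>e\<bar>"
      using taylor[OF t] by blast
    have "Cauchy (\<lambda>n. v n t)"
    proof (rule metric_CauchyI)
      fix \<epsilon> :: real assume \<epsilon>: "\<epsilon> > 0"
      \<comment> \<open>a step so small that the difference quotients approximate \<open>v n t\<close> within \<open>\<epsilon> / 4\<close>\<close>
      define e where "e = min (t / 2) (\<epsilon> / (4 * (B + 1)))"
      have e: "0 < e" "e \<le> t / 2" "B * e \<le> \<epsilon> / 4"
      proof -
        show "0 < e" using t \<epsilon> B(1) by (auto simp: e_def)
        show "e \<le> t / 2" unfolding e_def by (rule min.cobounded1)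
        have "B * e \<le> (B + 1) * (\<epsilon> / (4 * (B + 1)))"
          using B(1) \<epsilon> t by (intro mult_mono) (auto simp: e_def)
        also have "\<dots> = \<epsilon> / 4"
        proof -
          have "B + 1 \<noteq> 0" using B(1) by linarith
          then show ?thesis by (simp add: divide_simps)
        qed
        finally show "B * e \<le> \<epsilon> / 4" .
      qed
      have "(\<lambda>n. (u n (t + e) - u n t) / e) \<longlonglongrightarrow> (l (t + e) - l t) / e"
        using t e by (intro tendsto_intros conv) auto
      then have "Cauchy (\<lambda>n. (u n (t + e) - u n t) / e)" by (intro convergent_Cauchy) (auto simp: convergent_def)
      then obtain N where N: "\<And>m n. m \<ge> N \<Longrightarrow> n \<ge> N \<Longrightarrow>
          \<bar>(u m (t + e) - u m t) / e - (u n (t + e) - u n t) / e\<bar> < \<epsilon> / 2"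
        using half_gt_zero[OF \<epsilon>] unfolding Cauchy_def dist_real_def by blast
      have q: "\<bar>(u n (t + e) - u n t) / e - v n t\<bar> \<le> \<epsilon> / 4" for n
        using B(2)[of e n] e by simp
      have "dist (v m t) (v n t) < \<epsilon>" if "m \<ge> N" "n \<ge> N" for m n
        using N[OF that] q[of m] q[of n] unfolding dist_real_def by linarith
      then show "\<exists>M. \<forall>m\<ge>M. \<forall>n\<ge>M. dist (v m t) (v n t) < \<epsilon>" by blast
    qed
    then show ?thesis by (rule Cauchy_convergent)
  qed
  define l' where "l' t = lim (\<lambda>n. v n t)" for t
  have l': "(\<lambda>n. v n t) \<longlonglongrightarrow> l' t" if "t > 0" for t
    unfolding l'_def using conv_v[OF that] by (simp add: convergent_LIMSEQ_iff)
  have "(l has_real_derivative l' t) (at t)" if t: "t > 0" for t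
  proof -
    obtain B where B: "B \<ge> 0" "\<And>n e. 0 < \<bar>e\<bar> \<Longrightarrow> \<bar>e\<bar> \<le> t / 2 \<Longrightarrow> \<bar>(u n (t + e) - u n t) / e - v n t\<bar> \<le> B * \<bar>e\<bar>"
      using taylor[OF t] by blast
    have le: "\<bar>(l (t + e) - l t) / e - l' t\<bar> \<le> B * \<bar>e\<bar>" if e: "0 < \<bar>e\<bar>" "\<bar>e\<bar> \<le> t / 2" for e
    proof (rule LIMSEQ_le_const2)
      show "(\<lambda>n. \<bar>(u n (t + e) - u n t) / e - v n t\<bar>) \<longlonglongrightarrow> \<bar>(l (t + e) - l t) / e - l' t\<bar>"
        using t e by (intro tendsto_intros conv l') auto
    qed (use B(2)[OF e] in blast)
    show ?thesis
      unfolding DERIV_def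
    proof (rule LIM_I)
      fix \<epsilon> :: real assume \<epsilon>: "\<epsilon> > 0"
      define d where "d = min (t / 2) (\<epsilon> / (B + 1))"
      have d: "0 < d" using t \<epsilon> B(1) by (simp add: d_def)
      have "norm ((l (t + e) - l t) / e - l' t) < \<epsilon>" if e: "e \<noteq> 0" "norm (e - 0) < d" for e
      proof -
        have "B * \<bar>e\<bar> \<le> (B + 1) * \<bar>e\<bar>" by (intro mult_right_mono) auto
        also have "\<dots> < \<epsilon>" using e B(1) by (simp add: d_def field_simps)
        finally show ?thesis using le[of e] e by (simp add: d_def)
      qed
      then show "\<exists>s>0. \<forall>e. e \<noteq> 0 \<and> norm (e - 0) < s \<longrightarrow> norm ((l (t + e) - l t) / e - l' t) < \<epsilon>"
        using d by blast
    qed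
  qed
  then show ?thesis using l' by blast
qed

lemma equibounded_derivatives:
  assumes g: "\<And>n. completely_monotone (g n)" and a: "0 < a" and K: "\<And>n. g n (a / 2) \<le> K"
  shows "\<exists>B. \<forall>n. \<forall>t\<ge>a. \<bar>deriv (g n) t\<bar> \<le> B"
proof -
  note dg = completely_monotone_imp_deriv[OF g]
  have "\<bar>deriv (g n) t\<bar> \<le> (2 / a) * K" if t: "t \<ge> a" for n t
  proof -
    have t0: "t > 0" using t a by simp
    have "\<bar>deriv (g n) t\<bar> = - deriv (g n) t"
      using completely_monotone_imp_deriv(3)[OF dg(1)[of n] t0] by simp
    also have "\<dots> \<le> (2 / t) * g n (t / 2)" by (rule completely_monotone_derivative_bound[OF g t0])
    also have "\<dots> \<le> (2 / a) * g n (a / 2)"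
      using a t dg(3)[of "t / 2" n] by (intro mult_mono completely_monotone_antimono[OF g] divide_left_mono) auto
    also have "\<dots> \<le> (2 / a) * K" using a K[of n] by (intro mult_left_mono) auto
    finally show ?thesis .
  qed
  then show ?thesis by blast
qed

text \<open>
  Values of a completely monotone function control its derivatives further to the right
  (\<open>completely_monotone_derivative_bound\<close>), so pointwise convergence alone meets
  the assumption of \<open>derivative_of_limit\<close>.
\<close>

theorem completely_monotone_limit:
  assumes cm: "\<And>n. completely_monotone (u n)"
    and conv: "\<And>t. t > 0 \<Longrightarrow> (\<lambda>n. u n t) \<longlonglongrightarrow> l t"
  shows "completely_monotone l"
proof -
  have "monotone_order m l" for m
    using assms
  proof (induction m arbitrary: u l)
    case 0
    have "0 \<le> l t" if "t > 0" for t
      by (rule LIMSEQ_le_const[OF 0(2)[OF that]]) (use completely_monotone_imp_deriv(3)[OF 0(1) that] in blast)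
    then show ?case by simp
  next
    case (Suc m)
    note cm = Suc.prems(1) and conv = Suc.prems(2)
    define g where "g n t = - deriv (u n) t" for n t
    have g: "completely_monotone (g n)" for n
      unfolding g_def by (rule completely_monotone_imp_deriv(1)[OF cm])
    note du = completely_monotone_imp_deriv[OF cm] and dg = completely_monotone_imp_deriv[OF g]
    have bound: "\<exists>B. \<forall>n. \<forall>t\<ge>a. \<bar>- deriv (g n) t\<bar> \<le> B" if a: "a > 0" for a
    proof -
      obtain K where K: "\<And>n. norm (u n (a / 4)) \<le> K"
        using convergent_imp_Bseq[of "\<lambda>n. u n (a / 4)"] conv[of "a / 4"] a
        by (auto simp: convergent_def Bseq_def)
      have "g n (a / 2) \<le> (4 / a) * K" for n
      proof -
        have "g n (a / 2) \<le> (2 / (a / 2)) * u n (a / 2 / 2)"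
          unfolding g_def using a by (intro completely_monotone_derivative_bound[OF cm]) simp
        also have "\<dots> \<le> (4 / a) * K" using a K[of n] by (simp add: divide_right_mono)
        finally show ?thesis .
      qed
      from equibounded_derivatives[OF g a this] show ?thesis by simp
    qed
    have "\<exists>l'. \<forall>t>0. (\<lambda>n. - g n t) \<longlonglongrightarrow> l' t \<and> (l has_real_derivative l' t) (at t)"
    proof (rule derivative_of_limit[OF conv _ _ bound])
      show "(u n has_real_derivative - g n t) (at t)" if "t > 0" for n t
        using du(2)[OF that] by (simp add: g_def)
      show "((\<lambda>t. - g n t) has_real_derivative - deriv (g n) t) (at t)" if "t > 0" for n t
        using DERIV_minus[OF dg(2)[OF that]] by simp
    qed
    then obtain l' where l': "\<And>t. t > 0 \<Longrightarrow> (\<lambda>n. - g n t) \<longlonglongrightarrow> l' t"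
      "\<And>t. t > 0 \<Longrightarrow> (l has_real_derivative l' t) (at t)" by blast
    have "(\<lambda>n. g n t) \<longlonglongrightarrow> - l' t" if "t > 0" for t
      using tendsto_minus[OF l'(1)[OF that]] by simp
    then have "monotone_order m (\<lambda>t. - l' t)" by (intro Suc.IH[OF g])
    moreover have "0 \<le> l t" if "t > 0" for t
      by (rule LIMSEQ_le_const[OF conv[OF that]]) (use du(3)[OF that] in blast)
    ultimately show ?case using l'(2) by (auto intro!: exI[of _ "\<lambda>t. - l' t"])
  qed
  then show ?thesis by (simp add: completely_monotone_iff_order)
qed

text \<open>
  As for \<open>completely_monotone_limit\<close>, where the first derivative is now controlled
  by \<open>Bernstein_derivative_bound\<close>.
\<close>

theorem Bernstein_function_limit:
  assumes g: "\<And>n. completely_monotone (g n)"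
    and ug: "\<And>n t. t > 0 \<Longrightarrow> (u n has_real_derivative g n t) (at t)" "\<And>n t. t > 0 \<Longrightarrow> 0 \<le> u n t"
    and conv: "\<And>t. t > 0 \<Longrightarrow> (\<lambda>n. u n t) \<longlonglongrightarrow> l t"
  shows "\<exists>l'. completely_monotone l' \<and> (\<forall>t>0. (l has_real_derivative l' t) (at t))"
proof -
  note dg = completely_monotone_imp_deriv[OF g]
  have bound: "\<exists>B. \<forall>n. \<forall>t\<ge>a. \<bar>deriv (g n) t\<bar> \<le> B" if a: "a > 0" for a
  proof -
    obtain K where K: "\<And>n. norm (u n (a / 2)) \<le> K"
      using convergent_imp_Bseq[of "\<lambda>n. u n (a / 2)"] conv[of "a / 2"] a
      by (auto simp: convergent_def Bseq_def)
    have "g n (a / 2) \<le> (4 / a) * K" for n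
    proof -
      have "g n (a / 2) \<le> (2 / (a / 2)) * u n (a / 2)"
        using a by (intro Bernstein_derivative_bound[OF g] ug) auto
      also have "\<dots> \<le> (4 / a) * K" using a K[of n] by (simp add: divide_right_mono)
      finally show ?thesis .
    qed
    from equibounded_derivatives[OF g a this] show ?thesis .
  qed
  obtain l' where l': "\<And>t. t > 0 \<Longrightarrow> (\<lambda>n. g n t) \<longlonglongrightarrow> l' t"
      "\<And>t. t > 0 \<Longrightarrow> (l has_real_derivative l' t) (at t)"
    using derivative_of_limit[OF conv ug(1) _ bound] dg(2) by auto
  then show ?thesis using completely_monotone_limit[OF g l'(1)] by blast
qed

text \<open>
  Round \<open>X\<close> down to multiples of \<open>1 / (k + 1)\<close> and truncate at
  \<open>k + 1\<close>. The mixture becomes a finite sum, and the limit \<open>k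
  \<longlonglongrightarrow> \<infinity>\<close> is covered by
  \<open>completely_monotone_limit\<close>; nothing is differentiated under the integral.
\<close>

theorem completely_monotone_mixture:
  fixes N :: "'b measure"
  assumes N: "prob_space N" and X [measurable]: "X \<in> borel_measurable N" and X0: "AE \<omega> in N. 0 \<le> X \<omega>"
    and \<psi>: "\<And>t. t > 0 \<Longrightarrow> 0 \<le> \<psi> t"
    and cm: "\<And>w. 0 \<le> w \<Longrightarrow> completely_monotone (\<lambda>t. exp (- (w * \<psi> t)))"
  shows "completely_monotone (\<lambda>t. \<integral>\<omega>. exp (- (\<psi> t * X \<omega>)) \<partial>N)"
proof -
  interpret prob_space N by fact
  define Y where "Y k \<omega> = min (Suc k * Suc k) (nat \<lfloor>real (Suc k) * X \<omega>\<rfloor>)" for k \<omega>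
  have [measurable]: "Y k \<in> measurable N (count_space UNIV)" for k unfolding Y_def by measurable
  define u where "u k t = (\<integral>\<omega>. exp (- (\<psi> t * (real (Y k \<omega>) / real (Suc k)))) \<partial>N)" for k t
  have u_eq: "u k t = (\<Sum>i\<le>Suc k * Suc k. prob {\<omega> \<in> space N. Y k \<omega> = i} * exp (- (real i / real (Suc k) * \<psi> t)))" for k t
  proof -
    have "u k t = (\<integral>\<omega>. (\<Sum>i\<le>Suc k * Suc k. indicator {\<omega> \<in> space N. Y k \<omega> = i} \<omega> * exp (- (real i / real (Suc k) * \<psi> t))) \<partial>N)"
      unfolding u_def
    proof (rule Bochner_Integration.integral_cong)
      fix \<omega> assume \<omega>: "\<omega> \<in> space N"
      have "Y k \<omega> \<le> Suc k * Suc k" by (simp only: Y_def min.cobounded1)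
      have "(\<Sum>i\<le>Suc k * Suc k. indicator {\<omega> \<in> space N. Y k \<omega> = i} \<omega> * exp (- (real i / real (Suc k) * \<psi> t))) =
        (\<Sum>i\<le>Suc k * Suc k. if i = Y k \<omega> then exp (- (real i / real (Suc k) * \<psi> t)) else 0)"
        using \<omega> by (intro sum.cong) (auto simp: indicator_def)
      also have "\<dots> = exp (- (real (Y k \<omega>) / real (Suc k) * \<psi> t))"
        using \<open>Y k \<omega> \<le> Suc k * Suc k\<close> by (simp only: sum.delta finite_atMost atMost_iff if_True)
      finally show "exp (- (\<psi> t * (real (Y k \<omega>) / real (Suc k)))) =
        (\<Sum>i\<le>Suc k * Suc k. indicator {\<omega> \<in> space N. Y k \<omega> = i} \<omega> * exp (- (real i / real (Suc k) * \<psi> t)))"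
        by (simp only: mult.commute)
    qed simp
    also have "\<dots> = (\<Sum>i\<le>Suc k * Suc k. prob {\<omega> \<in> space N. Y k \<omega> = i} * exp (- (real i / real (Suc k) * \<psi> t)))"
    proof (subst Bochner_Integration.integral_sum)
      show "integrable N (\<lambda>\<omega>. indicator {\<omega> \<in> space N. Y k \<omega> = i} \<omega> * exp (- (real i / real (Suc k) * \<psi> t)))" for i
        by (intro integrable_mult_left integrable_real_indicator) (auto simp: emeasure_eq_measure)
    qed simp
    finally show ?thesis .
  qed
  have "completely_monotone (u k)" for k
    unfolding u_eq[abs_def]
    by (intro completely_monotone_sum completely_monotone_mult completely_monotone_const cm) auto
  moreover have "(\<lambda>k. u k t) \<longlonglongrightarrow> (\<integral>\<omega>. exp (- (\<psi> t * X \<omega>)) \<partial>N)" if t: "t > 0" for t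
    unfolding u_def
  proof (rule integral_dominated_convergence[where w="\<lambda>_. 1"])
    show "AE \<omega> in N. (\<lambda>k. exp (- (\<psi> t * (real (Y k \<omega>) / real (Suc k))))) \<longlonglongrightarrow> exp (- (\<psi> t * X \<omega>))"
      using X0
    proof eventually_elim
      case (elim \<omega>)
      have "(\<lambda>k. real (Y k \<omega>) / real (Suc k)) \<longlonglongrightarrow> X \<omega>"
      proof (rule tendsto_sandwich)
        show "(\<lambda>k. X \<omega> - 1 / real (Suc k)) \<longlonglongrightarrow> X \<omega>"
          using tendsto_diff[OF tendsto_const LIMSEQ_inverse_real_of_nat, of "X \<omega>"] by (simp add: inverse_eq_divide)
        have Y_eq: "real (Y k \<omega>) = of_int \<lfloor>real (Suc k) * X \<omega>\<rfloor>" if "X \<omega> \<le> real k" for k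
        proof -
          have "real (Suc k) * X \<omega> \<le> real (Suc k) * real (Suc k)" using that elim by (intro mult_left_mono) auto
          then have "nat \<lfloor>real (Suc k) * X \<omega>\<rfloor> \<le> Suc k * Suc k"
            by (simp add: nat_le_iff floor_le_iff of_nat_mult[symmetric] del: of_nat_mult of_nat_Suc mult_Suc mult_Suc_right)
          then have "Y k \<omega> = nat \<lfloor>real (Suc k) * X \<omega>\<rfloor>" unfolding Y_def by (rule min_absorb2)
          then show ?thesis using elim by simp
        qed
        have ev: "eventually (\<lambda>k. X \<omega> \<le> real k) sequentially"
          by (rule eventually_sequentiallyI[of "nat \<lceil>X \<omega>\<rceil>"]) linarith
        then show "eventually (\<lambda>k. X \<omega> - 1 / real (Suc k) \<le> real (Y k \<omega>) / real (Suc k)) sequentially"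
        proof eventually_elim
          case (elim k)
          have "real (Suc k) * X \<omega> - 1 \<le> real (Y k \<omega>)" unfolding Y_eq[OF elim] by linarith
          then have "(real (Suc k) * X \<omega> - 1) / real (Suc k) \<le> real (Y k \<omega>) / real (Suc k)"
            by (intro divide_right_mono) auto
          then show ?case by (simp add: diff_divide_distrib del: of_nat_Suc)
        qed
        from ev show "eventually (\<lambda>k. real (Y k \<omega>) / real (Suc k) \<le> X \<omega>) sequentially"
        proof eventually_elim
          case (elim k)
          have "real (Y k \<omega>) \<le> real (Suc k) * X \<omega>" unfolding Y_eq[OF elim] by linarith
          then show ?case by (simp add: field_simps)
        qed
      qed simp
      then show ?case by (intro tendsto_intros)
    qed
  qed (use \<psi>[OF t] in auto)
  ultimately show ?thesis by (rule completely_monotone_limit)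
qed

lemma completely_monotone_Laplace:
  assumes "prob_space N" "X \<in> borel_measurable N" "AE \<omega> in N. 0 \<le> X \<omega>"
  shows "completely_monotone (\<lambda>t. \<integral>\<omega>. exp (- (t * X \<omega>)) \<partial>N)"
proof (rule completely_monotone_mixture[OF assms, where \<psi>="\<lambda>t. t"])
  show "completely_monotone (\<lambda>t. exp (- (w * t)))" if "0 \<le> w" for w
    by (rule completely_monotone_exp_Bernstein[OF completely_monotone_const[of 1] that]) auto
qed auto

section \<open>Laplace transforms of probability measures\<close>

text \<open>
  All derivatives of \<open>f (n - u)\<close> in \<open>u\<close> are nonnegative. The Taylor
  remainder \<open>R\<close> at \<open>0\<close> then satisfies \<open>R N (c * s) \<le> c ^ N *
  R N s\<close> for \<open>0 \<le> c \<le> 1\<close>, by induction on \<open>N\<close> through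
  differentiation in \<open>s\<close>, and so tends to \<open>0\<close> at \<open>u = c *
  v\<close> as soon as \<open>u < v < n\<close>.
\<close>

lemma completely_monotone_Taylor:
  assumes f: "completely_monotone f" and n: "0 < n"
  shows "\<exists>a. (\<forall>j. 0 \<le> a j) \<and> (\<forall>u. 0 \<le> u \<and> u < n \<longrightarrow> (\<lambda>j. a j * u ^ j) sums f (n - u))"
proof -
  define d where "d k t = (-1) ^ k * (deriv ^^ k) f t" for k t
  have d0: "d 0 = f" by (simp add: d_def fun_eq_iff)
  have d_nonneg: "0 \<le> d k t" if "t > 0" for k t
    using f that by (simp add: d_def completely_monotone_def)
  have d_deriv: "(d k has_real_derivative - d (Suc k) t) (at t)" if "t > 0" for k t
  proof -
    have "((deriv ^^ k) f has_real_derivative (deriv ^^ Suc k) f t) (at t)"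
      using f that by (auto simp: completely_monotone_def DERIV_deriv_iff_field_differentiable)
    then have "((\<lambda>t. (-1) ^ k * (deriv ^^ k) f t) has_real_derivative (-1) ^ k * (deriv ^^ Suc k) f t) (at t)"
      by (rule DERIV_cmult)
    then show ?thesis unfolding d_def by simp
  qed
  have d_anti: "d k t \<le> d k s" if "0 < s" "s \<le> t" for k s t
    using that d_deriv[of _ k] d_nonneg[of _ "Suc k"]
    by (intro DERIV_nonpos_imp_nonincreasing[OF that(2)]) (metis less_le_trans neg_le_0_iff_le)
  define R where "R k N u = d k (n - u) - (\<Sum>j<N. d (k + j) n * (u ^ j / fact j))" for k N u
  have R_deriv: "(R k (Suc N) has_real_derivative R (Suc k) N u) (at u)" if u: "u < n" for k N u
  proof -
    have 1: "((\<lambda>u. d k (n - u)) has_real_derivative d (Suc k) (n - u)) (at u)"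
    proof -
      have "((\<lambda>u. d k (n - u)) has_real_derivative - d (Suc k) (n - u) * (-1)) (at u)"
        by (rule DERIV_chain2[where f="d k" and g="\<lambda>u. n - u"])
           (use u in \<open>auto intro!: d_deriv derivative_eq_intros\<close>)
      then show ?thesis by simp
    qed
    have 2: "((\<lambda>u. d (k + j) n * (u ^ j / fact j)) has_real_derivative
      (if j = 0 then 0 else d (k + j) n * (u ^ (j - 1) / fact (j - 1)))) (at u)" for j
    proof (cases j)
      case (Suc m)
      have "((\<lambda>u. u ^ Suc m / fact (Suc m)) has_real_derivative (real (Suc m) * u ^ m) / fact (Suc m)) (at u)"
        by (intro DERIV_cdivide) (use DERIV_pow[of "Suc m" u UNIV] in simp)
      also have "(real (Suc m) * u ^ m) / fact (Suc m) = u ^ m / fact m"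
        by (simp add: fact_Suc del: of_nat_Suc)
      finally have "((\<lambda>u. d (k + Suc m) n * (u ^ Suc m / fact (Suc m))) has_real_derivative
        d (k + Suc m) n * (u ^ m / fact m)) (at u)" by (rule DERIV_cmult)
      then show ?thesis unfolding Suc by (simp only: nat.distinct if_False diff_Suc_1)
    qed simp
    have "((\<lambda>u. \<Sum>j<Suc N. d (k + j) n * (u ^ j / fact j)) has_real_derivative
      (\<Sum>j<Suc N. if j = 0 then 0 else d (k + j) n * (u ^ (j - 1) / fact (j - 1)))) (at u)"
      by (intro DERIV_sum 2)
    also have "(\<Sum>j<Suc N. if j = 0 then 0 else d (k + j) n * (u ^ (j - 1) / fact (j - 1))) =
      (\<Sum>j<N. d (Suc k + j) n * (u ^ j / fact j))"
      by (subst sum.lessThan_Suc_shift) simp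
    finally have 3: "((\<lambda>u. \<Sum>j<Suc N. d (k + j) n * (u ^ j / fact j)) has_real_derivative
      (\<Sum>j<N. d (Suc k + j) n * (u ^ j / fact j))) (at u)" .
    show ?thesis unfolding R_def by (rule DERIV_diff[OF 1 3])
  qed
  have R_0: "R k (Suc N) 0 = 0" for k N
    unfolding R_def by (subst sum.lessThan_Suc_shift) simp
  have key: "0 \<le> R k N s \<and> R k N (c * s) \<le> c ^ N * R k N s" if "0 \<le> c" "c \<le> 1" "0 \<le> s" "s < n" for k N c s
    using that
  proof (induction N arbitrary: k s)
    case 0
    then have "c * s \<le> s" by (simp add: mult_left_le_one_le)
    then show ?case using 0 by (auto simp: R_def intro!: d_nonneg d_anti)
  next
    case (Suc N)
    have nonneg: "R k (Suc N) 0 \<le> R k (Suc N) s"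
    proof (rule DERIV_nonneg_imp_nondecreasing[OF Suc.prems(3)])
      fix x assume "0 \<le> x" "x \<le> s"
      then show "\<exists>y. (R k (Suc N) has_real_derivative y) (at x) \<and> 0 \<le> y"
        using R_deriv[of x k N] Suc.IH[of x "Suc k"] Suc.prems by auto
    qed
    let ?q = "\<lambda>s. c ^ Suc N * R k (Suc N) s - R k (Suc N) (c * s)"
    have "?q 0 \<le> ?q s"
    proof (rule DERIV_nonneg_imp_nondecreasing[OF Suc.prems(3)])
      fix x assume x: "0 \<le> x" "x \<le> s"
      then have "c * x \<le> x" using Suc.prems by (simp add: mult_left_le_one_le)
      then have cx: "c * x < n" using x Suc.prems by linarith
      have "((\<lambda>x. R k (Suc N) (c * x)) has_real_derivative R (Suc k) N (c * x) * c) (at x)"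
        by (rule DERIV_chain2[where f="R k (Suc N)" and g="\<lambda>x. c * x", OF R_deriv[OF cx] DERIV_cmult_Id])
      then have "(?q has_real_derivative c ^ Suc N * R (Suc k) N x - R (Suc k) N (c * x) * c) (at x)"
        using x Suc.prems by (intro DERIV_diff DERIV_cmult R_deriv) auto
      moreover have "R (Suc k) N (c * x) * c \<le> c ^ N * R (Suc k) N x * c"
        using Suc.IH[of x "Suc k"] Suc.prems x by (intro mult_right_mono) auto
      ultimately show "\<exists>y. (?q has_real_derivative y) (at x) \<and> 0 \<le> y"
        by (intro exI[of _ "c ^ Suc N * R (Suc k) N x - R (Suc k) N (c * x) * c"]) (simp add: mult_ac)
    qed
    then show ?case using nonneg by (simp add: R_0)
  qed
  have "(\<lambda>j. d j n / fact j * u ^ j) sums f (n - u)" if u: "0 \<le> u" "u < n" for u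
    unfolding sums_def
  proof -
    define v where "v = (u + n) / 2"
    have v: "u < v" "v < n" "0 < v" using u by (auto simp: v_def)
    define c where "c = u / v"
    have c: "0 \<le> c" "c < 1" "u = c * v" using u v by (auto simp: c_def)
    have R_small: "0 \<le> R 0 N u \<and> R 0 N u \<le> c ^ N * f (n - v)" for N
    proof -
      have "(\<Sum>j<N. d (0 + j) n * (v ^ j / fact j)) \<ge> 0"
        using v n d_nonneg by (intro sum_nonneg mult_nonneg_nonneg) auto
      then have "R 0 N v \<le> f (n - v)" by (simp add: R_def d0)
      moreover have "R 0 N u \<le> c ^ N * R 0 N v" using key[of c v 0 N] c v by simp
      moreover have "c ^ N * R 0 N v \<le> c ^ N * f (n - v)" using calculation(1) c by (intro mult_left_mono) auto
      ultimately show ?thesis using key[of 1 u 0 N] u by auto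
    qed
    have "(\<lambda>N. c ^ N) \<longlonglongrightarrow> 0" using c by (intro LIMSEQ_power_zero) simp
    then have upper: "(\<lambda>N. c ^ N * f (n - v)) \<longlonglongrightarrow> 0" by (rule tendsto_mult_left_zero)
    have "(\<lambda>N. R 0 N u) \<longlonglongrightarrow> 0"
    proof (rule tendsto_sandwich[OF _ _ tendsto_const upper])
      show "eventually (\<lambda>N. 0 \<le> R 0 N u) sequentially" using R_small by simp
      show "eventually (\<lambda>N. R 0 N u \<le> c ^ N * f (n - v)) sequentially" using R_small by simp
    qed
    then have "(\<lambda>N. f (n - u) - R 0 N u) \<longlonglongrightarrow> f (n - u) - 0" by (intro tendsto_intros)
    then show "(\<lambda>N. \<Sum>j<N. d j n / fact j * u ^ j) \<longlonglongrightarrow> f (n - u)"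
      by (simp add: R_def d0)
  qed
  then show ?thesis using d_nonneg[OF n] by (intro exI[of _ "\<lambda>j. d j n / fact j"]) auto
qed

text \<open>
  Expand \<open>f\<close> at \<open>m\<close> into the power series of
  \<open>completely_monotone_Taylor\<close>, and put \<open>u = m * exp (- t / m)\<close>: the
  coefficients become the masses of a probability measure on the multiples of \<open>1 /
  m\<close>, whose Laplace transform at \<open>t\<close> is \<open>f (\<tau> m t)\<close> with
  \<open>\<tau> m t = m * (1 - exp (- t / m))\<close>. These converge to \<open>f t\<close>; the
  measures are tight because \<open>f\<close> tends to \<open>1\<close> at \<open>0\<close>, and
  each weak limit point has Laplace transform \<open>f\<close>. In the proof, \<open>Suc
  m\<close> stands for \<open>m\<close>.
\<close>

theorem Bernstein_Widder:
  assumes f: "completely_monotone f" and lim: "(f \<longlongrightarrow> 1) (at_right 0)"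
  shows "\<exists>\<mu>. real_distribution \<mu> \<and> (AE x in \<mu>. 0 \<le> x) \<and> (\<forall>t>0. f t = (\<integral>x. exp (- t * x) \<partial>\<mu>))"
proof -
  have f_le_1: "f t \<le> 1" if "t > 0" for t
  proof (rule tendsto_lowerbound[OF lim])
    show "eventually (\<lambda>s. f t \<le> f s) (at_right 0)"
      using that by (auto simp: eventually_at_right_field intro!: exI[of _ t] completely_monotone_antimono[OF f])
  qed simp
  have "\<forall>m. \<exists>a. (\<forall>j. 0 \<le> a j) \<and> (\<forall>u. 0 \<le> u \<and> u < real (Suc m) \<longrightarrow> (\<lambda>j. a j * u ^ j) sums f (real (Suc m) - u))"
    using completely_monotone_Taylor[OF f] by simp
  from choice[OF this] obtain a where a_all: "\<forall>m. (\<forall>j. 0 \<le> a m j) \<and>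
    (\<forall>u. 0 \<le> u \<and> u < real (Suc m) \<longrightarrow> (\<lambda>j. a m j * u ^ j) sums f (real (Suc m) - u))" ..
  have a0: "0 \<le> a m j" for m j using a_all by blast
  have a: "(\<lambda>j. a m j * u ^ j) sums f (real (Suc m) - u)" if "0 \<le> u" "u < real (Suc m)" for m u
    using a_all that by blast
  define p where "p m j = a m j * real (Suc m) ^ j" for m j
  have p0: "0 \<le> p m j" for m j by (simp add: p_def a0)
  define \<tau> where "\<tau> m t = real (Suc m) * (1 - exp (- t / real (Suc m)))" for m t
  have \<tau>: "0 < \<tau> m t" "\<tau> m t \<le> t" if "0 < t" for m t
  proof -
    show "0 < \<tau> m t" using that by (simp add: \<tau>_def)
    have "1 - t / real (Suc m) \<le> exp (- t / real (Suc m))"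
      using exp_ge_add_one_self[of "- t / real (Suc m)"] by simp
    then have "\<tau> m t \<le> real (Suc m) * (t / real (Suc m))"
      unfolding \<tau>_def by (intro mult_left_mono) auto
    then show "\<tau> m t \<le> t" by simp
  qed
  have p_sums: "(\<lambda>j. p m j * exp (- t * (real j / real (Suc m)))) sums f (\<tau> m t)" if t: "0 < t" for m t
  proof -
    define u where "u = real (Suc m) * exp (- t / real (Suc m))"
    have "exp (- t / real (Suc m)) < 1" using t by simp
    then have "0 \<le> u" "u < real (Suc m)" by (auto simp: u_def mult_less_cancel_left2)
    from a[OF this] have "(\<lambda>j. a m j * u ^ j) sums f (\<tau> m t)" by (simp add: u_def \<tau>_def algebra_simps)
    moreover have "a m j * u ^ j = p m j * exp (- t * (real j / real (Suc m)))" for j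
      unfolding u_def p_def power_mult_distrib by (simp add: exp_of_nat_mult[symmetric] mult_ac)
    ultimately show ?thesis by simp
  qed
  have p_sum1: "p m sums 1" for m
  proof -
    have partial: "(\<Sum>j<N. p m j) \<le> 1" for N
    proof (rule tendsto_upperbound)
      show "((\<lambda>t. \<Sum>j<N. p m j * exp (- t * (real j / real (Suc m)))) \<longlongrightarrow> (\<Sum>j<N. p m j)) (at_right 0)"
        by (auto intro!: tendsto_eq_intros)
      have "(\<Sum>j<N. p m j * exp (- t * (real j / real (Suc m)))) \<le> 1" if "0 < t" for t
        using sum_le_suminf[OF sums_summable[OF p_sums[OF that, of m]], of "{..<N}"] p0
          sums_unique[OF p_sums[OF that, of m]] f_le_1[OF \<tau>(1)[OF that], of m] by simp
      then show "eventually (\<lambda>t. (\<Sum>j<N. p m j * exp (- t * (real j / real (Suc m)))) \<le> 1) (at_right 0)"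
        by (auto simp: eventually_at_right_field intro!: exI[of _ 1])
    qed simp
    have summable: "summable (p m)"
      by (rule summableI_nonneg_bounded[OF p0 partial])
    have "suminf (p m) \<le> 1" by (rule suminf_le_const[OF summable partial])
    moreover have "1 \<le> suminf (p m)"
    proof (rule tendsto_upperbound)
      have "filterlim (\<lambda>t. \<tau> m t) (at_right 0) (at_right 0)"
      proof (rule tendsto_imp_filterlim_at_right)
        show "(\<tau> m \<longlongrightarrow> 0) (at_right 0)" unfolding \<tau>_def by (auto intro!: tendsto_eq_intros)
        show "eventually (\<lambda>t. 0 < \<tau> m t) (at_right 0)"
          using \<tau>(1) by (auto simp: eventually_at_right_field intro!: exI[of _ 1])
      qed
      then show "((\<lambda>t. f (\<tau> m t)) \<longlongrightarrow> 1) (at_right 0)" by (rule filterlim_compose[OF lim])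
      have "f (\<tau> m t) \<le> suminf (p m)" if "0 < t" for t
      proof -
        have "p m j * exp (- t * (real j / real (Suc m))) \<le> p m j" for j
          using that p0[of m j] by (intro mult_left_le) auto
        then have "suminf (\<lambda>j. p m j * exp (- t * (real j / real (Suc m)))) \<le> suminf (p m)"
          by (intro suminf_le sums_summable[OF p_sums[OF that]] summable)
        then show ?thesis using sums_unique[OF p_sums[OF that, of m]] by simp
      qed
      then show "eventually (\<lambda>t. f (\<tau> m t) \<le> suminf (p m)) (at_right 0)"
        by (auto simp: eventually_at_right_field intro!: exI[of _ 1])
    qed simp
    ultimately have "suminf (p m) = 1" by simp
    then show ?thesis using summable_sums[OF summable] by simp
  qed
  define P where "P m = embed_pmf (p m)" for m
  have pmf_P: "pmf (P m) j = p m j" for m j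
  proof -
    have "(\<integral>\<^sup>+j. ennreal (p m j) \<partial>count_space UNIV) = 1"
      using p_sum1[of m] p0[of m] unfolding nn_integral_count_space_nat
      by (subst suminf_ennreal2) (auto simp: sums_iff)
    then show ?thesis unfolding P_def by (intro pmf_embed_pmf p0)
  qed
  define \<mu> where "\<mu> m = distr (measure_pmf (P m)) borel (\<lambda>j. real j / real (Suc m))" for m
  have rd: "real_distribution (\<mu> m)" for m
    unfolding \<mu>_def by (intro prob_space.real_distribution_distr measure_pmf.prob_space_axioms) simp
  have \<mu>_nonneg: "AE x in \<mu> m. 0 \<le> x" for m
    unfolding \<mu>_def by (subst AE_distr_iff) auto
  have \<mu>_int: "(\<integral>x. exp (- t * max 0 x) \<partial>\<mu> m) = f (\<tau> m t)" if t: "0 < t" for m t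
  proof -
    have "(\<integral>x. exp (- t * max 0 x) \<partial>\<mu> m) = (\<integral>j. exp (- t * (real j / real (Suc m))) \<partial>measure_pmf (P m))"
      unfolding \<mu>_def by (subst integral_distr) auto
    also have "\<dots> = enn2real (\<integral>\<^sup>+j. ennreal (exp (- t * (real j / real (Suc m)))) \<partial>measure_pmf (P m))"
      by (rule integral_eq_nn_integral) auto
    also have "(\<integral>\<^sup>+j. ennreal (exp (- t * (real j / real (Suc m)))) \<partial>measure_pmf (P m)) =
      (\<Sum>j. ennreal (p m j * exp (- t * (real j / real (Suc m)))))"
      by (simp add: nn_integral_measure_pmf pmf_P nn_integral_count_space_nat ennreal_mult p0)
    also have "\<dots> = ennreal (f (\<tau> m t))"
      using p_sums[OF t, of m] p0 by (subst suminf_ennreal2) (auto simp: sums_iff)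
    finally show ?thesis using completely_monotone_imp_deriv(3)[OF f \<tau>(1)[OF t]] by simp
  qed
  have "tight \<mu>"
    unfolding tight_def
  proof (intro conjI allI impI rd)
    fix \<epsilon> :: real assume \<epsilon>: "\<epsilon> > 0"
    \<comment> \<open>beyond \<open>1 / t\<close> the integrand \<open>exp (- t * x)\<close> is at most \<open>1 - q\<close>\<close>
    define q where "q = 1 - exp (- 1 :: real)"
    have q: "0 < q" by (simp add: q_def)
    have "eventually (\<lambda>t. 1 - \<epsilon> * q < f t) (at_right 0)"
      using \<epsilon> q by (intro order_tendstoD(1)[OF lim]) simp
    then obtain t0 where t0: "t0 > 0" "\<And>t. 0 < t \<Longrightarrow> t < t0 \<Longrightarrow> 1 - \<epsilon> * q < f t"
      by (auto simp: eventually_at_right_field)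
    define t where "t = t0 / 2"
    have t: "0 < t" "1 - \<epsilon> * q < f t" using t0 by (auto simp: t_def)
    have "1 - \<epsilon> < measure (\<mu> m) {-1<..1/t}" for m
    proof -
      interpret real_distribution "\<mu> m" by (rule rd)
      have int: "integrable (\<mu> m) (\<lambda>x. exp (- t * max 0 x))"
        by (rule integrable_const_bound[where B=1]) (use t in auto)
      have "1 - \<epsilon> * q < f (\<tau> m t)"
        using t completely_monotone_antimono[OF f \<tau>(1)[OF t(1)] \<tau>(2)[OF t(1)], of m] by simp
      also have "\<dots> = (\<integral>x. exp (- t * max 0 x) \<partial>\<mu> m)" by (rule \<mu>_int[OF t(1), symmetric])
      also have "\<dots> \<le> (\<integral>x. (1 - q) + q * indicator {-1<..1/t} x \<partial>\<mu> m)"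
      proof (rule integral_mono_AE[OF int])
        show "AE x in \<mu> m. exp (- t * max 0 x) \<le> (1 - q) + q * indicator {-1<..1/t} x"
          using \<mu>_nonneg[of m]
        proof eventually_elim
          case (elim x)
          show ?case
          proof (cases "x \<le> 1 / t")
            case True
            then show ?thesis using elim t by (simp add: indicator_def)
          next
            case False
            then have "1 \<le> t * x" using t by (simp add: field_simps)
            then show ?thesis using elim False by (simp add: indicator_def q_def max_def)
          qed
        qed
        show "integrable (\<mu> m) (\<lambda>x. (1 - q) + q * indicator {-1<..1/t} x)"
          by (intro Bochner_Integration.integrable_add integrable_mult_right integrable_real_indicator)
             (auto simp: emeasure_eq_measure)
      qed
      also have "\<dots> = (1 - q) + q * measure (\<mu> m) {-1<..1/t}"
      proof -
        have "integrable (\<mu> m) (indicator {-1<..1/t} :: real \<Rightarrow> real)"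
          by (intro integrable_real_indicator) (auto simp: emeasure_eq_measure)
        then show ?thesis using prob_space by simp
      qed
      finally have "q * (1 - \<epsilon>) < q * measure (\<mu> m) {-1<..1/t}" by (simp add: algebra_simps)
      then show ?thesis using q by simp
    qed
    moreover have "-1 < 1/t" using t by (simp add: less_trans[of "-1" 0])
    ultimately show "\<exists>a b. a < b \<and> (\<forall>n. 1 - \<epsilon> < measure (\<mu> n) {a<..b})" by blast
  qed
  then obtain r M where r: "strict_mono (r :: nat \<Rightarrow> nat)" and M: "real_distribution M"
    and weak: "weak_conv_m (\<lambda>n. \<mu> (r n)) M"
    using tight_imp_convergent_subsubsequence[of \<mu> id] by (auto simp: strict_mono_id o_def)
  interpret M: real_distribution M by (rule M)
  have rd': "real_distribution (\<mu> (r n))" for n by (rule rd)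
  have AE_M: "AE x in M. 0 \<le> x"
  proof -
    \<comment> \<open>a bounded continuous function that vanishes exactly on the nonnegative numbers\<close>
    let ?g = "\<lambda>x::real. min 1 (max 0 (- x))"
    have "(\<lambda>n. \<integral>x. ?g x \<partial>(\<mu> (r n))) \<longlonglongrightarrow> (\<integral>x. ?g x \<partial>M)"
      by (rule weak_conv_imp_integral_bdd_continuous_conv[OF rd' M weak, where B=1])
         (auto intro!: continuous_intros)
    moreover have "(\<integral>x. ?g x \<partial>(\<mu> (r n))) = 0" for n
    proof -
      have "(\<integral>x. ?g x \<partial>(\<mu> (r n))) = (\<integral>x. 0 \<partial>(\<mu> (r n)))"
      proof (rule integral_cong_AE)
        show "AE x in \<mu> (r n). ?g x = 0" using \<mu>_nonneg by (rule eventually_mono) simp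
      qed (simp_all add: \<mu>_def)
      then show ?thesis by simp
    qed
    ultimately have "(\<integral>x. ?g x \<partial>M) = 0" using LIMSEQ_unique[of "\<lambda>n. 0 :: real"] by auto
    moreover have "integrable M ?g" by (rule M.integrable_const_bound[where B=1]) auto
    ultimately have "AE x in M. ?g x = 0" by (subst (asm) integral_nonneg_eq_0_iff_AE) auto
    then show ?thesis by eventually_elim (auto simp: min_def max_def split: if_splits)
  qed
  have "f t = (\<integral>x. exp (- t * x) \<partial>M)" if t: "0 < t" for t
  proof -
    have "(\<lambda>n. \<integral>x. exp (- t * max 0 x) \<partial>(\<mu> (r n))) \<longlonglongrightarrow> (\<integral>x. exp (- t * max 0 x) \<partial>M)"
      by (rule weak_conv_imp_integral_bdd_continuous_conv[OF rd' M weak, where B=1])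
         (use t in \<open>auto intro!: continuous_intros\<close>)
    then have "(\<lambda>n. f (\<tau> (r n) t)) \<longlonglongrightarrow> (\<integral>x. exp (- t * max 0 x) \<partial>M)" by (simp only: \<mu>_int[OF t])
    moreover have "(\<lambda>n. f (\<tau> (r n) t)) \<longlonglongrightarrow> f t"
    proof -
      have "(\<lambda>m. \<tau> m t) \<longlonglongrightarrow> t"
      proof (rule tendsto_sandwich[OF _ _ _ tendsto_const])
        show "eventually (\<lambda>m. \<tau> m t \<le> t) sequentially" using \<tau>(2)[OF t] by simp
        have "t - t\<^sup>2 / real (Suc m) \<le> \<tau> m t" for m
        proof -
          define v where "v = t / real (Suc m)"
          have v: "0 \<le> v" "real (Suc m) * v = t" using t by (auto simp: v_def)
          have "exp (- v) \<le> 1 - v + v\<^sup>2" by (rule exp_minus_le_quadratic[OF v(1)])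
          then have "real (Suc m) * (v - v\<^sup>2) \<le> real (Suc m) * (1 - exp (- v))"
            by (intro mult_left_mono) auto
          moreover have "real (Suc m) * (v - v\<^sup>2) = t - t\<^sup>2 / real (Suc m)"
            unfolding right_diff_distrib power2_eq_square mult.assoc[symmetric] v(2) by (simp add: v_def)
          moreover have "real (Suc m) * (1 - exp (- v)) = \<tau> m t"
            by (simp only: \<tau>_def v_def minus_divide_left)
          ultimately show ?thesis by linarith
        qed
        then show "eventually (\<lambda>m. t - t\<^sup>2 / real (Suc m) \<le> \<tau> m t) sequentially" by simp
        have "(\<lambda>m. t - t\<^sup>2 * inverse (real (Suc m))) \<longlonglongrightarrow> t - t\<^sup>2 * 0"
          by (intro tendsto_intros LIMSEQ_inverse_real_of_nat)
        then show "(\<lambda>m. t - t\<^sup>2 / real (Suc m)) \<longlonglongrightarrow> t" by (simp add: divide_inverse)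
      qed
      then have "(\<lambda>m. f (\<tau> m t)) \<longlonglongrightarrow> f t"
        by (rule isCont_tendsto_compose[OF DERIV_isCont[OF completely_monotone_imp_deriv(2)[OF f t]]])
      from LIMSEQ_subseq_LIMSEQ[OF this r] show ?thesis by (simp add: o_def)
    qed
    ultimately have "f t = (\<integral>x. exp (- t * max 0 x) \<partial>M)" by (rule LIMSEQ_unique[rotated])
    also have "\<dots> = (\<integral>x. exp (- t * x) \<partial>M)"
    proof (rule integral_cong_AE)
      show "AE x in M. exp (- t * max 0 x) = exp (- t * x)" using AE_M by eventually_elim simp
    qed simp_all
    finally show ?thesis .
  qed
  then show ?thesis using M AE_M by blast
qed

section \<open>Subgroups of the real line\<close>

lemma real_additive_group_cases:
  fixes H :: "real set"
  assumes zero: "0 \<in> H" and closed: "\<forall>x\<in>H. \<forall>y\<in>H. x - y \<in> H"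
  obtains (dense) "\<forall>\<epsilon>>0. \<exists>x\<in>H. 0 < x \<and> x < \<epsilon>"
    | (trivial) "H = {0}"
    | (cyclic) c where "c > 0" "c \<in> H" "\<forall>x\<in>H. \<exists>n::int. x = of_int n * c"
proof -
  have diff: "x - y \<in> H" if "x \<in> H" "y \<in> H" for x y using closed that by blast
  have neg: "- x \<in> H" if "x \<in> H" for x using diff[OF zero that] by simp
  have add: "x + y \<in> H" if "x \<in> H" "y \<in> H" for x y using diff[OF that(1) neg[OF that(2)]] by simp
  have nat_mult: "of_nat n * x \<in> H" if "x \<in> H" for n :: nat and x
    by (induction n) (use zero add that in \<open>auto simp: algebra_simps\<close>)
  have int_mult: "of_int n * x \<in> H" if "x \<in> H" for n :: int and x
    using nat_mult[OF that, of "nat n"] neg[OF nat_mult[OF that, of "nat (- n)"]]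
    by (cases "0 \<le> n") auto
  consider "\<forall>\<epsilon>>0. \<exists>x\<in>H. 0 < x \<and> x < \<epsilon>" | "H = {0}"
    | \<epsilon> where "\<epsilon> > 0" "\<not> (\<exists>x\<in>H. 0 < x \<and> x < \<epsilon>)" "H \<noteq> {0}" by blast
  then show thesis
  proof cases
    case (3 \<epsilon>)
    then obtain x where "x \<in> H" "x \<noteq> 0" using zero by blast
    then obtain x1 where x1: "x1 \<in> H" "x1 > 0" using neg[of x] by (cases "x > 0") (auto simp: not_less)
    let ?P = "{x \<in> H. x > 0}"
    define c where "c = Inf ?P"
    have bdd: "bdd_below ?P" by (intro bdd_belowI[of _ 0]) auto
    have le: "c \<le> x" if "x \<in> H" "x > 0" for x unfolding c_def by (rule cInf_lower[OF _ bdd]) (use that in auto)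
    have "\<epsilon> \<le> c" unfolding c_def by (rule cInf_greatest) (use 3 x1 in \<open>auto simp: not_less\<close>)
    then have "c > 0" using 3(1) by simp
    have near: "\<exists>x\<in>H. 0 < x \<and> x < c + \<epsilon>'" if "\<epsilon>' > 0" for \<epsilon>'
      using cInf_lessD[of ?P "c + \<epsilon>'"] x1 that unfolding c_def by auto
    have "c \<in> H"
    proof (rule ccontr)
      assume "c \<notin> H"
      obtain x where x: "x \<in> H" "0 < x" "x < c + \<epsilon>" using near[OF 3(1)] by blast
      have "c < x" using le[OF x(1,2)] x(1) \<open>c \<notin> H\<close> by (cases "c = x") auto
      then obtain y where y: "y \<in> H" "0 < y" "y < x" using near[of "x - c"] by auto
      have "c \<le> y" using le y by simp
      then have "x - y \<in> H" "0 < x - y" "x - y < \<epsilon>" using diff x y by auto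
      then show False using 3(2) by blast
    qed
    moreover have "\<exists>n::int. x = of_int n * c" if "x \<in> H" for x
    proof -
      define n where "n = \<lfloor>x / c\<rfloor>"
      have n: "of_int n \<le> x / c" "x / c < of_int n + 1" unfolding n_def by linarith+
      then have "0 \<le> x - of_int n * c" "x - of_int n * c < c"
        using \<open>c > 0\<close> by (auto simp: pos_le_divide_eq pos_divide_less_eq algebra_simps)
      moreover have "x - of_int n * c \<in> H" using that \<open>c \<in> H\<close> int_mult diff by blast
      ultimately have "x - of_int n * c = 0" using le[of "x - of_int n * c"] by force
      then show ?thesis by (intro exI[of _ n]) simp
    qed
    ultimately show thesis using cyclic \<open>c > 0\<close> by blast
  qed (use dense trivial in blast)+
qed

lemma powi_eq_exp: "0 < r \<Longrightarrow> r powi n = exp (of_int n * ln r)" for r :: real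
  by (simp add: powr_real_of_int'[symmetric] powr_def)

lemma range_powi_iff: "0 < r \<Longrightarrow> 0 < x \<Longrightarrow> x \<in> range (\<lambda>n::int. r powi n) \<longleftrightarrow> (\<exists>n::int. ln x = of_int n * ln r)"
  for r x :: real
  by (auto simp: powi_eq_exp image_iff) (metis exp_ln)

section \<open>The functional equation of a branching random walk\<close>

text \<open>
  If the sum diverges, both sides are \<open>0\<close>.
\<close>

lemma infsum_eq_enn2real:
  fixes f :: "'b \<Rightarrow> real"
  assumes "\<And>x. 0 \<le> f x"
  shows "(\<Sum>\<^sub>\<infinity>x\<in>A. f x) = enn2real (\<integral>\<^sup>+x. ennreal (f x) \<partial>count_space A)"
proof (cases "integrable (count_space A) f")
  case True
  then have "(\<Sum>\<^sub>\<infinity>x\<in>A. f x) = infsetsum f A"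
    by (intro infsetsum_infsum[symmetric]) (simp add: abs_summable_on_def)
  also have "\<dots> = enn2real (\<integral>\<^sup>+x. ennreal (f x) \<partial>count_space A)"
    unfolding infsetsum_def by (rule integral_eq_nn_integral) (use assms in auto)
  finally show ?thesis .
next
  case False
  have "\<not> f summable_on A"
    using False assms abs_summable_equivalent[of f A] by (simp add: abs_summable_on_def)
  then have "(\<Sum>\<^sub>\<infinity>x\<in>A. f x) = 0" by (rule infsum_not_exists)
  moreover have "(\<integral>\<^sup>+x. ennreal (f x) \<partial>count_space A) = \<infinity>"
  proof (rule ccontr)
    assume "(\<integral>\<^sup>+x. ennreal (f x) \<partial>count_space A) \<noteq> \<infinity>"
    then have "integrable (count_space A) f"
      by (intro integrableI_nonneg) (use assms in \<open>auto simp: less_top\<close>)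
    then show False using False by simp
  qed
  ultimately show ?thesis by simp
qed

locale branching_walk = prob_space M for M :: "'a measure" +
  fixes T :: "nat \<Rightarrow> 'a \<Rightarrow> real" and TT :: "nat list \<Rightarrow> nat \<Rightarrow> 'a \<Rightarrow> real" and \<alpha> :: real
  assumes rv [measurable]: "\<And>j. T j \<in> borel_measurable M"
    and nonneg: "\<And>j \<omega>. \<omega> \<in> space M \<Longrightarrow> 0 \<le> T j \<omega>"
    and alpha: "\<alpha> > 0"
    and copies: "iid_copies M T TT"
    and mean: "(\<integral>\<^sup>+\<omega>. (\<Sum>j. ennreal (T j \<omega> powr \<alpha>)) \<partial>M) = 1"
    and log_summ: "AE \<omega> in M. summable (\<lambda>j. T j \<omega> powr \<alpha> * ln (T j \<omega>))"
    and log_int: "integrable M (\<lambda>\<omega>. \<Sum>j. T j \<omega> powr \<alpha> * ln (T j \<omega>))"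
    and log_drift: "(\<integral>\<omega>. (\<Sum>j. T j \<omega> powr \<alpha> * ln (T j \<omega>)) \<partial>M) < 0"
    and xlogx: "integrable M (\<lambda>\<omega>. (\<Sum>j. T j \<omega> powr \<alpha>) * ln (\<Sum>j. T j \<omega> powr \<alpha>))"
begin

abbreviation seqs :: "(nat \<Rightarrow> real) measure" where "seqs \<equiv> Pi\<^sub>M UNIV (\<lambda>_. borel)"

definition law :: "(nat \<Rightarrow> real) measure" where "law = distr M seqs (\<lambda>\<omega> j. T j \<omega>)"

lemma T_seq_measurable [measurable]: "(\<lambda>\<omega> j. T j \<omega>) \<in> measurable M seqs"
  by (rule measurable_PiM_single') auto

lemma sets_law [measurable_cong, simp]: "sets law = sets seqs"
  by (simp add: law_def)

lemma log_weight_eq: "t powr \<alpha> * ln (t powr \<alpha>) = \<alpha> * (t powr \<alpha> * ln t)" if "0 \<le> t"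
  using that by (cases "t = 0") (auto simp: ln_powr)

lemma log_weight_suminf:
  assumes \<omega>: "\<omega> \<in> space M" and s: "summable (\<lambda>j. T j \<omega> powr \<alpha> * ln (T j \<omega>))"
  shows "summable (\<lambda>j. T j \<omega> powr \<alpha> * ln (T j \<omega> powr \<alpha>))"
    "(\<Sum>j. T j \<omega> powr \<alpha> * ln (T j \<omega> powr \<alpha>)) = \<alpha> * (\<Sum>j. T j \<omega> powr \<alpha> * ln (T j \<omega>))"
  unfolding log_weight_eq[OF nonneg[OF \<omega>]] using s by (auto intro: summable_mult suminf_mult)

text \<open>
  The reproduction law on sequence space, with weights \<open>b j powr \<alpha>\<close>; the
  logarithms, and with them the drift, are multiplied by \<open>\<alpha> > 0\<close>.
\<close>

lemma smoothing_law: "smoothing law (\<lambda>j b. b j powr \<alpha>)"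
proof -
  interpret L: prob_space law unfolding law_def by (rule prob_space_distr) measurable
  have AE1: "AE \<omega> in M. (\<Sum>j. T j \<omega> powr \<alpha> * ln (T j \<omega> powr \<alpha>)) = \<alpha> * (\<Sum>j. T j \<omega> powr \<alpha> * ln (T j \<omega>))"
    using log_summ AE_space by eventually_elim (rule log_weight_suminf(2))
  have [measurable]: "(\<lambda>b. \<Sum>j. b j powr \<alpha> * ln (b j powr \<alpha>)) \<in> borel_measurable seqs"
    "(\<lambda>b. (\<Sum>j. b j powr \<alpha>) * ln (\<Sum>j. b j powr \<alpha>)) \<in> borel_measurable seqs"
    by measurable
  have int: "integrable M (\<lambda>\<omega>. \<Sum>j. T j \<omega> powr \<alpha> * ln (T j \<omega> powr \<alpha>))"
    using log_int AE1 by (subst integrable_cong_AE[of _ _ "\<lambda>\<omega>. \<alpha> * (\<Sum>j. T j \<omega> powr \<alpha> * ln (T j \<omega>))"]) auto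
  show ?thesis
  proof
    show "(\<lambda>b. b j powr \<alpha>) \<in> borel_measurable law" for j by measurable
    show "(\<integral>\<^sup>+b. (\<Sum>j. ennreal (b j powr \<alpha>)) \<partial>law) = 1"
      unfolding law_def by (subst nn_integral_distr) (auto simp: mean)
    show "AE b in law. summable (\<lambda>j. b j powr \<alpha> * ln (b j powr \<alpha>))"
      unfolding law_def
    proof (subst AE_distr_iff)
      show "{b \<in> space seqs. summable (\<lambda>j. b j powr \<alpha> * ln (b j powr \<alpha>))} \<in> sets seqs"
        unfolding summable_iff_convergent Cauchy_convergent_iff[symmetric] by measurable
      show "AE \<omega> in M. summable (\<lambda>j. T j \<omega> powr \<alpha> * ln (T j \<omega> powr \<alpha>))"
        using log_summ AE_space by eventually_elim (rule log_weight_suminf(1))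
    qed measurable
    show "integrable law (\<lambda>b. \<Sum>j. b j powr \<alpha> * ln (b j powr \<alpha>))"
      unfolding law_def by (rule integrable_distr_eq[THEN iffD2, OF T_seq_measurable]) (measurable, rule int)
    have "(\<integral>b. (\<Sum>j. b j powr \<alpha> * ln (b j powr \<alpha>)) \<partial>law) = (\<integral>\<omega>. (\<Sum>j. T j \<omega> powr \<alpha> * ln (T j \<omega> powr \<alpha>)) \<partial>M)"
      unfolding law_def by (subst integral_distr) auto
    also have "\<dots> = (\<integral>\<omega>. \<alpha> * (\<Sum>j. T j \<omega> powr \<alpha> * ln (T j \<omega>)) \<partial>M)"
      by (rule integral_cong_AE[OF _ _ AE1]) measurable
    also have "\<dots> < 0" using log_drift alpha by (simp add: mult_pos_neg)
    finally show "(\<integral>b. (\<Sum>j. b j powr \<alpha> * ln (b j powr \<alpha>)) \<partial>law) < 0" .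
    show "integrable law (\<lambda>b. (\<Sum>j. b j powr \<alpha>) * ln (\<Sum>j. b j powr \<alpha>))"
      unfolding law_def using xlogx by (subst integrable_distr_eq) auto
  qed simp
qed

sublocale sm: smoothing law "\<lambda>j b. b j powr \<alpha>" by (rule smoothing_law)

lemma TT_rv: "(\<lambda>\<omega> j. TT v j \<omega>) \<in> measurable M seqs"
  using copies by (auto simp: iid_copies_def indep_vars_def)

text \<open>
  Independence and equality of the marginal laws say that the whole family of copies has the
  product law.
\<close>

lemma field_law: "distr M sm.field (\<lambda>\<omega> v j. TT v j \<omega>) = sm.field"
proof -
  have indep: "indep_vars (\<lambda>_. seqs) (\<lambda>v \<omega> j. TT v j \<omega>) UNIV"
    and eq: "distr M seqs (\<lambda>\<omega> j. TT v j \<omega>) = law" for v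
    using copies by (auto simp: iid_copies_def law_def)
  have "distr M (Pi\<^sub>M UNIV (\<lambda>_::nat list. seqs)) (\<lambda>\<omega>. \<lambda>v\<in>UNIV. \<lambda>j. TT v j \<omega>) = Pi\<^sub>M UNIV (\<lambda>v. distr M seqs (\<lambda>\<omega> j. TT v j \<omega>))"
    using indep by (subst (asm) indep_vars_iff_distr_eq_PiM) (auto intro: TT_rv)
  then have "distr M (Pi\<^sub>M UNIV (\<lambda>_::nat list. seqs)) (\<lambda>\<omega> v j. TT v j \<omega>) = sm.field"
    by (simp add: eq restrict_UNIV)
  moreover have "distr M (Pi\<^sub>M UNIV (\<lambda>_::nat list. seqs)) (\<lambda>\<omega> v j. TT v j \<omega>) = distr M sm.field (\<lambda>\<omega> v j. TT v j \<omega>)"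
    by (intro distr_cong sets_PiM_cong) auto
  ultimately show ?thesis by simp
qed

lemma TT_measurable [measurable]: "(\<lambda>\<omega> v j. TT v j \<omega>) \<in> measurable M sm.field"
proof (rule measurable_PiM_single')
  fix v
  show "(\<lambda>\<omega> j. TT v j \<omega>) \<in> measurable M law"
    using TT_rv[of v] by (subst measurable_cong_sets[OF refl sets_law])
qed (auto simp: space_PiM sets_eq_imp_space_eq[OF sets_law])

lemma TT_entry_measurable [measurable]: "TT v j \<in> borel_measurable M"
  using measurable_compose[OF TT_rv[of v] measurable_component_singleton[of j UNIV "\<lambda>_. borel"]] by simp

lemma AE_TT_nonneg: "AE \<omega> in M. \<forall>v j. 0 \<le> TT v j \<omega>"
proof -
  have "AE \<omega> in M. 0 \<le> TT v j \<omega>" for v j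
  proof -
    have "AE b in law. 0 \<le> b j"
      unfolding law_def using nonneg by (subst AE_distr_iff) auto
    moreover have eq: "distr M seqs (\<lambda>\<omega> j. TT v j \<omega>) = law"
      using copies unfolding iid_copies_def law_def by blast
    ultimately have "AE b in distr M seqs (\<lambda>\<omega> j. TT v j \<omega>). 0 \<le> b j" unfolding eq by blast
    then show ?thesis by (rule AE_distrD[OF TT_rv])
  qed
  then show ?thesis by (simp add: AE_all_countable)
qed

lemma Wn_eq_enn2real: "Wn TT \<alpha> n \<omega> = enn2real (\<integral>\<^sup>+v. ennreal (branch_weight TT v \<omega> powr \<alpha>) \<partial>count_space (level n))"
  unfolding Wn_def by (rule infsum_eq_enn2real) simp

lemma Wlim_measurable [measurable]: "Wlim TT \<alpha> \<in> borel_measurable M"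
proof -
  have [measurable]: "branch_weight TT v \<in> borel_measurable M" for v
    unfolding branch_weight_def by measurable
  have [measurable]: "Wn TT \<alpha> n \<in> borel_measurable M" for n
    unfolding Wn_eq_enn2real by measurable
  show ?thesis unfolding Wlim_def by measurable
qed

lemma AE_Wlim: "AE \<omega> in M. Wlim TT \<alpha> \<omega> = sm.wlim (\<lambda>v j. TT v j \<omega>)"
  using AE_TT_nonneg
proof eventually_elim
  case (elim \<omega>)
  have "branch_weight TT v \<omega> powr \<alpha> = sm.wt (\<lambda>v j. TT v j \<omega>) v" for v
    unfolding branch_weight_def sm.wt_def using elim by (subst prod_powr_distrib) auto
  then have "Wn TT \<alpha> n \<omega> = sm.w n (\<lambda>v j. TT v j \<omega>)" for n
    by (simp add: Wn_eq_enn2real sm.w_def sm.W_def)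
  then show ?case by (simp add: Wlim_def sm.wlim_def)
qed

lemma AE_Wlim_nonneg: "AE \<omega> in M. 0 \<le> Wlim TT \<alpha> \<omega>"
proof -
  have "AE b in distr M sm.field (\<lambda>\<omega> v j. TT v j \<omega>). 0 \<le> sm.wlim b"
    unfolding field_law by (rule sm.AE_wlim_nonneg)
  then have "AE \<omega> in M. 0 \<le> sm.wlim (\<lambda>v j. TT v j \<omega>)" by (rule AE_distrD[OF TT_measurable])
  with AE_Wlim show ?thesis by eventually_elim simp
qed

lemma phi_eq_Wlim:
  assumes "0 \<le> x"
  shows "sm.phi x = (\<integral>\<omega>. exp (- (x * Wlim TT \<alpha> \<omega>)) \<partial>M)"
proof -
  have "sm.phi x = (\<integral>b. exp (- (x * sm.wlim b)) \<partial>distr M sm.field (\<lambda>\<omega> v j. TT v j \<omega>))"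
    unfolding field_law by (rule sm.phi_eq[OF assms])
  also have "\<dots> = (\<integral>\<omega>. exp (- (x * sm.wlim (\<lambda>v j. TT v j \<omega>))) \<partial>M)"
    by (rule integral_distr) measurable
  also have "\<dots> = (\<integral>\<omega>. exp (- (x * Wlim TT \<alpha> \<omega>)) \<partial>M)"
  proof (rule integral_cong_AE)
    show "AE \<omega> in M. exp (- (x * sm.wlim (\<lambda>v j. TT v j \<omega>))) = exp (- (x * Wlim TT \<alpha> \<omega>))"
      using AE_Wlim by eventually_elim simp
  qed measurable
  finally show ?thesis .
qed

text \<open>
  Passes from the variable \<open>t\<close> to \<open>x = t powr \<alpha>\<close>; for negative
  \<open>x\<close> the value at \<open>0\<close> is repeated.
\<close>

definition lift :: "(real \<Rightarrow> real) \<Rightarrow> real \<Rightarrow> real" where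
  "lift f x = f (max 0 x powr (1 / \<alpha>))"

lemma powr_alpha_inverse: "0 \<le> t \<Longrightarrow> (t powr \<alpha>) powr (1 / \<alpha>) = t" "0 \<le> t \<Longrightarrow> (t powr (1 / \<alpha>)) powr \<alpha> = t"
  using alpha by (simp_all add: powr_powr)

lemma lift_powr: "0 \<le> t \<Longrightarrow> lift f (t powr \<alpha>) = f t"
  by (simp add: lift_def powr_alpha_inverse)

lemma S_lift:
  assumes f: "sm.admissible (lift f)" and t: "0 \<le> t"
  shows "sm.S (lift f) (t powr \<alpha>) = (\<integral>\<omega>. lim (\<lambda>n. \<Prod>j<n. f (t * T j \<omega>)) \<partial>M)"
proof -
  note [measurable] = sm.admissibleD(1)[OF f]
  have "sm.S (lift f) (t powr \<alpha>) = (\<integral>\<omega>. infprod (\<lambda>j. lift f (t powr \<alpha> * T j \<omega> powr \<alpha>)) \<partial>M)"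
    unfolding sm.S_def unfolding law_def by (rule integral_distr) measurable
  also have "\<dots> = (\<integral>\<omega>. lim (\<lambda>n. \<Prod>j<n. f (t * T j \<omega>)) \<partial>M)"
  proof (rule Bochner_Integration.integral_cong)
    fix \<omega> assume "\<omega> \<in> space M"
    then have "lift f (t powr \<alpha> * T j \<omega> powr \<alpha>) = f (t * T j \<omega>)" for j
      using t nonneg by (subst powr_mult[symmetric]) (auto intro!: lift_powr)
    then show "infprod (\<lambda>j. lift f (t powr \<alpha> * T j \<omega> powr \<alpha>)) = lim (\<lambda>n. \<Prod>j<n. f (t * T j \<omega>))"
      by (simp add: infprod_def)
  qed simp
  finally show ?thesis .
qed

lemma admissible_lift:
  assumes bounds: "\<And>t. 0 \<le> t \<Longrightarrow> 0 \<le> f t \<and> f t \<le> 1" and anti: "antimono_on {0..} f"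
  shows "sm.admissible (lift f)"
  unfolding sm.admissible_def
proof (intro conjI allI)
  have "mono (\<lambda>x. - lift f x)"
  proof (rule monoI)
    fix x y :: real assume "x \<le> y"
    then have "max 0 x powr (1 / \<alpha>) \<le> max 0 y powr (1 / \<alpha>)" using alpha by (intro powr_mono2) auto
    then show "- lift f x \<le> - lift f y"
      unfolding lift_def using monotone_onD[OF anti] by simp
  qed
  then have "(\<lambda>x. - lift f x) \<in> borel_measurable borel" by (rule borel_measurable_mono)
  then have "(\<lambda>x. - (- lift f x)) \<in> borel_measurable borel" by (rule borel_measurable_uminus)
  then show "lift f \<in> borel_measurable borel" by simp
qed (use bounds in \<open>auto simp: lift_def\<close>)

text \<open>
  Otherwise all \<open>T j powr \<alpha> * ln (T j)\<close> would vanish, and the drift would be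
  \<open>0\<close>.
\<close>

lemma not_AE_zero_one: "\<not> (AE \<omega> in M. \<forall>j. T j \<omega> \<in> {0, 1})"
proof
  assume "AE \<omega> in M. \<forall>j. T j \<omega> \<in> {0, 1}"
  then have "AE \<omega> in M. (\<Sum>j. T j \<omega> powr \<alpha> * ln (T j \<omega>)) = 0"
  proof eventually_elim
    case (elim \<omega>)
    have "T j \<omega> powr \<alpha> * ln (T j \<omega>) = 0" for j using elim[rule_format, of j] by auto
    then show ?case by (simp only: suminf_zero)
  qed
  then have "(\<integral>\<omega>. (\<Sum>j. T j \<omega> powr \<alpha> * ln (T j \<omega>)) \<partial>M) = (\<integral>\<omega>. 0 \<partial>M)"
    by (rule integral_cong_AE[rotated 2]) measurable
  then show False using log_drift by simp
qed

text \<open>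
  \<open>fixed_point_representation\<close> in the variable \<open>t\<close>.
\<close>

lemma solution_representation:
  assumes "f \<in> solutions_M M T"
  obtains h C where "\<And>t. t > 0 \<Longrightarrow> 0 \<le> h t" "\<And>t. t > 0 \<Longrightarrow> h t \<le> C"
    "\<And>t. t > 0 \<Longrightarrow> f t = sm.phi (h t * t powr \<alpha>)"
    "\<And>t. t > 0 \<Longrightarrow> AE \<omega> in M. \<forall>j. 0 < T j \<omega> \<longrightarrow> h (t * T j \<omega>) = h t"
proof -
  have f: "\<And>t. 0 \<le> t \<Longrightarrow> 0 \<le> f t \<and> f t \<le> 1" "antimono_on {0..} f" "f 0 = 1" "(f \<longlongrightarrow> 1) (at_right 0)"
    and eq: "\<And>t. 0 \<le> t \<Longrightarrow> f t = (\<integral>\<omega>. lim (\<lambda>n. \<Prod>j<n. f (t * T j \<omega>)) \<partial>M)"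
    using assms unfolding solutions_M_def class_M_def mem_Collect_eq by blast+
  have adm: "sm.admissible (lift f)" by (rule admissible_lift[OF f(1,2)])
  have "\<exists>h C. (\<forall>x>0. 0 \<le> h x \<and> h x \<le> C) \<and> (\<forall>x>0. lift f x = sm.phi (x * h x)) \<and>
    (\<forall>x>0. AE b in law. \<forall>j. 0 < b j powr \<alpha> \<longrightarrow> h (x * b j powr \<alpha>) = h x)"
  proof (rule sm.fixed_point_representation[OF adm])
    show "sm.S (lift f) x = lift f x" if "0 < x" for x
      using S_lift[OF adm, of "x powr (1 / \<alpha>)"] eq[of "x powr (1 / \<alpha>)"] that
      by (simp add: powr_alpha_inverse lift_def)
    show "lift f 0 = 1" using alpha by (simp add: lift_def f(3))
    show "lift f x' \<le> lift f x" if "0 < x" "x \<le> x'" for x x'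
      unfolding lift_def using that alpha by (intro monotone_onD[OF f(2)] powr_mono2) auto
    have "filterlim (\<lambda>x. x powr (1 / \<alpha>)) (at_right 0) (at_right 0)"
    proof (rule tendsto_imp_filterlim_at_right)
      show "((\<lambda>x. x powr (1 / \<alpha>)) \<longlongrightarrow> 0) (at_right 0)"
        using alpha by (auto intro!: tendsto_eq_intros simp: eventually_at_right_field)
      show "eventually (\<lambda>x. 0 < x powr (1 / \<alpha>)) (at_right (0::real))"
        by (auto simp: eventually_at_right_field intro!: exI[of _ 1])
    qed
    then have "((\<lambda>x. f (x powr (1 / \<alpha>))) \<longlongrightarrow> 1) (at_right 0)" by (rule filterlim_compose[OF f(4)])
    moreover have "eventually (\<lambda>x. f (x powr (1 / \<alpha>)) = lift f x) (at_right 0)"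
      by (auto simp: eventually_at_right_field lift_def intro!: exI[of _ 1])
    ultimately show "(lift f \<longlongrightarrow> 1) (at_right 0)" by (rule Lim_transform_eventually)
  qed
  then obtain h0 C where h0: "\<And>x. x > 0 \<Longrightarrow> 0 \<le> h0 x \<and> h0 x \<le> C" "\<And>x. x > 0 \<Longrightarrow> lift f x = sm.phi (x * h0 x)"
    "\<And>x. x > 0 \<Longrightarrow> AE b in law. \<forall>j. 0 < b j powr \<alpha> \<longrightarrow> h0 (x * b j powr \<alpha>) = h0 x" by blast
  show thesis
  proof (rule that[of "\<lambda>t. h0 (t powr \<alpha>)" C])
    show "0 \<le> h0 (t powr \<alpha>)" "h0 (t powr \<alpha>) \<le> C" if "t > 0" for t using h0(1)[of "t powr \<alpha>"] that by auto
    show "f t = sm.phi (h0 (t powr \<alpha>) * t powr \<alpha>)" if "t > 0" for t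
      using h0(2)[of "t powr \<alpha>"] that by (simp add: lift_powr mult.commute)
    show "AE \<omega> in M. \<forall>j. 0 < T j \<omega> \<longrightarrow> h0 ((t * T j \<omega>) powr \<alpha>) = h0 (t powr \<alpha>)" if "t > 0" for t
    proof -
      have "AE b in law. \<forall>j. 0 < b j powr \<alpha> \<longrightarrow> h0 (t powr \<alpha> * b j powr \<alpha>) = h0 (t powr \<alpha>)"
        using h0(3)[of "t powr \<alpha>"] that by simp
      then have "AE \<omega> in M. \<forall>j. 0 < T j \<omega> powr \<alpha> \<longrightarrow> h0 (t powr \<alpha> * T j \<omega> powr \<alpha>) = h0 (t powr \<alpha>)"
        unfolding law_def by (rule AE_distrD[OF T_seq_measurable])
      then show ?thesis
        by eventually_elim (use that in \<open>auto simp: powr_mult\<close>)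
    qed
  qed
qed

text \<open>
  \<open>phi_mixture_fixed_point\<close> in the variable \<open>t\<close>. The set
  \<open>V\<close> holds the multipliers under which \<open>h\<close> is known to be invariant;
  as a Borel set it transports from \<open>M\<close> to the law of \<open>T\<close>.
\<close>

lemma mixture_solution:
  assumes h_pos: "\<And>t. 0 \<le> t \<Longrightarrow> 0 < h t" and mono: "mono_on {0..} (\<lambda>t. h t * t powr \<alpha>)"
    and left: "left_cont h" and bound: "\<And>t. t > 0 \<Longrightarrow> h t \<le> C"
    and V [measurable]: "V \<in> sets borel" and AE_V_T: "AE \<omega> in M. \<forall>j. T j \<omega> \<in> V"
    and period: "\<And>v t. v \<in> V \<Longrightarrow> 0 < v \<Longrightarrow> 0 < t \<Longrightarrow> h (t * v) = h t"
    and f: "\<And>t. 0 \<le> t \<Longrightarrow> f t = sm.phi (h t * t powr \<alpha>)"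
  shows "f \<in> solutions_M M T"
proof -
  have arg: "0 \<le> h t * t powr \<alpha>" if "0 \<le> t" for t using h_pos[OF that] by simp
  have bounds: "0 \<le> f t \<and> f t \<le> 1" if "0 \<le> t" for t
    using f[OF that] sm.admissibleD(2,3)[OF sm.admissible_phi] by simp
  have anti: "antimono_on {0..} f"
    by (rule monotone_onI) (use f arg sm.phi_le_iff monotone_onD[OF mono] in auto)
  have zero: "f 0 = 1" using f[of 0] by simp
  have left_f: "left_cont f"
    unfolding left_cont_def
  proof (intro allI impI)
    fix t :: real assume t: "t > 0"
    have "(h \<longlongrightarrow> h t) (at_left t)" using left t by (simp add: left_cont_def continuous_within)
    then have "((\<lambda>s. h s * s powr \<alpha>) \<longlongrightarrow> h t * t powr \<alpha>) (at_left t)"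
      using t by (intro tendsto_intros) auto
    then have "((\<lambda>s. sm.phi (h s * s powr \<alpha>)) \<longlongrightarrow> sm.phi (h t * t powr \<alpha>)) (at_left t)"
      by (rule isCont_tendsto_compose[OF sm.isCont_phi])
    moreover have "eventually (\<lambda>s. sm.phi (h s * s powr \<alpha>) = f s) (at_left t)"
      using t f by (auto simp: eventually_at_left_field intro!: exI[of _ 0])
    ultimately have "(f \<longlongrightarrow> sm.phi (h t * t powr \<alpha>)) (at_left t)" by (rule Lim_transform_eventually)
    then show "continuous (at_left t) f" using f t by (simp add: continuous_within)
  qed
  have lim: "(f \<longlongrightarrow> 1) (at_right 0)"
  proof -
    have pos: "eventually (\<lambda>t::real. 0 < t) (at_right 0)" by (simp add: eventually_at_right_less)
    have "((\<lambda>t. t powr \<alpha>) \<longlongrightarrow> 0 powr \<alpha>) (at_right 0)"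
      using alpha by (intro tendsto_powr' tendsto_ident_at tendsto_const) (auto intro: eventually_mono[OF pos])
    then have "((\<lambda>t. t powr \<alpha>) \<longlongrightarrow> 0) (at_right 0)" by simp
    then have upper: "((\<lambda>t. C * t powr \<alpha>) \<longlongrightarrow> 0) (at_right 0)" by (rule tendsto_mult_right_zero)
    have "((\<lambda>t. h t * t powr \<alpha>) \<longlongrightarrow> 0) (at_right 0)"
    proof (rule tendsto_sandwich[OF _ _ tendsto_const upper])
      show "eventually (\<lambda>t. 0 \<le> h t * t powr \<alpha>) (at_right 0)"
        using pos by eventually_elim (simp add: arg)
      show "eventually (\<lambda>t. h t * t powr \<alpha> \<le> C * t powr \<alpha>) (at_right 0)"
        using pos by eventually_elim (simp add: bound mult_right_mono)
    qed
    then have "((\<lambda>t. sm.phi (h t * t powr \<alpha>)) \<longlongrightarrow> sm.phi 0) (at_right 0)"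
      by (rule isCont_tendsto_compose[OF sm.isCont_phi])
    moreover have "eventually (\<lambda>t. sm.phi (h t * t powr \<alpha>) = f t) (at_right 0)"
      using f by (auto simp: eventually_at_right_field intro!: exI[of _ 1])
    ultimately have "(f \<longlongrightarrow> sm.phi 0) (at_right 0)" by (rule Lim_transform_eventually)
    then show ?thesis by simp
  qed
  have f1: "f 1 = sm.phi (h 1)" using f[of 1] by simp
  have "0 < f 1" unfolding f1 by (rule sm.phi_pos)
  moreover have "f 1 < 1"
    unfolding f1 using sm.phi_strict_antimono[of 0 "h 1"] h_pos[of 1] by (simp del: One_nat_def)
  ultimately have "\<exists>t>0. 0 < f t \<and> f t < 1" by (intro exI[of _ 1]) simp
  with bounds anti left_f zero lim have in_M: "f \<in> class_M"
    unfolding class_M_def mem_Collect_eq by (intro conjI) blast+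
  have adm: "sm.admissible (lift f)" by (rule admissible_lift[OF bounds anti])
  have "f t = (\<integral>\<omega>. lim (\<lambda>n. \<Prod>j<n. f (t * T j \<omega>)) \<partial>M)" if t: "0 \<le> t" for t
  proof (cases "t = 0")
    case True
    then show ?thesis by (simp add: zero prob_space)
  next
    case False
    then have t0: "t > 0" using t by simp
    have AE_V: "AE b in law. \<forall>j. b j \<in> V"
      unfolding law_def by (rule AE_distr_iff[THEN iffD2]) (measurable, rule AE_V_T)
    have "sm.S (lift f) (t powr \<alpha>) = lift f (t powr \<alpha>)"
    proof (rule sm.phi_mixture_fixed_point[OF adm, of "\<lambda>x. h (max 0 x powr (1 / \<alpha>))"])
      show "lift f x = sm.phi (x * h (max 0 x powr (1 / \<alpha>)))" if "0 \<le> x" for x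
        using that f[of "x powr (1 / \<alpha>)"] by (simp add: lift_def powr_alpha_inverse mult.commute)
      show "0 \<le> h (max 0 x powr (1 / \<alpha>))" for x using h_pos[of "max 0 x powr (1 / \<alpha>)"] by simp
      show "0 < t powr \<alpha>" using t0 by simp
      show "AE b in law. \<forall>j. 0 < b j powr \<alpha> \<longrightarrow>
        h (max 0 (t powr \<alpha> * b j powr \<alpha>) powr (1 / \<alpha>)) = h (max 0 (t powr \<alpha>) powr (1 / \<alpha>))"
      proof -
        have AE_nn: "AE b in law. \<forall>j. 0 \<le> b j"
          unfolding law_def by (rule AE_distr_iff[THEN iffD2]) (measurable, auto simp: nonneg)
        show ?thesis using AE_V AE_nn
        proof eventually_elim
          case (elim b)
          show ?case
          proof (intro allI impI)
            fix j assume "0 < b j powr \<alpha>"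
            then have bj: "0 < b j" using elim(2)[rule_format, of j] by (cases "b j = 0") auto
            have "max 0 (t powr \<alpha> * b j powr \<alpha>) powr (1 / \<alpha>) = t * b j"
              using t bj by (simp add: powr_mult[symmetric] powr_alpha_inverse)
            moreover have "max 0 (t powr \<alpha>) powr (1 / \<alpha>) = t" using t by (simp add: powr_alpha_inverse)
            ultimately show "h (max 0 (t powr \<alpha> * b j powr \<alpha>) powr (1 / \<alpha>)) = h (max 0 (t powr \<alpha>) powr (1 / \<alpha>))"
              using period[OF elim(1)[rule_format, of j] bj t0] by simp
          qed
        qed
      qed
    qed
    then show ?thesis using S_lift[OF adm t] by (simp add: lift_powr t)
  qed
  then show ?thesis using in_M by (simp add: solutions_M_def)
qed

section \<open>Periods and the span\<close>

lemma carrier_group_nontrivial: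
  assumes "AE \<omega> in M. \<forall>j. T j \<omega> = 0 \<or> (0 < T j \<omega> \<and> ln (T j \<omega>) \<in> H)"
  shows "H \<noteq> {0}"
proof
  assume H: "H = {0}"
  have "AE \<omega> in M. \<forall>j. T j \<omega> \<in> {0, 1}"
    using assms by eventually_elim (use H in auto)
  then show False using not_AE_zero_one by simp
qed

lemma supported_on_cyclic:
  assumes "AE \<omega> in M. \<forall>j. T j \<omega> = 0 \<or> (0 < T j \<omega> \<and> ln (T j \<omega>) \<in> H)"
    and cyclic: "\<forall>x\<in>H. \<exists>n::int. x = of_int n * c"
  shows "supported_on_powers M T (exp c)"
  unfolding supported_on_powers_def using assms(1)
proof eventually_elim
  case (elim \<omega>)
  show ?case
  proof
    fix j
    show "T j \<omega> \<in> {0} \<union> range (\<lambda>n::int. exp c powi n)"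
      using elim[rule_format, of j] cyclic[rule_format, of "ln (T j \<omega>)"] range_powi_iff[of "exp c" "T j \<omega>"] by auto
  qed
qed

text \<open>
  Let \<open>\<Gamma>\<close> be the intersection of the lattices \<open>{n * ln s | n}\<close>
  over all \<open>s\<close> whose powers support \<open>T\<close>. It lies in the countable
  lattice of \<open>c0\<close>, so only countably many exceptional events occur, and almost
  surely it contains every \<open>ln (T j)\<close> with \<open>T j > 0\<close>. The exponential
  of its generator is the largest base.
\<close>

lemma geometric_exists:
  assumes c0: "1 < c0" "supported_on_powers M T c0"
  shows "\<exists>s. geometric M T s"
proof -
  define \<Gamma> where "\<Gamma> = {y. (\<exists>m::int. y = of_int m * ln c0) \<and>
    (\<forall>s>1. supported_on_powers M T s \<longrightarrow> (\<exists>n::int. y = of_int n * ln s))}"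
  have AE_\<Gamma>: "AE \<omega> in M. \<forall>j. T j \<omega> = 0 \<or> (0 < T j \<omega> \<and> ln (T j \<omega>) \<in> \<Gamma>)"
  proof -
    have "AE \<omega> in M. \<forall>j. T j \<omega> \<noteq> c0 powi m" if "ln (c0 powi m) \<notin> \<Gamma>" for m :: int
    proof -
      have "ln (c0 powi m) = of_int m * ln c0" using c0 by (simp add: powi_eq_exp)
      then obtain s where s: "s > 1" "supported_on_powers M T s" "\<not> (\<exists>n::int. ln (c0 powi m) = of_int n * ln s)"
        using \<open>ln (c0 powi m) \<notin> \<Gamma>\<close> by (auto simp: \<Gamma>_def)
      have "c0 powi m \<notin> {0} \<union> range (\<lambda>n::int. s powi n)"
        using s(1,3) c0 range_powi_iff[of s "c0 powi m"] by (simp add: powi_eq_exp[of c0])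
      from s(2)[unfolded supported_on_powers_def] show ?thesis
        by eventually_elim (use \<open>c0 powi m \<notin> _\<close> in metis)
    qed
    then have "AE \<omega> in M. \<forall>m::int. ln (c0 powi m) \<notin> \<Gamma> \<longrightarrow> (\<forall>j. T j \<omega> \<noteq> c0 powi m)"
      by (subst AE_all_countable) auto
    with c0(2)[unfolded supported_on_powers_def] show ?thesis
    proof eventually_elim
      case (elim \<omega>)
      show ?case
      proof
        fix j
        consider "T j \<omega> = 0" | m :: int where "T j \<omega> = c0 powi m" using elim(1)[rule_format, of j] by auto
        then show "T j \<omega> = 0 \<or> (0 < T j \<omega> \<and> ln (T j \<omega>) \<in> \<Gamma>)"
        proof cases
          case (2 m)
          then have "ln (c0 powi m) \<in> \<Gamma>" using elim(2) by blast
          then show ?thesis using 2 c0 by (simp add: powi_eq_exp)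
        qed simp
      qed
    qed
  qed
  have "0 \<in> \<Gamma>" by (auto simp: \<Gamma>_def intro!: exI[of _ 0])
  moreover have "\<forall>x\<in>\<Gamma>. \<forall>y\<in>\<Gamma>. x - y \<in> \<Gamma>"
  proof (intro ballI, subst \<Gamma>_def, intro CollectI conjI allI impI)
    fix x y assume xy: "x \<in> \<Gamma>" "y \<in> \<Gamma>"
    show "\<exists>m::int. x - y = of_int m * ln c0"
    proof -
      obtain m n :: int where "x = of_int m * ln c0" "y = of_int n * ln c0" using xy by (auto simp: \<Gamma>_def)
      then show ?thesis by (intro exI[of _ "m - n"]) (simp add: algebra_simps)
    qed
    fix s assume s: "(1::real) < s" "supported_on_powers M T s"
    obtain m n :: int where "x = of_int m * ln s" "y = of_int n * ln s"
      using xy s unfolding \<Gamma>_def by blast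
    then show "\<exists>n::int. x - y = of_int n * ln s" by (intro exI[of _ "m - n"]) (simp add: algebra_simps)
  qed
  ultimately show ?thesis
  proof (cases rule: real_additive_group_cases)
    case dense
    obtain x where x: "x \<in> \<Gamma>" "0 < x" "x < ln c0" using dense[rule_format, of "ln c0"] c0 by auto
    obtain m :: int where m: "x = of_int m * ln c0" using x(1) unfolding \<Gamma>_def by blast
    then have "0 < m" "m < 1" using x(2,3) c0 by (auto simp: zero_less_mult_iff)
    then show ?thesis by simp
  next
    case trivial
    then show ?thesis using carrier_group_nontrivial[OF AE_\<Gamma>] by simp
  next
    case (cyclic u)
    have "supported_on_powers M T (exp u)" by (rule supported_on_cyclic[OF AE_\<Gamma> cyclic(3)])
    moreover have "s \<le> exp u" if s: "1 < s" "supported_on_powers M T s" for s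
    proof -
      obtain n :: int where n: "u = of_int n * ln s" using cyclic(2) s unfolding \<Gamma>_def by blast
      then have "0 < n" using cyclic(1) that by (auto simp: zero_less_mult_iff)
      then have "1 * ln s \<le> of_int n * ln s" using that by (intro mult_right_mono) auto
      then have "exp (ln s) \<le> exp u" using n by simp
      then show ?thesis using that by simp
    qed
    ultimately have "geometric M T (exp u)" using cyclic(1) by (auto simp: geometric_def)
    then show ?thesis by blast
  qed
qed

context
  fixes h :: "real \<Rightarrow> real"
  assumes period: "AE \<omega> in M. \<forall>j. 0 < T j \<omega> \<longrightarrow> (\<forall>t>0. h (t * T j \<omega>) = h t)"
begin

definition period_group :: "real set" where
  "period_group = {y. \<forall>t>0. h (t * exp y) = h t}"

lemma period_group_zero: "0 \<in> period_group"
  by (simp add: period_group_def)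

lemma period_group_diff: "\<forall>x\<in>period_group. \<forall>y\<in>period_group. x - y \<in> period_group"
proof (intro ballI)
  fix x y assume x: "x \<in> period_group" and y: "y \<in> period_group"
  have "h (t * exp (x - y)) = h t" if t: "t > 0" for t
  proof -
    have "h (t * exp (x - y)) = h (t * exp (- y) * exp x)" by (simp add: exp_add[symmetric] mult.assoc)
    also have "\<dots> = h (t * exp (- y))" using x t by (simp add: period_group_def)
    also have "\<dots> = h (t * exp (- y) * exp y)" using y t by (simp add: period_group_def)
    also have "\<dots> = h t" by (simp add: mult.assoc exp_add[symmetric])
    finally show ?thesis .
  qed
  then show "x - y \<in> period_group" by (simp add: period_group_def)
qed

lemma AE_period_group: "AE \<omega> in M. \<forall>j. T j \<omega> = 0 \<or> (0 < T j \<omega> \<and> ln (T j \<omega>) \<in> period_group)"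
  using period AE_space
proof eventually_elim
  case (elim \<omega>)
  show ?case
  proof
    fix j
    show "T j \<omega> = 0 \<or> (0 < T j \<omega> \<and> ln (T j \<omega>) \<in> period_group)"
      using elim(1)[rule_format, of j] nonneg[OF elim(2), of j] by (cases "T j \<omega> = 0") (auto simp: period_group_def)
  qed
qed

text \<open>
  The periods of \<open>h\<close> in the lattice of \<open>r\<close> form a group
  \<open>H\<close> that contains almost surely every \<open>ln (T j)\<close> with \<open>T j >
  0\<close>. The exponential of its generator is another base for \<open>T\<close>, so it is at
  most \<open>r\<close>; being an element of the lattice of \<open>r\<close>, it equals
  \<open>r\<close>.
\<close>

lemma geometric_period:
  assumes "geometric M T r" "t > 0"
  shows "h (r * t) = h t"
proof -
  have r: "r > 1" "supported_on_powers M T r" "\<And>s. s > 1 \<Longrightarrow> supported_on_powers M T s \<Longrightarrow> s \<le> r"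
    using assms(1) by (auto simp: geometric_def)
  define H where "H = {y \<in> period_group. \<exists>n::int. y = of_int n * ln r}"
  have AE_H: "AE \<omega> in M. \<forall>j. T j \<omega> = 0 \<or> (0 < T j \<omega> \<and> ln (T j \<omega>) \<in> H)"
    using AE_period_group r(2)[unfolded supported_on_powers_def]
  proof eventually_elim
    case (elim \<omega>)
    show ?case
    proof
      fix j
      show "T j \<omega> = 0 \<or> (0 < T j \<omega> \<and> ln (T j \<omega>) \<in> H)"
        using elim(1)[rule_format, of j] elim(2)[rule_format, of j] range_powi_iff[of r "T j \<omega>"] r(1)
        by (auto simp: H_def)
    qed
  qed
  have "0 \<in> H" using period_group_zero by (auto simp: H_def intro!: exI[of _ 0])
  moreover have "\<forall>x\<in>H. \<forall>y\<in>H. x - y \<in> H"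
  proof (intro ballI)
    fix x y assume xy: "x \<in> H" "y \<in> H"
    obtain m n :: int where "x = of_int m * ln r" "y = of_int n * ln r" using xy by (auto simp: H_def)
    then have "x - y = of_int (m - n) * ln r" by (simp add: algebra_simps)
    moreover have "x - y \<in> period_group" using xy period_group_diff by (simp add: H_def)
    ultimately show "x - y \<in> H" unfolding H_def by blast
  qed
  ultimately have "ln r \<in> period_group"
  proof (cases rule: real_additive_group_cases)
    case dense
    obtain x where x: "x \<in> H" "0 < x" "x < ln r" using dense[rule_format, of "ln r"] r(1) by auto
    obtain m :: int where m: "x = of_int m * ln r" using x(1) unfolding H_def by blast
    then have "0 < m" "m < 1" using x(2,3) r(1) by (auto simp: zero_less_mult_iff)
    then show ?thesis by simp
  next
    case trivial
    then show ?thesis using carrier_group_nontrivial[OF AE_H] by simp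
  next
    case (cyclic c)
    have "supported_on_powers M T (exp c)" by (rule supported_on_cyclic[OF AE_H cyclic(3)])
    then have "exp c \<le> r" using r(3) cyclic(1) by simp
    then have "c \<le> ln r" using r(1) by (simp add: ln_ge_iff)
    moreover have "ln r \<le> c"
    proof -
      obtain n :: int where n: "c = of_int n * ln r" using cyclic(2) by (auto simp: H_def)
      then have "0 < n" using cyclic(1) r(1) by (auto simp: zero_less_mult_iff)
      then have "1 * ln r \<le> of_int n * ln r" using r(1) by (intro mult_right_mono) auto
      then show ?thesis using n by simp
    qed
    ultimately show ?thesis using cyclic(2) by (simp add: H_def)
  qed
  then have "h (t * exp (ln r)) = h t" using assms(2) unfolding period_group_def by blast
  then show ?thesis using r(1) by (simp add: mult.commute)
qed

text \<open>
  A cyclic group of periods would give \<open>T\<close> a span. So the group is dense, the value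
  \<open>h s\<close> is taken at points arbitrarily close to \<open>t\<close> from the left, and
  it equals \<open>h t\<close> by left continuity.
\<close>

lemma nongeometric_constant:
  assumes "\<nexists>s. geometric M T s" and left: "\<And>t. t > 0 \<Longrightarrow> (h \<longlongrightarrow> h t) (at_left t)"
    and t: "t > 0" and s: "s > 0"
  shows "h t = h s"
  using period_group_zero period_group_diff
proof (cases rule: real_additive_group_cases)
  case dense
  have near: "\<exists>v. b < v \<and> v < t \<and> h v = h s" if b: "0 < b" "b < t" for b
  proof -
    define a where "a = ln (b / s)"
    have "0 < ln (t / s) - a" using b s by (simp add: a_def ln_div)
    then obtain x where x: "x \<in> period_group" "0 < x" "x < ln (t / s) - a" using dense by blast
    \<comment> \<open>the first multiple of \<open>x\<close> beyond \<open>a\<close>; as \<open>x\<close> is small, it is still before \<open>ln (t / s)\<close>\<close>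
    define k where "k = \<lfloor>a / x\<rfloor> + 1"
    have k: "a / x < of_int k" "of_int k \<le> a / x + 1" unfolding k_def by linarith+
    then have k': "a < of_int k * x" "of_int k * x \<le> a + x"
      using x(2) by (auto simp: field_simps)
    have nat_mult: "of_nat i * y \<in> period_group" if "y \<in> period_group" for i :: nat and y
    proof (induction i)
      case (Suc i)
      have "of_nat i * y - (0 - y) \<in> period_group"
        using Suc that period_group_zero period_group_diff by blast
      then show ?case by (simp add: algebra_simps)
    qed (simp add: period_group_zero)
    have "of_int k * x \<in> period_group"
    proof (cases "0 \<le> k")
      case True then show ?thesis using nat_mult[OF x(1), of "nat k"] by simp
    next
      case False
      have "0 - x \<in> period_group" using x(1) period_group_zero period_group_diff by blast
      from nat_mult[OF this, of "nat (- k)"] show ?thesis using False by simp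
    qed
    then have "h (s * exp (of_int k * x)) = h s" using s by (simp add: period_group_def)
    moreover have "b < s * exp (of_int k * x)"
    proof -
      have "exp a < exp (of_int k * x)" using k'(1) by simp
      then show ?thesis using b s by (simp add: a_def field_simps)
    qed
    moreover have "s * exp (of_int k * x) < t"
    proof -
      have "of_int k * x < ln (t / s)" using k'(2) x(3) by simp
      then have "exp (of_int k * x) < exp (ln (t / s))" by simp
      then show ?thesis using s t by (simp add: field_simps)
    qed
    ultimately show ?thesis by blast
  qed
  show ?thesis
  proof (rule ccontr)
    assume "h t \<noteq> h s"
    then have "eventually (\<lambda>v. h v \<noteq> h s) (at_left t)"
      by (rule tendsto_imp_eventually_ne[OF left[OF t]])
    then obtain b where b: "b < t" "\<And>v. b < v \<Longrightarrow> v < t \<Longrightarrow> h v \<noteq> h s"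
      by (auto simp: eventually_at_left_field)
    obtain v where "max b (t / 2) < v" "v < t" "h v = h s" using near[of "max b (t / 2)"] b(1) t by fastforce
    then show False using b(2)[of v] by simp
  qed
next
  case trivial
  then show ?thesis using carrier_group_nontrivial[OF AE_period_group] by simp
next
  case (cyclic c)
  have "supported_on_powers M T (exp c)" by (rule supported_on_cyclic[OF AE_period_group cyclic(3)])
  then have "\<exists>s. geometric M T s" using cyclic(1) by (intro geometric_exists[of "exp c"]) auto
  then show ?thesis using assms(1) by blast
qed

end

lemma representation_mono:
  assumes f: "antimono_on {0..} f" and rep: "\<And>t. t > 0 \<Longrightarrow> f t = sm.phi (h t * t powr \<alpha>)"
    and h: "\<And>t. t > 0 \<Longrightarrow> 0 \<le> h t" and st: "0 < s" "s \<le> t"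
  shows "h s * s powr \<alpha> \<le> h t * t powr \<alpha>"
proof -
  have "f t \<le> f s" using monotone_onD[OF f, of s t] st by simp
  then show ?thesis using st h[of s] h[of t] by (simp add: rep sm.phi_le_iff)
qed

text \<open>
  \<open>phi\<close> is strictly decreasing, so left continuity of \<open>f\<close> carries over
  to its argument \<open>h t * t powr \<alpha>\<close>.
\<close>

lemma representation_left_cont:
  assumes f: "antimono_on {0..} f" "left_cont f" and rep: "\<And>t. t > 0 \<Longrightarrow> f t = sm.phi (h t * t powr \<alpha>)"
    and h: "\<And>t. t > 0 \<Longrightarrow> 0 \<le> h t" and t: "t > 0"
  shows "(h \<longlongrightarrow> h t) (at_left t)"
proof -
  have pos: "eventually (\<lambda>s. 0 < s \<and> s < t) (at_left t)"
    using t by (auto simp: eventually_at_left_field intro!: exI[of _ 0])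
  have lim: "(f \<longlongrightarrow> f t) (at_left t)" using f(2) t by (simp add: left_cont_def continuous_within)
  have "((\<lambda>s. h s * s powr \<alpha>) \<longlongrightarrow> h t * t powr \<alpha>) (at_left t)"
  proof (rule order_tendstoI)
    fix a assume a: "a < h t * t powr \<alpha>"
    show "eventually (\<lambda>s. a < h s * s powr \<alpha>) (at_left t)"
    proof (cases "a < 0")
      case True
      show ?thesis using pos
      proof eventually_elim
        case (elim s)
        then have "0 \<le> h s * s powr \<alpha>" using h[of s] by simp
        then show ?case using True by simp
      qed
    next
      case False
      then have "f t < sm.phi a" using a t by (simp add: rep sm.phi_strict_antimono)
      then have "eventually (\<lambda>s. f s < sm.phi a) (at_left t)" by (rule order_tendstoD(2)[OF lim])
      with pos show ?thesis
      proof eventually_elim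
        case (elim s)
        have "\<not> h s * s powr \<alpha> \<le> a"
        proof
          assume "h s * s powr \<alpha> \<le> a"
          then have "sm.phi a \<le> sm.phi (h s * s powr \<alpha>)"
            using elim h[of s] False by (subst sm.phi_le_iff) auto
          then show False using elim by (simp add: rep)
        qed
        then show ?case by simp
      qed
    qed
  next
    fix a assume a: "h t * t powr \<alpha> < a"
    show "eventually (\<lambda>s. h s * s powr \<alpha> < a) (at_left t)"
      using pos
    proof eventually_elim
      case (elim s)
      then have "h s * s powr \<alpha> \<le> h t * t powr \<alpha>"
        by (intro representation_mono[OF f(1)]) (auto intro: rep h)
      then show ?case using a by simp
    qed
  qed
  then have "((\<lambda>s. h s * s powr \<alpha> / s powr \<alpha>) \<longlongrightarrow> h t * t powr \<alpha> / t powr \<alpha>) (at_left t)"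
    by (rule tendsto_divide) (use t in \<open>auto intro!: tendsto_intros\<close>)
  moreover have "eventually (\<lambda>s. h s * s powr \<alpha> / s powr \<alpha> = h s) (at_left t)"
    using pos by eventually_elim simp
  ultimately have "(h \<longlongrightarrow> h t * t powr \<alpha> / t powr \<alpha>) (at_left t)" by (rule Lim_transform_eventually)
  then show ?thesis using t by simp
qed

text \<open>
  The exceptional event may depend on \<open>t\<close>. It can be chosen once for all positive
  rational numbers, and left continuity extends the period to all \<open>t\<close>.
\<close>

lemma period_all_t:
  fixes h :: "real \<Rightarrow> real"
  assumes left: "\<And>t. t > 0 \<Longrightarrow> (h \<longlongrightarrow> h t) (at_left t)"
    and ae: "\<And>t. t > 0 \<Longrightarrow> AE \<omega> in M. \<forall>j. 0 < T j \<omega> \<longrightarrow> h (t * T j \<omega>) = h t"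
  shows "AE \<omega> in M. \<forall>j. 0 < T j \<omega> \<longrightarrow> (\<forall>t>0. h (t * T j \<omega>) = h t)"
proof -
  have "AE \<omega> in M. \<forall>q\<in>{q\<in>\<rat>. q > 0}. \<forall>j. 0 < T j \<omega> \<longrightarrow> h (q * T j \<omega>) = h q"
    by (subst AE_ball_countable) (auto intro: countable_subset[OF _ countable_rat] ae)
  then show ?thesis
  proof eventually_elim
    case (elim \<omega>)
    show ?case
    proof (intro allI impI)
      fix j and t :: real assume x: "0 < T j \<omega>" and t: "0 < t"
      let ?x = "T j \<omega>"
      have "filterlim (\<lambda>s. s * ?x) (at_left (t * ?x)) (at_left t)"
      proof (rule tendsto_imp_filterlim_at_left)
        show "((\<lambda>s. s * ?x) \<longlongrightarrow> t * ?x) (at_left t)" by (intro tendsto_intros)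
        show "eventually (\<lambda>s. s * ?x < t * ?x) (at_left t)"
          using x by (auto simp: eventually_at_left_field intro!: exI[of _ "t - 1"])
      qed
      then have "((\<lambda>s. h (s * ?x)) \<longlongrightarrow> h (t * ?x)) (at_left t)"
        using left[of "t * ?x"] x t filterlim_compose[of h "nhds (h (t * ?x))" "at_left (t * ?x)" "\<lambda>s. s * ?x" "at_left t"]
        by simp
      then have lim: "((\<lambda>s. h (s * ?x) - h s) \<longlongrightarrow> h (t * ?x) - h t) (at_left t)"
        by (intro tendsto_diff left t)
      show "h (t * ?x) = h t"
      proof (rule ccontr)
        assume "h (t * ?x) \<noteq> h t"
        then have "h (t * ?x) - h t \<noteq> 0" by simp
        then have "eventually (\<lambda>s. h (s * ?x) - h s \<noteq> 0) (at_left t)"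
          by (rule tendsto_imp_eventually_ne[OF lim])
        then obtain b where b: "b < t" "\<And>s. b < s \<Longrightarrow> s < t \<Longrightarrow> h (s * ?x) \<noteq> h s"
          by (auto simp: eventually_at_left_field)
        obtain q where q: "q \<in> \<rat>" "max b 0 < q" "q < t" using Rats_dense_in_real[of "max b 0" t] b(1) t by auto
        then show False using elim x b(2)[of q] by auto
      qed
    qed
  qed
qed

lemma period_nat_pow: "(\<And>t. t > 0 \<Longrightarrow> h (r * t) = h t) \<Longrightarrow> 0 < r \<Longrightarrow> t > 0 \<Longrightarrow> h (r ^ n * t) = h t"
  for h :: "real \<Rightarrow> real"
proof (induction n)
  case (Suc n)
  have "h (r ^ Suc n * t) = h (r * (r ^ n * t))" by (simp add: mult.assoc)
  also have "\<dots> = h (r ^ n * t)" using Suc.prems by simp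
  finally show ?case using Suc by simp
qed simp

lemma period_powi:
  fixes h :: "real \<Rightarrow> real"
  assumes p: "\<And>t. t > 0 \<Longrightarrow> h (r * t) = h t" and r: "0 < r" and t: "t > 0"
  shows "h (r powi n * t) = h t"
proof (cases "0 \<le> n")
  case True
  then show ?thesis using period_nat_pow[of h r t "nat n"] p r t by (simp add: power_int_def)
next
  case False
  have "h (r powi n * t) = h (r ^ nat (- n) * (r powi n * t))"
    using period_nat_pow[of h r "r powi n * t" "nat (- n)"] p r t by simp
  also have "r ^ nat (- n) * (r powi n * t) = t"
    using False r by (simp add: power_int_def field_simps)
  finally show ?thesis .
qed

text \<open>
  The representation determines \<open>h\<close> on the positive numbers only, where it is
  positive because some value is, and because \<open>h\<close> is periodic with \<open>h t * t
  powr \<alpha>\<close> nondecreasing.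
\<close>

lemma solution_in_class_H:
  assumes span: "has_span M T r" and f: "f \<in> solutions_M M T"
  shows "\<exists>h\<in>class_H \<alpha> r. left_cont h \<and> (\<forall>t\<ge>0. f t = sm.phi (h t * t powr \<alpha>))"
proof -
  obtain h C where h: "\<And>t. t > 0 \<Longrightarrow> 0 \<le> h t" "\<And>t. t > 0 \<Longrightarrow> h t \<le> C"
    "\<And>t. t > 0 \<Longrightarrow> f t = sm.phi (h t * t powr \<alpha>)"
    "\<And>t. t > 0 \<Longrightarrow> AE \<omega> in M. \<forall>j. 0 < T j \<omega> \<longrightarrow> h (t * T j \<omega>) = h t"
    by (rule solution_representation[OF f]) blast
  have fM: "antimono_on {0..} f" "left_cont f" "f 0 = 1" and ex: "\<exists>t>0. 0 < f t \<and> f t < 1"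
    using f by (auto simp: solutions_M_def class_M_def)
  have mono: "h s * s powr \<alpha> \<le> h t * t powr \<alpha>" if "0 < s" "s \<le> t" for s t
    using that by (intro representation_mono[OF fM(1)]) (auto intro: h(1,3))
  have left: "(h \<longlongrightarrow> h t) (at_left t)" if "t > 0" for t
    using that by (intro representation_left_cont[OF fM(1,2)]) (auto intro: h(1,3))
  have period: "AE \<omega> in M. \<forall>j. 0 < T j \<omega> \<longrightarrow> (\<forall>t>0. h (t * T j \<omega>) = h t)"
    using left h(4) by (rule period_all_t)
  obtain t1 where t1: "t1 > 0" "f t1 < 1" using ex by blast
  have "h t1 \<noteq> 0" using h(3)[OF t1(1)] t1(2) by auto
  then have h_t1: "0 < h t1" using h(1)[OF t1(1)] by simp
  show ?thesis
  proof (cases "r = 1")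
    case True
    have nongeo: "\<nexists>s. geometric M T s" using span True by (auto simp: has_span_def geometric_def)
    have const: "h t = h t1" if "t > 0" for t
      by (rule nongeometric_constant[OF period nongeo left that t1(1)])
    show ?thesis
    proof (intro bexI[of _ "\<lambda>_. h t1"] conjI allI impI)
      show "(\<lambda>_. h t1) \<in> class_H \<alpha> r" using True h_t1 by (auto simp: class_H_def)
      show "left_cont (\<lambda>_. h t1)" by (simp add: left_cont_def)
      show "f t = sm.phi (h t1 * t powr \<alpha>)" if "0 \<le> t" for t
        using h(3)[of t] const[of t] that fM(3) by (cases "t = 0") auto
    qed
  next
    case False
    then have geo: "geometric M T r" using span by (auto simp: has_span_def)
    then have r: "r > 1" by (simp add: geometric_def)
    have per: "h (r * t) = h t" if "t > 0" for t by (rule geometric_period[OF period geo that])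
    have h_pos: "0 < h t" if t: "t > 0" for t
    proof -
      obtain n where n: "t1 / t < r ^ n" using real_arch_pow[OF r] by blast
      then have "t1 \<le> r ^ n * t" using t by (simp add: field_simps)
      then have "h t1 * t1 powr \<alpha> \<le> h (r ^ n * t) * (r ^ n * t) powr \<alpha>" using t1(1) by (intro mono)
      moreover have "0 < h t1 * t1 powr \<alpha>" using h_t1 t1(1) by simp
      ultimately have "0 < h (r ^ n * t) * (r ^ n * t) powr \<alpha>" by linarith
      then have "h (r ^ n * t) \<noteq> 0" by auto
      moreover have "h (r ^ n * t) = h t" using r t by (intro period_nat_pow per) auto
      ultimately show ?thesis using h(1)[OF t] by simp
    qed
    \<comment> \<open>the value at \<open>0\<close> is multiplied by \<open>0 powr \<alpha> = 0\<close>; any positive number will do\<close>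
    define h' where "h' t = (if t > 0 then h t else 1)" for t
    show ?thesis
    proof (intro bexI[of _ h'] conjI allI impI)
      have "mono_on {0..} (\<lambda>t. h' t * t powr \<alpha>)"
      proof (rule mono_onI)
        fix s t :: real assume "s \<in> {0..}" "t \<in> {0..}" "s \<le> t"
        then show "h' s * s powr \<alpha> \<le> h' t * t powr \<alpha>"
          using mono[of s t] h(1)[of t] by (auto simp: h'_def)
      qed
      moreover have "h' t > 0 \<and> h' (r * t) = h' t" if "0 \<le> t" for t
        using that h_pos per r by (auto simp: h'_def zero_less_mult_iff)
      ultimately show "h' \<in> class_H \<alpha> r" using False by (simp add: class_H_def)
      show "left_cont h'"
        unfolding left_cont_def
      proof (intro allI impI)
        fix t :: real assume t: "t > 0"
        have "eventually (\<lambda>s. h s = h' s) (at_left t)"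
          using t by (auto simp: eventually_at_left_field h'_def intro!: exI[of _ 0])
        then have "(h' \<longlongrightarrow> h t) (at_left t)" by (rule Lim_transform_eventually[OF left[OF t]])
        then show "continuous (at_left t) h'" using t by (simp add: continuous_within h'_def)
      qed
      show "f t = sm.phi (h' t * t powr \<alpha>)" if "0 \<le> t" for t
        using h(3)[of t] that fM(3) by (cases "t = 0") (auto simp: h'_def)
    qed
  qed
qed

lemma class_H_facts:
  assumes h: "h \<in> class_H \<alpha> r" and r: "1 \<le> r"
  shows "\<And>t. 0 \<le> t \<Longrightarrow> 0 < h t" "mono_on {0..} (\<lambda>t. h t * t powr \<alpha>)"
    "\<exists>C. \<forall>t>0. h t \<le> C" "\<And>t. t > 0 \<Longrightarrow> h (r * t) = h t"
proof -
  show pos: "0 < h t" if "0 \<le> t" for t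
    using h that by (auto simp: class_H_def split: if_splits)
  show mono: "mono_on {0..} (\<lambda>t. h t * t powr \<alpha>)"
  proof (cases "r = 1")
    case True
    then obtain c where "c > 0" "\<And>t. t \<ge> 0 \<Longrightarrow> h t = c" using h by (auto simp: class_H_def)
    then show ?thesis using alpha by (auto intro!: mono_onI mult_left_mono powr_mono2)
  qed (use h in \<open>auto simp: class_H_def\<close>)
  show per: "h (r * t) = h t" if "t > 0" for t
    using h that by (auto simp: class_H_def split: if_splits)
  show "\<exists>C. \<forall>t>0. h t \<le> C"
  proof (cases "r = 1")
    case True
    then show ?thesis using h by (auto simp: class_H_def)
  next
    case False
    then have r1: "r > 1" using r by simp
    \<comment> \<open>a power of \<open>r\<close> moves \<open>t\<close> into \<open>[1, r]\<close>\<close>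
    have "h t \<le> h r * r powr \<alpha>" if t: "t > 0" for t
    proof -
      define n where "n = - \<lfloor>ln t / ln r\<rfloor>"
      define s where "s = r powi n * t"
      have "of_int \<lfloor>ln t / ln r\<rfloor> \<le> ln t / ln r" "ln t / ln r < of_int \<lfloor>ln t / ln r\<rfloor> + 1" by linarith+
      moreover have "0 < ln r" using r1 by simp
      ultimately have "of_int \<lfloor>ln t / ln r\<rfloor> * ln r \<le> ln t" "ln t < (of_int \<lfloor>ln t / ln r\<rfloor> + 1) * ln r"
        by (simp_all only: pos_le_divide_eq pos_divide_less_eq)
      then have "0 \<le> of_int n * ln r + ln t" "of_int n * ln r + ln t \<le> ln r"
        by (auto simp: n_def algebra_simps)
      moreover have "s = exp (of_int n * ln r + ln t)" using r1 t by (simp add: s_def powi_eq_exp exp_add)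
      ultimately have s: "1 \<le> s" "s \<le> r"
        using r1 exp_le_cancel_iff[of "of_int n * ln r + ln t" "ln r"] by simp_all
      have "h t = h s" unfolding s_def using r1 t by (intro period_powi[symmetric] per) auto
      also have "\<dots> \<le> h s * s powr \<alpha>"
        using s(1) pos[of s] alpha by (simp add: ge_one_powr_ge_zero)
      also have "\<dots> \<le> h r * r powr \<alpha>"
        using monotone_onD[OF mono, of s r] s r1 by simp
      finally show ?thesis .
    qed
    then show ?thesis by blast
  qed
qed

lemma class_H_solution:
  assumes span: "has_span M T r" and h: "h \<in> class_H \<alpha> r" "left_cont h"
    and f: "\<And>t. 0 \<le> t \<Longrightarrow> f t = sm.phi (h t * t powr \<alpha>)"
  shows "f \<in> solutions_M M T"
proof -
  have r: "1 \<le> r" using span by (auto simp: has_span_def geometric_def)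
  note hf = class_H_facts[OF h(1) r]
  obtain C where C: "\<And>t. t > 0 \<Longrightarrow> h t \<le> C" using hf(3) by blast
  show ?thesis
  proof (cases "r = 1")
    case True
    show ?thesis
    proof (rule mixture_solution[OF hf(1,2) h(2) C, of UNIV])
      show "h (t * v) = h t" if "0 < v" "0 < t" for v t
        using h(1) True that by (auto simp: class_H_def)
    qed (use f in auto)
  next
    case False
    then have supp: "supported_on_powers M T r" using span by (auto simp: has_span_def geometric_def)
    show ?thesis
    proof (rule mixture_solution[OF hf(1,2) h(2) C, of "{0} \<union> range (\<lambda>n::int. r powi n)"])
      show "{0} \<union> range (\<lambda>n::int. r powi n) \<in> sets borel"
        by (rule sets.countable) auto
      show "AE \<omega> in M. \<forall>j. T j \<omega> \<in> {0} \<union> range (\<lambda>n::int. r powi n)"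
        using supp by (simp add: supported_on_powers_def)
      show "h (t * v) = h t" if v: "v \<in> {0} \<union> range (\<lambda>n::int. r powi n)" "0 < v" and t: "0 < t" for v t
      proof -
        obtain n :: int where "v = r powi n" using v by auto
        then show ?thesis using period_powi[of h r t n] hf(4) r t by (simp add: mult.commute)
      qed
    qed (use f in auto)
  qed
qed

section \<open>Solutions that are Laplace transforms\<close>

text \<open>
  By concavity \<open>1 - f s\<close> is at least a constant times \<open>s\<close> for small
  \<open>s\<close>, whereas the representation bounds it by \<open>C * s powr \<alpha>\<close>,
  which is of smaller order if \<open>\<alpha> > 1\<close>.
\<close>

lemma Laplace_exponent_le_1:
  assumes f: "f \<in> class_L" and rep: "\<And>t. t > 0 \<Longrightarrow> f t = sm.phi (h t * t powr \<alpha>)"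
    and h: "\<And>t. t > 0 \<Longrightarrow> 0 \<le> h t" "\<And>t. t > 0 \<Longrightarrow> h t \<le> C"
  shows "\<alpha> \<le> 1"
proof (rule ccontr)
  assume "\<not> \<alpha> \<le> 1"
  then have a: "0 < \<alpha> - 1" by simp
  obtain \<mu> where \<mu>: "real_distribution \<mu>" "AE x in \<mu>. 0 \<le> x" and f_eq: "\<And>t. t \<ge> 0 \<Longrightarrow> f t = (\<integral>x. exp (- t * x) \<partial>\<mu>)"
    using f by (auto simp: class_L_def)
  interpret \<mu>: real_distribution \<mu> by fact
  obtain t0 where t0: "t0 > 0" "f t0 < 1" using f by (auto simp: class_L_def class_M_def)
  have int: "integrable \<mu> (\<lambda>x. exp (- t * x))" if "t \<ge> 0" for t
  proof (rule \<mu>.integrable_const_bound[where B=1])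
    show "AE x in \<mu>. norm (exp (- t * x)) \<le> 1" using \<mu>(2) by eventually_elim (use that in simp)
  qed simp
  have lower: "s * (1 - f t0) \<le> t0 * (1 - f s)" if s: "0 < s" "s \<le> t0" for s
  proof -
    have "s * (1 - f t0) = (\<integral>x. s * (1 - exp (- (t0 * x))) \<partial>\<mu>)"
      using int[of t0] t0 \<mu>.prob_space by (simp add: f_eq del: \<mu>.space_eq_univ)
    also have "\<dots> \<le> (\<integral>x. t0 * (1 - exp (- (s * x))) \<partial>\<mu>)"
      using int[of t0] int[of s] s t0 by (intro integral_mono one_minus_exp_slope_antimono) auto
    also have "\<dots> = t0 * (1 - f s)" using int[of s] s \<mu>.prob_space by (simp add: f_eq del: \<mu>.space_eq_univ)
    finally show ?thesis .
  qed
  have C: "0 \<le> C" using h[of 1] by simp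
  have upper: "1 - f s \<le> C * s powr \<alpha>" if "s > 0" for s
  proof -
    have "1 - f s \<le> h s * s powr \<alpha>" unfolding rep[OF that] using h[OF that] by (intro sm.one_minus_phi_le) simp
    also have "\<dots> \<le> C * s powr \<alpha>" using h[OF that] by (intro mult_right_mono) auto
    finally show ?thesis .
  qed
  have "1 - f t0 \<le> t0 * C * s powr (\<alpha> - 1)" if s: "0 < s" "s \<le> t0" for s
  proof -
    have "s * (1 - f t0) \<le> t0 * (C * s powr \<alpha>)"
      by (rule order_trans[OF lower[OF s]]) (use upper[OF s(1)] t0 in \<open>simp add: mult_left_mono\<close>)
    also have "s powr \<alpha> = s * s powr (\<alpha> - 1)" using s by (simp add: powr_diff)
    finally show ?thesis using s by (simp add: mult_ac)
  qed
  moreover have "((\<lambda>s. t0 * C * s powr (\<alpha> - 1)) \<longlongrightarrow> 0) (at_right 0)"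
  proof -
    have pos: "eventually (\<lambda>t::real. 0 \<le> t) (at_right 0)"
      by (rule eventually_mono[OF eventually_at_right_less]) simp
    have "((\<lambda>s. s powr (\<alpha> - 1)) \<longlongrightarrow> 0 powr (\<alpha> - 1)) (at_right 0)"
      using a pos by (intro tendsto_powr' tendsto_ident_at tendsto_const) auto
    then have "((\<lambda>s. s powr (\<alpha> - 1)) \<longlongrightarrow> 0) (at_right 0)" by simp
    then show ?thesis by (rule tendsto_mult_right_zero)
  qed
  ultimately have "1 - f t0 \<le> 0"
    by (intro tendsto_lowerbound) (auto simp: eventually_at_right_field t0 intro!: exI[of _ t0])
  then show False using t0 by simp
qed

text \<open>
  Along \<open>a n = 1 / r ^ n\<close> the factor \<open>h\<close> does not change, and
  \<open>phi\<close> has slope \<open>1\<close> at \<open>0\<close>. Hence \<open>h t * t powr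
  \<alpha>\<close> is the limit of the functions \<open>(1 - f (a n * t)) / a n powr
  \<alpha>\<close>, which are Bernstein functions because \<open>f\<close> is completely
  monotone.
\<close>

lemma Laplace_solution_in_class_P:
  assumes f: "f \<in> class_L" and h: "h \<in> class_H \<alpha> r" and r: "1 \<le> r"
    and rep: "\<And>t. 0 \<le> t \<Longrightarrow> f t = sm.phi (h t * t powr \<alpha>)"
  shows "h \<in> class_P \<alpha> r"
proof (cases "r = 1")
  case False
  then have r1: "r > 1" using r by simp
  note hf = class_H_facts[OF h r]
  obtain \<mu> where \<mu>: "real_distribution \<mu>" "AE x in \<mu>. 0 \<le> x" and f_eq: "\<And>t. t \<ge> 0 \<Longrightarrow> f t = (\<integral>x. exp (- t * x) \<partial>\<mu>)"
    using f by (auto simp: class_L_def)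
  interpret \<mu>: real_distribution \<mu> by fact
  have "completely_monotone (\<lambda>t. \<integral>x. exp (- (t * x)) \<partial>\<mu>)"
    by (rule completely_monotone_Laplace[OF \<mu>.prob_space_axioms]) (use \<mu> in auto)
  then have cm: "completely_monotone f"
    by (subst completely_monotone_cong[of f "\<lambda>t. \<integral>x. exp (- (t * x)) \<partial>\<mu>"]) (use f_eq in auto)
  note d = completely_monotone_imp_deriv[OF cm]
  define a where "a n = r powi (- int n)" for n :: nat
  have a: "0 < a n" for n using r1 by (simp add: a_def)
  define c where "c n = a n powr (- \<alpha>)" for n
  have c: "0 < c n" for n using a[of n] by (simp add: c_def)
  have "\<exists>l'. completely_monotone l' \<and> (\<forall>t>0. ((\<lambda>t. t powr \<alpha> * h t) has_real_derivative l' t) (at t))"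
  proof (rule Bernstein_function_limit[where u="\<lambda>n t. c n * (1 - f (a n * t))" and g="\<lambda>n t. c n * a n * (- deriv f (a n * t))"])
    show "completely_monotone (\<lambda>t. c n * a n * (- deriv f (a n * t)))" for n
      using a[of n] c[of n]
      by (intro completely_monotone_mult completely_monotone_const completely_monotone_scale[OF d(1)]) auto
    show "((\<lambda>t. c n * (1 - f (a n * t))) has_real_derivative c n * a n * (- deriv f (a n * t))) (at t)" if "t > 0" for n t
    proof -
      have "((\<lambda>t. f (a n * t)) has_real_derivative deriv f (a n * t) * a n) (at t)"
        by (rule DERIV_chain2[where f=f and g="\<lambda>t. a n * t"])
           (use d(2)[of "a n * t"] a[of n] that DERIV_cmult_Id in auto)
      then have "((\<lambda>t. c n * (1 - f (a n * t))) has_real_derivative c n * (0 - deriv f (a n * t) * a n)) (at t)"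
        by (intro DERIV_cmult DERIV_diff DERIV_const)
      then show ?thesis by (simp add: mult_ac)
    qed
    show "0 \<le> c n * (1 - f (a n * t))" if "t > 0" for n t
      using c[of n] rep[of "a n * t"] sm.admissibleD(3)[OF sm.admissible_phi] a[of n] that by simp
    show "(\<lambda>n. c n * (1 - f (a n * t))) \<longlonglongrightarrow> t powr \<alpha> * h t" if t: "t > 0" for t
    proof -
      define x where "x = h t * t powr \<alpha>"
      have x: "0 < x" using hf(1)[of t] t by (simp add: x_def)
      have arg: "h (a n * t) * (a n * t) powr \<alpha> = x * a n powr \<alpha>" for n
      proof -
        have "h (a n * t) = h t" unfolding a_def using r1 t hf(4) by (intro period_powi) auto
        then show ?thesis using a[of n] t by (simp add: x_def powr_mult)
      qed
      define y where "y n = - ln (x * a n powr \<alpha>)" for n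
      have e: "exp (- y n) = x * a n powr \<alpha>" "exp (y n) = c n / x" for n
        using x a[of n] by (simp_all add: y_def c_def exp_minus powr_minus field_simps)
      have eq: "c n * (1 - f (a n * t)) = x * sm.slope (y n)" for n
        unfolding sm.slope_def e using rep[of "a n * t"] a[of n] t x by (simp add: arg)
      have y_eq: "y n = - ln x + \<alpha> * (real n * ln r)" for n
        using x a[of n] r1 by (simp add: y_def ln_mult ln_powr a_def powi_eq_exp)
      have "(\<lambda>n. sm.slope (y n)) \<longlonglongrightarrow> 1"
      proof (rule order_tendstoI)
        fix b :: real assume "b < 1"
        then obtain y0 where y0: "\<And>v. y0 \<le> v \<Longrightarrow> 1 - (1 - b) / 2 \<le> sm.slope v"
          using sm.slope_tendsto_1[of "(1 - b) / 2"] by auto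
        have "0 < \<alpha> * ln r" using alpha r1 by simp
        then obtain N :: nat where N: "y0 + ln x < real N * (\<alpha> * ln r)" using reals_Archimedean3 by blast
        show "eventually (\<lambda>n. b < sm.slope (y n)) sequentially"
        proof (rule eventually_sequentiallyI[of N])
          fix n assume "N \<le> n"
          then have "real N * (\<alpha> * ln r) \<le> real n * (\<alpha> * ln r)"
            using \<open>0 < \<alpha> * ln r\<close> by (intro mult_right_mono) auto
          then have "y0 \<le> y n" using N by (simp add: y_eq mult_ac)
          from y0[OF this] show "b < sm.slope (y n)" using \<open>b < 1\<close> by (simp add: field_simps)
        qed
      next
        fix b :: real assume "1 < b"
        then show "eventually (\<lambda>n. sm.slope (y n) < b) sequentially"
          using sm.slope_le_1 by (intro always_eventually allI) (rule le_less_trans)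
      qed
      then have "(\<lambda>n. x * sm.slope (y n)) \<longlonglongrightarrow> x * 1" by (intro tendsto_mult tendsto_const)
      then show ?thesis unfolding eq by (simp add: x_def mult.commute)
    qed
  qed
  then show ?thesis using h False by (simp add: class_P_def)
qed (use h in \<open>simp add: class_P_def\<close>)

text \<open>
  For each \<open>w \<ge> 0\<close> the function \<open>exp (- (w * (h t * t powr
  \<alpha>)))\<close> is completely monotone, hence so is the mixture \<open>f\<close>. For
  \<open>r = 1\<close> the Bernstein function is a multiple of \<open>t powr \<alpha>\<close>,
  and this is where \<open>\<alpha> \<le> 1\<close> enters.
\<close>

lemma class_P_Laplace:
  assumes h: "h \<in> class_P \<alpha> r" and r: "1 \<le> r" and \<alpha>: "\<alpha> \<le> 1"
    and rep: "\<And>t. 0 \<le> t \<Longrightarrow> f t = (\<integral>\<omega>. exp (- (h t * t powr \<alpha> * Wlim TT \<alpha> \<omega>)) \<partial>M)"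
    and f: "f \<in> class_M"
  shows "f \<in> class_L"
proof -
  have hH: "h \<in> class_H \<alpha> r" using h by (auto simp: class_P_def split: if_splits)
  have "\<exists>g. completely_monotone g \<and> (\<forall>t>0. ((\<lambda>t. h t * t powr \<alpha>) has_real_derivative g t) (at t))"
  proof (cases "r = 1")
    case True
    then obtain c where c: "c > 0" "\<And>t. t \<ge> 0 \<Longrightarrow> h t = c" using hH by (auto simp: class_H_def)
    have "completely_monotone (\<lambda>t. c * \<alpha> * t powr (\<alpha> - 1))"
      using c alpha \<alpha> by (intro completely_monotone_powr) auto
    moreover have "((\<lambda>t. h t * t powr \<alpha>) has_real_derivative c * \<alpha> * t powr (\<alpha> - 1)) (at t)" if "t > 0" for t
      by (subst has_real_derivative_cong_pos[of _ "\<lambda>t. c * t powr \<alpha>"])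
         (use c that in \<open>auto intro!: derivative_eq_intros\<close>)
    ultimately show ?thesis by blast
  next
    case False
    then show ?thesis using h by (simp add: class_P_def mult.commute)
  qed
  then obtain g where g: "completely_monotone g" "\<And>t. t > 0 \<Longrightarrow> ((\<lambda>t. h t * t powr \<alpha>) has_real_derivative g t) (at t)"
    by blast
  have "completely_monotone (\<lambda>t. \<integral>\<omega>. exp (- (h t * t powr \<alpha> * Wlim TT \<alpha> \<omega>)) \<partial>M)"
  proof (rule completely_monotone_mixture[OF prob_space_axioms Wlim_measurable AE_Wlim_nonneg])
    show "0 \<le> h t * t powr \<alpha>" if "t > 0" for t using class_H_facts(1)[OF hH r, of t] that by simp
    show "completely_monotone (\<lambda>t. exp (- (w * (h t * t powr \<alpha>))))" if "0 \<le> w" for w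
      by (rule completely_monotone_exp_Bernstein[OF g(1) that g(2)])
  qed
  then have "completely_monotone f"
    by (subst completely_monotone_cong[of f "\<lambda>t. \<integral>\<omega>. exp (- (h t * t powr \<alpha> * Wlim TT \<alpha> \<omega>)) \<partial>M"]) (use rep in auto)
  moreover have "(f \<longlongrightarrow> 1) (at_right 0)" "f 0 = 1" using f by (auto simp: class_M_def)
  ultimately obtain \<mu> where \<mu>: "real_distribution \<mu>" "AE x in \<mu>. 0 \<le> x" "\<And>t. t > 0 \<Longrightarrow> f t = (\<integral>x. exp (- t * x) \<partial>\<mu>)"
    using Bernstein_Widder[of f] by blast
  interpret \<mu>: real_distribution \<mu> by fact
  have "f t = (\<integral>x. exp (- t * x) \<partial>\<mu>)" if "0 \<le> t" for t
    using that \<mu>(3)[of t] \<open>f 0 = 1\<close> \<mu>.prob_space by (cases "t = 0") auto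
  then show ?thesis using f \<mu>(1,2) by (auto simp: class_L_def)
qed

end

section \<open>The two characterisations\<close>

theorem theorem1p2:
  fixes M :: "'a measure"
    and T :: "nat \<Rightarrow> 'a \<Rightarrow> real"
    and TT :: "nat list \<Rightarrow> nat \<Rightarrow> 'a \<Rightarrow> real"
    and \<alpha> r :: real
  assumes prob: "prob_space M"
    and rv: "\<And>j. T j \<in> borel_measurable M"
    and nonneg: "\<And>j \<omega>. \<omega> \<in> space M \<Longrightarrow> 0 \<le> T j \<omega>"
    and noninc: "AE \<omega> in M. decseq (\<lambda>j. T j \<omega>)"
    and null: "AE \<omega> in M. (\<lambda>j. T j \<omega>) \<longlonglongrightarrow> 0"
    and alpha: "\<alpha> > 0"
    and copies: "iid_copies M T TT"
    and i: "(\<integral>\<^sup>+\<omega>. (\<Sum>j. indicator {\<omega>. T j \<omega> > 0} \<omega>) \<partial>M) > 1"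
    and ii: "(\<integral>\<^sup>+\<omega>. (\<Sum>j. ennreal (T j \<omega> powr \<alpha>)) \<partial>M) = 1"
    and iii: "AE \<omega> in M. summable (\<lambda>j. T j \<omega> powr \<alpha> * ln (T j \<omega>))"
      "integrable M (\<lambda>\<omega>. \<Sum>j. T j \<omega> powr \<alpha> * ln (T j \<omega>))"
      "(\<integral>\<omega>. (\<Sum>j. T j \<omega> powr \<alpha> * ln (T j \<omega>)) \<partial>M) < 0"
    and iv: "integrable M (\<lambda>\<omega>. (\<Sum>j. T j \<omega> powr \<alpha>) * ln (\<Sum>j. T j \<omega> powr \<alpha>))"
    and span: "has_span M T r"
  shows "solutions_M M T =
        {f. \<exists>h\<in>class_H \<alpha> r. left_cont h \<and>
            (\<forall>t\<ge>0. f t = (\<integral>\<omega>. exp (- (h t * t powr \<alpha> * Wlim TT \<alpha> \<omega>)) \<partial>M))} \<and>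
      (solutions_L M T \<noteq> {} \<longrightarrow> 0 < \<alpha> \<and> \<alpha> \<le> 1) \<and>
      (0 < \<alpha> \<and> \<alpha> \<le> 1 \<longrightarrow> solutions_L M T =
        {f. \<exists>h\<in>class_P \<alpha> r. left_cont h \<and>
            (\<forall>t\<ge>0. f t = (\<integral>\<omega>. exp (- (h t * t powr \<alpha> * Wlim TT \<alpha> \<omega>)) \<partial>M))})"
proof -
  interpret prob_space M by (rule prob)
  interpret branching_walk M T TT \<alpha>
    by unfold_locales (use rv nonneg alpha copies ii iii iv in auto)
  have r: "1 \<le> r" using span by (auto simp: has_span_def geometric_def)
  have phi: "sm.phi (h t * t powr \<alpha>) = (\<integral>\<omega>. exp (- (h t * t powr \<alpha> * Wlim TT \<alpha> \<omega>)) \<partial>M)"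
    if "h \<in> class_H \<alpha> r" "0 \<le> t" for h t
    using class_H_facts(1)[OF that(1) r that(2)] by (intro phi_eq_Wlim) simp
  have P_H: "h \<in> class_H \<alpha> r" if "h \<in> class_P \<alpha> r" for h
    using that by (auto simp: class_P_def split: if_splits)
  have rep: "\<exists>h\<in>class_H \<alpha> r. left_cont h \<and> (\<forall>t\<ge>0. f t = sm.phi (h t * t powr \<alpha>))"
    if "f \<in> solutions_M M T" for f
    by (rule solution_in_class_H[OF span that])
  have mixture: "f \<in> solutions_M M T" if "h \<in> class_H \<alpha> r" "left_cont h"
    "\<And>t. t \<ge> 0 \<Longrightarrow> f t = (\<integral>\<omega>. exp (- (h t * t powr \<alpha> * Wlim TT \<alpha> \<omega>)) \<partial>M)" for f h
    by (rule class_H_solution[OF span that(1,2)]) (simp add: that(3) phi[OF that(1)])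
  have M_eq: "solutions_M M T = {f. \<exists>h\<in>class_H \<alpha> r. left_cont h \<and>
            (\<forall>t\<ge>0. f t = (\<integral>\<omega>. exp (- (h t * t powr \<alpha> * Wlim TT \<alpha> \<omega>)) \<partial>M))}"
  proof (intro equalityI subsetI CollectI)
    fix f assume "f \<in> solutions_M M T"
    then obtain h where h: "h \<in> class_H \<alpha> r" "left_cont h" "\<And>t. t \<ge> 0 \<Longrightarrow> f t = sm.phi (h t * t powr \<alpha>)"
      using rep by blast
    then show "\<exists>h\<in>class_H \<alpha> r. left_cont h \<and>
            (\<forall>t\<ge>0. f t = (\<integral>\<omega>. exp (- (h t * t powr \<alpha> * Wlim TT \<alpha> \<omega>)) \<partial>M))"
      using phi[OF h(1)] by (intro bexI[of _ h]) auto
  qed (use mixture in blast)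
  moreover have "\<alpha> \<le> 1" if ne: "solutions_L M T \<noteq> {}"
  proof -
    obtain f where f: "f \<in> solutions_M M T" "f \<in> class_L" using ne by (auto simp: solutions_L_def)
    obtain h C where h: "\<And>t. t > 0 \<Longrightarrow> 0 \<le> h t" "\<And>t. t > 0 \<Longrightarrow> h t \<le> C"
      "\<And>t. t > 0 \<Longrightarrow> f t = sm.phi (h t * t powr \<alpha>)"
      by (rule solution_representation[OF f(1)]) blast
    show ?thesis by (rule Laplace_exponent_le_1[OF f(2), of h C]) (auto simp: h)
  qed
  moreover have "solutions_L M T = {f. \<exists>h\<in>class_P \<alpha> r. left_cont h \<and>
            (\<forall>t\<ge>0. f t = (\<integral>\<omega>. exp (- (h t * t powr \<alpha> * Wlim TT \<alpha> \<omega>)) \<partial>M))}" if \<alpha>: "\<alpha> \<le> 1"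
  proof (intro equalityI subsetI CollectI)
    fix f assume f: "f \<in> solutions_L M T"
    then obtain h where h: "h \<in> class_H \<alpha> r" "left_cont h" "\<And>t. t \<ge> 0 \<Longrightarrow> f t = sm.phi (h t * t powr \<alpha>)"
      using rep by (auto simp: solutions_L_def)
    have "h \<in> class_P \<alpha> r"
      using f by (intro Laplace_solution_in_class_P[OF _ h(1) r h(3)]) (auto simp: solutions_L_def)
    then show "\<exists>h\<in>class_P \<alpha> r. left_cont h \<and>
            (\<forall>t\<ge>0. f t = (\<integral>\<omega>. exp (- (h t * t powr \<alpha> * Wlim TT \<alpha> \<omega>)) \<partial>M))"
      using h phi[OF h(1)] by (intro bexI[of _ h]) auto
  next
    fix f assume "f \<in> {f. \<exists>h\<in>class_P \<alpha> r. left_cont h \<and>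
            (\<forall>t\<ge>0. f t = (\<integral>\<omega>. exp (- (h t * t powr \<alpha> * Wlim TT \<alpha> \<omega>)) \<partial>M))}"
    then obtain h where h: "h \<in> class_P \<alpha> r" "left_cont h"
      "\<And>t. t \<ge> 0 \<Longrightarrow> f t = (\<integral>\<omega>. exp (- (h t * t powr \<alpha> * Wlim TT \<alpha> \<omega>)) \<partial>M)" by blast
    have "f \<in> solutions_M M T" by (rule mixture[OF P_H[OF h(1)] h(2,3)])
    moreover from this have "f \<in> class_L"
      by (intro class_P_Laplace[OF h(1) r \<alpha> h(3)]) (auto simp: solutions_M_def)
    ultimately show "f \<in> solutions_L M T" by (simp add: solutions_L_def)
  qed
  ultimately show ?thesis using alpha by blast
qed

end
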